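(* Let $q$ be a power of a prime $p$, let $\mathbb{F}_q$ be the finite field with $q$ elements, let $V$ be an $\mathbb{F}_q$-vector space of finite dimension $d$, and let $G \subseteq GL(V)$ be a subgroup. Let $R = \mathbb{F}_q[V] = \operatorname{Sym}(V^* )$, let $S = R^G$, and let $\mathbf{d}_{d,0} = \prod_{0 \neq v \in V^*} v \in S$. For $0 \leq j \leq d-1$ let $a_j \geq 1$ be the smallest positive integer such that $\mathbf{d}_{d,0}^{a_j} \in \operatorname{ann}_S H^j_{S_+}(S)$, and for $0 \leq i \leq d-1$ set $\mathfrak{q}_i = \prod_{j=0}^{i} \mathbf{d}_{d,0}^{a_j}$. Let $$\mathbb{G}^\bullet = \; 0 \to G^0 \to G^1 \to \cdots \to G^r \to 0$$ be a complex of free graded $S$-modules and homogeneous maps such that $H^i(\mathbb{G}^\bullet)$ has finite length for all $i$. Then $\mathfrak{q}_i \in \operatorname{ann}_S H^i(\mathbb{G}^\bullet)$ for $0 \leq i \leq d-1$.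
   Context: The group $G$ (which is finite) acts on $V^*$ by the dual action and on $R = \operatorname{Sym}(V^* )$ by the induced $\mathbb{F}_q$-algebra automorphisms. $R$ is graded with the elements of $V^*$ in degree $1$, and $S = R^G$ is a graded subring with $S_0 = \mathbb{F}_q$ and irrelevant maximal ideal $S_+ = \bigoplus_{n \geq 1} S_n$. $H^j_{S_+}(S)$ is the $j$-th local cohomology module of $S$ with respect to $S_+$. The element $\mathbf{d}_{d,0}$ (the top Dickson class) is invariant under $GL(V)$, so it lies in $S$. For each $0 \leq j \leq d-1$ some power of $\mathbf{d}_{d,0}$ annihilates $H^j_{S_+}(S)$, so the integers $a_j$ are well defined. The modules $G^0, \ldots, G^r$ of the complex are unrelated to the group $G$, and $r$ is any non-negative integer. *)

theory Defs
  imports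
    Complex_Main
    "HOL-Library.Poly_Mapping"
    "HOL-Computational_Algebra.Primes"
    "HOL-Algebra.Module"
    "HOL-Algebra.QuotRing"
    "HOL-Algebra.Ideal_Product"
begin

section \<open>The symmetric algebra of a dual space\<close>

text \<open>A polynomial with coefficients in \<open>'k\<close> and variables from \<open>'w\<close> is a finitely supported
  function from monomials to coefficients; a monomial is a finitely supported function from
  variables to exponents.\<close>

type_synonym ('w, 'k) mpoly = "('w \<Rightarrow>\<^sub>0 nat) \<Rightarrow>\<^sub>0 'k"

definition poly_ring :: "'w set \<Rightarrow> ('w, 'k::comm_ring_1) mpoly ring" where
  "poly_ring W =
    \<lparr>carrier = {P. \<forall>m\<in>Poly_Mapping.keys P. Poly_Mapping.keys m \<subseteq> W},
     monoid.mult = (*), one = 1, zero = 0, add = (+)\<rparr>"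

definition lin_mono :: "'w \<Rightarrow> 'k \<Rightarrow> ('w, 'k::comm_ring_1) mpoly" where
  "lin_mono x c = Poly_Mapping.single (Poly_Mapping.single x 1) c"

definition mono_deg :: "('w \<Rightarrow>\<^sub>0 nat) \<Rightarrow> nat" where
  "mono_deg m = (\<Sum>x\<in>Poly_Mapping.keys m. Poly_Mapping.lookup m x)"

definition rename_mono :: "('w \<Rightarrow> 'w) \<Rightarrow> ('w \<Rightarrow>\<^sub>0 nat) \<Rightarrow> ('w \<Rightarrow>\<^sub>0 nat)" where
  "rename_mono \<sigma> m =
    (\<Sum>x\<in>Poly_Mapping.keys m. Poly_Mapping.single (\<sigma> x) (Poly_Mapping.lookup m x))"

definition rename_vars :: "('w \<Rightarrow> 'w) \<Rightarrow> ('w, 'k::comm_ring_1) mpoly \<Rightarrow> ('w, 'k) mpoly" where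
  "rename_vars \<sigma> P =
    (\<Sum>m\<in>Poly_Mapping.keys P.
      Poly_Mapping.single (rename_mono \<sigma> m) (Poly_Mapping.lookup P m))"

text \<open>A vector space \<open>V\<close> over the field \<open>'k\<close> is the type \<open>'v\<close> together with a scalar multiplication.
  \<open>Sym(V\<^sup>*)\<close> is the polynomial ring with one variable for each \<open>f \<in> V\<^sup>*\<close>, modulo the ideal which
  makes \<open>f \<mapsto> X\<^sub>f\<close> linear.\<close>

definition dual_space :: "('k::field \<Rightarrow> 'v::ab_group_add \<Rightarrow> 'v) \<Rightarrow> ('v \<Rightarrow> 'k) set" where
  "dual_space scale = {f. Vector_Spaces.linear scale (*) f}"

definition sym_rels ::
    "('k::field \<Rightarrow> 'v::ab_group_add \<Rightarrow> 'v) \<Rightarrow> ('v \<Rightarrow> 'k, 'k) mpoly set" where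
  "sym_rels scale =
    {lin_mono (\<lambda>v. f v + h v) 1 - lin_mono f 1 - lin_mono h 1 | f h.
       f \<in> dual_space scale \<and> h \<in> dual_space scale} \<union>
    {lin_mono (\<lambda>v. c * f v) 1 - lin_mono f c | c f. f \<in> dual_space scale}"

definition sym_ideal ::
    "('k::field \<Rightarrow> 'v::ab_group_add \<Rightarrow> 'v) \<Rightarrow> ('v \<Rightarrow> 'k, 'k) mpoly set" where
  "sym_ideal scale = Idl\<^bsub>poly_ring (dual_space scale)\<^esub> (sym_rels scale)"

definition sym_dual ::
    "('k::field \<Rightarrow> 'v::ab_group_add \<Rightarrow> 'v) \<Rightarrow> ('v \<Rightarrow> 'k, 'k) mpoly set ring" where
  "sym_dual scale = poly_ring (dual_space scale) Quot sym_ideal scale"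

definition sym_class ::
    "('k::field \<Rightarrow> 'v::ab_group_add \<Rightarrow> 'v) \<Rightarrow> ('v \<Rightarrow> 'k, 'k) mpoly
      \<Rightarrow> ('v \<Rightarrow> 'k, 'k) mpoly set" where
  "sym_class scale P = sym_ideal scale +>\<^bsub>poly_ring (dual_space scale)\<^esub> P"

definition sym_deg ::
    "('k::field \<Rightarrow> 'v::ab_group_add \<Rightarrow> 'v) \<Rightarrow> nat \<Rightarrow> ('v \<Rightarrow> 'k, 'k) mpoly set set" where
  "sym_deg scale n = sym_class scale `
    {P \<in> carrier (poly_ring (dual_space scale)). \<forall>m\<in>Poly_Mapping.keys P. mono_deg m = n}"


section \<open>The invariant ring and the top Dickson class\<close>

definition gen_lin_group :: "('k::field \<Rightarrow> 'v::ab_group_add \<Rightarrow> 'v) \<Rightarrow> ('v \<Rightarrow> 'v) monoid" where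
  "gen_lin_group scale =
    \<lparr>carrier = {g. Vector_Spaces.linear scale scale g \<and> bij g}, monoid.mult = (\<circ>), one = id\<rparr>"

definition dual_act :: "('v \<Rightarrow> 'v) \<Rightarrow> ('v \<Rightarrow> 'k) \<Rightarrow> ('v \<Rightarrow> 'k)" where
  "dual_act g f = (\<lambda>v. f (inv_into UNIV g v))"

text \<open>An element of \<open>Sym(V\<^sup>*)\<close> is a coset \<open>C\<close> of \<^const>\<open>sym_ideal\<close>. For \<open>g \<in> GL(V)\<close>, renaming
  variables by \<open>X\<^sub>f \<mapsto> X\<^bsub>g f\<^esub>\<close> is an automorphism of the polynomial ring that maps the ideal
  onto itself, so the induced automorphism of the quotient maps \<open>C\<close> to its image.\<close>

definition sym_act ::
    "('v \<Rightarrow> 'v) \<Rightarrow> ('v \<Rightarrow> 'k, 'k::field) mpoly set \<Rightarrow> ('v \<Rightarrow> 'k, 'k) mpoly set" where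
  "sym_act g C = rename_vars (dual_act g) ` C"

definition inv_ring ::
    "('k::field \<Rightarrow> 'v::ab_group_add \<Rightarrow> 'v) \<Rightarrow> ('v \<Rightarrow> 'v) set
      \<Rightarrow> ('v \<Rightarrow> 'k, 'k) mpoly set ring" where
  "inv_ring scale G =
    (sym_dual scale)\<lparr>carrier := {C \<in> carrier (sym_dual scale). \<forall>g\<in>G. sym_act g C = C}\<rparr>"

definition inv_deg ::
    "('k::field \<Rightarrow> 'v::ab_group_add \<Rightarrow> 'v) \<Rightarrow> ('v \<Rightarrow> 'v) set \<Rightarrow> nat
      \<Rightarrow> ('v \<Rightarrow> 'k, 'k) mpoly set set" where
  "inv_deg scale G n = sym_deg scale n \<inter> carrier (inv_ring scale G)"

definition dickson_top ::
    "('k::field \<Rightarrow> 'v::ab_group_add \<Rightarrow> 'v) \<Rightarrow> ('v \<Rightarrow> 'k, 'k) mpoly set" where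
  "dickson_top scale =
    (\<Otimes>\<^bsub>sym_dual scale\<^esub> f \<in> dual_space scale - {\<lambda>v. 0}. sym_class scale (lin_mono f 1))"

definition irrelevant_ideal :: "('s, 'b) ring_scheme \<Rightarrow> (nat \<Rightarrow> 's set) \<Rightarrow> 's set" where
  "irrelevant_ideal S Sg =
    {\<Oplus>\<^bsub>S\<^esub> n \<in> A. c n | A c. finite A \<and> (\<forall>n\<in>A. 1 \<le> n \<and> c n \<in> Sg n)}"


section \<open>Modules and complexes\<close>

definition lin_maps ::
    "('s, 'b) ring_scheme \<Rightarrow> ('s, 'm) module \<Rightarrow> ('s, 'n) module \<Rightarrow> ('m \<Rightarrow> 'n) set" where
  "lin_maps S M N =
    {h \<in> carrier M \<rightarrow> carrier N.
      (\<forall>x\<in>carrier M. \<forall>y\<in>carrier M. h (x \<oplus>\<^bsub>M\<^esub> y) = h x \<oplus>\<^bsub>N\<^esub> h y) \<and>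
      (\<forall>s\<in>carrier S. \<forall>x\<in>carrier M. h (s \<odot>\<^bsub>M\<^esub> x) = s \<odot>\<^bsub>N\<^esub> h x)}"

definition annihilator :: "('s, 'b) ring_scheme \<Rightarrow> ('s, 'm) module \<Rightarrow> 's set" where
  "annihilator S M = {s \<in> carrier S. \<forall>x\<in>carrier M. s \<odot>\<^bsub>M\<^esub> x = \<zero>\<^bsub>M\<^esub>}"

text \<open>The fields \<^const>\<open>monoid.mult\<close> and \<^const>\<open>one\<close> of a module record play no role below.\<close>

definition self_module :: "('s, 'b) ring_scheme \<Rightarrow> ('s, 's) module" where
  "self_module S =
    \<lparr>carrier = carrier S, monoid.mult = monoid.mult S, one = one S, zero = zero S, add = add S,
     smult = monoid.mult S\<rparr>"

text \<open>\<open>subquotient M Z B\<close> is \<open>Z / B\<close>, for submodules \<open>B \<subseteq> Z\<close> of \<open>M\<close>.\<close>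

definition subquotient :: "('s, 'm) module \<Rightarrow> 'm set \<Rightarrow> 'm set \<Rightarrow> ('s, 'm set) module" where
  "subquotient M Z B =
    \<lparr>carrier = (\<lambda>z. B +>\<^bsub>M\<^esub> z) ` Z, monoid.mult = undefined, one = undefined,
     zero = B, add = set_add M,
     smult = (\<lambda>s C. B <+>\<^bsub>M\<^esub> ((\<lambda>x. s \<odot>\<^bsub>M\<^esub> x) ` C))\<rparr>"

definition finite_length :: "('s, 'b) ring_scheme \<Rightarrow> ('s, 'm) module \<Rightarrow> bool" where
  "finite_length S M \<longleftrightarrow>
    (\<exists>n N. N 0 = {\<zero>\<^bsub>M\<^esub>} \<and> N n = carrier M \<and>
      (\<forall>k\<le>n. submodule (N k) S M) \<and>
      (\<forall>k<n. N k \<subset> N (Suc k) \<and>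
        (\<forall>L. submodule L S M \<longrightarrow> N k \<subseteq> L \<longrightarrow> L \<subseteq> N (Suc k) \<longrightarrow> L = N k \<or> L = N (Suc k))))"

text \<open>Complexes are indexed by \<open>nat\<close>; nothing precedes degree \<open>0\<close>.\<close>

definition cochain_complex ::
    "('s, 'b) ring_scheme \<Rightarrow> (nat \<Rightarrow> ('s, 'm) module) \<Rightarrow> (nat \<Rightarrow> 'm \<Rightarrow> 'm) \<Rightarrow> bool" where
  "cochain_complex S K \<delta> \<longleftrightarrow>
    (\<forall>i. module S (K i) \<and> \<delta> i \<in> lin_maps S (K i) (K (Suc i)) \<and>
      (\<forall>x\<in>carrier (K i). \<delta> (Suc i) (\<delta> i x) = \<zero>\<^bsub>K (Suc (Suc i))\<^esub>))"

definition cocycles ::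
    "(nat \<Rightarrow> ('s, 'm) module) \<Rightarrow> (nat \<Rightarrow> 'm \<Rightarrow> 'm) \<Rightarrow> nat \<Rightarrow> 'm set" where
  "cocycles K \<delta> i = {x \<in> carrier (K i). \<delta> i x = \<zero>\<^bsub>K (Suc i)\<^esub>}"

definition coboundaries ::
    "(nat \<Rightarrow> ('s, 'm) module) \<Rightarrow> (nat \<Rightarrow> 'm \<Rightarrow> 'm) \<Rightarrow> nat \<Rightarrow> 'm set" where
  "coboundaries K \<delta> i =
    (case i of 0 \<Rightarrow> {\<zero>\<^bsub>K 0\<^esub>} | Suc k \<Rightarrow> \<delta> k ` carrier (K k))"

definition cohomology ::
    "(nat \<Rightarrow> ('s, 'm) module) \<Rightarrow> (nat \<Rightarrow> 'm \<Rightarrow> 'm) \<Rightarrow> nat \<Rightarrow> ('s, 'm set) module" where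
  "cohomology K \<delta> i = subquotient (K i) (cocycles K \<delta> i) (coboundaries K \<delta> i)"


section \<open>Local cohomology\<close>

text \<open>The test modules in the definition of injectivity have to live in a fixed type; here it is the
  type of \<open>Q\<close> itself. If some copy of \<open>S\<close> lives in that type, as it does for the terms of an
  injective resolution of \<open>S\<close>, then so do copies of all ideals of \<open>S\<close>, and by Baer's criterion
  \<open>Q\<close> is injective with respect to all \<open>S\<close>-modules.\<close>

definition injective_module :: "('s, 'b) ring_scheme \<Rightarrow> ('s, 'e) module \<Rightarrow> bool" where
  "injective_module S Q \<longleftrightarrow> module S Q \<and>
    (\<forall>(M :: ('s, 'e) module) (N :: ('s, 'e) module) \<iota> f.
      module S M \<longrightarrow> module S N \<longrightarrow>
      \<iota> \<in> lin_maps S M N \<longrightarrow> inj_on \<iota> (carrier M) \<longrightarrow> f \<in> lin_maps S M Q \<longrightarrow>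
      (\<exists>h\<in>lin_maps S N Q. \<forall>x\<in>carrier M. h (\<iota> x) = f x))"

definition injective_resolution ::
    "('s, 'b) ring_scheme \<Rightarrow> ('s, 'm) module \<Rightarrow> (nat \<Rightarrow> ('s, 'e) module) \<Rightarrow> ('m \<Rightarrow> 'e)
      \<Rightarrow> (nat \<Rightarrow> 'e \<Rightarrow> 'e) \<Rightarrow> bool" where
  "injective_resolution S M E \<epsilon> \<delta> \<longleftrightarrow>
    cochain_complex S E \<delta> \<and> (\<forall>i. injective_module S (E i)) \<and>
    \<epsilon> \<in> lin_maps S M (E 0) \<and> inj_on \<epsilon> (carrier M) \<and>
    \<epsilon> ` carrier M = cocycles E \<delta> 0 \<and>
    (\<forall>i. cocycles E \<delta> (Suc i) = coboundaries E \<delta> (Suc i))"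

primrec ideal_pow :: "('s, 'b) ring_scheme \<Rightarrow> 's set \<Rightarrow> nat \<Rightarrow> 's set" where
  "ideal_pow S I 0 = carrier S"
| "ideal_pow S I (Suc n) = ideal_prod S (ideal_pow S I n) I"

definition torsion_part ::
    "('s, 'b) ring_scheme \<Rightarrow> 's set \<Rightarrow> ('s, 'm) module \<Rightarrow> ('s, 'm) module" where
  "torsion_part S I M =
    M\<lparr>carrier := {x \<in> carrier M. \<exists>n. \<forall>s\<in>ideal_pow S I n. s \<odot>\<^bsub>M\<^esub> x = \<zero>\<^bsub>M\<^esub>}\<rparr>"

text \<open>The right derived functors of the \<open>I\<close>-torsion functor, at the module of which
  \<open>(E, \<delta>)\<close> is an injective resolution.\<close>

definition local_cohomology ::
    "('s, 'b) ring_scheme \<Rightarrow> 's set \<Rightarrow> (nat \<Rightarrow> ('s, 'e) module) \<Rightarrow> (nat \<Rightarrow> 'e \<Rightarrow> 'e)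
      \<Rightarrow> nat \<Rightarrow> ('s, 'e set) module" where
  "local_cohomology S I E \<delta> j = cohomology (\<lambda>i. torsion_part S I (E i)) \<delta> j"


section \<open>Graded free modules\<close>

definition internal_direct_sum :: "('s, 'm) module \<Rightarrow> ('i \<Rightarrow> 'm set) \<Rightarrow> bool" where
  "internal_direct_sum M N \<longleftrightarrow>
    (\<forall>n. additive_subgroup (N n) M) \<and>
    (\<forall>x\<in>carrier M. \<exists>!c. (\<forall>n. c n \<in> N n) \<and> finite {n. c n \<noteq> \<zero>\<^bsub>M\<^esub>} \<and>
      x = (\<Oplus>\<^bsub>M\<^esub> n \<in> {n. c n \<noteq> \<zero>\<^bsub>M\<^esub>}. c n))"

definition graded_module ::
    "('s, 'b) ring_scheme \<Rightarrow> (nat \<Rightarrow> 's set) \<Rightarrow> ('s, 'm) module \<Rightarrow> (int \<Rightarrow> 'm set) \<Rightarrow> bool" where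
  "graded_module S Sg M Mg \<longleftrightarrow>
    module S M \<and> internal_direct_sum M Mg \<and>
    (\<forall>a n. \<forall>s\<in>Sg a. \<forall>x\<in>Mg n. s \<odot>\<^bsub>M\<^esub> x \<in> Mg (int a + n))"

definition is_basis :: "('s, 'b) ring_scheme \<Rightarrow> ('s, 'm) module \<Rightarrow> 'm set \<Rightarrow> bool" where
  "is_basis S M B \<longleftrightarrow>
    B \<subseteq> carrier M \<and>
    (\<forall>x\<in>carrier M. \<exists>!c. c \<in> B \<rightarrow> carrier S \<and> (\<forall>b. b \<notin> B \<longrightarrow> c b = \<zero>\<^bsub>S\<^esub>) \<and>
      finite {b. c b \<noteq> \<zero>\<^bsub>S\<^esub>} \<and>
      x = (\<Oplus>\<^bsub>M\<^esub> b \<in> {b. c b \<noteq> \<zero>\<^bsub>S\<^esub>}. c b \<odot>\<^bsub>M\<^esub> b))"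

text \<open>That is, a direct sum of shifts \<open>S(n)\<close>, \<open>n \<in> \<int>\<close>; the rank may be infinite.\<close>

definition graded_free_module ::
    "('s, 'b) ring_scheme \<Rightarrow> (nat \<Rightarrow> 's set) \<Rightarrow> ('s, 'm) module \<Rightarrow> (int \<Rightarrow> 'm set) \<Rightarrow> bool" where
  "graded_free_module S Sg M Mg \<longleftrightarrow>
    graded_module S Sg M Mg \<and> (\<exists>B. B \<subseteq> (\<Union>n. Mg n) \<and> is_basis S M B)"

definition homogeneous_map :: "(int \<Rightarrow> 'm set) \<Rightarrow> (int \<Rightarrow> 'n set) \<Rightarrow> ('m \<Rightarrow> 'n) \<Rightarrow> bool" where
  "homogeneous_map Mg Ng h \<longleftrightarrow> (\<exists>e. \<forall>n. h ` Mg n \<subseteq> Ng (n + e))"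

end

theory Submission
  imports Defs "HOL-Algebra.Ring_Divisibility" "HOL-Algebra.Subrings" "HOL-Library.FuncSet"
begin

text \<open>
  Let \<open>f\<^sub>1, \<dots>, f\<^sub>n\<close> generate \<open>S\<^sub>+\<close>. For a module \<open>M\<close>, the Koszul complexes of \<open>f\<^sub>1\<^sup>N, \<dots>, f\<^sub>n\<^sup>N\<close> with
  coefficients in \<open>M\<close> form a direct system in \<open>N\<close>, and the cohomology of its colimit is the
  local cohomology of \<open>M\<close>. The proof is about the elements of \<open>S\<close> that annihilate the
  cohomology of this colimit in a given degree \<open>t\<close>. The predicate \<open>kills S fs M W z t\<close> says
  this for \<open>z\<close> and a submodule \<open>W\<close> of \<open>M\<close> without forming the colimit: every cocycle of level
  \<open>N\<close> becomes a coboundary after passing to some level \<open>N + k\<close> and multiplying by \<open>z\<close>. Three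
  facts carry the proof.

  First, annihilating \<open>H\<^sup>j(S)\<close>, computed with an injective resolution, is the same as killing
  the Koszul cocycles of \<open>S\<close> in degree \<open>j\<close> (\<open>local_cohomology_annihilator\<close>). Over a Noetherian
  ring, injective modules have no Koszul cohomology in positive degrees in the colimit, since
  they and their torsion submodules are divisible up to torsion by each \<open>f\<^sub>i\<close>; so one can shift
  degrees along the resolution. \<open>S\<close> is Noetherian by Hilbert's argument: the orbit polynomials
  of the variables have invariant coefficients (\<open>noetherian_RG\<close>).

  Second, some power of the top Dickson class kills \<open>S\<close> in all degrees \<open>< d\<close>
  (\<open>dickson_power_kills\<close>). Hence the minima \<open>a\<^sub>j\<close> are attained. The reason is that \<open>Sym(V\<^sup>*)\<close> is
  a polynomial ring in \<open>d\<close> variables, which form a regular sequence and have powers in the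
  ideal generated by \<open>S\<^sub>+\<close>, so that its Koszul cohomology vanishes below degree \<open>d\<close>; and that
  there is an \<open>S\<close>-linear map from \<open>Sym(V\<^sup>*)\<close> to \<open>S\<close> whose restriction to \<open>S\<close> is multiplication
  by a power of the Dickson class. This map is \<open>r \<mapsto> tr(t r)\<close> where the trace of \<open>t\<close> is that
  power. Such a \<open>t\<close> exists because the Dickson class is divisible, for each \<open>g \<noteq> 1\<close> in \<open>G\<close>, by
  some nonzero difference \<open>f - g f\<close> of linear forms: the action is free away from the zero
  locus of the class (\<open>power_in_trace\<close>).

  Third, let \<open>z\<^sub>t\<close> kill \<open>S\<close> in degree \<open>t\<close>, for all \<open>t < d\<close>. Then \<open>z\<^sub>t\<close> kills the free modules
  \<open>K\<^sup>p\<close> in degree \<open>t\<close> (\<open>kills_free\<close>). Let \<open>Z\<^sup>p\<close> and \<open>B\<^sup>p\<close> be the cocycles and coboundaries of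
  \<open>K\<close>. The quotients \<open>Z\<^sup>p/B\<^sup>p\<close> have finite length and are graded, hence \<open>S\<^sub>+\<close>-torsion
  (\<open>finite_length_power_torsion\<close>), hence without local cohomology in positive degrees. The
  sequences \<open>0 \<rightarrow> Z\<^sup>p \<rightarrow> K\<^sup>p \<rightarrow> B\<^sup>p\<^sup>+\<^sup>1 \<rightarrow> 0\<close> and \<open>0 \<rightarrow> B\<^sup>p \<rightarrow> Z\<^sup>p \<rightarrow> Z\<^sup>p/B\<^sup>p \<rightarrow> 0\<close> then show by induction on
  \<open>p\<close> that \<open>z\<^sub>t z\<^bsub>t+1\<^esub> \<dots> z\<^bsub>t+p-1\<^esub>\<close> kills \<open>B\<^sup>p\<close> in degree \<open>t\<close> when \<open>t + p \<le> d\<close>. Finally \<open>Z\<^sup>i/B\<^sup>i\<close> is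
  its own local cohomology in degree \<open>0\<close>; modulo the image of the degree \<open>0\<close> part of
  \<open>Z\<^sup>i \<subseteq> K\<^sup>i\<close>, which \<open>z\<^sub>0\<close> kills, it embeds into the degree \<open>1\<close> part of \<open>B\<^sup>i\<close>, which \<open>z\<^sub>1 \<dots> z\<^sub>i\<close>
  kills. So \<open>z\<^sub>0 z\<^sub>1 \<dots> z\<^sub>i\<close> annihilates \<open>H\<^sup>i(K)\<close> (\<open>consecutive_prod_kills_cohomology\<close>), and the
  theorem is the case \<open>z\<^sub>j = D\<^bsup>a\<^sub>j\<^esup>\<close>.
\<close>

(* In the theorem, primality is that of a natural number. *)
hide_const (open) Divisibility.prime

section \<open>Koszul cochains\<close>

text \<open>A cochain on \<open>g\<^sub>1, \<dots>, g\<^sub>n\<close> assigns a module element to each subset of \<open>{1, \<dots>, n}\<close>, written as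
  a list of \<open>n\<close> truth values. With this encoding the Koszul complex of \<open>g # gs\<close> is the mapping
  cone of multiplication by \<open>g\<close> on the Koszul complex of \<open>gs\<close>, and identities are proved by
  recursion along the list of ring elements.\<close>

primrec kos_d :: "('s, 'm, 'z) module_scheme \<Rightarrow> 's list \<Rightarrow> (bool list \<Rightarrow> 'm) \<Rightarrow> bool list \<Rightarrow> 'm" where
  "kos_d M [] c = (\<lambda>xs. \<zero>\<^bsub>M\<^esub>)"
| "kos_d M (g # gs) c = (\<lambda>xs. case xs of [] \<Rightarrow> \<zero>\<^bsub>M\<^esub> | b # ys \<Rightarrow>
     (if b then g \<odot>\<^bsub>M\<^esub> c (False # ys) \<ominus>\<^bsub>M\<^esub> kos_d M gs (\<lambda>zs. c (True # zs)) ys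
      else kos_d M gs (\<lambda>zs. c (False # zs)) ys))"

text \<open>For \<open>gs = f\<^sub>1\<^sup>k, \<dots>, f\<^sub>n\<^sup>k\<close> this is the transition map from the Koszul complex of \<open>f\<^sub>1\<^sup>N, \<dots>, f\<^sub>n\<^sup>N\<close>
  to that of \<open>f\<^sub>1\<^bsup>N+k\<^esup>, \<dots>, f\<^sub>n\<^bsup>N+k\<^esup>\<close>: the component at a subset is multiplied by the product of the
  \<open>g\<^sub>i\<close> over that subset.\<close>

primrec kos_t :: "('s, 'm, 'z) module_scheme \<Rightarrow> 's list \<Rightarrow> (bool list \<Rightarrow> 'm) \<Rightarrow> bool list \<Rightarrow> 'm" where
  "kos_t M [] c = c"
| "kos_t M (g # gs) c = (\<lambda>xs. case xs of [] \<Rightarrow> \<zero>\<^bsub>M\<^esub> | b # ys \<Rightarrow>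
     (if b then g \<odot>\<^bsub>M\<^esub> kos_t M gs (\<lambda>zs. c (True # zs)) ys
      else kos_t M gs (\<lambda>zs. c (False # zs)) ys))"

text \<open>The cochains of degree \<open>t\<close> with values in \<open>W\<close>. Degrees are integers, so that the degree
  \<open>t - 1\<close> below \<open>t = 0\<close> exists and contains only the zero cochain.\<close>

definition cochains :: "('s, 'm, 'z) module_scheme \<Rightarrow> 'm set \<Rightarrow> nat \<Rightarrow> int \<Rightarrow> (bool list \<Rightarrow> 'm) set" where
  "cochains M W n t = {c. \<forall>xs. c xs \<in> W \<and>
     (c xs \<noteq> \<zero>\<^bsub>M\<^esub> \<longrightarrow> length xs = n \<and> int (count_list xs True) = t)}"

context module begin

lemma submodule_subset: "submodule W R M \<Longrightarrow> x \<in> W \<Longrightarrow> x \<in> carrier M"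
  using submoduleE(1) by blast

lemma submodule_zero: "submodule W R M \<Longrightarrow> \<zero>\<^bsub>M\<^esub> \<in> W"
  using submodule.axioms(1) subgroup.one_closed by fastforce

lemma submodule_add: "submodule W R M \<Longrightarrow> x \<in> W \<Longrightarrow> y \<in> W \<Longrightarrow> x \<oplus>\<^bsub>M\<^esub> y \<in> W"
  by (rule submoduleE(5))

lemma submodule_neg: "submodule W R M \<Longrightarrow> x \<in> W \<Longrightarrow> \<ominus>\<^bsub>M\<^esub> x \<in> W"
  by (rule submoduleE(6))

lemma submodule_minus: "submodule W R M \<Longrightarrow> x \<in> W \<Longrightarrow> y \<in> W \<Longrightarrow> x \<ominus>\<^bsub>M\<^esub> y \<in> W"
  unfolding a_minus_def by (intro submodule_add submodule_neg)

lemma submodule_smult: "submodule W R M \<Longrightarrow> a \<in> carrier R \<Longrightarrow> x \<in> W \<Longrightarrow> a \<odot>\<^bsub>M\<^esub> x \<in> W"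
  by (rule submoduleE(4))

lemmas submodule_closed = submodule_zero submodule_add submodule_neg submodule_minus submodule_smult

lemma submodule_criterion:
  assumes sub: "W \<subseteq> carrier M" and "\<zero>\<^bsub>M\<^esub> \<in> W"
    and "\<And>x y. x \<in> W \<Longrightarrow> y \<in> W \<Longrightarrow> x \<oplus>\<^bsub>M\<^esub> y \<in> W"
    and smult: "\<And>a x. a \<in> carrier R \<Longrightarrow> x \<in> W \<Longrightarrow> a \<odot>\<^bsub>M\<^esub> x \<in> W"
  shows "submodule W R M"
proof (rule submoduleI)
  show "\<ominus>\<^bsub>M\<^esub> x \<in> W" if x: "x \<in> W" for x
    using smult[OF _ x, of "\<ominus> \<one>"] smult_l_minus[of \<one> x] smult_one[of x] sub x by auto
qed (use assms in auto)

lemma submodule_Int: "submodule V R M \<Longrightarrow> submodule W R M \<Longrightarrow> submodule (V \<inter> W) R M"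
  by (rule submodule_criterion) (auto simp: submodule_closed dest: submodule_subset)

lemma submodule_sum:
  assumes V: "submodule V R M" and W: "submodule W R M"
  shows "submodule {v \<oplus>\<^bsub>M\<^esub> w | v w. v \<in> V \<and> w \<in> W} R M" (is "submodule ?U R M")
proof (rule submodule_criterion)
  note VM = submodule_subset[OF V] and WM = submodule_subset[OF W]
  show "?U \<subseteq> carrier M" using VM WM by auto
  show "\<zero>\<^bsub>M\<^esub> \<in> ?U" using submodule_zero[OF V] submodule_zero[OF W] by force
  show "x \<oplus>\<^bsub>M\<^esub> y \<in> ?U" if x: "x \<in> ?U" and y: "y \<in> ?U" for x y
  proof -
    obtain v w v' w' where xy: "v \<in> V" "w \<in> W" "x = v \<oplus>\<^bsub>M\<^esub> w" "v' \<in> V" "w' \<in> W" "y = v' \<oplus>\<^bsub>M\<^esub> w'"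
      using x y by blast
    have "x \<oplus>\<^bsub>M\<^esub> y = (v \<oplus>\<^bsub>M\<^esub> v') \<oplus>\<^bsub>M\<^esub> (w \<oplus>\<^bsub>M\<^esub> w')" using xy VM WM by (simp add: M.a_ac)
    then show ?thesis using submodule_add[OF V xy(1,4)] submodule_add[OF W xy(2,5)] by blast
  qed
  show "a \<odot>\<^bsub>M\<^esub> x \<in> ?U" if a: "a \<in> carrier R" and x: "x \<in> ?U" for a x
  proof -
    obtain v w where vw: "v \<in> V" "w \<in> W" "x = v \<oplus>\<^bsub>M\<^esub> w" using x by blast
    have "a \<odot>\<^bsub>M\<^esub> x = a \<odot>\<^bsub>M\<^esub> v \<oplus>\<^bsub>M\<^esub> a \<odot>\<^bsub>M\<^esub> w" using a vw VM WM by (simp add: smult_r_distr)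
    then show ?thesis using submodule_smult[OF V a vw(1)] submodule_smult[OF W a vw(2)] by blast
  qed
qed

lemma smult_minus: "a \<in> carrier R \<Longrightarrow> x \<in> carrier M \<Longrightarrow> y \<in> carrier M \<Longrightarrow>
    a \<odot>\<^bsub>M\<^esub> (x \<ominus>\<^bsub>M\<^esub> y) = a \<odot>\<^bsub>M\<^esub> x \<ominus>\<^bsub>M\<^esub> a \<odot>\<^bsub>M\<^esub> y"
  by (simp add: a_minus_def smult_r_distr smult_r_minus)

lemma minus_self [simp]: "x \<in> carrier M \<Longrightarrow> x \<ominus>\<^bsub>M\<^esub> x = \<zero>\<^bsub>M\<^esub>"
  by (simp add: a_minus_def M.r_neg)

lemma minus_zero [simp]: "x \<in> carrier M \<Longrightarrow> x \<ominus>\<^bsub>M\<^esub> \<zero>\<^bsub>M\<^esub> = x"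
  by (simp add: a_minus_def)

lemma minus_add4: "\<lbrakk>a \<in> carrier M; b \<in> carrier M; c \<in> carrier M; d \<in> carrier M\<rbrakk> \<Longrightarrow>
    (a \<oplus>\<^bsub>M\<^esub> b) \<ominus>\<^bsub>M\<^esub> (c \<oplus>\<^bsub>M\<^esub> d) = (a \<ominus>\<^bsub>M\<^esub> c) \<oplus>\<^bsub>M\<^esub> (b \<ominus>\<^bsub>M\<^esub> d)"
  by (simp add: a_minus_def M.minus_add M.a_ac)

lemma minus_minus4: "\<lbrakk>a \<in> carrier M; b \<in> carrier M; c \<in> carrier M; d \<in> carrier M\<rbrakk> \<Longrightarrow>
    (a \<ominus>\<^bsub>M\<^esub> b) \<ominus>\<^bsub>M\<^esub> (c \<ominus>\<^bsub>M\<^esub> d) = (a \<ominus>\<^bsub>M\<^esub> c) \<ominus>\<^bsub>M\<^esub> (b \<ominus>\<^bsub>M\<^esub> d)"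
  by (simp add: a_minus_def M.minus_add M.a_ac M.minus_minus)

lemma kos_d_closed:
  assumes W: "submodule W R M"
  shows "set gs \<subseteq> carrier R \<Longrightarrow> (\<And>xs. c xs \<in> W) \<Longrightarrow> kos_d M gs c xs \<in> W"
  by (induction gs arbitrary: c xs)
     (auto simp: W submodule_closed split: list.split)

lemma kos_t_closed:
  assumes W: "submodule W R M"
  shows "set gs \<subseteq> carrier R \<Longrightarrow> (\<And>xs. c xs \<in> W) \<Longrightarrow> kos_t M gs c xs \<in> W"
  by (induction gs arbitrary: c xs)
     (auto simp: W submodule_closed split: list.split)

lemmas kos_d_carrier [simp] = kos_d_closed[OF carrier_is_submodule]
lemmas kos_t_carrier [simp] = kos_t_closed[OF carrier_is_submodule]

lemma kos_d_zero: "set gs \<subseteq> carrier R \<Longrightarrow> kos_d M gs (\<lambda>xs. \<zero>\<^bsub>M\<^esub>) xs = \<zero>\<^bsub>M\<^esub>"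
  by (induction gs arbitrary: xs) (auto split: list.split)

lemma kos_t_zero: "set gs \<subseteq> carrier R \<Longrightarrow> kos_t M gs (\<lambda>xs. \<zero>\<^bsub>M\<^esub>) xs = \<zero>\<^bsub>M\<^esub>"
  by (induction gs arbitrary: xs) (auto split: list.split)

lemma kos_d_minus:
  "set gs \<subseteq> carrier R \<Longrightarrow> (\<And>xs. c xs \<in> carrier M) \<Longrightarrow> (\<And>xs. c' xs \<in> carrier M) \<Longrightarrow>
   kos_d M gs (\<lambda>xs. c xs \<ominus>\<^bsub>M\<^esub> c' xs) xs = kos_d M gs c xs \<ominus>\<^bsub>M\<^esub> kos_d M gs c' xs"
  by (induction gs arbitrary: c c' xs)
     (auto simp: smult_minus minus_minus4 split: list.split)

lemma kos_t_minus:
  "set gs \<subseteq> carrier R \<Longrightarrow> (\<And>xs. c xs \<in> carrier M) \<Longrightarrow> (\<And>xs. c' xs \<in> carrier M) \<Longrightarrow>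
   kos_t M gs (\<lambda>xs. c xs \<ominus>\<^bsub>M\<^esub> c' xs) xs = kos_t M gs c xs \<ominus>\<^bsub>M\<^esub> kos_t M gs c' xs"
  by (induction gs arbitrary: c c' xs)
     (auto simp: smult_minus minus_minus4 split: list.split)

lemma kos_d_add:
  "set gs \<subseteq> carrier R \<Longrightarrow> (\<And>xs. c xs \<in> carrier M) \<Longrightarrow> (\<And>xs. c' xs \<in> carrier M) \<Longrightarrow>
   kos_d M gs (\<lambda>xs. c xs \<oplus>\<^bsub>M\<^esub> c' xs) xs = kos_d M gs c xs \<oplus>\<^bsub>M\<^esub> kos_d M gs c' xs"
  by (induction gs arbitrary: c c' xs)
     (auto simp: smult_r_distr minus_add4 split: list.split)

lemma kos_d_smult:
  "set gs \<subseteq> carrier R \<Longrightarrow> (\<And>xs. c xs \<in> carrier M) \<Longrightarrow> a \<in> carrier R \<Longrightarrow>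
   kos_d M gs (\<lambda>xs. a \<odot>\<^bsub>M\<^esub> c xs) xs = a \<odot>\<^bsub>M\<^esub> kos_d M gs c xs"
  by (induction gs arbitrary: c xs)
     (auto simp: smult_minus smult_assoc1[symmetric] m_comm split: list.split)

lemma kos_t_smult:
  "set gs \<subseteq> carrier R \<Longrightarrow> (\<And>xs. c xs \<in> carrier M) \<Longrightarrow> a \<in> carrier R \<Longrightarrow>
   kos_t M gs (\<lambda>xs. a \<odot>\<^bsub>M\<^esub> c xs) xs = a \<odot>\<^bsub>M\<^esub> kos_t M gs c xs"
  by (induction gs arbitrary: c xs)
     (auto simp: smult_minus smult_assoc1[symmetric] m_comm split: list.split)

lemma kos_d_kos_d:
  "set gs \<subseteq> carrier R \<Longrightarrow> (\<And>xs. c xs \<in> carrier M) \<Longrightarrow>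
   kos_d M gs (kos_d M gs c) xs = \<zero>\<^bsub>M\<^esub>"
proof (induction gs arbitrary: c xs)
  case (Cons g gs)
  have c: "\<And>xs. c xs \<in> carrier M" and g: "g \<in> carrier R" and gs: "set gs \<subseteq> carrier R"
    using Cons.prems by auto
  show ?case
    using kos_d_minus[OF gs, of "\<lambda>zs. g \<odot>\<^bsub>M\<^esub> c (False # zs)" "kos_d M gs (\<lambda>zs. c (True # zs))"]
      kos_d_smult[OF gs, of "\<lambda>zs. c (False # zs)" g] Cons.IH[OF gs] c g gs
    by (auto split: list.split)
qed simp

text \<open>A transition map intertwines the differentials of its source and target, which are built
  from different ring elements.\<close>

lemma kos_d_kos_t:
  "set fs \<subseteq> carrier R \<Longrightarrow> set gs \<subseteq> carrier R \<Longrightarrow> length fs = length gs \<Longrightarrow>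
   (\<And>xs. c xs \<in> carrier M) \<Longrightarrow>
   kos_d M (map2 (\<otimes>) fs gs) (kos_t M gs c) xs = kos_t M gs (kos_d M fs c) xs"
proof (induction fs arbitrary: gs c xs)
  case (Cons f fs)
  obtain g gs' where gs: "gs = g # gs'" using Cons.prems by (cases gs) auto
  have c: "\<And>xs. c xs \<in> carrier M" and f: "f \<in> carrier R" "g \<in> carrier R"
     "set fs \<subseteq> carrier R" "set gs' \<subseteq> carrier R" "length fs = length gs'"
    using Cons.prems gs by auto
  have sub: "set (map2 (\<otimes>) fs gs') \<subseteq> carrier R"
    using f(3,4) by (auto dest: set_zip_leftD set_zip_rightD)
  have t: "\<And>b ys. kos_t M gs' (\<lambda>zs. c (b # zs)) ys \<in> carrier M" using c f by simp
  show ?case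
    unfolding gs
    using kos_d_smult[OF sub, of "kos_t M gs' (\<lambda>zs. c (True # zs))" g]
      kos_t_minus[OF f(4), of "\<lambda>ys. f \<odot>\<^bsub>M\<^esub> c (False # ys)" "kos_d M fs (\<lambda>zs. c (True # zs))"]
      kos_t_smult[OF f(4), of "\<lambda>ys. c (False # ys)" f]
      Cons.IH[OF f(3-5)] c f t sub
    by (auto simp: smult_minus smult_assoc1 m_comm[of f g] split: list.split)
qed (simp add: kos_d_zero)

lemma kos_t_kos_t:
  "set fs \<subseteq> carrier R \<Longrightarrow> set gs \<subseteq> carrier R \<Longrightarrow> length fs = length gs \<Longrightarrow>
   (\<And>xs. c xs \<in> carrier M) \<Longrightarrow>
   kos_t M fs (kos_t M gs c) xs = kos_t M (map2 (\<otimes>) fs gs) c xs"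
proof (induction fs arbitrary: gs c xs)
  case (Cons f fs)
  obtain g gs' where gs: "gs = g # gs'" using Cons.prems by (cases gs) auto
  have c: "\<And>xs. c xs \<in> carrier M" and f: "f \<in> carrier R" "g \<in> carrier R"
     "set fs \<subseteq> carrier R" "set gs' \<subseteq> carrier R" "length fs = length gs'"
    using Cons.prems gs by auto
  have sub: "set (map2 (\<otimes>) fs gs') \<subseteq> carrier R"
    using f(3,4) by (auto dest: set_zip_leftD set_zip_rightD)
  have t: "\<And>b ys. kos_t M gs' (\<lambda>zs. c (b # zs)) ys \<in> carrier M" using c f by simp
  have t2: "\<And>b ys. kos_t M (map2 (\<otimes>) fs gs') (\<lambda>zs. c (b # zs)) ys \<in> carrier M" using c sub by simp
  show ?case
    unfolding gs
    using kos_t_smult[OF f(3), of "kos_t M gs' (\<lambda>zs. c (True # zs))" g]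
      Cons.IH[OF f(3-5)] c f t t2 sub
    by (auto simp: smult_assoc1  split: list.split)
qed simp

lemma cochainsI:
  "(\<And>xs. c xs \<in> W) \<Longrightarrow> (\<And>xs. c xs \<noteq> \<zero>\<^bsub>M\<^esub> \<Longrightarrow> length xs = n \<and> int (count_list xs True) = t) \<Longrightarrow>
   c \<in> cochains M W n t"
  by (auto simp: cochains_def)

lemma cochains_closed: "c \<in> cochains M W n t \<Longrightarrow> c xs \<in> W"
  by (auto simp: cochains_def)

lemma cochains_zero: "c \<in> cochains M W n t \<Longrightarrow>
   length xs \<noteq> n \<or> int (count_list xs True) \<noteq> t \<Longrightarrow> c xs = \<zero>\<^bsub>M\<^esub>"
  by (auto simp: cochains_def)

lemma cochains_False: "c \<in> cochains M W (Suc n) t \<Longrightarrow> (\<lambda>ys. c (False # ys)) \<in> cochains M W n t"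
  by (auto simp: cochains_def)

lemma cochains_True: "c \<in> cochains M W (Suc n) t \<Longrightarrow> (\<lambda>ys. c (True # ys)) \<in> cochains M W n (t - 1)"
  by (fastforce simp: cochains_def)

lemma cochains_mono: "c \<in> cochains M W n t \<Longrightarrow> W \<subseteq> W' \<Longrightarrow> c \<in> cochains M W' n t"
  by (auto simp: cochains_def)

lemma cochains_change: "c \<in> cochains M W n t \<Longrightarrow> (\<And>xs. c xs \<in> W') \<Longrightarrow> c \<in> cochains M W' n t"
  by (auto simp: cochains_def)

lemma cochains_neg_degree: "c \<in> cochains M W n t \<Longrightarrow> t < 0 \<Longrightarrow> c xs = \<zero>\<^bsub>M\<^esub>"
  by (auto simp: cochains_def)

lemma cochains_null: "submodule W R M \<Longrightarrow> (\<lambda>xs. \<zero>\<^bsub>M\<^esub>) \<in> cochains M W n t"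
  by (simp add: cochains_def submodule_zero)

lemma cochains_minus:
  assumes "submodule W R M" "c \<in> cochains M W n t" "c' \<in> cochains M W n t"
  shows "(\<lambda>xs. c xs \<ominus>\<^bsub>M\<^esub> c' xs) \<in> cochains M W n t"
  using assms cochains_zero[OF assms(2)] cochains_zero[OF assms(3)]
  by (fastforce intro!: cochainsI submodule_minus dest: cochains_closed)

lemma cochains_add:
  assumes "submodule W R M" "c \<in> cochains M W n t" "c' \<in> cochains M W n t"
  shows "(\<lambda>xs. c xs \<oplus>\<^bsub>M\<^esub> c' xs) \<in> cochains M W n t"
  using assms cochains_zero[OF assms(2)] cochains_zero[OF assms(3)]
  by (fastforce intro!: cochainsI submodule_add dest: cochains_closed)

lemma cochains_smult:
  assumes "submodule W R M" "c \<in> cochains M W n t" "a \<in> carrier R"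
  shows "(\<lambda>xs. a \<odot>\<^bsub>M\<^esub> c xs) \<in> cochains M W n t"
  using assms cochains_zero[OF assms(2)]
  by (fastforce intro!: cochainsI submodule_smult dest: cochains_closed)

lemma cochains_kos_d:
  assumes W: "submodule W R M"
  shows "set gs \<subseteq> carrier R \<Longrightarrow> length gs = n \<Longrightarrow> c \<in> cochains M W n t \<Longrightarrow>
    kos_d M gs c \<in> cochains M W n (t + 1)"
proof (induction gs arbitrary: c n t)
  case Nil then show ?case by (simp add: cochains_null W)
next
  case (Cons g gs)
  have n: "n = Suc (length gs)" and g: "g \<in> carrier R" "set gs \<subseteq> carrier R" using Cons.prems by auto
  note c = Cons.prems(3)[unfolded n]
  note F = Cons.IH[OF g(2) refl cochains_False[OF c]]
  note T = Cons.IH[OF g(2) refl cochains_True[OF c]]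
  show ?case
  proof (rule cochainsI)
    fix xs
    show "kos_d M (g # gs) c xs \<in> W"
      by (rule kos_d_closed[OF W Cons.prems(1)]) (rule cochains_closed[OF c])
    show "length xs = n \<and> int (count_list xs True) = t + 1" if nz: "kos_d M (g # gs) c xs \<noteq> \<zero>\<^bsub>M\<^esub>"
    proof (rule ccontr)
      assume neg: "\<not> ?thesis"
      then obtain b ys where xs: "xs = b # ys" using nz by (cases xs) auto
      show False
      proof (cases b)
        case True
        then have "c (False # ys) = \<zero>\<^bsub>M\<^esub>" "kos_d M gs (\<lambda>zs. c (True # zs)) ys = \<zero>\<^bsub>M\<^esub>"
          using neg xs n by (auto intro!: cochains_zero[OF c] cochains_zero[OF T])
        then show False using nz xs True g by simp
      next
        case False
        then have "kos_d M gs (\<lambda>zs. c (False # zs)) ys = \<zero>\<^bsub>M\<^esub>"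
          using neg xs n by (auto intro!: cochains_zero[OF F])
        then show False using nz xs False by simp
      qed
    qed
  qed
qed

lemma cochains_kos_t:
  assumes W: "submodule W R M"
  shows "set gs \<subseteq> carrier R \<Longrightarrow> length gs = n \<Longrightarrow> c \<in> cochains M W n t \<Longrightarrow>
    kos_t M gs c \<in> cochains M W n t"
proof (induction gs arbitrary: c n t)
  case Nil then show ?case by simp
next
  case (Cons g gs)
  have n: "n = Suc (length gs)" and g: "g \<in> carrier R" "set gs \<subseteq> carrier R" using Cons.prems by auto
  note c = Cons.prems(3)[unfolded n]
  note F = Cons.IH[OF g(2) refl cochains_False[OF c]]
  note T = Cons.IH[OF g(2) refl cochains_True[OF c]]
  show ?case
  proof (rule cochainsI)
    fix xs
    show "kos_t M (g # gs) c xs \<in> W"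
      by (rule kos_t_closed[OF W Cons.prems(1)]) (rule cochains_closed[OF c])
    show "length xs = n \<and> int (count_list xs True) = t" if nz: "kos_t M (g # gs) c xs \<noteq> \<zero>\<^bsub>M\<^esub>"
    proof (rule ccontr)
      assume neg: "\<not> ?thesis"
      then obtain b ys where xs: "xs = b # ys" using nz by (cases xs) auto
      show False
      proof (cases b)
        case True
        then have "kos_t M gs (\<lambda>zs. c (True # zs)) ys = \<zero>\<^bsub>M\<^esub>"
          using neg xs n by (auto intro!: cochains_zero[OF T])
        then show False using nz xs True g by simp
      next
        case False
        then have "kos_t M gs (\<lambda>zs. c (False # zs)) ys = \<zero>\<^bsub>M\<^esub>"
          using neg xs n by (auto intro!: cochains_zero[OF F])
        then show False using nz xs False by simp
      qed
    qed
  qed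
qed

end

locale module_map = M: module S M + N: module S N
  for S :: "('s, 'b) ring_scheme" and M :: "('s, 'm) module" and N :: "('s, 'n) module" +
  fixes \<phi> :: "'m \<Rightarrow> 'n"
  assumes map: "\<phi> \<in> lin_maps S M N"
begin

lemma map_closed [simp, intro]: "x \<in> carrier M \<Longrightarrow> \<phi> x \<in> carrier N"
  using map by (auto simp: lin_maps_def)

lemma map_add: "x \<in> carrier M \<Longrightarrow> y \<in> carrier M \<Longrightarrow> \<phi> (x \<oplus>\<^bsub>M\<^esub> y) = \<phi> x \<oplus>\<^bsub>N\<^esub> \<phi> y"
  using map by (auto simp: lin_maps_def)

lemma map_smult: "s \<in> carrier S \<Longrightarrow> x \<in> carrier M \<Longrightarrow> \<phi> (s \<odot>\<^bsub>M\<^esub> x) = s \<odot>\<^bsub>N\<^esub> \<phi> x"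
  using map by (auto simp: lin_maps_def)

lemma map_zero [simp]: "\<phi> \<zero>\<^bsub>M\<^esub> = \<zero>\<^bsub>N\<^esub>"
  using map_smult[of "\<zero>\<^bsub>S\<^esub>" "\<zero>\<^bsub>M\<^esub>"] by simp

lemma map_neg: "x \<in> carrier M \<Longrightarrow> \<phi> (\<ominus>\<^bsub>M\<^esub> x) = \<ominus>\<^bsub>N\<^esub> \<phi> x"
  using map_add[of x "\<ominus>\<^bsub>M\<^esub> x"]
  by (metis M.add.inv_closed M.r_neg N.add.inv_equality N.M.a_comm map_closed map_zero)

lemma map_minus: "x \<in> carrier M \<Longrightarrow> y \<in> carrier M \<Longrightarrow> \<phi> (x \<ominus>\<^bsub>M\<^esub> y) = \<phi> x \<ominus>\<^bsub>N\<^esub> \<phi> y"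
  by (simp add: a_minus_def map_add map_neg)

lemma map_kos_d:
  "set gs \<subseteq> carrier S \<Longrightarrow> (\<And>xs. c xs \<in> carrier M) \<Longrightarrow>
   \<phi> (kos_d M gs c xs) = kos_d N gs (\<lambda>xs. \<phi> (c xs)) xs"
  by (induction gs arbitrary: c xs) (auto simp: map_minus map_smult split: list.split)

lemma map_kos_t:
  "set gs \<subseteq> carrier S \<Longrightarrow> (\<And>xs. c xs \<in> carrier M) \<Longrightarrow>
   \<phi> (kos_t M gs c xs) = kos_t N gs (\<lambda>xs. \<phi> (c xs)) xs"
  by (induction gs arbitrary: c xs) (auto simp: map_smult split: list.split)

lemma map_cochains:
  "c \<in> cochains M W n t \<Longrightarrow> (\<lambda>xs. \<phi> (c xs)) \<in> cochains N (\<phi> ` W) n t"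
  by (force simp: cochains_def)

text \<open>Preimages are chosen entry by entry, and zero is lifted to zero in order not to enlarge the
  support.\<close>

lemma lift_cochains:
  assumes "c \<in> cochains N (\<phi> ` W) n t" and W: "submodule W S M"
  obtains c' where "c' \<in> cochains M W n t" "\<And>xs. \<phi> (c' xs) = c xs"
proof -
  have "\<exists>w\<in>W. c xs = \<phi> w \<and> (c xs = \<zero>\<^bsub>N\<^esub> \<longrightarrow> w = \<zero>\<^bsub>M\<^esub>)" for xs
  proof (cases "c xs = \<zero>\<^bsub>N\<^esub>")
    case True
    then show ?thesis using M.submodule_zero[OF W] by (intro bexI[of _ "\<zero>\<^bsub>M\<^esub>"]) auto
  next
    case False
    then show ?thesis using N.cochains_closed[OF assms(1), of xs] by auto
  qed
  then obtain f where f: "\<And>xs. f xs \<in> W \<and> c xs = \<phi> (f xs) \<and> (c xs = \<zero>\<^bsub>N\<^esub> \<longrightarrow> f xs = \<zero>\<^bsub>M\<^esub>)"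
    by metis
  show ?thesis
  proof
    show "f \<in> cochains M W n t"
      using f assms(1) unfolding cochains_def mem_Collect_eq by metis
    show "\<phi> (f xs) = c xs" for xs using f by metis
  qed
qed

end

section \<open>Annihilating Koszul cohomology\<close>

definition powers :: "('s, 'b) ring_scheme \<Rightarrow> 's list \<Rightarrow> nat \<Rightarrow> 's list" where
  "powers S fs k = map (\<lambda>f. f [^]\<^bsub>S\<^esub> k) fs"

text \<open>The element \<open>z\<close> annihilates the degree \<open>t\<close> cohomology of the colimit over \<open>N\<close> of the Koszul
  complexes of \<open>f\<^sub>1\<^sup>N, \<dots>, f\<^sub>n\<^sup>N\<close> with coefficients in \<open>W\<close>. The submodule \<open>W\<close> is a separate
  argument because the submodules of \<open>M\<close> share the operations of \<open>M\<close>.\<close>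

definition kills :: "('s, 'b) ring_scheme \<Rightarrow> 's list \<Rightarrow> ('s, 'm, 'z) module_scheme \<Rightarrow> 'm set \<Rightarrow> 's \<Rightarrow> int \<Rightarrow> bool" where
  "kills S fs M W z t \<longleftrightarrow>
    (\<forall>N. \<forall>c\<in>cochains M W (length fs) t. (\<forall>xs. kos_d M (powers S fs N) c xs = \<zero>\<^bsub>M\<^esub>) \<longrightarrow>
      (\<exists>k. \<exists>h\<in>cochains M W (length fs) (t - 1).
        \<forall>xs. z \<odot>\<^bsub>M\<^esub> kos_t M (powers S fs k) c xs = kos_d M (powers S fs (N + k)) h xs))"

text \<open>The list of \<open>n\<close> values \<open>False\<close> stands for the empty subset, so this is the cochain of degree
  \<open>0\<close> with value \<open>x\<close>.\<close>

definition deg0 :: "('s, 'm, 'z) module_scheme \<Rightarrow> nat \<Rightarrow> 'm \<Rightarrow> bool list \<Rightarrow> 'm" where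
  "deg0 M n x = (\<lambda>xs. if xs = replicate n False then x else \<zero>\<^bsub>M\<^esub>)"

lemma length_powers [simp]: "length (powers S fs k) = length fs"
  by (simp add: powers_def)

lemma killsE:
  assumes "kills S fs M W z t" "c \<in> cochains M W (length fs) t"
    "\<And>xs. kos_d M (powers S fs N) c xs = \<zero>\<^bsub>M\<^esub>"
  obtains k h where "h \<in> cochains M W (length fs) (t - 1)"
    "\<And>xs. z \<odot>\<^bsub>M\<^esub> kos_t M (powers S fs k) c xs = kos_d M (powers S fs (N + k)) h xs"
  using assms unfolding kills_def by metis

lemma killsI:
  assumes "\<And>N c. c \<in> cochains M W (length fs) t \<Longrightarrow> (\<And>xs. kos_d M (powers S fs N) c xs = \<zero>\<^bsub>M\<^esub>) \<Longrightarrow>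
     \<exists>k. \<exists>h\<in>cochains M W (length fs) (t - 1).
        \<forall>xs. z \<odot>\<^bsub>M\<^esub> kos_t M (powers S fs k) c xs = kos_d M (powers S fs (N + k)) h xs"
  shows "kills S fs M W z t"
  using assms unfolding kills_def by metis

context cring begin

lemma powers_carrier [simp]: "set fs \<subseteq> carrier R \<Longrightarrow> set (powers R fs k) \<subseteq> carrier R"
  by (auto simp: powers_def)

lemma powers_add: "set fs \<subseteq> carrier R \<Longrightarrow> map2 (\<otimes>) (powers R fs a) (powers R fs b) = powers R fs (a + b)"
  by (induction fs) (auto simp: powers_def nat_pow_mult)

end

context module begin

lemma kos_d_kos_t_powers:
  assumes "set fs \<subseteq> carrier R" "\<And>xs. c xs \<in> carrier M"
  shows "kos_d M (powers R fs (N + k)) (kos_t M (powers R fs k) c) xs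
       = kos_t M (powers R fs k) (kos_d M (powers R fs N) c) xs"
  using kos_d_kos_t[of "powers R fs N" "powers R fs k" c] assms by (simp add: powers_add)

lemma kos_t_kos_t_powers:
  assumes "set fs \<subseteq> carrier R" "\<And>xs. c xs \<in> carrier M"
  shows "kos_t M (powers R fs a) (kos_t M (powers R fs b) c) xs = kos_t M (powers R fs (b + a)) c xs"
  using kos_t_kos_t[of "powers R fs a" "powers R fs b" c] assms by (simp add: powers_add add.commute)

lemma cocycle_kos_t:
  assumes "set fs \<subseteq> carrier R" "\<And>xs. c xs \<in> carrier M" "\<And>xs. kos_d M (powers R fs N) c xs = \<zero>\<^bsub>M\<^esub>"
  shows "kos_d M (powers R fs (N + k)) (kos_t M (powers R fs k) c) xs = \<zero>\<^bsub>M\<^esub>"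
proof -
  have "kos_d M (powers R fs N) c = (\<lambda>xs. \<zero>\<^bsub>M\<^esub>)" using assms(3) by blast
  then show ?thesis using kos_d_kos_t_powers[OF assms(1,2)] assms(1) by (simp add: kos_t_zero)
qed

lemma kos_t_powers_0:
  assumes "set fs \<subseteq> carrier R" "c \<in> cochains M (carrier M) (length fs) t"
  shows "kos_t M (powers R fs 0) c xs = c xs"
  using assms
proof (induction fs arbitrary: c t xs)
  case Nil then show ?case by (simp add: powers_def)
next
  case (Cons f fs)
  have "c [] = \<zero>\<^bsub>M\<^esub>" using cochains_zero[OF Cons.prems(2), of "[]"] by simp
  moreover have "kos_t M (powers R fs 0) (\<lambda>zs. c (True # zs)) ys = c (True # ys)"
     "kos_t M (powers R fs 0) (\<lambda>zs. c (False # zs)) ys = c (False # ys)" for ys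
    using Cons.IH[OF _ cochains_False[of c "carrier M" "length fs" t]]
      Cons.IH[OF _ cochains_True[of c "carrier M" "length fs" t]] Cons.prems by auto
  moreover have "\<And>xs. c xs \<in> carrier M" using Cons.prems(2) cochains_closed by blast
  ultimately show ?case by (auto simp: powers_def split: list.split)
qed

lemma deg0_cochain: "submodule W R M \<Longrightarrow> x \<in> W \<Longrightarrow> deg0 M n x \<in> cochains M W n 0"
  by (auto simp: deg0_def cochains_def submodule_zero)

lemma cochains_deg0:
  assumes "c \<in> cochains M W n 0" shows "c = deg0 M n (c (replicate n False))"
proof
  fix xs
  have "xs = replicate n False" if "length xs = n" "count_list xs True = 0"
    using that by (metis (full_types) count_list_0_iff replicate_eqI)
  then show "c xs = deg0 M n (c (replicate n False)) xs"
    using cochains_zero[OF assms, of xs] unfolding deg0_def of_nat_eq_0_iff by metis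
qed

lemma kos_t_deg0:
  "set gs \<subseteq> carrier R \<Longrightarrow> length gs = n \<Longrightarrow> x \<in> carrier M \<Longrightarrow> kos_t M gs (deg0 M n x) = deg0 M n x"
proof (induction gs arbitrary: n)
  case (Cons g gs)
  have eq: "(\<lambda>zs. deg0 M n x (True # zs)) = (\<lambda>zs. \<zero>\<^bsub>M\<^esub>)"
       "(\<lambda>zs. deg0 M n x (False # zs)) = deg0 M (length gs) x"
    using Cons.prems by (auto simp: deg0_def)
  have "kos_t M (g # gs) (deg0 M n x) xs = deg0 M n x xs" for xs
  proof (cases xs)
    case Nil then show ?thesis using Cons.prems by (auto simp: deg0_def)
  next
    case (Cons b ys)
    show ?thesis
    proof (cases b)
      case True
      then show ?thesis using Cons Cons.prems eq fun_cong[OF eq(1), of ys] by (simp add: kos_t_zero)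
    next
      case False
      then show ?thesis using Cons Cons.prems eq(2) fun_cong[OF eq(2), of ys] Cons.IH[OF _ refl] by simp
    qed
  qed
  then show ?case by blast
qed simp

lemma kos_d_deg0:
  "set gs \<subseteq> carrier R \<Longrightarrow> length gs = n \<Longrightarrow> x \<in> carrier M \<Longrightarrow>
   (\<forall>xs. kos_d M gs (deg0 M n x) xs = \<zero>\<^bsub>M\<^esub>) \<longleftrightarrow> (\<forall>g\<in>set gs. g \<odot>\<^bsub>M\<^esub> x = \<zero>\<^bsub>M\<^esub>)"
proof (induction gs arbitrary: n)
  case (Cons g gs)
  have eq: "(\<lambda>zs. deg0 M n x (True # zs)) = (\<lambda>zs. \<zero>\<^bsub>M\<^esub>)"
       "(\<lambda>zs. deg0 M n x (False # zs)) = deg0 M (length gs) x"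
    using Cons.prems by (auto simp: deg0_def)
  have 1: "kos_d M (g # gs) (deg0 M n x) (False # ys) = kos_d M gs (deg0 M (length gs) x) ys" for ys
    using eq by simp
  have 2: "kos_d M (g # gs) (deg0 M n x) (True # ys) = g \<odot>\<^bsub>M\<^esub> deg0 M (length gs) x ys" for ys
    using eq Cons.prems fun_cong[OF eq(2), of ys] by (simp add: kos_d_zero) (simp add: deg0_def)
  have "(\<forall>xs. kos_d M (g # gs) (deg0 M n x) xs = \<zero>\<^bsub>M\<^esub>) \<longleftrightarrow>
     (\<forall>ys. kos_d M (g # gs) (deg0 M n x) (False # ys) = \<zero>\<^bsub>M\<^esub>) \<and>
     (\<forall>ys. kos_d M (g # gs) (deg0 M n x) (True # ys) = \<zero>\<^bsub>M\<^esub>)"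
    (is "?L \<longleftrightarrow> ?Rr")
  proof
    show "?L \<Longrightarrow> ?Rr" by blast
    assume r: ?Rr
    show ?L
    proof
      fix xs show "kos_d M (g # gs) (deg0 M n x) xs = \<zero>\<^bsub>M\<^esub>"
      proof (cases xs)
        case (Cons b ys) then show ?thesis using r by (metis (full_types))
      qed simp
    qed
  qed
  also have "\<dots> \<longleftrightarrow> (\<forall>h\<in>set gs. h \<odot>\<^bsub>M\<^esub> x = \<zero>\<^bsub>M\<^esub>) \<and> g \<odot>\<^bsub>M\<^esub> x = \<zero>\<^bsub>M\<^esub>"
    unfolding 1 2 using Cons.IH[OF _ refl] Cons.prems by (auto simp: deg0_def)
  finally show ?case by auto
qed simp

lemma kos_t_multiple:
  assumes "set gs \<subseteq> carrier R" "\<And>xs. c xs \<in> carrier M" "length xs = length gs"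
  shows "\<exists>r\<in>carrier R. kos_t M gs c xs = r \<odot>\<^bsub>M\<^esub> c xs"
  using assms
proof (induction gs arbitrary: c xs)
  case Nil then show ?case by (intro bexI[of _ \<one>]) auto
next
  case (Cons g gs)
  then obtain b ys where xs: "xs = b # ys" by (cases xs) auto
  obtain r where r: "r \<in> carrier R" "kos_t M gs (\<lambda>zs. c (b # zs)) ys = r \<odot>\<^bsub>M\<^esub> c (b # ys)"
    using Cons.IH[of "\<lambda>zs. c (b # zs)" ys] Cons.prems xs by auto
  show ?case
  proof (cases b)
    case True
    then show ?thesis using r xs Cons.prems
      by (intro bexI[of _ "g \<otimes> r"]) (auto simp: smult_assoc1)
  qed (use r xs in auto)
qed

lemma kos_t_multiple_of_entry:
  assumes "set gs \<subseteq> carrier R" "\<And>xs. c xs \<in> carrier M" "length xs = length gs" "True \<in> set xs"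
  shows "\<exists>r\<in>carrier R. \<exists>g\<in>set gs. kos_t M gs c xs = r \<odot>\<^bsub>M\<^esub> (g \<odot>\<^bsub>M\<^esub> c xs)"
  using assms
proof (induction gs arbitrary: c xs)
  case Nil then show ?case by auto
next
  case (Cons g gs)
  then obtain b ys where xs: "xs = b # ys" by (cases xs) auto
  have c: "c (b # ys) \<in> carrier M" "g \<in> carrier R" using Cons.prems by auto
  show ?case
  proof (cases b)
    case True
    obtain r where r: "r \<in> carrier R" "kos_t M gs (\<lambda>zs. c (b # zs)) ys = r \<odot>\<^bsub>M\<^esub> c (b # ys)"
      using kos_t_multiple[of gs "\<lambda>zs. c (b # zs)" ys] Cons.prems xs by auto
    show ?thesis using True r xs c
      by (intro bexI[of _ r] bexI[of _ g]) (auto simp: smult_assoc1[symmetric] m_comm)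
  next
    case False
    then show ?thesis using Cons.IH[of "\<lambda>zs. c (b # zs)" ys] Cons.prems xs by auto
  qed
qed

text \<open>Torsion modules have no local cohomology in positive degrees: in degree \<open>t \<ge> 1\<close> every entry
  of a cochain acquires a factor \<open>f\<^sub>i\<^sup>k\<close> under the transition map. The relative form, with
  torsion modulo \<open>U\<close>, applies to cocycles modulo coboundaries.\<close>

lemma kos_t_torsion:
  assumes fs: "set fs \<subseteq> carrier R" and W: "submodule W R M" and U: "submodule U R M"
    and tors: "\<And>x. x \<in> W \<Longrightarrow> \<exists>N. \<forall>f\<in>set fs. f [^] (N::nat) \<odot>\<^bsub>M\<^esub> x \<in> U"
    and c: "c \<in> cochains M W (length fs) t" and t: "1 \<le> t"
  shows "\<exists>k. kos_t M (powers R fs k) c \<in> cochains M U (length fs) t"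
proof -
  have "\<forall>xs. \<exists>N. \<forall>f\<in>set fs. f [^] (N::nat) \<odot>\<^bsub>M\<^esub> c xs \<in> U"
    using tors cochains_closed[OF c] by blast
  then obtain N where N: "\<And>xs f. f \<in> set fs \<Longrightarrow> f [^] (N xs::nat) \<odot>\<^bsub>M\<^esub> c xs \<in> U" by metis
  define k where "k = Max (N ` {xs. length xs = length fs})"
  have fin: "finite {xs :: bool list. length xs = length fs}"
    using finite_lists_length_eq[of "UNIV :: bool set" "length fs"] by simp
  have ck: "c xs \<in> carrier M" for xs using cochains_closed[OF c] submodule_subset[OF W] by blast
  have in_U: "kos_t M (powers R fs k) c xs \<in> U" for xs
  proof (cases "length xs = length fs \<and> True \<in> set xs")
    case True
    then have "N xs \<le> k" unfolding k_def using fin by (intro Max_ge) auto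
    obtain r f where r: "r \<in> carrier R" "f \<in> set fs"
      "kos_t M (powers R fs k) c xs = r \<odot>\<^bsub>M\<^esub> (f [^] k \<odot>\<^bsub>M\<^esub> c xs)"
      using kos_t_multiple_of_entry[of "powers R fs k" c xs] True fs ck
      by (auto simp: powers_def)
    have f: "f \<in> carrier R" using r fs by auto
    have "f [^] k = f [^] (k - N xs) \<otimes> f [^] N xs"
      using \<open>N xs \<le> k\<close> f by (simp add: nat_pow_mult)
    then have "f [^] k \<odot>\<^bsub>M\<^esub> c xs = f [^] (k - N xs) \<odot>\<^bsub>M\<^esub> (f [^] N xs \<odot>\<^bsub>M\<^esub> c xs)"
      using f ck by (simp add: smult_assoc1)
    also have "\<dots> \<in> U" by (rule submodule_smult[OF U nat_pow_closed[OF f] N[OF r(2)]])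
    finally show ?thesis using r submodule_smult[OF U] by metis
  next
    case False
    have "count_list xs True = 0" if "length xs = length fs"
      using that False by (simp add: count_list_0_iff)
    then have "kos_t M (powers R fs k) c xs = \<zero>\<^bsub>M\<^esub>"
      using t False cochains_zero[OF cochains_kos_t[OF W _ _ c], of "powers R fs k" xs] fs
      by (cases "length xs = length fs") auto
    then show ?thesis using submodule_zero[OF U] by simp
  qed
  have "kos_t M (powers R fs k) c \<in> cochains M W (length fs) t"
    using cochains_kos_t[OF W _ _ c] fs by simp
  then show ?thesis using in_U by (blast intro: cochains_change)
qed

end

context module_map begin

lemma image_submodule:
  assumes W: "submodule W S M" shows "submodule (\<phi> ` W) S N"
proof (rule N.submodule_criterion)
  note WM = M.submodule_subset[OF W]
  show "\<phi> ` W \<subseteq> carrier N" using WM by blast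
  show "\<zero>\<^bsub>N\<^esub> \<in> \<phi> ` W" using imageI[OF M.submodule_zero[OF W], of \<phi>] by simp
  show "x \<oplus>\<^bsub>N\<^esub> y \<in> \<phi> ` W" if "x \<in> \<phi> ` W" "y \<in> \<phi> ` W" for x y
    using that M.submodule_add[OF W] by (auto simp: WM simp flip: map_add)
  show "a \<odot>\<^bsub>N\<^esub> x \<in> \<phi> ` W" if "a \<in> carrier S" "x \<in> \<phi> ` W" for a x
    using that M.submodule_smult[OF W] by (auto simp: WM simp flip: map_smult)
qed

lemma kernel_submodule:
  assumes W: "submodule W S M" shows "submodule {x \<in> W. \<phi> x = \<zero>\<^bsub>N\<^esub>} S M"
  by (rule M.submoduleI)
     (auto simp: M.submodule_closed[OF W] map_add map_neg map_smult M.submodule_subset[OF W])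

text \<open>For the exact sequence of the kernel \<open>L\<close> of \<open>\<phi>\<close> on \<open>W\<close>, of \<open>W\<close> and of \<open>\<phi> ` W\<close>, this says
  that \<open>z\<close> maps the cohomology of \<open>\<phi> ` W\<close> into the image of the cohomology of \<open>W\<close>. In the long
  exact sequence, the quotient by that image embeds into the cohomology of \<open>L\<close> one degree
  higher. So the condition sits between killing \<open>\<phi> ` W\<close> in degree \<open>t\<close> and killing \<open>L\<close> in
  degree \<open>t + 1\<close>, and equals either one when the relevant cohomology of \<open>W\<close> vanishes.\<close>

definition lifts :: "'s list \<Rightarrow> 'm set \<Rightarrow> 's \<Rightarrow> int \<Rightarrow> bool" where
  "lifts fs W z t \<longleftrightarrow>
    (\<forall>n. \<forall>c\<in>cochains N (\<phi> ` W) (length fs) t. (\<forall>xs. kos_d N (powers S fs n) c xs = \<zero>\<^bsub>N\<^esub>) \<longrightarrow>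
      (\<exists>k. \<exists>m\<in>cochains M W (length fs) t. (\<forall>xs. kos_d M (powers S fs (n + k)) m xs = \<zero>\<^bsub>M\<^esub>) \<and>
        (\<forall>xs. z \<odot>\<^bsub>N\<^esub> kos_t N (powers S fs k) c xs = \<phi> (m xs))))"

context
  fixes fs W z
  assumes fs: "set fs \<subseteq> carrier S" and W: "submodule W S M" and z: "z \<in> carrier S"
begin

private lemma WM: "x \<in> W \<Longrightarrow> x \<in> carrier M" using M.submodule_subset[OF W] .

private lemma CM: "c \<in> cochains M W n t \<Longrightarrow> c xs \<in> carrier M"
  using WM M.cochains_closed by blast

text \<open>A cocycle \<open>c\<close> of the kernel bounds some cochain \<open>u\<close> of \<open>W\<close> after a transition. The image of
  \<open>u\<close> is a cocycle; if \<open>m\<close> is a cocycle that lifts \<open>z\<close> times this image, then \<open>z u - m\<close> has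
  values in the kernel and bounds \<open>z c\<close>.\<close>

lemma lifts_imp_kills_kernel:
  assumes l: "lifts fs W z t" and acyc: "kills S fs M W \<one>\<^bsub>S\<^esub> (t + 1)"
  shows "kills S fs M {x \<in> W. \<phi> x = \<zero>\<^bsub>N\<^esub>} z (t + 1)"
proof (rule killsI)
  fix n c
  let ?L = "{x \<in> W. \<phi> x = \<zero>\<^bsub>N\<^esub>}"
  assume c: "c \<in> cochains M ?L (length fs) (t + 1)"
    and dc: "\<And>xs. kos_d M (powers S fs n) c xs = \<zero>\<^bsub>M\<^esub>"
  have cW: "c \<in> cochains M W (length fs) (t + 1)" using c by (rule M.cochains_mono) auto
  from killsE[OF acyc cW dc] obtain a u where u0: "u \<in> cochains M W (length fs) (t + 1 - 1)"
    and du0: "\<And>xs. \<one>\<^bsub>S\<^esub> \<odot>\<^bsub>M\<^esub> kos_t M (powers S fs a) c xs = kos_d M (powers S fs (n + a)) u xs"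
    by blast
  have u: "u \<in> cochains M W (length fs) t" using u0 by simp
  have du: "\<And>xs. kos_t M (powers S fs a) c xs = kos_d M (powers S fs (n + a)) u xs"
    using du0 CM[OF cW] fs by simp
  have "kos_d N (powers S fs (n + a)) (\<lambda>xs. \<phi> (u xs)) xs = \<zero>\<^bsub>N\<^esub>" for xs
  proof -
    have "kos_d N (powers S fs (n + a)) (\<lambda>xs. \<phi> (u xs)) xs = \<phi> (kos_t M (powers S fs a) c xs)"
      using map_kos_d[of "powers S fs (n + a)" u xs] CM[OF u] fs du by simp
    also have "\<dots> = kos_t N (powers S fs a) (\<lambda>xs. \<zero>\<^bsub>N\<^esub>) xs"
      using map_kos_t[of "powers S fs a" c xs] CM[OF cW] fs M.cochains_closed[OF c] by simp
    finally show ?thesis using fs by (simp add: N.kos_t_zero)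
  qed
  with l map_cochains[OF u] obtain b m where m: "m \<in> cochains M W (length fs) t"
    "\<And>xs. kos_d M (powers S fs (n + a + b)) m xs = \<zero>\<^bsub>M\<^esub>"
    "\<And>xs. z \<odot>\<^bsub>N\<^esub> kos_t N (powers S fs b) (\<lambda>xs. \<phi> (u xs)) xs = \<phi> (m xs)"
    unfolding lifts_def by metis
  define v where "v = (\<lambda>xs. z \<odot>\<^bsub>M\<^esub> kos_t M (powers S fs b) u xs)"
  have v: "v \<in> cochains M W (length fs) t"
    unfolding v_def by (intro M.cochains_smult[OF W] M.cochains_kos_t[OF W] u) (auto simp: fs z)
  define w where "w = (\<lambda>xs. v xs \<ominus>\<^bsub>M\<^esub> m xs)"
  have w: "w \<in> cochains M W (length fs) t" unfolding w_def by (rule M.cochains_minus[OF W v m(1)])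
  have "\<phi> (w xs) = \<zero>\<^bsub>N\<^esub>" for xs
    using m(3)[of xs] map_kos_t[of "powers S fs b" u xs] CM[OF u] CM[OF m(1)] fs z
    by (simp add: w_def v_def map_minus map_smult)
  then have wL: "w \<in> cochains M ?L (length fs) t"
    using w M.cochains_closed[OF w] by (intro M.cochains_change[OF w]) auto
  have tu: "\<And>xs. kos_t M (powers S fs b) u xs \<in> carrier M" using CM[OF u] fs by simp
  have "z \<odot>\<^bsub>M\<^esub> kos_t M (powers S fs (a + b)) c xs = kos_d M (powers S fs (n + (a + b))) w xs" for xs
  proof -
    have "kos_d M (powers S fs (n + a + b)) w xs = kos_d M (powers S fs (n + a + b)) v xs"
      unfolding w_def using M.kos_d_minus[of "powers S fs (n + a + b)" v m] CM[OF v] CM[OF m(1)] fs m(2)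
      by simp
    also have "\<dots> = z \<odot>\<^bsub>M\<^esub> kos_d M (powers S fs (n + a + b)) (kos_t M (powers S fs b) u) xs"
      unfolding v_def using tu fs z by (intro M.kos_d_smult) auto
    also have "\<dots> = z \<odot>\<^bsub>M\<^esub> kos_t M (powers S fs b) (kos_d M (powers S fs (n + a)) u) xs"
      using M.kos_d_kos_t_powers[OF fs, of u "n + a" b xs] CM[OF u] by simp
    also have "kos_d M (powers S fs (n + a)) u = kos_t M (powers S fs a) c" using du by auto
    also have "kos_t M (powers S fs b) (kos_t M (powers S fs a) c) xs = kos_t M (powers S fs (a + b)) c xs"
      using M.kos_t_kos_t_powers[OF fs, of c] CM[OF cW] by simp
    finally show ?thesis by (simp add: add.assoc)
  qed
  then show "\<exists>k. \<exists>h\<in>cochains M ?L (length fs) (t + 1 - 1).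
       \<forall>xs. z \<odot>\<^bsub>M\<^esub> kos_t M (powers S fs k) c xs = kos_d M (powers S fs (n + k)) h xs"
    using wL by (intro exI[of _ "a + b"] bexI[of _ w]) auto
qed

text \<open>The differential of a lift \<open>c'\<close> of a cocycle is a cocycle of the kernel. If \<open>z\<close> times it
  bounds \<open>h\<close> in the kernel, then \<open>z c' - h\<close> is a cocycle lifting \<open>z c\<close>.\<close>

lemma kills_kernel_imp_lifts:
  assumes kl: "kills S fs M {x \<in> W. \<phi> x = \<zero>\<^bsub>N\<^esub>} z (t + 1)"
  shows "lifts fs W z t"
  unfolding lifts_def
proof (intro allI ballI impI)
  fix n c
  let ?L = "{x \<in> W. \<phi> x = \<zero>\<^bsub>N\<^esub>}"
  assume c: "c \<in> cochains N (\<phi> ` W) (length fs) t"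
    and dc: "\<forall>xs. kos_d N (powers S fs n) c xs = \<zero>\<^bsub>N\<^esub>"
  obtain c' where c': "c' \<in> cochains M W (length fs) t" "\<And>xs. \<phi> (c' xs) = c xs"
    using lift_cochains[OF c W] by blast
  have d: "kos_d M (powers S fs n) c' \<in> cochains M W (length fs) (t + 1)"
    using M.cochains_kos_d[OF W _ _ c'(1)] fs by simp
  have "\<phi> (kos_d M (powers S fs n) c' xs) = \<zero>\<^bsub>N\<^esub>" for xs
    using map_kos_d[of "powers S fs n" c' xs] CM[OF c'(1)] fs c'(2) dc by simp
  then have dL: "kos_d M (powers S fs n) c' \<in> cochains M ?L (length fs) (t + 1)"
    using M.cochains_closed[OF d] by (intro M.cochains_change[OF d]) auto
  have dd: "\<And>xs. kos_d M (powers S fs n) (kos_d M (powers S fs n) c') xs = \<zero>\<^bsub>M\<^esub>"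
    using M.kos_d_kos_d[of "powers S fs n" c'] CM[OF c'(1)] fs by simp
  from killsE[OF kl dL dd] obtain a u where u0: "u \<in> cochains M ?L (length fs) (t + 1 - 1)"
    and du: "\<And>xs. z \<odot>\<^bsub>M\<^esub> kos_t M (powers S fs a) (kos_d M (powers S fs n) c') xs = kos_d M (powers S fs (n + a)) u xs"
    by blast
  have u: "u \<in> cochains M ?L (length fs) t" using u0 by simp
  have uW: "u \<in> cochains M W (length fs) t" using u by (rule M.cochains_mono) auto
  define v where "v = (\<lambda>xs. z \<odot>\<^bsub>M\<^esub> kos_t M (powers S fs a) c' xs)"
  have v: "v \<in> cochains M W (length fs) t"
    unfolding v_def by (intro M.cochains_smult[OF W] M.cochains_kos_t[OF W] c') (auto simp: fs z)
  have m: "(\<lambda>xs. v xs \<ominus>\<^bsub>M\<^esub> u xs) \<in> cochains M W (length fs) t" by (rule M.cochains_minus[OF W v uW])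
  have tc: "\<And>xs. kos_t M (powers S fs a) c' xs \<in> carrier M" using CM[OF c'(1)] fs by simp
  have "kos_d M (powers S fs (n + a)) v xs = kos_d M (powers S fs (n + a)) u xs" for xs
    unfolding v_def
    using M.kos_d_smult[of "powers S fs (n + a)" "kos_t M (powers S fs a) c'" z xs] tc fs z
      M.kos_d_kos_t_powers[OF fs, of c' n a xs] CM[OF c'(1)] du by simp
  then have dm: "kos_d M (powers S fs (n + a)) (\<lambda>xs. v xs \<ominus>\<^bsub>M\<^esub> u xs) xs = \<zero>\<^bsub>M\<^esub>" for xs
    using M.kos_d_minus[of "powers S fs (n + a)" v u xs] CM[OF v] CM[OF uW] fs by simp
  have "z \<odot>\<^bsub>N\<^esub> kos_t N (powers S fs a) c xs = \<phi> (v xs \<ominus>\<^bsub>M\<^esub> u xs)" for xs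
    using M.cochains_closed[OF u, of xs] CM[OF v] WM map_kos_t[of "powers S fs a" c' xs] CM[OF c'(1)] fs z
      c'(2) tc
    by (simp add: map_minus) (simp add: v_def map_smult)
  then show "\<exists>k. \<exists>m\<in>cochains M W (length fs) t. (\<forall>xs. kos_d M (powers S fs (n + k)) m xs = \<zero>\<^bsub>M\<^esub>) \<and>
        (\<forall>xs. z \<odot>\<^bsub>N\<^esub> kos_t N (powers S fs k) c xs = \<phi> (m xs))"
    using m dm by blast
qed

lemma lifts_imp_kills_image:
  assumes l: "lifts fs W z t" and acyc: "kills S fs M W \<one>\<^bsub>S\<^esub> t"
  shows "kills S fs N (\<phi> ` W) z t"
proof (rule killsI)
  fix n c
  assume c: "c \<in> cochains N (\<phi> ` W) (length fs) t"
    and dc: "\<And>xs. kos_d N (powers S fs n) c xs = \<zero>\<^bsub>N\<^esub>"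
  from l c dc obtain a m where m: "m \<in> cochains M W (length fs) t"
    "\<And>xs. kos_d M (powers S fs (n + a)) m xs = \<zero>\<^bsub>M\<^esub>"
    "\<And>xs. z \<odot>\<^bsub>N\<^esub> kos_t N (powers S fs a) c xs = \<phi> (m xs)"
    unfolding lifts_def by metis
  from killsE[OF acyc m(1,2)] obtain b u where u: "u \<in> cochains M W (length fs) (t - 1)"
    and du0: "\<And>xs. \<one>\<^bsub>S\<^esub> \<odot>\<^bsub>M\<^esub> kos_t M (powers S fs b) m xs = kos_d M (powers S fs (n + a + b)) u xs"
    by blast
  have du: "\<And>xs. kos_t M (powers S fs b) m xs = kos_d M (powers S fs (n + a + b)) u xs"
    using du0 CM[OF m(1)] fs by simp
  have cN: "\<And>xs. c xs \<in> carrier N"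
    using N.cochains_closed[OF c] N.submodule_subset[OF image_submodule[OF W]] by blast
  have "z \<odot>\<^bsub>N\<^esub> kos_t N (powers S fs (a + b)) c xs = kos_d N (powers S fs (n + (a + b))) (\<lambda>xs. \<phi> (u xs)) xs" for xs
  proof -
    have "z \<odot>\<^bsub>N\<^esub> kos_t N (powers S fs (a + b)) c xs = z \<odot>\<^bsub>N\<^esub> kos_t N (powers S fs b) (kos_t N (powers S fs a) c) xs"
      using N.kos_t_kos_t_powers[OF fs, of c b a] cN by simp
    also have "\<dots> = kos_t N (powers S fs b) (\<lambda>xs. z \<odot>\<^bsub>N\<^esub> kos_t N (powers S fs a) c xs) xs"
      using N.kos_t_smult[of "powers S fs b" "kos_t N (powers S fs a) c" z xs] cN fs z by simp
    also have "\<dots> = \<phi> (kos_t M (powers S fs b) m xs)"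
      using map_kos_t[of "powers S fs b" m xs] CM[OF m(1)] fs m(3) by simp
    also have "\<dots> = kos_d N (powers S fs (n + a + b)) (\<lambda>xs. \<phi> (u xs)) xs"
      unfolding du by (intro map_kos_d CM[OF u]) (simp add: fs)
    finally show ?thesis by (simp add: add.assoc)
  qed
  then show "\<exists>k. \<exists>h\<in>cochains N (\<phi> ` W) (length fs) (t - 1).
       \<forall>xs. z \<odot>\<^bsub>N\<^esub> kos_t N (powers S fs k) c xs = kos_d N (powers S fs (n + k)) h xs"
    using map_cochains[OF u] by blast
qed

lemma kills_image_imp_lifts:
  assumes kl: "kills S fs N (\<phi> ` W) z t"
  shows "lifts fs W z t"
  unfolding lifts_def
proof (intro allI ballI impI)
  fix n c
  assume c: "c \<in> cochains N (\<phi> ` W) (length fs) t"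
    and dc: "\<forall>xs. kos_d N (powers S fs n) c xs = \<zero>\<^bsub>N\<^esub>"
  from killsE[OF kl c] dc obtain a u where u: "u \<in> cochains N (\<phi> ` W) (length fs) (t - 1)"
    and du: "\<And>xs. z \<odot>\<^bsub>N\<^esub> kos_t N (powers S fs a) c xs = kos_d N (powers S fs (n + a)) u xs"
    by metis
  obtain u' where u': "u' \<in> cochains M W (length fs) (t - 1)" "\<And>xs. \<phi> (u' xs) = u xs"
    using lift_cochains[OF u W] by blast
  let ?m = "kos_d M (powers S fs (n + a)) u'"
  have "?m \<in> cochains M W (length fs) t"
    using M.cochains_kos_d[OF W _ _ u'(1)] fs by fastforce
  moreover have "kos_d M (powers S fs (n + a)) ?m xs = \<zero>\<^bsub>M\<^esub>" for xs
    using M.kos_d_kos_d CM[OF u'(1)] fs by simp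
  moreover have "z \<odot>\<^bsub>N\<^esub> kos_t N (powers S fs a) c xs = \<phi> (?m xs)" for xs
    using map_kos_d[of "powers S fs (n + a)" u' xs] CM[OF u'(1)] fs du u'(2) by simp
  ultimately show "\<exists>k. \<exists>m\<in>cochains M W (length fs) t. (\<forall>xs. kos_d M (powers S fs (n + k)) m xs = \<zero>\<^bsub>M\<^esub>) \<and>
        (\<forall>xs. z \<odot>\<^bsub>N\<^esub> kos_t N (powers S fs k) c xs = \<phi> (m xs))" by blast
qed

lemma kills_inj_image:
  assumes inj: "inj_on \<phi> W"
  shows "kills S fs N (\<phi> ` W) z t \<longleftrightarrow> kills S fs M W z t"
proof -
  have inj0: "x = \<zero>\<^bsub>M\<^esub>" if "x \<in> W" "\<phi> x = \<zero>\<^bsub>N\<^esub>" for x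
    using inj_onD[OF inj, of x "\<zero>\<^bsub>M\<^esub>"] that M.submodule_zero[OF W] by simp
  show ?thesis
  proof
    assume kl: "kills S fs N (\<phi> ` W) z t"
    show "kills S fs M W z t"
    proof (rule killsI)
      fix n c
      assume c: "c \<in> cochains M W (length fs) t" and dc: "\<And>xs. kos_d M (powers S fs n) c xs = \<zero>\<^bsub>M\<^esub>"
      have "kos_d N (powers S fs n) (\<lambda>xs. \<phi> (c xs)) xs = \<zero>\<^bsub>N\<^esub>" for xs
        using map_kos_d[of "powers S fs n" c xs] CM[OF c] fs dc by simp
      from killsE[OF kl map_cochains[OF c] this] obtain a u where u: "u \<in> cochains N (\<phi> ` W) (length fs) (t - 1)"
        and du: "\<And>xs. z \<odot>\<^bsub>N\<^esub> kos_t N (powers S fs a) (\<lambda>xs. \<phi> (c xs)) xs = kos_d N (powers S fs (n + a)) u xs"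
        by metis
      obtain u' where u': "u' \<in> cochains M W (length fs) (t - 1)" "\<And>xs. \<phi> (u' xs) = u xs"
        using lift_cochains[OF u W] by blast
      have "z \<odot>\<^bsub>M\<^esub> kos_t M (powers S fs a) c xs = kos_d M (powers S fs (n + a)) u' xs" for xs
      proof -
        have W1: "z \<odot>\<^bsub>M\<^esub> kos_t M (powers S fs a) c xs \<in> W"
          using M.cochains_closed[OF c] fs z by (intro M.submodule_smult[OF W] M.kos_t_closed[OF W]) auto
        have W2: "kos_d M (powers S fs (n + a)) u' xs \<in> W"
          using M.cochains_closed[OF u'(1)] fs z by (intro M.kos_d_closed[OF W]) auto
        have "\<phi> (z \<odot>\<^bsub>M\<^esub> kos_t M (powers S fs a) c xs) = \<phi> (kos_d M (powers S fs (n + a)) u' xs)"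
          using map_kos_d[of "powers S fs (n + a)" u' xs] map_kos_t[of "powers S fs a" c xs]
            CM[OF u'(1)] CM[OF c] fs z du u'(2) by (simp add: map_smult)
        then show ?thesis using inj_onD[OF inj _ W1 W2] by blast
      qed
      then show "\<exists>k. \<exists>h\<in>cochains M W (length fs) (t - 1).
         \<forall>xs. z \<odot>\<^bsub>M\<^esub> kos_t M (powers S fs k) c xs = kos_d M (powers S fs (n + k)) h xs"
        using u' by blast
    qed
  next
    assume kl: "kills S fs M W z t"
    show "kills S fs N (\<phi> ` W) z t"
    proof (rule killsI)
      fix n c
      assume c: "c \<in> cochains N (\<phi> ` W) (length fs) t" and dc: "\<And>xs. kos_d N (powers S fs n) c xs = \<zero>\<^bsub>N\<^esub>"
      obtain c' where c': "c' \<in> cochains M W (length fs) t" "\<And>xs. \<phi> (c' xs) = c xs"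
        using lift_cochains[OF c W] by blast
      have "kos_d M (powers S fs n) c' xs = \<zero>\<^bsub>M\<^esub>" for xs
      proof (rule inj0)
        show "kos_d M (powers S fs n) c' xs \<in> W"
          using M.cochains_closed[OF c'(1)] fs by (intro M.kos_d_closed[OF W]) auto
        show "\<phi> (kos_d M (powers S fs n) c' xs) = \<zero>\<^bsub>N\<^esub>"
          using map_kos_d[of "powers S fs n" c' xs] CM[OF c'(1)] fs c'(2) dc by simp
      qed
      from killsE[OF kl c'(1) this] obtain a u where u: "u \<in> cochains M W (length fs) (t - 1)"
        and du: "\<And>xs. z \<odot>\<^bsub>M\<^esub> kos_t M (powers S fs a) c' xs = kos_d M (powers S fs (n + a)) u xs"
        by metis
      have "z \<odot>\<^bsub>N\<^esub> kos_t N (powers S fs a) c xs = kos_d N (powers S fs (n + a)) (\<lambda>xs. \<phi> (u xs)) xs" for xs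
        using map_kos_d[of "powers S fs (n + a)" u xs] map_kos_t[of "powers S fs a" c' xs]
            map_smult[of z "kos_t M (powers S fs a) c' xs"] CM[OF c'(1)] CM[OF u] fs z du[of xs] c'(2) by simp
      then show "\<exists>k. \<exists>h\<in>cochains N (\<phi> ` W) (length fs) (t - 1).
         \<forall>xs. z \<odot>\<^bsub>N\<^esub> kos_t N (powers S fs k) c xs = kos_d N (powers S fs (n + k)) h xs"
        using map_cochains[OF u] by blast
    qed
  qed
qed

end

end

section \<open>Complexes with torsion cohomology\<close>

context module_map begin

text \<open>The differential of \<open>u\<close> lies in the kernel of \<open>\<phi>\<close>, which is torsion modulo \<open>B\<close>. As it has
  degree at least \<open>1\<close>, a transition moves it into \<open>B\<close>, where \<open>y\<close> makes it the differential of
  a cochain \<open>b\<close> of \<open>B\<close>. Then \<open>y u - b\<close> is a cocycle of \<open>M\<close>, which \<open>z\<close> turns into a coboundary.\<close>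

lemma descend_cochain:
  assumes fs: "set fs \<subseteq> carrier S" and y: "y \<in> carrier S" and z: "z \<in> carrier S"
    and B: "submodule B S M"
    and tors: "\<And>x. x \<in> carrier M \<Longrightarrow> \<phi> x = \<zero>\<^bsub>N\<^esub> \<Longrightarrow> \<exists>N. \<forall>f\<in>set fs. f [^]\<^bsub>S\<^esub> (N::nat) \<odot>\<^bsub>M\<^esub> x \<in> B"
    and kB: "kills S fs M B y (t + 1)" and kM: "kills S fs M (carrier M) z t" and t: "0 \<le> t"
    and u: "u \<in> cochains M (carrier M) (length fs) t"
    and du: "\<And>xs. \<phi> (kos_d M (powers S fs n) u xs) = \<zero>\<^bsub>N\<^esub>"
  obtains a b h where "b \<in> cochains M B (length fs) t" "h \<in> cochains M (carrier M) (length fs) (t - 1)"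
    "\<And>xs. (z \<otimes>\<^bsub>S\<^esub> y) \<odot>\<^bsub>M\<^esub> kos_t M (powers S fs a) u xs = b xs \<oplus>\<^bsub>M\<^esub> kos_d M (powers S fs (n + a)) h xs"
proof -
  let ?L = "{x \<in> carrier M. \<phi> x = \<zero>\<^bsub>N\<^esub>}"
  note WM = M.carrier_is_submodule
  have L: "submodule ?L S M" by (rule kernel_submodule[OF WM])
  have BM: "c xs \<in> carrier M" if "c \<in> cochains M B k s" for c xs k s
    using M.cochains_closed[OF that] M.submodule_subset[OF B] by blast
  have MM: "c xs \<in> carrier M" if "c \<in> cochains M (carrier M) k s" for c xs k s
    using M.cochains_closed[OF that] .
  let ?v = "kos_d M (powers S fs n) u"
  have v: "?v \<in> cochains M (carrier M) (length fs) (t + 1)"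
    by (rule M.cochains_kos_d[OF WM _ _ u]) (auto simp: fs)
  have vL: "?v \<in> cochains M ?L (length fs) (t + 1)"
    using MM[OF v] du by (intro M.cochains_change[OF v]) auto
  obtain a where a: "kos_t M (powers S fs a) ?v \<in> cochains M B (length fs) (t + 1)"
    using M.kos_t_torsion[OF fs L B _ vL] tors t by auto
  have da: "kos_d M (powers S fs (n + a)) (kos_t M (powers S fs a) ?v) xs = \<zero>\<^bsub>M\<^esub>" for xs
    by (rule M.cocycle_kos_t[OF fs MM[OF v]]) (rule M.kos_d_kos_d, auto simp: fs MM[OF u])
  from killsE[OF kB a da] obtain b w where w0: "w \<in> cochains M B (length fs) (t + 1 - 1)"
    and dw: "\<And>xs. y \<odot>\<^bsub>M\<^esub> kos_t M (powers S fs b) (kos_t M (powers S fs a) ?v) xs = kos_d M (powers S fs (n + a + b)) w xs"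
    by blast
  have w: "w \<in> cochains M B (length fs) t" using w0 by simp
  have wM: "w \<in> cochains M (carrier M) (length fs) t"
    using BM[OF w] by (rule M.cochains_change[OF w])
  define r where "r = (\<lambda>xs. y \<odot>\<^bsub>M\<^esub> kos_t M (powers S fs (a + b)) u xs)"
  have tu: "kos_t M (powers S fs k) u xs \<in> carrier M" for k xs using fs MM[OF u] by simp
  have r: "r \<in> cochains M (carrier M) (length fs) t"
    unfolding r_def by (intro M.cochains_smult[OF WM] M.cochains_kos_t[OF WM] u y) (auto simp: fs)
  define s where "s = (\<lambda>xs. r xs \<ominus>\<^bsub>M\<^esub> w xs)"
  have s: "s \<in> cochains M (carrier M) (length fs) t"
    unfolding s_def by (rule M.cochains_minus[OF WM r wM])
  have dr: "kos_d M (powers S fs (n + a + b)) r xs = kos_d M (powers S fs (n + a + b)) w xs" for xs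
  proof -
    have "kos_d M (powers S fs (n + a + b)) r xs
        = y \<odot>\<^bsub>M\<^esub> kos_d M (powers S fs (n + (a + b))) (kos_t M (powers S fs (a + b)) u) xs"
      unfolding r_def add.assoc using tu y fs by (intro M.kos_d_smult) auto
    also have "\<dots> = y \<odot>\<^bsub>M\<^esub> kos_t M (powers S fs (a + b)) ?v xs"
      using M.kos_d_kos_t_powers[OF fs, of u n "a + b" xs] MM[OF u] by simp
    also have "\<dots> = y \<odot>\<^bsub>M\<^esub> kos_t M (powers S fs b) (kos_t M (powers S fs a) ?v) xs"
      using M.kos_t_kos_t_powers[OF fs, of ?v b a xs] MM[OF v] by simp
    finally show ?thesis by (simp add: dw)
  qed
  have ds: "kos_d M (powers S fs (n + a + b)) s xs = \<zero>\<^bsub>M\<^esub>" for xs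
    unfolding s_def using M.kos_d_minus[of "powers S fs (n + a + b)" r w xs] dr MM[OF r] MM[OF wM] fs by simp
  from killsE[OF kM s ds] obtain c h where h: "h \<in> cochains M (carrier M) (length fs) (t - 1)"
    and dh: "\<And>xs. z \<odot>\<^bsub>M\<^esub> kos_t M (powers S fs c) s xs = kos_d M (powers S fs (n + a + b + c)) h xs"
    by blast
  define q where "q = (\<lambda>xs. z \<odot>\<^bsub>M\<^esub> kos_t M (powers S fs c) w xs)"
  have "q \<in> cochains M B (length fs) t"
    unfolding q_def by (intro M.cochains_smult[OF B] M.cochains_kos_t[OF B] w z) (auto simp: fs)
  moreover have "(z \<otimes>\<^bsub>S\<^esub> y) \<odot>\<^bsub>M\<^esub> kos_t M (powers S fs (a + b + c)) u xs
      = q xs \<oplus>\<^bsub>M\<^esub> kos_d M (powers S fs (n + (a + b + c))) h xs" for xs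
  proof -
    have wt: "kos_t M (powers S fs c) w xs \<in> carrier M" "kos_t M (powers S fs c) r xs \<in> carrier M"
      using MM[OF wM] MM[OF r] fs by simp_all
    have "(z \<otimes>\<^bsub>S\<^esub> y) \<odot>\<^bsub>M\<^esub> kos_t M (powers S fs (a + b + c)) u xs
        = z \<odot>\<^bsub>M\<^esub> (y \<odot>\<^bsub>M\<^esub> kos_t M (powers S fs c) (kos_t M (powers S fs (a + b)) u) xs)"
      using tu y z M.kos_t_kos_t_powers[OF fs, of u c "a + b" xs] MM[OF u] by (simp add: M.smult_assoc1)
    also have "y \<odot>\<^bsub>M\<^esub> kos_t M (powers S fs c) (kos_t M (powers S fs (a + b)) u) xs = kos_t M (powers S fs c) r xs"
      unfolding r_def using tu y fs by (intro M.kos_t_smult[symmetric]) auto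
    finally have 1: "(z \<otimes>\<^bsub>S\<^esub> y) \<odot>\<^bsub>M\<^esub> kos_t M (powers S fs (a + b + c)) u xs = z \<odot>\<^bsub>M\<^esub> kos_t M (powers S fs c) r xs" .
    have 2: "z \<odot>\<^bsub>M\<^esub> kos_t M (powers S fs c) s xs = z \<odot>\<^bsub>M\<^esub> kos_t M (powers S fs c) r xs \<ominus>\<^bsub>M\<^esub> q xs"
      unfolding s_def q_def
      using M.kos_t_minus[of "powers S fs c" r w xs] MM[OF r] MM[OF wM] fs z wt by (simp add: M.smult_minus)
    have qM: "q xs \<in> carrier M" "z \<odot>\<^bsub>M\<^esub> kos_t M (powers S fs c) r xs \<in> carrier M" using wt z by (simp_all add: q_def)
    have "z \<odot>\<^bsub>M\<^esub> kos_t M (powers S fs c) r xs = q xs \<oplus>\<^bsub>M\<^esub> (z \<odot>\<^bsub>M\<^esub> kos_t M (powers S fs c) r xs \<ominus>\<^bsub>M\<^esub> q xs)"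
      using qM M.M.a_lcomm[of "q xs" "z \<odot>\<^bsub>M\<^esub> kos_t M (powers S fs c) r xs" "\<ominus>\<^bsub>M\<^esub> q xs"]
      by (simp add: a_minus_def M.M.r_neg)
    then show ?thesis using 1 2 dh[of xs] by (simp add: add.assoc)
  qed
  ultimately show ?thesis using h that by blast
qed

text \<open>Lift a cocycle of the image to a cochain \<open>u\<close> of \<open>M\<close> and apply \<open>\<phi>\<close> to the equation for \<open>u\<close> in
  \<open>descend_cochain\<close>: the term in \<open>B\<close> disappears.\<close>

lemma kills_image_step:
  assumes fs: "set fs \<subseteq> carrier S" and y: "y \<in> carrier S" and z: "z \<in> carrier S"
    and B: "submodule B S M" and B0: "\<And>x. x \<in> B \<Longrightarrow> \<phi> x = \<zero>\<^bsub>N\<^esub>"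
    and tors: "\<And>x. x \<in> carrier M \<Longrightarrow> \<phi> x = \<zero>\<^bsub>N\<^esub> \<Longrightarrow> \<exists>N. \<forall>f\<in>set fs. f [^]\<^bsub>S\<^esub> (N::nat) \<odot>\<^bsub>M\<^esub> x \<in> B"
    and kB: "kills S fs M B y (t + 1)" and kM: "kills S fs M (carrier M) z t" and t: "0 \<le> t"
  shows "kills S fs N (\<phi> ` carrier M) (z \<otimes>\<^bsub>S\<^esub> y) t"
proof (rule killsI)
  fix n c
  assume c: "c \<in> cochains N (\<phi> ` carrier M) (length fs) t"
    and dc: "\<And>xs. kos_d N (powers S fs n) c xs = \<zero>\<^bsub>N\<^esub>"
  obtain u where u: "u \<in> cochains M (carrier M) (length fs) t" "\<And>xs. \<phi> (u xs) = c xs"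
    using lift_cochains[OF c M.carrier_is_submodule] by blast
  have uM: "\<And>xs. u xs \<in> carrier M" using M.cochains_closed[OF u(1)] .
  have "\<phi> (kos_d M (powers S fs n) u xs) = \<zero>\<^bsub>N\<^esub>" for xs
    using map_kos_d[of "powers S fs n" u xs] uM fs dc u(2) by simp
  then obtain a b h where b: "b \<in> cochains M B (length fs) t"
    and h: "h \<in> cochains M (carrier M) (length fs) (t - 1)"
    and eq: "\<And>xs. (z \<otimes>\<^bsub>S\<^esub> y) \<odot>\<^bsub>M\<^esub> kos_t M (powers S fs a) u xs = b xs \<oplus>\<^bsub>M\<^esub> kos_d M (powers S fs (n + a)) h xs"
    using descend_cochain[OF fs y z B tors kB kM t u(1)] by metis
  have "(z \<otimes>\<^bsub>S\<^esub> y) \<odot>\<^bsub>N\<^esub> kos_t N (powers S fs a) c xs = kos_d N (powers S fs (n + a)) (\<lambda>xs. \<phi> (h xs)) xs" for xs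
  proof -
    have bx: "b xs \<in> carrier M" "\<phi> (b xs) = \<zero>\<^bsub>N\<^esub>"
      using M.cochains_closed[OF b] B0 M.submodule_subset[OF B] by blast+
    have "(z \<otimes>\<^bsub>S\<^esub> y) \<odot>\<^bsub>N\<^esub> kos_t N (powers S fs a) c xs = \<phi> ((z \<otimes>\<^bsub>S\<^esub> y) \<odot>\<^bsub>M\<^esub> kos_t M (powers S fs a) u xs)"
      using map_smult[of "z \<otimes>\<^bsub>S\<^esub> y" "kos_t M (powers S fs a) u xs"] map_kos_t[of "powers S fs a" u xs] uM fs y z u(2)
      by simp
    also have "\<dots> = \<phi> (kos_d M (powers S fs (n + a)) h xs)"
      unfolding eq using bx M.cochains_closed[OF h] fs by (simp add: map_add)
    also have "\<dots> = kos_d N (powers S fs (n + a)) (\<lambda>xs. \<phi> (h xs)) xs"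
      using M.cochains_closed[OF h] fs by (intro map_kos_d) auto
    finally show ?thesis .
  qed
  then show "\<exists>k. \<exists>h\<in>cochains N (\<phi> ` carrier M) (length fs) (t - 1).
       \<forall>xs. (z \<otimes>\<^bsub>S\<^esub> y) \<odot>\<^bsub>N\<^esub> kos_t N (powers S fs k) c xs = kos_d N (powers S fs (n + k)) h xs"
    using map_cochains[OF h] by blast
qed

text \<open>This is \<open>descend_cochain\<close> in degree \<open>0\<close> for the cochain with value \<open>x\<close>: there are no
  cochains of degree \<open>-1\<close>, so the equation puts a multiple of \<open>x\<close> into \<open>B\<close>.\<close>

lemma kernel_into_submodule:
  assumes fs: "set fs \<subseteq> carrier S" and y: "y \<in> carrier S" and z: "z \<in> carrier S"
    and B: "submodule B S M"
    and tors: "\<And>x. x \<in> carrier M \<Longrightarrow> \<phi> x = \<zero>\<^bsub>N\<^esub> \<Longrightarrow> \<exists>N. \<forall>f\<in>set fs. f [^]\<^bsub>S\<^esub> (N::nat) \<odot>\<^bsub>M\<^esub> x \<in> B"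
    and kB: "kills S fs M B y 1" and kM: "kills S fs M (carrier M) z 0"
    and x: "x \<in> carrier M" "\<phi> x = \<zero>\<^bsub>N\<^esub>"
  shows "(z \<otimes>\<^bsub>S\<^esub> y) \<odot>\<^bsub>M\<^esub> x \<in> B"
proof -
  let ?L = "{x \<in> carrier M. \<phi> x = \<zero>\<^bsub>N\<^esub>}" and ?u = "deg0 M (length fs) x"
  have L: "submodule ?L S M" by (rule kernel_submodule[OF M.carrier_is_submodule])
  have u: "?u \<in> cochains M (carrier M) (length fs) 0"
    by (rule M.deg0_cochain[OF M.carrier_is_submodule x(1)])
  have "kos_d M (powers S fs 0) ?u xs \<in> ?L" for xs
    using x by (intro M.kos_d_closed[OF L]) (auto simp: fs deg0_def)
  then have "\<And>xs. \<phi> (kos_d M (powers S fs 0) ?u xs) = \<zero>\<^bsub>N\<^esub>" by blast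
  then obtain a b h where b: "b \<in> cochains M B (length fs) 0"
    and h: "h \<in> cochains M (carrier M) (length fs) (0 - 1)"
    and eq: "\<And>xs. (z \<otimes>\<^bsub>S\<^esub> y) \<odot>\<^bsub>M\<^esub> kos_t M (powers S fs a) ?u xs = b xs \<oplus>\<^bsub>M\<^esub> kos_d M (powers S fs (0 + a)) h xs"
    using descend_cochain[OF fs y z B tors, of 0 ?u 0] kB kM u by (metis add_0 order_refl)
  have "h = (\<lambda>xs. \<zero>\<^bsub>M\<^esub>)" using M.cochains_neg_degree[OF h] by auto
  then have "(z \<otimes>\<^bsub>S\<^esub> y) \<odot>\<^bsub>M\<^esub> kos_t M (powers S fs a) ?u (replicate (length fs) False) = b (replicate (length fs) False)"
    using eq M.kos_d_zero fs M.cochains_closed[OF b] M.submodule_subset[OF B] by simp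
  moreover have "kos_t M (powers S fs a) ?u = ?u" using x fs by (intro M.kos_t_deg0) auto
  ultimately show ?thesis using M.cochains_closed[OF b] by (simp add: deg0_def)
qed

end

primrec consecutive_prod :: "('s, 'b) ring_scheme \<Rightarrow> (nat \<Rightarrow> 's) \<Rightarrow> nat \<Rightarrow> nat \<Rightarrow> 's" where
  "consecutive_prod S z t 0 = \<one>\<^bsub>S\<^esub>"
| "consecutive_prod S z t (Suc p) = z t \<otimes>\<^bsub>S\<^esub> consecutive_prod S z (Suc t) p"

lemma (in cring) consecutive_prod_carrier [simp]:
  "(\<And>t. z t \<in> carrier R) \<Longrightarrow> consecutive_prod R z t p \<in> carrier R"
  by (induction p arbitrary: t) auto

lemma (in cring) consecutive_prod_finprod:
  assumes "\<And>t. z t \<in> carrier R"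
  shows "consecutive_prod R z t p = (\<Otimes> j\<in>{t..<t + p}. z j)"
proof (induction p arbitrary: t)
  case (Suc p)
  have "{t..<t + Suc p} = insert t {Suc t..<Suc t + p}" by auto
  then show ?case using Suc assms by (simp add: Pi_def)
qed simp

locale cochain_complex_of_modules =
  fixes S :: "('s, 'b) ring_scheme" and K :: "nat \<Rightarrow> ('s, 'm) module" and \<phi> :: "nat \<Rightarrow> 'm \<Rightarrow> 'm"
  assumes complex: "cochain_complex S K \<phi>"
begin

lemma module_K: "module S (K i)" using complex by (simp add: cochain_complex_def)

lemma map_K: "module_map S (K i) (K (Suc i)) (\<phi> i)"
  using complex module_K by (simp add: cochain_complex_def module_map_def module_map_axioms_def)

lemma composite_zero: "x \<in> carrier (K i) \<Longrightarrow> \<phi> (Suc i) (\<phi> i x) = \<zero>\<^bsub>K (Suc (Suc i))\<^esub>"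
  using complex by (simp add: cochain_complex_def)

lemma cocycles_submodule: "submodule (cocycles K \<phi> i) S (K i)"
  unfolding cocycles_def
  by (rule module_map.kernel_submodule[OF map_K]) (rule module.carrier_is_submodule[OF module_K])

lemma coboundaries_Suc: "coboundaries K \<phi> (Suc i) = \<phi> i ` carrier (K i)"
  by (simp add: coboundaries_def)

lemma coboundaries_0: "coboundaries K \<phi> 0 = {\<zero>\<^bsub>K 0\<^esub>}"
  by (simp add: coboundaries_def)

lemma coboundaries_submodule: "submodule (coboundaries K \<phi> i) S (K i)"
proof (cases i)
  case 0
  interpret module S "K 0" by (rule module_K)
  show ?thesis unfolding 0 coboundaries_0 by (rule submoduleI) auto
next
  case (Suc j)
  show ?thesis unfolding Suc coboundaries_Suc
    by (rule module_map.image_submodule[OF map_K]) (rule module.carrier_is_submodule[OF module_K])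
qed

lemma coboundaries_cocycles: "coboundaries K \<phi> i \<subseteq> cocycles K \<phi> i"
proof (cases i)
  case 0
  interpret module_map S "K 0" "K (Suc 0)" "\<phi> 0" by (rule map_K)
  show ?thesis unfolding 0 coboundaries_0 by (simp add: cocycles_def)
next
  case (Suc j)
  interpret module_map S "K j" "K (Suc j)" "\<phi> j" by (rule map_K)
  show ?thesis unfolding Suc coboundaries_Suc by (auto simp: cocycles_def composite_zero)
qed

context
  fixes fs z d
  assumes fs: "set fs \<subseteq> carrier S" and z: "\<And>t. z t \<in> carrier S"
    and vanishing: "\<And>p t. t < d \<Longrightarrow> kills S fs (K p) (carrier (K p)) (z t) (int t)"
    and torsion: "\<And>p x. x \<in> cocycles K \<phi> p \<Longrightarrow>
       \<exists>N. \<forall>f\<in>set fs. f [^]\<^bsub>S\<^esub> (N::nat) \<odot>\<^bsub>K p\<^esub> x \<in> coboundaries K \<phi> p"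
begin

text \<open>Induction on \<open>p\<close>: \<open>B\<^sup>0\<close> is zero, and passing from \<open>B\<^sup>p\<close> in degree \<open>t + 1\<close> to \<open>B\<^sup>p\<^sup>+\<^sup>1 \<cong> K\<^sup>p/Z\<^sup>p\<close> in
  degree \<open>t\<close> costs the factor \<open>z\<^sub>t\<close> that kills \<open>K\<^sup>p\<close> in degree \<open>t\<close>.\<close>

lemma kills_coboundaries:
  "t + p \<le> d \<Longrightarrow> kills S fs (K p) (coboundaries K \<phi> p) (consecutive_prod S z t p) (int t)"
proof (induction p arbitrary: t)
  case 0
  interpret module S "K 0" by (rule module_K)
  show ?case
  proof (rule killsI)
    fix n c assume c: "c \<in> cochains (K 0) (coboundaries K \<phi> 0) (length fs) (int t)"
    have "c = (\<lambda>xs. \<zero>\<^bsub>K 0\<^esub>)" using cochains_closed[OF c] by (auto simp: coboundaries_0)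
    then show "\<exists>k. \<exists>h\<in>cochains (K 0) (coboundaries K \<phi> 0) (length fs) (int t - 1).
        \<forall>xs. consecutive_prod S z t 0 \<odot>\<^bsub>K 0\<^esub> kos_t (K 0) (powers S fs k) c xs = kos_d (K 0) (powers S fs (n + k)) h xs"
      using fs by (intro exI[of _ 0] bexI[of _ "\<lambda>xs. \<zero>\<^bsub>K 0\<^esub>"] cochains_null coboundaries_submodule)
                  (auto simp: kos_d_zero kos_t_zero)
  qed
next
  case (Suc p)
  interpret module_map S "K p" "K (Suc p)" "\<phi> p" by (rule map_K)
  show ?case
    unfolding coboundaries_Suc consecutive_prod.simps
  proof (rule kills_image_step[OF fs _ z coboundaries_submodule])
    show "consecutive_prod S z (Suc t) p \<in> carrier S" using z by (rule M.R.consecutive_prod_carrier)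
    show "\<phi> p x = \<zero>\<^bsub>K (Suc p)\<^esub>" if "x \<in> coboundaries K \<phi> p" for x
      using that coboundaries_cocycles by (auto simp: cocycles_def)
    show "\<exists>N. \<forall>f\<in>set fs. f [^]\<^bsub>S\<^esub> (N::nat) \<odot>\<^bsub>K p\<^esub> x \<in> coboundaries K \<phi> p"
      if "x \<in> carrier (K p)" "\<phi> p x = \<zero>\<^bsub>K (Suc p)\<^esub>" for x
      using that torsion by (simp add: cocycles_def)
    show "kills S fs (K p) (coboundaries K \<phi> p) (consecutive_prod S z (Suc t) p) (int t + 1)"
      using Suc.IH[of "Suc t"] Suc.prems by (simp add: add.commute)
    show "kills S fs (K p) (carrier (K p)) (z t) (int t)" using Suc.prems by (intro vanishing) auto
  qed simp
qed

theorem consecutive_prod_kills_cohomology: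
  assumes "i < d" "x \<in> cocycles K \<phi> i"
  shows "consecutive_prod S z 0 (Suc i) \<odot>\<^bsub>K i\<^esub> x \<in> coboundaries K \<phi> i"
proof -
  interpret module_map S "K i" "K (Suc i)" "\<phi> i" by (rule map_K)
  show ?thesis
    unfolding consecutive_prod.simps
  proof (rule kernel_into_submodule[OF fs _ z coboundaries_submodule])
    show "consecutive_prod S z (Suc 0) i \<in> carrier S" using z by (rule M.R.consecutive_prod_carrier)
    show "\<exists>N. \<forall>f\<in>set fs. f [^]\<^bsub>S\<^esub> (N::nat) \<odot>\<^bsub>K i\<^esub> x \<in> coboundaries K \<phi> i"
      if "x \<in> carrier (K i)" "\<phi> i x = \<zero>\<^bsub>K (Suc i)\<^esub>" for x
      using that torsion by (simp add: cocycles_def)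
    show "kills S fs (K i) (coboundaries K \<phi> i) (consecutive_prod S z (Suc 0) i) 1"
      using kills_coboundaries[of "Suc 0" i] assms by simp
    show "kills S fs (K i) (carrier (K i)) (z 0) 0" using vanishing[of 0 i] assms by simp
    show "x \<in> carrier (K i)" "\<phi> i x = \<zero>\<^bsub>K (Suc i)\<^esub>" using assms by (auto simp: cocycles_def)
  qed
qed

end

end

section \<open>Free modules\<close>

lemma (in cring) self_module_is_module: "module R (self_module R)"
proof (rule moduleI)
  show "abelian_group (self_module R)"
    by (rule abelian_groupI) (auto simp: self_module_def a_ac intro: exI[of _ "\<ominus> x" for x] l_neg)
qed (auto simp: self_module_def cring_axioms l_distr r_distr m_assoc)

locale free_module = module R M for R :: "('s, 'b) ring_scheme" (structure) and M :: "('s, 'm) module" +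
  fixes B assumes basis: "is_basis R M B"
begin

definition coord :: "'m \<Rightarrow> 'm \<Rightarrow> 's" where
  "coord x = (THE c. c \<in> B \<rightarrow> carrier R \<and> (\<forall>b. b \<notin> B \<longrightarrow> c b = \<zero>) \<and> finite {b. c b \<noteq> \<zero>} \<and>
      x = (\<Oplus>\<^bsub>M\<^esub> b \<in> {b. c b \<noteq> \<zero>}. c b \<odot>\<^bsub>M\<^esub> b))"

lemma B_carrier: "b \<in> B \<Longrightarrow> b \<in> carrier M"
  using basis by (auto simp: is_basis_def)

lemma coord_unique:
  assumes "x \<in> carrier M" "c \<in> B \<rightarrow> carrier R" "\<And>b. b \<notin> B \<Longrightarrow> c b = \<zero>"
    "finite A" "A \<subseteq> B" "\<And>b. b \<notin> A \<Longrightarrow> c b = \<zero>" "x = (\<Oplus>\<^bsub>M\<^esub> b \<in> A. c b \<odot>\<^bsub>M\<^esub> b)"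
  shows "coord x = c"
proof -
  have sub: "{b. c b \<noteq> \<zero>} \<subseteq> A" using assms(6) by auto
  have ex: "\<exists>!c. c \<in> B \<rightarrow> carrier R \<and> (\<forall>b. b \<notin> B \<longrightarrow> c b = \<zero>) \<and> finite {b. c b \<noteq> \<zero>} \<and>
      x = (\<Oplus>\<^bsub>M\<^esub> b \<in> {b. c b \<noteq> \<zero>}. c b \<odot>\<^bsub>M\<^esub> b)"
    using basis assms(1) by (simp add: is_basis_def)
  have "(\<Oplus>\<^bsub>M\<^esub> b \<in> {b. c b \<noteq> \<zero>}. c b \<odot>\<^bsub>M\<^esub> b) = (\<Oplus>\<^bsub>M\<^esub> b \<in> A. c b \<odot>\<^bsub>M\<^esub> b)"
    using assms(2,4,5) B_carrier sub by (intro M.add.finprod_mono_neutral_cong_left) (auto simp: Pi_def subset_iff)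
  then show ?thesis
    unfolding coord_def using assms finite_subset[OF sub assms(4)] by (intro the1_equality[OF ex]) auto
qed

lemma coord_spec:
  assumes "x \<in> carrier M"
  shows "b \<in> B \<Longrightarrow> coord x b \<in> carrier R" "b \<notin> B \<Longrightarrow> coord x b = \<zero>" "finite {b. coord x b \<noteq> \<zero>}"
    "x = (\<Oplus>\<^bsub>M\<^esub> b \<in> {b. coord x b \<noteq> \<zero>}. coord x b \<odot>\<^bsub>M\<^esub> b)"
proof -
  have ex: "\<exists>!c. c \<in> B \<rightarrow> carrier R \<and> (\<forall>b. b \<notin> B \<longrightarrow> c b = \<zero>) \<and> finite {b. c b \<noteq> \<zero>} \<and>
      x = (\<Oplus>\<^bsub>M\<^esub> b \<in> {b. c b \<noteq> \<zero>}. c b \<odot>\<^bsub>M\<^esub> b)"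
    using basis assms by (simp add: is_basis_def)
  note * = theI'[OF ex, folded coord_def]
  show "b \<in> B \<Longrightarrow> coord x b \<in> carrier R" "b \<notin> B \<Longrightarrow> coord x b = \<zero>" "finite {b. coord x b \<noteq> \<zero>}"
    "x = (\<Oplus>\<^bsub>M\<^esub> b \<in> {b. coord x b \<noteq> \<zero>}. coord x b \<odot>\<^bsub>M\<^esub> b)"
    using * by auto
qed

lemma coord_carrier [simp]: "x \<in> carrier M \<Longrightarrow> coord x b \<in> carrier R"
  using coord_spec(1,2)[of x b] by (cases "b \<in> B") auto

lemma coord_sum:
  assumes "x \<in> carrier M" "finite A" "A \<subseteq> B" "{b. coord x b \<noteq> \<zero>} \<subseteq> A"
  shows "x = (\<Oplus>\<^bsub>M\<^esub> b \<in> A. coord x b \<odot>\<^bsub>M\<^esub> b)"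
proof -
  have "(\<Oplus>\<^bsub>M\<^esub> b \<in> {b. coord x b \<noteq> \<zero>}. coord x b \<odot>\<^bsub>M\<^esub> b) = (\<Oplus>\<^bsub>M\<^esub> b \<in> A. coord x b \<odot>\<^bsub>M\<^esub> b)"
    using assms B_carrier by (intro M.add.finprod_mono_neutral_cong_left) (auto simp: Pi_def subset_iff)
  then show ?thesis using coord_spec(4)[OF assms(1)] by simp
qed

lemma coord_support: "x \<in> carrier M \<Longrightarrow> {b. coord x b \<noteq> \<zero>} \<subseteq> B"
  using coord_spec(2) by blast

lemma coord_add:
  assumes "x \<in> carrier M" "y \<in> carrier M"
  shows "coord (x \<oplus>\<^bsub>M\<^esub> y) = (\<lambda>b. coord x b \<oplus> coord y b)"
proof -
  let ?A = "{b. coord x b \<noteq> \<zero>} \<union> {b. coord y b \<noteq> \<zero>}"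
  have A: "finite ?A" "?A \<subseteq> B" using coord_spec(3) coord_support assms by auto
  show ?thesis
  proof (rule coord_unique[OF _ _ _ A])
    have x: "x = (\<Oplus>\<^bsub>M\<^esub> b \<in> ?A. coord x b \<odot>\<^bsub>M\<^esub> b)" by (rule coord_sum[OF assms(1) A]) auto
    have y: "y = (\<Oplus>\<^bsub>M\<^esub> b \<in> ?A. coord y b \<odot>\<^bsub>M\<^esub> b)" by (rule coord_sum[OF assms(2) A]) auto
    have cl: "(\<lambda>b. coord x b \<odot>\<^bsub>M\<^esub> b) \<in> ?A \<rightarrow> carrier M" "(\<lambda>b. coord y b \<odot>\<^bsub>M\<^esub> b) \<in> ?A \<rightarrow> carrier M"
      using A(2) B_carrier assms by (auto simp: subset_iff)
    have "(\<Oplus>\<^bsub>M\<^esub> b \<in> ?A. (coord x b \<oplus> coord y b) \<odot>\<^bsub>M\<^esub> b)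
        = (\<Oplus>\<^bsub>M\<^esub> b \<in> ?A. coord x b \<odot>\<^bsub>M\<^esub> b \<oplus>\<^bsub>M\<^esub> coord y b \<odot>\<^bsub>M\<^esub> b)"
      using A(2) B_carrier assms cl by (intro M.finsum_cong') (auto simp: smult_l_distr subset_iff)
    also have "\<dots> = x \<oplus>\<^bsub>M\<^esub> y" using M.finsum_addf[OF cl] x y by simp
    finally show "x \<oplus>\<^bsub>M\<^esub> y = (\<Oplus>\<^bsub>M\<^esub> b \<in> ?A. (coord x b \<oplus> coord y b) \<odot>\<^bsub>M\<^esub> b)" by simp
  qed (use assms coord_spec(2) in auto)
qed

lemma coord_smult:
  assumes "x \<in> carrier M" "s \<in> carrier R"
  shows "coord (s \<odot>\<^bsub>M\<^esub> x) = (\<lambda>b. s \<otimes> coord x b)"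
proof -
  let ?A = "{b. coord x b \<noteq> \<zero>}"
  have A: "finite ?A" "?A \<subseteq> B" using coord_spec(3) coord_support assms by auto
  show ?thesis
  proof (rule coord_unique[OF _ _ _ A])
    have x: "x = (\<Oplus>\<^bsub>M\<^esub> b \<in> ?A. coord x b \<odot>\<^bsub>M\<^esub> b)" by (rule coord_sum[OF assms(1) A]) auto
    have cl: "(\<lambda>b. coord x b \<odot>\<^bsub>M\<^esub> b) \<in> ?A \<rightarrow> carrier M"
      using A(2) B_carrier assms by (auto simp: subset_iff)
    have "(\<Oplus>\<^bsub>M\<^esub> b \<in> ?A. (s \<otimes> coord x b) \<odot>\<^bsub>M\<^esub> b) = (\<Oplus>\<^bsub>M\<^esub> b \<in> ?A. s \<odot>\<^bsub>M\<^esub> (coord x b \<odot>\<^bsub>M\<^esub> b))"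
      using A(2) B_carrier assms cl by (intro M.finsum_cong') (auto simp: smult_assoc1 subset_iff)
    also have "\<dots> = s \<odot>\<^bsub>M\<^esub> (\<Oplus>\<^bsub>M\<^esub> b \<in> ?A. coord x b \<odot>\<^bsub>M\<^esub> b)"
      using finsum_smult_ldistr[OF A(1) assms(2) cl] by simp
    finally show "s \<odot>\<^bsub>M\<^esub> x = (\<Oplus>\<^bsub>M\<^esub> b \<in> ?A. (s \<otimes> coord x b) \<odot>\<^bsub>M\<^esub> b)" using x by simp
  qed (use assms coord_spec(2) in auto)
qed

lemma coord_map: "module_map R M (self_module R) (\<lambda>x. coord x b)"
proof (intro module_map.intro module_map_axioms.intro)
  show "(\<lambda>x. coord x b) \<in> lin_maps R M (self_module R)"
    by (auto simp: lin_maps_def self_module_def coord_add coord_smult)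
qed (use self_module_is_module module_axioms in auto)

lemma basis_map: "b \<in> B \<Longrightarrow> module_map R (self_module R) M (\<lambda>s. s \<odot>\<^bsub>M\<^esub> b)"
proof (intro module_map.intro module_map_axioms.intro)
  show "b \<in> B \<Longrightarrow> (\<lambda>s. s \<odot>\<^bsub>M\<^esub> b) \<in> lin_maps R (self_module R) M"
    using B_carrier by (auto simp: lin_maps_def self_module_def smult_l_distr smult_assoc1)
qed (use self_module_is_module module_axioms in auto)

lemma coord_basis:
  assumes "b \<in> B" "s \<in> carrier R" shows "coord (s \<odot>\<^bsub>M\<^esub> b) = (\<lambda>b'. if b' = b then s else \<zero>)"
  by (rule coord_unique[where A = "{b}"]) (use assms B_carrier in auto)

text \<open>A cochain has finitely many nonzero entries, so it involves a finite set \<open>A\<close> of basis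
  elements. The induction on \<open>A\<close> splits off one coordinate, to which the hypothesis on the
  ring applies; the levels reached by the two parts are made equal by further transitions.\<close>

lemma kills_free:
  assumes fs: "set fs \<subseteq> carrier R" and z: "z \<in> carrier R"
    and k: "kills R fs (self_module R) (carrier R) z t"
  shows "kills R fs M (carrier M) z t"
proof (rule killsI)
  note MM = carrier_is_submodule
  have *: "\<exists>k. \<exists>h\<in>cochains M (carrier M) (length fs) (t - 1).
      \<forall>xs. z \<odot>\<^bsub>M\<^esub> kos_t M (powers R fs k) c xs = kos_d M (powers R fs (n + k)) h xs"
    if "finite A" "A \<subseteq> B" "c \<in> cochains M (carrier M) (length fs) t"
      "\<And>xs. kos_d M (powers R fs n) c xs = \<zero>\<^bsub>M\<^esub>" "\<And>xs b. b \<notin> A \<Longrightarrow> coord (c xs) b = \<zero>"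
    for A c n
    using that
  proof (induction A arbitrary: c n)
    case empty
    have "c xs = \<zero>\<^bsub>M\<^esub>" for xs
      using coord_sum[of "c xs" "{}"] cochains_closed[OF empty(2)] empty(4) by simp
    then have c: "c = (\<lambda>xs. \<zero>\<^bsub>M\<^esub>)" by blast
    show ?case unfolding c using fs z
      by (intro exI[of _ 0] bexI[of _ "\<lambda>xs. \<zero>\<^bsub>M\<^esub>"] cochains_null MM) (auto simp: kos_d_zero kos_t_zero)
  next
    case (insert b A)
    have b: "b \<in> B" "A \<subseteq> B" using insert.prems(1) by auto
    note c = insert.prems(2)
    note dc = insert.prems(3)
    have cM: "\<And>xs. c xs \<in> carrier M" using cochains_closed[OF c] .
    interpret C: module_map R M "self_module R" "\<lambda>x. coord x b" by (rule coord_map)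
    interpret I: module_map R "self_module R" M "\<lambda>s. s \<odot>\<^bsub>M\<^esub> b" by (rule basis_map[OF b(1)])
    define e where "e = (\<lambda>xs. coord (c xs) b)"
    have eR: "\<And>xs. e xs \<in> carrier R" using cM by (simp add: e_def)
    have e: "e \<in> cochains (self_module R) (carrier R) (length fs) t"
      unfolding e_def
      by (rule C.N.cochains_change[OF C.map_cochains[OF c]]) (use eR in \<open>auto simp: e_def\<close>)
    have de: "kos_d (self_module R) (powers R fs n) e xs = \<zero>\<^bsub>self_module R\<^esub>" for xs
      unfolding e_def using C.map_kos_d[of "powers R fs n" c xs] cM fs dc by simp
    obtain k1 h1 where h1: "h1 \<in> cochains (self_module R) (carrier R) (length fs) (t - 1)"
      and dh1: "\<And>xs. z \<odot>\<^bsub>self_module R\<^esub> kos_t (self_module R) (powers R fs k1) e xs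
          = kos_d (self_module R) (powers R fs (n + k1)) h1 xs"
      using killsE[OF k e de] by blast
    define e' where "e' = (\<lambda>xs. e xs \<odot>\<^bsub>M\<^esub> b)"
    define h1' where "h1' = (\<lambda>xs. h1 xs \<odot>\<^bsub>M\<^esub> b)"
    have SR: "carrier (self_module R) = carrier R" by (simp add: self_module_def)
    have bM: "b \<in> carrier M" using B_carrier b by blast
    have e'M: "\<And>xs. e' xs \<in> carrier M" using eR bM by (simp add: e'_def)
    have e': "e' \<in> cochains M (carrier M) (length fs) t"
      unfolding e'_def by (rule cochains_change[OF I.map_cochains[OF e]]) (use eR bM in auto)
    have h1R: "\<And>xs. h1 xs \<in> carrier R" using C.N.cochains_closed[OF h1] .
    have h1': "h1' \<in> cochains M (carrier M) (length fs) (t - 1)"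
      unfolding h1'_def by (rule cochains_change[OF I.map_cochains[OF h1]]) (use h1R bM in auto)
    have h1'M: "\<And>xs. h1' xs \<in> carrier M" using cochains_closed[OF h1'] .
    have de': "kos_d M (powers R fs n) e' xs = \<zero>\<^bsub>M\<^esub>" for xs
      unfolding e'_def using I.map_kos_d[of "powers R fs n" e xs] eR fs de by (simp add: SR)
    have teR: "kos_t (self_module R) (powers R fs k1) e xs \<in> carrier R" for xs
      using C.N.kos_t_carrier[of "powers R fs k1" e xs] eR fs by (simp add: SR)
    have dh1': "z \<odot>\<^bsub>M\<^esub> kos_t M (powers R fs k1) e' xs = kos_d M (powers R fs (n + k1)) h1' xs" for xs
      unfolding e'_def h1'_def
      using I.map_kos_d[of "powers R fs (n + k1)" h1 xs] I.map_kos_t[of "powers R fs k1" e xs]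
        I.map_smult[of z "kos_t (self_module R) (powers R fs k1) e xs"] eR h1R fs z dh1[of xs] teR
      by (simp add: SR)
    define g where "g = (\<lambda>xs. c xs \<ominus>\<^bsub>M\<^esub> e' xs)"
    have g: "g \<in> cochains M (carrier M) (length fs) t" unfolding g_def by (rule cochains_minus[OF MM c e'])
    have gM: "\<And>xs. g xs \<in> carrier M" using cochains_closed[OF g] .
    have dg: "kos_d M (powers R fs n) g xs = \<zero>\<^bsub>M\<^esub>" for xs
      unfolding g_def using kos_d_minus[of "powers R fs n" c e' xs] cM e'M fs dc de' by simp
    have "coord (g xs) b' = \<zero>" if "b' \<notin> A" for xs b'
    proof -
      interpret C': module_map R M "self_module R" "\<lambda>x. coord x b'" by (rule coord_map)

      have "coord (g xs) b' = coord (c xs) b' \<ominus>\<^bsub>self_module R\<^esub> coord (e' xs) b'"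
        unfolding g_def using cM e'M by (rule C'.map_minus)
      also have "coord (e' xs) b' = coord (c xs) b'"
        unfolding e'_def using coord_basis[OF b(1) eR] insert.prems(4)[of b' xs] that
        by (auto simp: e_def)
      also have "coord (c xs) b' \<ominus>\<^bsub>self_module R\<^esub> coord (c xs) b' = \<zero>\<^bsub>self_module R\<^esub>"
        by (rule module.minus_self[OF self_module_is_module]) (simp add: SR cM)
      finally show ?thesis by (simp add: self_module_def)
    qed
    from insert.IH[OF b(2) g dg this] obtain k2 h2 where h2: "h2 \<in> cochains M (carrier M) (length fs) (t - 1)"
      and dh2: "\<And>xs. z \<odot>\<^bsub>M\<^esub> kos_t M (powers R fs k2) g xs = kos_d M (powers R fs (n + k2)) h2 xs" by blast
    have h2M: "\<And>xs. h2 xs \<in> carrier M" using cochains_closed[OF h2] .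
    define h where "h = (\<lambda>xs. kos_t M (powers R fs k1) h2 xs \<oplus>\<^bsub>M\<^esub> kos_t M (powers R fs k2) h1' xs)"
    have h: "h \<in> cochains M (carrier M) (length fs) (t - 1)"
      unfolding h_def by (intro cochains_add[OF MM] cochains_kos_t[OF MM] h2 h1') (auto simp: fs)
    have raise: "kos_d M (powers R fs (n + (i + j))) (kos_t M (powers R fs j) u) xs
         = z \<odot>\<^bsub>M\<^esub> kos_t M (powers R fs (i + j)) v xs"
      if "\<And>xs. u xs \<in> carrier M" "\<And>xs. v xs \<in> carrier M"
        "\<And>xs. z \<odot>\<^bsub>M\<^esub> kos_t M (powers R fs i) v xs = kos_d M (powers R fs (n + i)) u xs" for i j u v xs
    proof -
      have "kos_d M (powers R fs (n + i + j)) (kos_t M (powers R fs j) u) xs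
          = kos_t M (powers R fs j) (\<lambda>xs. z \<odot>\<^bsub>M\<^esub> kos_t M (powers R fs i) v xs) xs"
        using kos_d_kos_t_powers[OF fs, of u "n + i" j xs] that(1,3) by simp
      also have "\<dots> = z \<odot>\<^bsub>M\<^esub> kos_t M (powers R fs j) (kos_t M (powers R fs i) v) xs"
        using that(2) fs z by (intro kos_t_smult) auto
      also have "kos_t M (powers R fs j) (kos_t M (powers R fs i) v) xs = kos_t M (powers R fs (i + j)) v xs"
        using kos_t_kos_t_powers[OF fs, of v j i xs] that(2) by simp
      finally show ?thesis by (simp add: add.assoc)
    qed
    have "z \<odot>\<^bsub>M\<^esub> kos_t M (powers R fs (k1 + k2)) c xs = kos_d M (powers R fs (n + (k1 + k2))) h xs" for xs
    proof -
      have eq: "c = (\<lambda>xs. g xs \<oplus>\<^bsub>M\<^esub> e' xs)"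
        using cM e'M by (auto simp: g_def a_minus_def M.a_assoc M.l_neg)
      have tadd: "kos_t M (powers R fs (k1 + k2)) c xs
           = kos_t M (powers R fs (k1 + k2)) g xs \<oplus>\<^bsub>M\<^esub> kos_t M (powers R fs (k1 + k2)) e' xs"
      proof -
        have "kos_t M (powers R fs (k1 + k2)) g xs
          = kos_t M (powers R fs (k1 + k2)) c xs \<ominus>\<^bsub>M\<^esub> kos_t M (powers R fs (k1 + k2)) e' xs"
          unfolding g_def using fs cM e'M by (intro kos_t_minus) auto
        then show ?thesis using fs cM e'M by (simp add: a_minus_def M.a_assoc M.l_neg)
      qed
      have "kos_d M (powers R fs (n + (k1 + k2))) h xs
         = kos_d M (powers R fs (n + (k1 + k2))) (kos_t M (powers R fs k1) h2) xs \<oplus>\<^bsub>M\<^esub>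
           kos_d M (powers R fs (n + (k1 + k2))) (kos_t M (powers R fs k2) h1') xs"
        unfolding h_def using h2M h1'M fs by (intro kos_d_add) auto
      also have "\<dots> = z \<odot>\<^bsub>M\<^esub> kos_t M (powers R fs (k1 + k2)) g xs \<oplus>\<^bsub>M\<^esub> z \<odot>\<^bsub>M\<^esub> kos_t M (powers R fs (k1 + k2)) e' xs"
        using raise[OF h1'M e'M dh1', of k2 xs] raise[OF h2M gM dh2, of k1 xs] by (simp add: add.commute)
      also have "\<dots> = z \<odot>\<^bsub>M\<^esub> kos_t M (powers R fs (k1 + k2)) c xs"
        unfolding tadd using gM e'M fs z by (intro smult_r_distr[symmetric]) auto
      finally show ?thesis by simp
    qed
    then show ?case using h by blast
  qed
  fix n c
  assume c: "c \<in> cochains M (carrier M) (length fs) t"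
    and dc: "\<And>xs. kos_d M (powers R fs n) c xs = \<zero>\<^bsub>M\<^esub>"
  let ?A = "\<Union>xs\<in>{xs. length xs = length fs}. {b. coord (c xs) b \<noteq> \<zero>}"
  have cM: "\<And>xs. c xs \<in> carrier M" using cochains_closed[OF c] .
  have fin: "finite {xs :: bool list. length xs = length fs}"
    using finite_lists_length_eq[of "UNIV :: bool set" "length fs"] by simp
  have c0: "coord \<zero>\<^bsub>M\<^esub> = (\<lambda>b. \<zero>)" by (rule coord_unique[where A = "{}"]) auto
  show "\<exists>k. \<exists>h\<in>cochains M (carrier M) (length fs) (t - 1).
      \<forall>xs. z \<odot>\<^bsub>M\<^esub> kos_t M (powers R fs k) c xs = kos_d M (powers R fs (n + k)) h xs"
  proof (rule *[of ?A])
    show "finite ?A" using fin coord_spec(3)[OF cM] by blast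
    show "?A \<subseteq> B" using coord_support[OF cM] by blast
    show "coord (c xs) b = \<zero>" if "b \<notin> ?A" for xs b
    proof (cases "length xs = length fs")
      case False
      then have "c xs = \<zero>\<^bsub>M\<^esub>" using cochains_zero[OF c] by blast
      then show ?thesis using c0 by simp
    qed (use that in auto)
  qed (use c dc in auto)
qed

end

section \<open>Power torsion and divisibility\<close>

context module begin

lemma ideal_pow_subset: "ideal I R \<Longrightarrow> ideal_pow R I n \<subseteq> carrier R"
proof (induction n)
  case (Suc n)
  have "ideal (ideal_pow R I m) R" for m
    by (induction m) (auto intro: oneideal ideal_prod_is_ideal[OF _ Suc.prems])
  then show ?case using ideal_prod_in_carrier Suc.prems by simp
qed simp

lemma smult_swap:
  "\<lbrakk>a \<in> carrier R; b \<in> carrier R; x \<in> carrier M\<rbrakk> \<Longrightarrow> a \<odot>\<^bsub>M\<^esub> (b \<odot>\<^bsub>M\<^esub> x) = b \<odot>\<^bsub>M\<^esub> (a \<odot>\<^bsub>M\<^esub> x)"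
  by (simp add: smult_assoc1[symmetric] m_comm)

lemma colon_ideal:
  assumes "submodule L R M" "x \<in> carrier M"
  shows "ideal {s \<in> carrier R. s \<odot>\<^bsub>M\<^esub> x \<in> L} R"
proof (rule idealI[OF R.ring_axioms])
  show "subgroup {s \<in> carrier R. s \<odot>\<^bsub>M\<^esub> x \<in> L} (add_monoid R)"
    using assms by (intro R.add.subgroupI) (auto simp: smult_l_distr submodule_closed smult_l_minus a_inv_def[symmetric] intro: exI[of _ \<zero>])
next
  have *: "a \<odot>\<^bsub>M\<^esub> (r \<odot>\<^bsub>M\<^esub> x) \<in> L" if "a \<in> carrier R" "r \<in> carrier R" "a \<odot>\<^bsub>M\<^esub> x \<in> L" for a r
    using smult_swap[OF that(1,2) assms(2)] submodule_smult[OF assms(1) that(2,3)] by simp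
  show "r \<otimes> a \<in> {s \<in> carrier R. s \<odot>\<^bsub>M\<^esub> x \<in> L}" "a \<otimes> r \<in> {s \<in> carrier R. s \<odot>\<^bsub>M\<^esub> x \<in> L}"
    if "a \<in> {s \<in> carrier R. s \<odot>\<^bsub>M\<^esub> x \<in> L}" "r \<in> carrier R" for a r
    using that * assms by (auto simp: smult_assoc1 submodule_smult)
qed

text \<open>The pigeonhole principle: a product of \<open>1 + \<Sum> e f\<close> generators contains some \<open>f\<close> at least
  \<open>e f\<close> times. The induction lowers one exponent \<open>e f\<close> at a time by replacing \<open>x\<close> with \<open>f x\<close>.\<close>

lemma ideal_pow_torsion:
  assumes A: "finite A" "A \<subseteq> carrier R" and L: "submodule L R M"
  shows "x \<in> carrier M \<Longrightarrow> (\<And>f. f \<in> A \<Longrightarrow> f [^] (e f :: nat) \<odot>\<^bsub>M\<^esub> x \<in> L) \<Longrightarrow>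
    s \<in> ideal_pow R (Idl A) (Suc (sum e A)) \<Longrightarrow> s \<odot>\<^bsub>M\<^esub> x \<in> L"
proof (induction "sum e A" arbitrary: e x s)
  have IA: "ideal (Idl A) R" by (rule genideal_ideal[OF A(2)])
  have step: "s \<odot>\<^bsub>M\<^esub> x \<in> L"
    if x: "x \<in> carrier M" and *: "\<And>f a. f \<in> A \<Longrightarrow> a \<in> ideal_pow R (Idl A) n \<Longrightarrow> a \<odot>\<^bsub>M\<^esub> (f \<odot>\<^bsub>M\<^esub> x) \<in> L"
      and s: "s \<in> ideal_pow R (Idl A) (Suc n)" for n x s
    using s unfolding ideal_pow.simps
  proof (induction rule: ideal_prod.induct)
    case (prod a b)
    have a: "a \<in> carrier R" using ideal_pow_subset[OF IA] prod by blast
    have "submodule {y \<in> carrier M. a \<odot>\<^bsub>M\<^esub> y \<in> L} R M"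
      using a by (intro submoduleI) (auto simp: smult_r_distr smult_r_minus submodule_closed[OF L] smult_swap[of a])
    from colon_ideal[OF this x] have "Idl A \<subseteq> {b \<in> carrier R. b \<odot>\<^bsub>M\<^esub> x \<in> {y \<in> carrier M. a \<odot>\<^bsub>M\<^esub> y \<in> L}}"
      by (rule genideal_minimal) (use * A(2) x prod(1) in auto)
    then show ?case using prod(2) a x by (auto simp: smult_assoc1)
  next
    case (sum a b)
    have "ideal_pow R (Idl A) (Suc n) \<subseteq> carrier R" by (rule ideal_pow_subset[OF IA])
    then have "a \<in> carrier R" "b \<in> carrier R" using sum by auto
    then show ?case using sum x by (simp add: smult_l_distr submodule_closed[OF L])
  qed
  {
    case 0
    then have e: "\<And>f. f \<in> A \<Longrightarrow> e f = 0" using A(1) by simp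
    have "a \<odot>\<^bsub>M\<^esub> (f \<odot>\<^bsub>M\<^esub> x) \<in> L" if f: "f \<in> A" and a: "a \<in> ideal_pow R (Idl A) 0" for f a
    proof -
      have "x \<in> L" using 0(3)[OF f] e[OF f] 0(2) by simp
      then show ?thesis using f a A by (auto intro!: submodule_smult[OF L])
    qed
    from step[OF 0(2) this] show ?case using 0(1,4) by metis
  next
    case (Suc n)
    have "a \<odot>\<^bsub>M\<^esub> (f \<odot>\<^bsub>M\<^esub> x) \<in> L" if f: "f \<in> A" and a: "a \<in> ideal_pow R (Idl A) (Suc n)" for f a
    proof (cases "e f")
      case 0
      have "x \<in> L" using Suc.prems(2)[OF f] 0 Suc.prems(1) by simp
      moreover have "a \<in> carrier R" using ideal_pow_subset[OF IA] a by blast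
      ultimately show ?thesis using f A by (auto intro!: submodule_smult[OF L])
    next
      case (Suc m)
      let ?e = "e(f := m)"
      have "sum e A = Suc (sum ?e A)"
        using A(1) f Suc by (simp add: sum.remove[of A f])
      then have n: "n = sum ?e A" using Suc.hyps(2) by simp
      have fR: "f \<in> carrier R" using f A by auto
      have "g [^] (?e g) \<odot>\<^bsub>M\<^esub> (f \<odot>\<^bsub>M\<^esub> x) \<in> L" if g: "g \<in> A" for g
      proof (cases "g = f")
        case True
        then show ?thesis using Suc.prems(2)[OF f] Suc fR Suc.prems(1) by (simp add: smult_assoc1[symmetric])
      next
        case False
        have gR: "g \<in> carrier R" using g A by auto
        have "g [^] (e g) \<odot>\<^bsub>M\<^esub> (f \<odot>\<^bsub>M\<^esub> x) = f \<odot>\<^bsub>M\<^esub> (g [^] (e g) \<odot>\<^bsub>M\<^esub> x)"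
          using gR fR Suc.prems(1) by (simp add: smult_assoc1[symmetric] m_comm)
        then show ?thesis using Suc.prems(2)[OF g] False fR by (simp add: submodule_smult[OF L])
      qed
      from Suc.hyps(1)[OF n _ this] show ?thesis using a n fR Suc.prems(1) by simp
    qed
    from step[OF Suc.prems(1) this] show ?case using Suc.hyps(2) Suc.prems(3) by metis
  }
qed

lemma power_in_ideal_pow: "ideal I R \<Longrightarrow> f \<in> I \<Longrightarrow> f [^] (n::nat) \<in> ideal_pow R I n"
  by (induction n) (auto intro: ideal_prod.prod)

lemma power_torsion_submodule:
  assumes fs: "set fs \<subseteq> carrier R" and W: "submodule W R M"
  shows "submodule {x \<in> W. \<exists>N. \<forall>f\<in>set fs. f [^] (N::nat) \<odot>\<^bsub>M\<^esub> x = \<zero>\<^bsub>M\<^esub>} R M"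
proof (rule submodule_criterion)
  fix x y
  assume x: "x \<in> {x \<in> W. \<exists>N. \<forall>f\<in>set fs. f [^] (N::nat) \<odot>\<^bsub>M\<^esub> x = \<zero>\<^bsub>M\<^esub>}"
    and y: "y \<in> {x \<in> W. \<exists>N. \<forall>f\<in>set fs. f [^] (N::nat) \<odot>\<^bsub>M\<^esub> x = \<zero>\<^bsub>M\<^esub>}"
  then obtain a b where ab: "\<And>f. f \<in> set fs \<Longrightarrow> f [^] (a::nat) \<odot>\<^bsub>M\<^esub> x = \<zero>\<^bsub>M\<^esub>"
     "\<And>f. f \<in> set fs \<Longrightarrow> f [^] (b::nat) \<odot>\<^bsub>M\<^esub> y = \<zero>\<^bsub>M\<^esub>" by auto
  have xy: "x \<in> carrier M" "y \<in> carrier M" using x y submodule_subset[OF W] by auto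
  have "f [^] (a + b) \<odot>\<^bsub>M\<^esub> (x \<oplus>\<^bsub>M\<^esub> y) = \<zero>\<^bsub>M\<^esub>" if "f \<in> set fs" for f
  proof -
    have f: "f \<in> carrier R" using that fs by auto
    have "f [^] (a + b) \<odot>\<^bsub>M\<^esub> (x \<oplus>\<^bsub>M\<^esub> y)
        = f [^] b \<odot>\<^bsub>M\<^esub> (f [^] a \<odot>\<^bsub>M\<^esub> x) \<oplus>\<^bsub>M\<^esub> f [^] a \<odot>\<^bsub>M\<^esub> (f [^] b \<odot>\<^bsub>M\<^esub> y)"
      using f xy by (simp add: smult_r_distr smult_assoc1[symmetric] nat_pow_mult add.commute)
    then show ?thesis using ab that f by simp
  qed
  then show "x \<oplus>\<^bsub>M\<^esub> y \<in> {x \<in> W. \<exists>N. \<forall>f\<in>set fs. f [^] (N::nat) \<odot>\<^bsub>M\<^esub> x = \<zero>\<^bsub>M\<^esub>}"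
    using x y submodule_add[OF W] by blast
next
  fix a x assume a: "a \<in> carrier R" and x: "x \<in> {x \<in> W. \<exists>N. \<forall>f\<in>set fs. f [^] (N::nat) \<odot>\<^bsub>M\<^esub> x = \<zero>\<^bsub>M\<^esub>}"
  then obtain n where n: "\<And>f. f \<in> set fs \<Longrightarrow> f [^] (n::nat) \<odot>\<^bsub>M\<^esub> x = \<zero>\<^bsub>M\<^esub>" by auto
  have xM: "x \<in> carrier M" using x submodule_subset[OF W] by auto
  have "f [^] n \<odot>\<^bsub>M\<^esub> (a \<odot>\<^bsub>M\<^esub> x) = \<zero>\<^bsub>M\<^esub>" if "f \<in> set fs" for f
  proof -
    have f: "f \<in> carrier R" using that fs by auto
    have "f [^] n \<odot>\<^bsub>M\<^esub> (a \<odot>\<^bsub>M\<^esub> x) = a \<odot>\<^bsub>M\<^esub> (f [^] n \<odot>\<^bsub>M\<^esub> x)"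
      using f a xM by (simp add: smult_assoc1[symmetric] m_comm)
    then show ?thesis using n[OF that] a by simp
  qed
  then show "a \<odot>\<^bsub>M\<^esub> x \<in> {x \<in> W. \<exists>N. \<forall>f\<in>set fs. f [^] (N::nat) \<odot>\<^bsub>M\<^esub> x = \<zero>\<^bsub>M\<^esub>}"
    using x a submodule_smult[OF W] by blast
qed (use submodule_subset[OF W] submodule_zero[OF W] fs in \<open>auto simp: subset_iff\<close>)

text \<open>The first condition says that \<open>W\<close> maps onto its localisation at \<open>f\<close>: the fraction \<open>x / f\<^sup>n\<close>
  is the image of \<open>y\<close>. The kernel of this map is the \<open>f\<close>-power torsion of \<open>W\<close>, on which the
  same is required for the remaining elements.\<close>

primrec divisible_tower :: "'a list \<Rightarrow> 'c set \<Rightarrow> bool" where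
  "divisible_tower [] W \<longleftrightarrow> True"
| "divisible_tower (f # fs) W \<longleftrightarrow>
    (\<forall>x\<in>W. \<forall>n. \<exists>y\<in>W. \<exists>c::nat. f [^] c \<odot>\<^bsub>M\<^esub> x = f [^] (c + n) \<odot>\<^bsub>M\<^esub> y) \<and>
    divisible_tower fs {x \<in> W. \<exists>N::nat. f [^] N \<odot>\<^bsub>M\<^esub> x = \<zero>\<^bsub>M\<^esub>}"

text \<open>In the colimit, the Koszul complex of \<open>f # fs\<close> is the cone of the localisation map at \<open>f\<close>,
  up to a shift. Where that map is onto, the cone can be replaced by its kernel, the \<open>f\<close>-power
  torsion, and one element of the list is gone. In terms of cocycles \<open>(u, v)\<close>, where \<open>v\<close>
  collects the entries at subsets that contain \<open>f\<close>: divide \<open>v\<close> by \<open>f\<^sup>n\<close> to obtain \<open>w\<close>; then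
  \<open>u - dw\<close> is an \<open>f\<close>-torsion cocycle, and if it bounds \<open>h\<close>, then \<open>(u, v)\<close> bounds \<open>(w + h, 0)\<close>,
  all up to transitions.\<close>

lemma divisible_tower_acyclic:
  assumes "1 \<le> t"
  shows "set fs \<subseteq> carrier R \<Longrightarrow> submodule W R M \<Longrightarrow> divisible_tower fs W \<Longrightarrow> kills R fs M W \<one> t"
proof (induction fs arbitrary: W)
  case Nil
  show ?case
  proof (rule killsI)
    fix n c assume c: "c \<in> cochains M W (length []) t"
    have "c xs = \<zero>\<^bsub>M\<^esub>" for xs using cochains_zero[OF c, of xs] assms by (cases xs) auto
    then have "c = (\<lambda>xs. \<zero>\<^bsub>M\<^esub>)" by blast
    then show "\<exists>k. \<exists>h\<in>cochains M W (length []) (t - 1).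
        \<forall>xs. \<one> \<odot>\<^bsub>M\<^esub> kos_t M (powers R [] k) c xs = kos_d M (powers R [] (n + k)) h xs"
      using cochains_null[OF Nil.prems(2)] by (auto simp: powers_def)
  qed
next
  case (Cons f fs)
  note W = Cons.prems(2)
  have f: "f \<in> carrier R" and fs: "set fs \<subseteq> carrier R" using Cons.prems by auto
  let ?W' = "{x \<in> W. \<exists>N::nat. f [^] N \<odot>\<^bsub>M\<^esub> x = \<zero>\<^bsub>M\<^esub>}"
  have W': "submodule ?W' R M" using power_torsion_submodule[of "[f]", OF _ W] f by simp
  have div: "\<And>x n. x \<in> W \<Longrightarrow> \<exists>y\<in>W. \<exists>c::nat. f [^] c \<odot>\<^bsub>M\<^esub> x = f [^] (c + n) \<odot>\<^bsub>M\<^esub> y"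
    and tow: "divisible_tower fs ?W'" using Cons.prems(3) by auto
  let ?P = "\<lambda>k. powers R fs k"
  have pow: "powers R (f # fs) k = f [^] k # ?P k" for k by (simp add: powers_def)
  have WM: "c xs \<in> carrier M" if "c \<in> cochains M W i j" for c xs i j
    using cochains_closed[OF that] submodule_subset[OF W] by blast
  show ?case
  proof (rule killsI)
    fix n c
    assume c: "c \<in> cochains M W (length (f # fs)) t"
      and dc: "\<And>xs. kos_d M (powers R (f # fs) n) c xs = \<zero>\<^bsub>M\<^esub>"
    define u where "u = (\<lambda>ys. c (False # ys))"
    define v where "v = (\<lambda>ys. c (True # ys))"
    have u: "u \<in> cochains M W (length fs) t" using cochains_False[of c W "length fs" t] c by (simp add: u_def)
    have v: "v \<in> cochains M W (length fs) (t - 1)" using cochains_True[of c W "length fs" t] c by (simp add: v_def)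
    note uM = WM[OF u] and vM = WM[OF v]
    have du: "kos_d M (?P n) u ys = \<zero>\<^bsub>M\<^esub>" for ys using dc[of "False # ys"] by (simp add: pow u_def)
    have fu: "f [^] n \<odot>\<^bsub>M\<^esub> u ys = kos_d M (?P n) v ys" for ys
    proof -
      have "f [^] n \<odot>\<^bsub>M\<^esub> u ys \<ominus>\<^bsub>M\<^esub> kos_d M (?P n) v ys = \<zero>\<^bsub>M\<^esub>"
        using dc[of "True # ys"] by (simp add: pow u_def v_def)
      moreover have "f [^] n \<odot>\<^bsub>M\<^esub> u ys \<in> carrier M" "kos_d M (?P n) v ys \<in> carrier M"
        using f fs uM vM by auto
      ultimately show ?thesis by (metis M.add.inv_closed M.add.inv_equality M.minus_minus a_minus_def)
    qed
    have "\<exists>w\<in>W. \<exists>a::nat. f [^] a \<odot>\<^bsub>M\<^esub> v ys = f [^] (a + n) \<odot>\<^bsub>M\<^esub> w \<and> (v ys = \<zero>\<^bsub>M\<^esub> \<longrightarrow> w = \<zero>\<^bsub>M\<^esub> \<and> a = 0)" for ys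
    proof (cases "v ys = \<zero>\<^bsub>M\<^esub>")
      case True then show ?thesis using f submodule_zero[OF W] by (intro bexI[of _ "\<zero>\<^bsub>M\<^esub>"] exI[of _ 0]) auto
    next
      case False then show ?thesis using div[OF cochains_closed[OF v]] by blast
    qed
    then obtain w a where wa: "\<And>ys. w ys \<in> W" "\<And>ys. f [^] (a ys :: nat) \<odot>\<^bsub>M\<^esub> v ys = f [^] (a ys + n) \<odot>\<^bsub>M\<^esub> w ys"
      "\<And>ys. v ys = \<zero>\<^bsub>M\<^esub> \<Longrightarrow> w ys = \<zero>\<^bsub>M\<^esub> \<and> a ys = 0"
      by metis
    have w: "w \<in> cochains M W (length fs) (t - 1)"
      using wa v unfolding cochains_def mem_Collect_eq by metis
    note wM = WM[OF w]
    have fin: "finite {ys :: bool list. length ys = length fs}"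
      using finite_lists_length_eq[of "UNIV :: bool set" "length fs"] by simp
    define k where "k = Max (a ` {ys. length ys = length fs})"
    have ak: "a ys \<le> k" for ys
    proof (cases "length ys = length fs")
      case True then show ?thesis unfolding k_def using fin by (intro Max_ge) auto
    next
      case False then show ?thesis using wa(3)[of ys] cochains_zero[OF v, of ys] by simp
    qed
    have fv: "f [^] k \<odot>\<^bsub>M\<^esub> v ys = f [^] (k + n) \<odot>\<^bsub>M\<^esub> w ys" for ys
    proof -
      have "f [^] (k - a ys) \<odot>\<^bsub>M\<^esub> (f [^] a ys \<odot>\<^bsub>M\<^esub> v ys) = f [^] (k - a ys) \<odot>\<^bsub>M\<^esub> (f [^] (a ys + n) \<odot>\<^bsub>M\<^esub> w ys)"
        using wa(2) by simp
      then show ?thesis using f vM wM ak[of ys] by (simp add: smult_assoc1[symmetric] nat_pow_mult)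
    qed
    let ?T = "\<lambda>k. kos_t M (?P k)" and ?d = "\<lambda>k. kos_d M (?P k)"
    have TM: "?T j g ys \<in> carrier M" if "\<And>ys. g ys \<in> carrier M" for j g ys using that fs by simp
    have dM: "?d j g ys \<in> carrier M" if "\<And>ys. g ys \<in> carrier M" for j g ys using that fs by simp
    \<comment> \<open>The correction of \<open>u\<close> by the differential of the quotient \<open>w\<close> is torsion for \<open>f\<close>.\<close>
    define u1 where "u1 = (\<lambda>ys. ?T k u ys \<ominus>\<^bsub>M\<^esub> ?d (n + k) (?T k w) ys)"
    have dTw: "?d (n + k) (?T k w) \<in> cochains M W (length fs) t"
      using cochains_kos_d[OF W _ _ cochains_kos_t[OF W _ _ w], of "?P (n + k)" "?P k"] fs by simp
    have Tu: "?T k u \<in> cochains M W (length fs) t" by (rule cochains_kos_t[OF W _ _ u]) (auto simp: fs)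
    have u1W: "u1 \<in> cochains M W (length fs) t" unfolding u1_def by (rule cochains_minus[OF W Tu dTw])
    have Tsm: "?T j (\<lambda>ys. r \<odot>\<^bsub>M\<^esub> g ys) ys = r \<odot>\<^bsub>M\<^esub> ?T j g ys" if "r \<in> carrier R" "\<And>ys. g ys \<in> carrier M" for j r g ys
      using that fs by (intro kos_t_smult) auto
    have dsm: "?d j (\<lambda>ys. r \<odot>\<^bsub>M\<^esub> g ys) ys = r \<odot>\<^bsub>M\<^esub> ?d j g ys" if "r \<in> carrier R" "\<And>ys. g ys \<in> carrier M" for j r g ys
      using that fs by (intro kos_d_smult) auto
    have dT: "?d (i + j) (?T j g) ys = ?T j (?d i g) ys" if "\<And>ys. g ys \<in> carrier M" for i j g ys
      using kos_d_kos_t_powers[OF fs, of g i j ys] that by simp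
    have TT: "?T j (?T i g) ys = ?T (i + j) g ys" if "\<And>ys. g ys \<in> carrier M" for i j g ys
      using kos_t_kos_t_powers[OF fs, of g j i ys] that by simp
    have key: "f [^] (n + k) \<odot>\<^bsub>M\<^esub> ?T k u ys = f [^] (n + k) \<odot>\<^bsub>M\<^esub> ?d (n + k) (?T k w) ys" for ys
    proof -
      have "f [^] (n + k) \<odot>\<^bsub>M\<^esub> ?T k u ys = f [^] k \<odot>\<^bsub>M\<^esub> (f [^] n \<odot>\<^bsub>M\<^esub> ?T k u ys)"
        using f uM fs by (simp add: smult_assoc1[symmetric] nat_pow_mult add.commute)
      also have "f [^] n \<odot>\<^bsub>M\<^esub> ?T k u ys = ?T k (\<lambda>ys. f [^] n \<odot>\<^bsub>M\<^esub> u ys) ys"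
        using Tsm f uM by simp
      also have "(\<lambda>ys. f [^] n \<odot>\<^bsub>M\<^esub> u ys) = ?d n v" using fu by blast
      also have "?T k (?d n v) ys = ?d (n + k) (?T k v) ys" using dT vM by simp
      also have "f [^] k \<odot>\<^bsub>M\<^esub> ?d (n + k) (?T k v) ys = ?d (n + k) (\<lambda>ys. f [^] k \<odot>\<^bsub>M\<^esub> ?T k v ys) ys"
        using dsm[of "f [^] k" "?T k v" "n + k"] f TM[of v] vM by simp
      also have "(\<lambda>ys. f [^] k \<odot>\<^bsub>M\<^esub> ?T k v ys) = (\<lambda>ys. f [^] (n + k) \<odot>\<^bsub>M\<^esub> ?T k w ys)"
      proof
        fix ys
        have "f [^] k \<odot>\<^bsub>M\<^esub> ?T k v ys = ?T k (\<lambda>ys. f [^] k \<odot>\<^bsub>M\<^esub> v ys) ys" using Tsm f vM by simp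
        also have "(\<lambda>ys. f [^] k \<odot>\<^bsub>M\<^esub> v ys) = (\<lambda>ys. f [^] (n + k) \<odot>\<^bsub>M\<^esub> w ys)"
          using fv by (simp add: add.commute)
        finally show "f [^] k \<odot>\<^bsub>M\<^esub> ?T k v ys = f [^] (n + k) \<odot>\<^bsub>M\<^esub> ?T k w ys" using Tsm f wM by simp
      qed
      also have "?d (n + k) (\<lambda>ys. f [^] (n + k) \<odot>\<^bsub>M\<^esub> ?T k w ys) ys = f [^] (n + k) \<odot>\<^bsub>M\<^esub> ?d (n + k) (?T k w) ys"
        using dsm[of "f [^] (n + k)" "?T k w" "n + k"] f TM[of w] wM by simp
      finally show ?thesis .
    qed
    have TuM: "?T k u ys \<in> carrier M" and dTwM: "?d (n + k) (?T k w) ys \<in> carrier M" for ys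
      using WM[OF Tu] WM[OF dTw] by auto
    have "f [^] (n + k) \<odot>\<^bsub>M\<^esub> u1 ys = \<zero>\<^bsub>M\<^esub>" for ys
      unfolding u1_def using key[of ys] f TuM[of ys] dTwM[of ys] by (simp add: smult_minus)
    then have "u1 ys \<in> ?W'" for ys using cochains_closed[OF u1W, of ys] by blast
    then have u1: "u1 \<in> cochains M ?W' (length fs) t" by (rule cochains_change[OF u1W])
    note u1M = WM[OF u1W]
    have du1: "?d (n + k) u1 ys = \<zero>\<^bsub>M\<^esub>" for ys
    proof -
      have "?d (n + k) u1 ys = ?d (n + k) (?T k u) ys \<ominus>\<^bsub>M\<^esub> ?d (n + k) (?d (n + k) (?T k w)) ys"
        unfolding u1_def using TuM dTwM fs by (intro kos_d_minus) auto
      also have "?d (n + k) (?d (n + k) (?T k w)) ys = \<zero>\<^bsub>M\<^esub>"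
        using TM[of w] wM fs by (intro kos_d_kos_d) auto
      also have "?d (n + k) (?T k u) ys = \<zero>\<^bsub>M\<^esub>" by (rule cocycle_kos_t[OF fs uM du])
      finally show ?thesis by simp
    qed
    from killsE[OF Cons.IH[OF fs W' tow] u1 du1] obtain b h
      where h: "h \<in> cochains M ?W' (length fs) (t - 1)"
        and dh0: "\<And>ys. \<one> \<odot>\<^bsub>M\<^esub> ?T b u1 ys = ?d (n + k + b) h ys" by blast
    have hW: "h \<in> cochains M W (length fs) (t - 1)" by (rule cochains_mono[OF h]) auto
    note hM = WM[OF hW]
    have dh: "?T b u1 ys = ?d (n + k + b) h ys" for ys using dh0[of ys] TM[OF u1M] by simp
    have "\<forall>ys. \<exists>N::nat. f [^] N \<odot>\<^bsub>M\<^esub> h ys = \<zero>\<^bsub>M\<^esub>" using cochains_closed[OF h] by blast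
    then obtain p where p: "\<And>ys. f [^] (p ys :: nat) \<odot>\<^bsub>M\<^esub> h ys = \<zero>\<^bsub>M\<^esub>" by metis
    define q where "q = Max (p ` {ys. length ys = length fs})"
    have fh: "f [^] (q + j) \<odot>\<^bsub>M\<^esub> h ys = \<zero>\<^bsub>M\<^esub>" for j ys
    proof (cases "length ys = length fs")
      case True
      then have "p ys \<le> q" unfolding q_def using fin by (intro Max_ge) auto
      then have "f [^] (q + j) = f [^] (q + j - p ys) \<otimes> f [^] p ys" using f by (simp add: nat_pow_mult)
      then show ?thesis using f hM p[of ys] by (simp add: smult_assoc1)
    next
      case False
      then show ?thesis using cochains_zero[OF hW, of ys] f by simp
    qed
    \<comment> \<open>The level is raised by \<open>q\<close> so that \<open>f\<close> annihilates the contribution of \<open>h\<close>.\<close>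
    define g where "g = (\<lambda>ys. ?T (b + q) (?T k w) ys \<oplus>\<^bsub>M\<^esub> ?T q h ys)"
    have g: "g \<in> cochains M W (length fs) (t - 1)"
      unfolding g_def by (intro cochains_add[OF W] cochains_kos_t[OF W] w hW) (auto simp: fs)
    note gM = WM[OF g]
    define H where "H = (\<lambda>xs. case xs of [] \<Rightarrow> \<zero>\<^bsub>M\<^esub> | b # ys \<Rightarrow> if b then \<zero>\<^bsub>M\<^esub> else g ys)"
    have H: "H \<in> cochains M W (length (f # fs)) (t - 1)"
      using cochains_closed[OF g] cochains_zero[OF g] submodule_zero[OF W]
      unfolding H_def by (intro cochainsI) (auto split: list.splits if_splits)
    let ?k = "k + b + q"
    have TwM: "?T j w ys \<in> carrier M" for j ys using TM wM by simp
    have dg: "?d (n + ?k) g ys = ?T ?k u ys" for ys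
    proof -
      have "?d (n + ?k) g ys = ?d (n + ?k) (?T (b + q) (?T k w)) ys \<oplus>\<^bsub>M\<^esub> ?d (n + ?k) (?T q h) ys"
        unfolding g_def using TM TwM hM fs by (intro kos_d_add) auto
      also have "?d (n + ?k) (?T (b + q) (?T k w)) ys = ?T (b + q) (?d (n + k) (?T k w)) ys"
        using dT[of "?T k w" "n + k" "b + q" ys] TwM by (simp add: add.assoc)
      also have "?d (n + ?k) (?T q h) ys = ?T q (?d (n + k + b) h) ys"
        using dT[of h "n + k + b" q ys] hM by (simp add: add.assoc)
      also have "?d (n + k + b) h = ?T b u1" using dh by (intro ext) simp
      also have "?T q (?T b u1) ys = ?T (b + q) u1 ys" using TT u1M by simp
      also have "\<dots> = ?T (b + q) (?T k u) ys \<ominus>\<^bsub>M\<^esub> ?T (b + q) (?d (n + k) (?T k w)) ys"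
        unfolding u1_def using TuM dTwM fs by (intro kos_t_minus) auto
      also have "?T (b + q) (?d (n + k) (?T k w)) ys \<oplus>\<^bsub>M\<^esub> \<dots> = ?T (b + q) (?T k u) ys"
        using TM[of "?T k u", OF TuM] TM[of "?d (n + k) (?T k w)", OF dTwM]
          M.a_lcomm[of "?T (b + q) (?d (n + k) (?T k w)) ys" "?T (b + q) (?T k u) ys"]
        by (simp add: a_minus_def M.r_neg)
      also have "\<dots> = ?T ?k u ys" using TT[where g=u and i=k and j="b + q"] uM by (simp add: add.assoc)
      finally show ?thesis .
    qed
    have fg: "f [^] (n + ?k) \<odot>\<^bsub>M\<^esub> g ys = f [^] ?k \<odot>\<^bsub>M\<^esub> ?T ?k v ys" for ys
    proof -
      have "f [^] (n + ?k) \<odot>\<^bsub>M\<^esub> ?T q h ys = ?T q (\<lambda>ys. f [^] (n + ?k) \<odot>\<^bsub>M\<^esub> h ys) ys"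
        using Tsm f hM by simp
      also have "(\<lambda>ys. f [^] (n + ?k) \<odot>\<^bsub>M\<^esub> h ys) = (\<lambda>ys. \<zero>\<^bsub>M\<^esub>)"
        using fh[of "n + k + b"] by (simp add: add_ac)
      also have "?T q (\<lambda>ys. \<zero>\<^bsub>M\<^esub>) ys = \<zero>\<^bsub>M\<^esub>" using fs by (intro kos_t_zero) auto
      finally have 1: "f [^] (n + ?k) \<odot>\<^bsub>M\<^esub> ?T q h ys = \<zero>\<^bsub>M\<^esub>" .
      have "f [^] (n + ?k) \<odot>\<^bsub>M\<^esub> ?T (b + q) (?T k w) ys = f [^] (n + ?k) \<odot>\<^bsub>M\<^esub> ?T ?k w ys"
        using TT[where g=w and i=k and j="b + q"] wM by (simp add: add.assoc)
      also have "\<dots> = ?T ?k (\<lambda>ys. f [^] (n + ?k) \<odot>\<^bsub>M\<^esub> w ys) ys" using Tsm f wM by simp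
      also have "(\<lambda>ys. f [^] (n + ?k) \<odot>\<^bsub>M\<^esub> w ys) = (\<lambda>ys. f [^] ?k \<odot>\<^bsub>M\<^esub> v ys)"
      proof
        fix ys
        have "f [^] (n + ?k) \<odot>\<^bsub>M\<^esub> w ys = f [^] (b + q) \<odot>\<^bsub>M\<^esub> (f [^] (k + n) \<odot>\<^bsub>M\<^esub> w ys)"
          using f wM by (simp add: smult_assoc1[symmetric] nat_pow_mult add_ac)
        also have "\<dots> = f [^] ?k \<odot>\<^bsub>M\<^esub> v ys"
          unfolding fv[symmetric] using f vM by (simp add: smult_assoc1[symmetric] nat_pow_mult add_ac)
        finally show "f [^] (n + ?k) \<odot>\<^bsub>M\<^esub> w ys = f [^] ?k \<odot>\<^bsub>M\<^esub> v ys" .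
      qed
      also have "?T ?k (\<lambda>ys. f [^] ?k \<odot>\<^bsub>M\<^esub> v ys) ys = f [^] ?k \<odot>\<^bsub>M\<^esub> ?T ?k v ys" using Tsm f vM by simp
      finally have 2: "f [^] (n + ?k) \<odot>\<^bsub>M\<^esub> ?T (b + q) (?T k w) ys = f [^] ?k \<odot>\<^bsub>M\<^esub> ?T ?k v ys" .
      show ?thesis unfolding g_def using 1 2 f TM[of "?T k w", OF TwM] TM[of h, OF hM] TM[of v, OF vM]
        by (simp add: smult_r_distr)
    qed
    have "\<one> \<odot>\<^bsub>M\<^esub> kos_t M (powers R (f # fs) ?k) c xs = kos_d M (powers R (f # fs) (n + ?k)) H xs" for xs
    proof (cases xs)
      case Nil then show ?thesis by (simp add: pow)
    next
      case (Cons x ys)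
      have H0: "(\<lambda>zs. H (True # zs)) = (\<lambda>zs. \<zero>\<^bsub>M\<^esub>)" "(\<lambda>zs. H (False # zs)) = g" by (auto simp: H_def)
      have 1: "kos_t M (powers R (f # fs) ?k) c (True # ys) = f [^] ?k \<odot>\<^bsub>M\<^esub> ?T ?k v ys"
        "kos_t M (powers R (f # fs) ?k) c (False # ys) = ?T ?k u ys" by (simp_all add: pow u_def v_def)
      have 2: "kos_d M (powers R (f # fs) (n + ?k)) H (True # ys) = f [^] (n + ?k) \<odot>\<^bsub>M\<^esub> g ys"
        using H0 fun_cong[OF H0(2), of ys] f fs gM by (simp add: pow kos_d_zero)
      have 3: "kos_d M (powers R (f # fs) (n + ?k)) H (False # ys) = ?d (n + ?k) g ys"
        using H0 by (simp add: pow)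
      have Tk: "?T ?k v ys \<in> carrier M" "?T ?k u ys \<in> carrier M" using TM vM uM by auto
      show ?thesis
      proof (cases x)
        case True
        show ?thesis unfolding Cons True[THEN eqTrueI] 1 2 fg using f Tk by simp
      next
        case False
        then have "x = False" by simp
        show ?thesis unfolding Cons \<open>x = False\<close> 1 3 dg using Tk by simp
      qed
    qed
    then show "\<exists>k. \<exists>h\<in>cochains M W (length (f # fs)) (t - 1).
        \<forall>xs. \<one> \<odot>\<^bsub>M\<^esub> kos_t M (powers R (f # fs) k) c xs = kos_d M (powers R (f # fs) (n + k)) h xs"
      using H by blast
  qed
qed

end

text \<open>Powers of the generators and powers of the ideal define the same torsion, by
  \<open>ideal_pow_torsion\<close> in one direction and \<open>f\<^sup>n \<in> I\<^sup>n\<close> in the other.\<close>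

lemma torsion_part_eq:
  fixes R (structure) and M :: "('a, 'm) module"
  assumes "module R M" and fs: "set fs \<subseteq> carrier R"
  shows "carrier (torsion_part R (Idl (set fs)) M) =
     {x \<in> carrier M. \<exists>N. \<forall>f\<in>set fs. f [^] (N::nat) \<odot>\<^bsub>M\<^esub> x = \<zero>\<^bsub>M\<^esub>}"
proof -
  interpret module R M by fact
  have L: "submodule {\<zero>\<^bsub>M\<^esub>} R M" by (rule submoduleI) auto
  have I: "ideal (Idl (set fs)) R" by (rule genideal_ideal[OF fs])
  have "(\<exists>n. \<forall>s\<in>ideal_pow R (Idl (set fs)) n. s \<odot>\<^bsub>M\<^esub> x = \<zero>\<^bsub>M\<^esub>) \<longleftrightarrow>
        (\<exists>N. \<forall>f\<in>set fs. f [^] (N::nat) \<odot>\<^bsub>M\<^esub> x = \<zero>\<^bsub>M\<^esub>)" if x: "x \<in> carrier M" for x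
  proof
    assume "\<exists>n. \<forall>s\<in>ideal_pow R (Idl (set fs)) n. s \<odot>\<^bsub>M\<^esub> x = \<zero>\<^bsub>M\<^esub>"
    then show "\<exists>N. \<forall>f\<in>set fs. f [^] (N::nat) \<odot>\<^bsub>M\<^esub> x = \<zero>\<^bsub>M\<^esub>"
      using power_in_ideal_pow[OF I] genideal_self[OF fs] by blast
  next
    assume "\<exists>N. \<forall>f\<in>set fs. f [^] (N::nat) \<odot>\<^bsub>M\<^esub> x = \<zero>\<^bsub>M\<^esub>"
    then obtain N where "\<And>f. f \<in> set fs \<Longrightarrow> f [^] (N::nat) \<odot>\<^bsub>M\<^esub> x \<in> {\<zero>\<^bsub>M\<^esub>}" by auto
    from ideal_pow_torsion[OF _ fs L x, of "\<lambda>_. N"] this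
    show "\<exists>n. \<forall>s\<in>ideal_pow R (Idl (set fs)) n. s \<odot>\<^bsub>M\<^esub> x = \<zero>\<^bsub>M\<^esub>" by blast
  qed
  then show ?thesis by (auto simp: torsion_part_def)
qed

section \<open>Injective modules and local cohomology\<close>

lemma subquotient_annihilator:
  fixes M :: "('s, 'm) module"
  assumes "module S M" and B: "submodule B S M" and Z: "submodule Z S M"
  shows "s \<in> annihilator S (subquotient M Z B) \<longleftrightarrow> s \<in> carrier S \<and> (\<forall>z\<in>Z. s \<odot>\<^bsub>M\<^esub> z \<in> B)"
proof -
  interpret module S M by fact
  note BM = submodule_subset[OF B] and ZM = submodule_subset[OF Z]
  have "B <+>\<^bsub>M\<^esub> (\<lambda>x. s \<odot>\<^bsub>M\<^esub> x) ` (B +>\<^bsub>M\<^esub> z) = B \<longleftrightarrow> s \<odot>\<^bsub>M\<^esub> z \<in> B"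
    if s: "s \<in> carrier S" and z: "z \<in> Z" for z
  proof -
    have eq: "B <+>\<^bsub>M\<^esub> (\<lambda>x. s \<odot>\<^bsub>M\<^esub> x) ` (B +>\<^bsub>M\<^esub> z) = {b \<oplus>\<^bsub>M\<^esub> s \<odot>\<^bsub>M\<^esub> (b' \<oplus>\<^bsub>M\<^esub> z) | b b'. b \<in> B \<and> b' \<in> B}"
      by (auto simp: set_add_def set_mult_def a_r_coset_def r_coset_def)
    show ?thesis unfolding eq
    proof
      assume eqB: "{b \<oplus>\<^bsub>M\<^esub> s \<odot>\<^bsub>M\<^esub> (b' \<oplus>\<^bsub>M\<^esub> z) | b b'. b \<in> B \<and> b' \<in> B} = B"
      have "\<zero>\<^bsub>M\<^esub> \<oplus>\<^bsub>M\<^esub> s \<odot>\<^bsub>M\<^esub> (\<zero>\<^bsub>M\<^esub> \<oplus>\<^bsub>M\<^esub> z) \<in> B"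
        using submodule_zero[OF B] by (subst eqB[symmetric]) blast
      then show "s \<odot>\<^bsub>M\<^esub> z \<in> B" using s ZM[OF z] by simp
    next
      assume sz: "s \<odot>\<^bsub>M\<^esub> z \<in> B"
      show "{b \<oplus>\<^bsub>M\<^esub> s \<odot>\<^bsub>M\<^esub> (b' \<oplus>\<^bsub>M\<^esub> z) | b b'. b \<in> B \<and> b' \<in> B} = B" (is "?X = B")
      proof
        show "?X \<subseteq> B" using sz s BM ZM[OF z] by (auto simp: smult_r_distr submodule_closed[OF B])
        show "B \<subseteq> ?X"
        proof
          fix b assume b: "b \<in> B"
          have "b = (b \<ominus>\<^bsub>M\<^esub> s \<odot>\<^bsub>M\<^esub> z) \<oplus>\<^bsub>M\<^esub> s \<odot>\<^bsub>M\<^esub> (\<zero>\<^bsub>M\<^esub> \<oplus>\<^bsub>M\<^esub> z)"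
            using s BM[OF b] ZM[OF z] by (simp add: a_minus_def M.a_assoc M.l_neg)
          then show "b \<in> ?X" using submodule_minus[OF B b sz] submodule_zero[OF B] by blast
        qed
      qed
    qed
  qed
  then have *: "s \<in> carrier S \<Longrightarrow> (\<forall>z\<in>Z. B <+>\<^bsub>M\<^esub> (\<lambda>x. s \<odot>\<^bsub>M\<^esub> x) ` (B +>\<^bsub>M\<^esub> z) = B) \<longleftrightarrow> (\<forall>z\<in>Z. s \<odot>\<^bsub>M\<^esub> z \<in> B)"
    by blast
  have "s \<in> annihilator S (subquotient M Z B) \<longleftrightarrow>
      s \<in> carrier S \<and> (\<forall>z\<in>Z. B <+>\<^bsub>M\<^esub> (\<lambda>x. s \<odot>\<^bsub>M\<^esub> x) ` (B +>\<^bsub>M\<^esub> z) = B)"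
    unfolding annihilator_def subquotient_def by simp
  then show ?thesis using * by blast
qed

lemma subquotient_torsion_part: "subquotient (torsion_part S I M) Z B = subquotient M Z B"
proof -
  have "set_add (torsion_part S I M) = set_add M"
    by (intro ext) (simp add: torsion_part_def set_add_def set_mult_def)
  moreover have "B +>\<^bsub>torsion_part S I M\<^esub> z = B +>\<^bsub>M\<^esub> z" for z
    by (simp add: torsion_part_def a_r_coset_def r_coset_def)
  ultimately show ?thesis by (simp add: subquotient_def) (simp add: torsion_part_def)
qed

lemma (in noetherian_ring) ascending_ideals_stabilise:
  assumes "\<And>n. ideal (I n) R" "\<And>n. I n \<subseteq> I (Suc n)"
  shows "\<exists>c. \<forall>n. I (c + n) = I c"
proof -
  have mono: "I i \<subseteq> I j" if "i \<le> j" for i j using lift_Suc_mono_le[of I, OF assms(2) that] .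
  have "subset.chain {J. ideal J R} (range I)"
  proof -
    have "I i \<subseteq> I j \<or> I j \<subseteq> I i" for i j using mono[of i j] mono[of j i] by linarith
    then show ?thesis using assms(1) unfolding subset_chain_def by blast
  qed
  then obtain c where c: "\<Union>(range I) = I c" using ideal_chain_is_trivial[of "range I"] by auto
  have "I (c + n) = I c" for n
  proof
    show "I (c + n) \<subseteq> I c" unfolding c[symmetric] by blast
    show "I c \<subseteq> I (c + n)" by (rule mono) simp
  qed
  then show ?thesis by blast
qed

lemma (in cring) ideal_submodule:
  assumes "ideal J R" shows "submodule J R (self_module R)"
proof -
  interpret ideal J R by fact
  show ?thesis
    by (rule module.submodule_criterion[OF self_module_is_module]) (auto simp: self_module_def I_l_closed)
qed

text \<open>Let \<open>I\<close> be the annihilator of \<open>x\<close>. Since \<open>S\<close> is Noetherian, the annihilators of \<open>f\<^sup>k x\<close> are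
  constant from some \<open>k = c\<close> on. Therefore \<open>f\<^sup>c\<^sup>+\<^sup>n s + i \<mapsto> f\<^sup>c s x\<close> is a well-defined linear map
  on the ideal generated by \<open>f\<^sup>c\<^sup>+\<^sup>n\<close> and \<open>I\<close>; extend it to \<open>S\<close> and let \<open>y\<close> be the value at \<open>1\<close>.
  Injectivity is tested on modules whose elements have the type of the elements of \<open>Q\<close>, so the
  ideals of \<open>S\<close> are replaced by their images in \<open>E0\<close>, where \<open>\<epsilon>\<close> embeds \<open>S\<close>.\<close>

lemma injective_divisible:
  fixes E0 Q :: "('s, 'e) module"
  assumes noeth: "noetherian_ring S" and "module S E0"
    and \<epsilon>: "\<epsilon> \<in> lin_maps S (self_module S) E0" and inj: "inj_on \<epsilon> (carrier S)"
    and Q: "injective_module S Q" and x: "x \<in> carrier Q" and f: "f \<in> carrier S"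
  shows "\<exists>y\<in>carrier Q. \<exists>c::nat. f [^]\<^bsub>S\<^esub> c \<odot>\<^bsub>Q\<^esub> x = f [^]\<^bsub>S\<^esub> (c + n) \<odot>\<^bsub>Q\<^esub> y \<and>
           (\<forall>s\<in>carrier S. s \<odot>\<^bsub>Q\<^esub> x = \<zero>\<^bsub>Q\<^esub> \<longrightarrow> s \<odot>\<^bsub>Q\<^esub> y = \<zero>\<^bsub>Q\<^esub>)"
proof -
  interpret E0: module S E0 by fact
  interpret Q: module S Q using Q by (simp add: injective_module_def)
  interpret N: noetherian_ring S by fact
  interpret SS: module S "self_module S" by (rule E0.R.self_module_is_module)
  interpret e: module_map S "self_module S" E0 \<epsilon> by unfold_locales (rule \<epsilon>)
  have SR: "carrier (self_module S) = carrier S" "smult (self_module S) = mult S"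
     "add (self_module S) = add S" "zero (self_module S) = zero S" by (simp_all add: self_module_def)
  have zQ: "submodule {\<zero>\<^bsub>Q\<^esub>} S Q" by (rule Q.submoduleI) auto
  define I where "I = {s \<in> carrier S. s \<odot>\<^bsub>Q\<^esub> x = \<zero>\<^bsub>Q\<^esub>}"
  define C where "C = (\<lambda>k::nat. {s \<in> carrier S. s \<odot>\<^bsub>Q\<^esub> (f [^]\<^bsub>S\<^esub> k \<odot>\<^bsub>Q\<^esub> x) \<in> {\<zero>\<^bsub>Q\<^esub>}})"
  have idealC: "ideal (C k) S" for k
    unfolding C_def by (rule Q.colon_ideal[OF zQ]) (use x f in auto)
  have ascC: "C k \<subseteq> C (Suc k)" for k
    unfolding C_def
  proof
    fix s assume "s \<in> {s \<in> carrier S. s \<odot>\<^bsub>Q\<^esub> (f [^]\<^bsub>S\<^esub> k \<odot>\<^bsub>Q\<^esub> x) \<in> {\<zero>\<^bsub>Q\<^esub>}}"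
    then have s: "s \<in> carrier S" "s \<odot>\<^bsub>Q\<^esub> (f [^]\<^bsub>S\<^esub> k \<odot>\<^bsub>Q\<^esub> x) = \<zero>\<^bsub>Q\<^esub>" by blast+
    have "f [^]\<^bsub>S\<^esub> Suc k \<odot>\<^bsub>Q\<^esub> x = f \<odot>\<^bsub>Q\<^esub> (f [^]\<^bsub>S\<^esub> k \<odot>\<^bsub>Q\<^esub> x)"
      using f x by (simp add: Q.smult_assoc1[symmetric] E0.R.m_comm)
    then have "s \<odot>\<^bsub>Q\<^esub> (f [^]\<^bsub>S\<^esub> Suc k \<odot>\<^bsub>Q\<^esub> x) = f \<odot>\<^bsub>Q\<^esub> (s \<odot>\<^bsub>Q\<^esub> (f [^]\<^bsub>S\<^esub> k \<odot>\<^bsub>Q\<^esub> x))"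
      using Q.smult_swap[OF s(1) f, of "f [^]\<^bsub>S\<^esub> k \<odot>\<^bsub>Q\<^esub> x"] f x by simp
    then have "s \<odot>\<^bsub>Q\<^esub> (f [^]\<^bsub>S\<^esub> Suc k \<odot>\<^bsub>Q\<^esub> x) = \<zero>\<^bsub>Q\<^esub>" unfolding s(2) using f by simp
    then show "s \<in> {s \<in> carrier S. s \<odot>\<^bsub>Q\<^esub> (f [^]\<^bsub>S\<^esub> Suc k \<odot>\<^bsub>Q\<^esub> x) \<in> {\<zero>\<^bsub>Q\<^esub>}}"
      using s(1) by blast
  qed
  obtain c where c0: "\<forall>n. C (c + n) = C c"
    using N.ascending_ideals_stabilise[of C] idealC ascC by blast
  have c: "s \<odot>\<^bsub>Q\<^esub> (f [^]\<^bsub>S\<^esub> c \<odot>\<^bsub>Q\<^esub> x) = \<zero>\<^bsub>Q\<^esub>"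
    if "s \<in> carrier S" "s \<odot>\<^bsub>Q\<^esub> (f [^]\<^bsub>S\<^esub> (c + n) \<odot>\<^bsub>Q\<^esub> x) = \<zero>\<^bsub>Q\<^esub>" for s
  proof -
    have "s \<in> C (c + n)" using that unfolding C_def by blast
    then have "s \<in> C c" using c0 by metis
    then show ?thesis unfolding C_def by blast
  qed
  let ?F = "f [^]\<^bsub>S\<^esub> (c + n)"
  have F: "?F \<in> carrier S" using f by simp
  have Fc: "f [^]\<^bsub>S\<^esub> c \<in> carrier S" using f by simp
  have IS: "i \<in> carrier S" if "i \<in> I" for i using that by (simp add: I_def)
  have I: "submodule I S (self_module S)"
  proof -
    have "I = {s \<in> carrier S. s \<odot>\<^bsub>Q\<^esub> x \<in> {\<zero>\<^bsub>Q\<^esub>}}" unfolding I_def by blast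
    then show ?thesis using E0.R.ideal_submodule[OF Q.colon_ideal[OF zQ x]] by metis
  qed
  define J where "J = {?F \<otimes>\<^bsub>S\<^esub> s \<oplus>\<^bsub>S\<^esub> i | s i. s \<in> carrier S \<and> i \<in> I}"
  have JI: "?F \<otimes>\<^bsub>S\<^esub> s \<oplus>\<^bsub>S\<^esub> i \<in> J" if "s \<in> carrier S" "i \<in> I" for s i using that by (auto simp: J_def)
  have JS: "J \<subseteq> carrier S" using F IS by (auto simp: J_def)
  have Jadd: "(?F \<otimes>\<^bsub>S\<^esub> s \<oplus>\<^bsub>S\<^esub> i) \<oplus>\<^bsub>S\<^esub> (?F \<otimes>\<^bsub>S\<^esub> s' \<oplus>\<^bsub>S\<^esub> i') = ?F \<otimes>\<^bsub>S\<^esub> (s \<oplus>\<^bsub>S\<^esub> s') \<oplus>\<^bsub>S\<^esub> (i \<oplus>\<^bsub>S\<^esub> i')"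
    if "s \<in> carrier S" "i \<in> I" "s' \<in> carrier S" "i' \<in> I" for s i s' i'
    using that IS F by (simp add: E0.R.r_distr E0.R.a_ac)
  have Jmult: "r \<otimes>\<^bsub>S\<^esub> (?F \<otimes>\<^bsub>S\<^esub> s \<oplus>\<^bsub>S\<^esub> i) = ?F \<otimes>\<^bsub>S\<^esub> (r \<otimes>\<^bsub>S\<^esub> s) \<oplus>\<^bsub>S\<^esub> r \<otimes>\<^bsub>S\<^esub> i"
    if "s \<in> carrier S" "i \<in> I" "r \<in> carrier S" for s i r
    using that IS F by (simp add: E0.R.r_distr E0.R.m_ac)
  have Iadd: "i \<oplus>\<^bsub>S\<^esub> j \<in> I" if "i \<in> I" "j \<in> I" for i j
    using SS.submodule_add[OF I that] by (simp add: SR)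
  have Imult: "r \<otimes>\<^bsub>S\<^esub> i \<in> I" if "i \<in> I" "r \<in> carrier S" for i r
    using SS.submodule_smult[OF I that(2,1)] by (simp add: SR)
  have I0: "\<zero>\<^bsub>S\<^esub> \<in> I" using SS.submodule_zero[OF I] by (simp add: SR)
  have J: "submodule J S (self_module S)"
  proof (rule SS.submodule_criterion)
    show "J \<subseteq> carrier (self_module S)" using JS by (simp add: SR)
    show "\<zero>\<^bsub>self_module S\<^esub> \<in> J" using JI[OF E0.R.zero_closed I0] F by (simp add: SR)
    show "r \<odot>\<^bsub>self_module S\<^esub> a \<in> J" if r: "r \<in> carrier S" and a: "a \<in> J" for r a
    proof -
      obtain s i where si: "s \<in> carrier S" "i \<in> I" "a = ?F \<otimes>\<^bsub>S\<^esub> s \<oplus>\<^bsub>S\<^esub> i" using a unfolding J_def by blast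
      show ?thesis unfolding SR si(3) Jmult[OF si(1,2) r]
        by (rule JI[OF E0.R.m_closed[OF r si(1)] Imult[OF si(2) r]])
    qed
    show "a \<oplus>\<^bsub>self_module S\<^esub> b \<in> J" if a: "a \<in> J" and b: "b \<in> J" for a b
    proof -
      obtain s i s' i' where si: "s \<in> carrier S" "i \<in> I" "s' \<in> carrier S" "i' \<in> I"
        "a = ?F \<otimes>\<^bsub>S\<^esub> s \<oplus>\<^bsub>S\<^esub> i" "b = ?F \<otimes>\<^bsub>S\<^esub> s' \<oplus>\<^bsub>S\<^esub> i'" using a b unfolding J_def by blast
      show ?thesis unfolding SR si(5,6) Jadd[OF si(1-4)]
        by (rule JI[OF E0.R.add.m_closed[OF si(1,3)] Iadd[OF si(2,4)]])
    qed
  qed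
  have indep: "f [^]\<^bsub>S\<^esub> c \<odot>\<^bsub>Q\<^esub> (s \<odot>\<^bsub>Q\<^esub> x) = f [^]\<^bsub>S\<^esub> c \<odot>\<^bsub>Q\<^esub> (s' \<odot>\<^bsub>Q\<^esub> x)"
    if "s \<in> carrier S" "i \<in> I" "s' \<in> carrier S" "i' \<in> I" "?F \<otimes>\<^bsub>S\<^esub> s \<oplus>\<^bsub>S\<^esub> i = ?F \<otimes>\<^bsub>S\<^esub> s' \<oplus>\<^bsub>S\<^esub> i'" for s i s' i'
  proof -
    have "(?F \<otimes>\<^bsub>S\<^esub> s \<oplus>\<^bsub>S\<^esub> i) \<odot>\<^bsub>Q\<^esub> x = ?F \<odot>\<^bsub>Q\<^esub> (s \<odot>\<^bsub>Q\<^esub> x)"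
      "(?F \<otimes>\<^bsub>S\<^esub> s' \<oplus>\<^bsub>S\<^esub> i') \<odot>\<^bsub>Q\<^esub> x = ?F \<odot>\<^bsub>Q\<^esub> (s' \<odot>\<^bsub>Q\<^esub> x)"
      using that(1-4) x F by (simp_all add: Q.smult_l_distr Q.smult_assoc1 I_def)
    then have eq: "?F \<odot>\<^bsub>Q\<^esub> (s \<odot>\<^bsub>Q\<^esub> x) = ?F \<odot>\<^bsub>Q\<^esub> (s' \<odot>\<^bsub>Q\<^esub> x)" using that(5) by simp
    have d: "s \<ominus>\<^bsub>S\<^esub> s' \<in> carrier S" using that by simp
    have dx: "g \<odot>\<^bsub>Q\<^esub> (s \<odot>\<^bsub>Q\<^esub> x) \<ominus>\<^bsub>Q\<^esub> g \<odot>\<^bsub>Q\<^esub> (s' \<odot>\<^bsub>Q\<^esub> x) = (s \<ominus>\<^bsub>S\<^esub> s') \<odot>\<^bsub>Q\<^esub> (g \<odot>\<^bsub>Q\<^esub> x)" if g: "g \<in> carrier S" for g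
      using g that x \<open>s \<in> carrier S\<close> \<open>s' \<in> carrier S\<close>
      by (simp add: a_minus_def Q.smult_l_distr Q.smult_l_minus Q.smult_swap[of g])
    have "(s \<ominus>\<^bsub>S\<^esub> s') \<odot>\<^bsub>Q\<^esub> (?F \<odot>\<^bsub>Q\<^esub> x) = \<zero>\<^bsub>Q\<^esub>" unfolding dx[OF F, symmetric] eq using that x F by simp
    from c[OF d this] have "f [^]\<^bsub>S\<^esub> c \<odot>\<^bsub>Q\<^esub> (s \<odot>\<^bsub>Q\<^esub> x) \<ominus>\<^bsub>Q\<^esub> f [^]\<^bsub>S\<^esub> c \<odot>\<^bsub>Q\<^esub> (s' \<odot>\<^bsub>Q\<^esub> x) = \<zero>\<^bsub>Q\<^esub>"
      unfolding dx[OF Fc] .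
    moreover have "f [^]\<^bsub>S\<^esub> c \<odot>\<^bsub>Q\<^esub> (s \<odot>\<^bsub>Q\<^esub> x) \<in> carrier Q" "f [^]\<^bsub>S\<^esub> c \<odot>\<^bsub>Q\<^esub> (s' \<odot>\<^bsub>Q\<^esub> x) \<in> carrier Q"
      using that x Fc by auto
    ultimately show ?thesis by (metis Q.M.add.inv_closed Q.M.add.inv_equality Q.M.minus_minus a_minus_def)
  qed
  \<comment> \<open>The linear map on the copy of the ideal \<open>J\<close> inside \<open>E0\<close>; the choice of \<open>s\<close> is irrelevant by \<open>indep\<close>.\<close>
  define \<psi> where "\<psi> = (\<lambda>v. f [^]\<^bsub>S\<^esub> c \<odot>\<^bsub>Q\<^esub> ((SOME s. s \<in> carrier S \<and> (\<exists>i\<in>I. v = \<epsilon> (?F \<otimes>\<^bsub>S\<^esub> s \<oplus>\<^bsub>S\<^esub> i))) \<odot>\<^bsub>Q\<^esub> x))"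
  have \<psi>: "\<psi> (\<epsilon> (?F \<otimes>\<^bsub>S\<^esub> s \<oplus>\<^bsub>S\<^esub> i)) = f [^]\<^bsub>S\<^esub> c \<odot>\<^bsub>Q\<^esub> (s \<odot>\<^bsub>Q\<^esub> x)" if s: "s \<in> carrier S" "i \<in> I" for s i
  proof -
    define s' where "s' = (SOME s'. s' \<in> carrier S \<and> (\<exists>i'\<in>I. \<epsilon> (?F \<otimes>\<^bsub>S\<^esub> s \<oplus>\<^bsub>S\<^esub> i) = \<epsilon> (?F \<otimes>\<^bsub>S\<^esub> s' \<oplus>\<^bsub>S\<^esub> i')))"
    have "s' \<in> carrier S \<and> (\<exists>i'\<in>I. \<epsilon> (?F \<otimes>\<^bsub>S\<^esub> s \<oplus>\<^bsub>S\<^esub> i) = \<epsilon> (?F \<otimes>\<^bsub>S\<^esub> s' \<oplus>\<^bsub>S\<^esub> i'))"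
      unfolding s'_def by (rule someI[of _ s]) (use s in blast)
    then obtain i' where i': "s' \<in> carrier S" "i' \<in> I" "\<epsilon> (?F \<otimes>\<^bsub>S\<^esub> s \<oplus>\<^bsub>S\<^esub> i) = \<epsilon> (?F \<otimes>\<^bsub>S\<^esub> s' \<oplus>\<^bsub>S\<^esub> i')" by blast
    have "?F \<otimes>\<^bsub>S\<^esub> s \<oplus>\<^bsub>S\<^esub> i = ?F \<otimes>\<^bsub>S\<^esub> s' \<oplus>\<^bsub>S\<^esub> i'"
      by (rule inj_onD[OF inj i'(3)]) (use s i' IS F in auto)
    from indep[OF s i'(1,2) this] show ?thesis unfolding \<psi>_def s'_def[symmetric] by simp
  qed
  let ?M = "E0\<lparr>carrier := \<epsilon> ` J\<rparr>" and ?N = "E0\<lparr>carrier := \<epsilon> ` carrier S\<rparr>"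
  have mM: "module S ?M" by (rule submodule.submodule_is_module[OF e.image_submodule[OF J]]) fact
  have mN: "module S ?N"
    using submodule.submodule_is_module[OF e.image_submodule[OF SS.carrier_is_submodule]] \<open>module S E0\<close> by (simp add: SR)
  have \<iota>: "(\<lambda>v. v) \<in> lin_maps S ?M ?N" using JS by (auto simp: lin_maps_def)
  have "\<psi> \<in> lin_maps S ?M Q"
  proof -
    have 1: "\<psi> (\<epsilon> j) \<in> carrier Q" if "j \<in> J" for j
      using that \<psi> x Fc unfolding J_def by auto
    have 2: "\<psi> (\<epsilon> j \<oplus>\<^bsub>E0\<^esub> \<epsilon> j') = \<psi> (\<epsilon> j) \<oplus>\<^bsub>Q\<^esub> \<psi> (\<epsilon> j')" if jj: "j \<in> J" "j' \<in> J" for j j'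
    proof -
      from jj obtain s i s' i' where s: "s \<in> carrier S" "i \<in> I" "s' \<in> carrier S" "i' \<in> I"
        and j: "j = ?F \<otimes>\<^bsub>S\<^esub> s \<oplus>\<^bsub>S\<^esub> i" "j' = ?F \<otimes>\<^bsub>S\<^esub> s' \<oplus>\<^bsub>S\<^esub> i'" unfolding J_def by blast
      have "\<epsilon> j \<oplus>\<^bsub>E0\<^esub> \<epsilon> j' = \<epsilon> (j \<oplus>\<^bsub>S\<^esub> j')" using e.map_add[of j j'] subsetD[OF JS jj(1)] subsetD[OF JS jj(2)] by (simp add: SR)
      also have "j \<oplus>\<^bsub>S\<^esub> j' = ?F \<otimes>\<^bsub>S\<^esub> (s \<oplus>\<^bsub>S\<^esub> s') \<oplus>\<^bsub>S\<^esub> (i \<oplus>\<^bsub>S\<^esub> i')" unfolding j by (rule Jadd[OF s])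
      finally have "\<psi> (\<epsilon> j \<oplus>\<^bsub>E0\<^esub> \<epsilon> j') = f [^]\<^bsub>S\<^esub> c \<odot>\<^bsub>Q\<^esub> ((s \<oplus>\<^bsub>S\<^esub> s') \<odot>\<^bsub>Q\<^esub> x)"
        using \<psi>[of "s \<oplus>\<^bsub>S\<^esub> s'" "i \<oplus>\<^bsub>S\<^esub> i'"] s Iadd by simp
      also have "\<dots> = \<psi> (\<epsilon> j) \<oplus>\<^bsub>Q\<^esub> \<psi> (\<epsilon> j')"
        unfolding j \<psi>[OF s(1,2)] \<psi>[OF s(3,4)] using s x Fc by (simp add: Q.smult_l_distr Q.smult_r_distr)
      finally show ?thesis .
    qed
    have 3: "\<psi> (r \<odot>\<^bsub>E0\<^esub> \<epsilon> j) = r \<odot>\<^bsub>Q\<^esub> \<psi> (\<epsilon> j)" if r: "r \<in> carrier S" and jj: "j \<in> J" for r j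
    proof -
      from jj obtain s i where s: "s \<in> carrier S" "i \<in> I" and j: "j = ?F \<otimes>\<^bsub>S\<^esub> s \<oplus>\<^bsub>S\<^esub> i" unfolding J_def by blast
      have "r \<odot>\<^bsub>E0\<^esub> \<epsilon> j = \<epsilon> (r \<otimes>\<^bsub>S\<^esub> j)" using e.map_smult[OF r, of j] subsetD[OF JS jj] by (simp add: SR)
      also have "r \<otimes>\<^bsub>S\<^esub> j = ?F \<otimes>\<^bsub>S\<^esub> (r \<otimes>\<^bsub>S\<^esub> s) \<oplus>\<^bsub>S\<^esub> r \<otimes>\<^bsub>S\<^esub> i" unfolding j by (rule Jmult[OF s r])
      finally have "\<psi> (r \<odot>\<^bsub>E0\<^esub> \<epsilon> j) = f [^]\<^bsub>S\<^esub> c \<odot>\<^bsub>Q\<^esub> ((r \<otimes>\<^bsub>S\<^esub> s) \<odot>\<^bsub>Q\<^esub> x)"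
        using \<psi>[of "r \<otimes>\<^bsub>S\<^esub> s" "r \<otimes>\<^bsub>S\<^esub> i"] s r Imult by simp
      also have "\<dots> = r \<odot>\<^bsub>Q\<^esub> \<psi> (\<epsilon> j)"
        unfolding j \<psi>[OF s] using s x Fc r by (simp add: Q.smult_assoc1 Q.smult_swap[of r])
      finally show ?thesis .
    qed
    show ?thesis
      unfolding lin_maps_def
    proof (intro CollectI conjI ballI Pi_I)
      fix v assume "v \<in> carrier ?M"
      then obtain j where j: "j \<in> J" "v = \<epsilon> j" by auto
      show "\<psi> v \<in> carrier Q" unfolding j by (rule 1[OF j(1)])
    next
      fix v w assume "v \<in> carrier ?M" "w \<in> carrier ?M"
      then obtain j j' where j: "j \<in> J" "v = \<epsilon> j" "j' \<in> J" "w = \<epsilon> j'" by auto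
      show "\<psi> (v \<oplus>\<^bsub>?M\<^esub> w) = \<psi> v \<oplus>\<^bsub>Q\<^esub> \<psi> w" using 2[OF j(1,3)] unfolding j by simp
    next
      fix r v assume r: "r \<in> carrier S" and "v \<in> carrier ?M"
      then obtain j where j: "j \<in> J" "v = \<epsilon> j" by auto
      show "\<psi> (r \<odot>\<^bsub>?M\<^esub> v) = r \<odot>\<^bsub>Q\<^esub> \<psi> v" using 3[OF r j(1)] unfolding j by simp
    qed
  qed
  from Q[unfolded injective_module_def, THEN conjunct2, rule_format, OF mM mN \<iota> _ this]
  have "\<exists>h\<in>lin_maps S ?N Q. \<forall>v\<in>carrier ?M. h v = \<psi> v" by (simp add: inj_on_def)
  then obtain h where h: "h \<in> lin_maps S ?N Q" "\<And>v. v \<in> \<epsilon> ` J \<Longrightarrow> h v = \<psi> v" by auto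
  define y where "y = h (\<epsilon> \<one>\<^bsub>S\<^esub>)"
  have y: "y \<in> carrier Q" using h(1) by (auto simp: y_def lin_maps_def)
  have sy: "s \<odot>\<^bsub>Q\<^esub> y = h (\<epsilon> s)" if s: "s \<in> carrier S" for s
  proof -
    have "s \<odot>\<^bsub>Q\<^esub> y = h (s \<odot>\<^bsub>E0\<^esub> \<epsilon> \<one>\<^bsub>S\<^esub>)" using h(1) s by (auto simp: y_def lin_maps_def)
    also have "s \<odot>\<^bsub>E0\<^esub> \<epsilon> \<one>\<^bsub>S\<^esub> = \<epsilon> s" using e.map_smult[OF s, of "\<one>\<^bsub>S\<^esub>"] s by (simp add: SR)
    finally show ?thesis .
  qed
  have "f [^]\<^bsub>S\<^esub> c \<odot>\<^bsub>Q\<^esub> x = ?F \<odot>\<^bsub>Q\<^esub> y"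
  proof -
    have "?F \<odot>\<^bsub>Q\<^esub> y = \<psi> (\<epsilon> (?F \<otimes>\<^bsub>S\<^esub> \<one>\<^bsub>S\<^esub> \<oplus>\<^bsub>S\<^esub> \<zero>\<^bsub>S\<^esub>))"
      using sy[OF F] h(2)[OF imageI[OF JI[OF E0.R.one_closed I0]]] F by simp
    then show ?thesis using \<psi>[OF E0.R.one_closed I0] x by simp
  qed
  moreover have "s \<odot>\<^bsub>Q\<^esub> y = \<zero>\<^bsub>Q\<^esub>" if "s \<in> I" for s
  proof -
    have "s \<odot>\<^bsub>Q\<^esub> y = \<psi> (\<epsilon> (?F \<otimes>\<^bsub>S\<^esub> \<zero>\<^bsub>S\<^esub> \<oplus>\<^bsub>S\<^esub> s))"
      using sy[OF IS[OF that]] h(2)[OF imageI[OF JI[OF E0.R.zero_closed that]]] F IS[OF that] by simp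
    then show ?thesis using \<psi>[OF E0.R.zero_closed that] x Fc by simp
  qed
  ultimately show ?thesis using y unfolding I_def by blast
qed

text \<open>The quotient \<open>y\<close> in \<open>injective_divisible\<close> is annihilated by everything that annihilates \<open>x\<close>,
  so division stays inside the torsion submodules.\<close>

lemma injective_tower:
  fixes E0 Q :: "('s, 'e) module"
  assumes noeth: "noetherian_ring S" and E0: "module S E0"
    and \<epsilon>: "\<epsilon> \<in> lin_maps S (self_module S) E0" and inj: "inj_on \<epsilon> (carrier S)"
    and Q: "injective_module S Q"
  shows "set fs \<subseteq> carrier S \<Longrightarrow> set gs \<subseteq> carrier S \<Longrightarrow>
     module.divisible_tower S Q fs {x \<in> carrier Q. \<exists>N. \<forall>g\<in>set gs. g [^]\<^bsub>S\<^esub> (N::nat) \<odot>\<^bsub>Q\<^esub> x = \<zero>\<^bsub>Q\<^esub>}"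
proof (induction fs arbitrary: gs)
  case Nil
  interpret Q: module S Q using Q by (simp add: injective_module_def)
  show ?case by simp
next
  case (Cons f fs)
  interpret Q: module S Q using Q by (simp add: injective_module_def)
  let ?W = "\<lambda>gs. {x \<in> carrier Q. \<exists>N. \<forall>g\<in>set gs. g [^]\<^bsub>S\<^esub> (N::nat) \<odot>\<^bsub>Q\<^esub> x = \<zero>\<^bsub>Q\<^esub>}"
  have f: "f \<in> carrier S" and fs: "set fs \<subseteq> carrier S" using Cons.prems by auto
  have 1: "\<exists>y\<in>?W gs. \<exists>c::nat. f [^]\<^bsub>S\<^esub> c \<odot>\<^bsub>Q\<^esub> x = f [^]\<^bsub>S\<^esub> (c + n) \<odot>\<^bsub>Q\<^esub> y" if x: "x \<in> ?W gs" for x n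
  proof -
    obtain N where N: "x \<in> carrier Q" "\<And>g. g \<in> set gs \<Longrightarrow> g [^]\<^bsub>S\<^esub> (N::nat) \<odot>\<^bsub>Q\<^esub> x = \<zero>\<^bsub>Q\<^esub>" using x by auto
    obtain y c where y: "y \<in> carrier Q" "f [^]\<^bsub>S\<^esub> (c::nat) \<odot>\<^bsub>Q\<^esub> x = f [^]\<^bsub>S\<^esub> (c + n) \<odot>\<^bsub>Q\<^esub> y"
      "\<And>s. s \<in> carrier S \<Longrightarrow> s \<odot>\<^bsub>Q\<^esub> x = \<zero>\<^bsub>Q\<^esub> \<Longrightarrow> s \<odot>\<^bsub>Q\<^esub> y = \<zero>\<^bsub>Q\<^esub>"
      using injective_divisible[OF noeth E0 \<epsilon> inj Q N(1) f, of n] by blast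
    have "y \<in> ?W gs" using y(1,3) N(2) Cons.prems(2) by blast
    then show ?thesis using y(2) by blast
  qed
  have 2: "{x \<in> ?W gs. \<exists>N::nat. f [^]\<^bsub>S\<^esub> N \<odot>\<^bsub>Q\<^esub> x = \<zero>\<^bsub>Q\<^esub>} = ?W (f # gs)"
  proof -
    have up: "g [^]\<^bsub>S\<^esub> (a + b) \<odot>\<^bsub>Q\<^esub> x = \<zero>\<^bsub>Q\<^esub>"
      if "g [^]\<^bsub>S\<^esub> a \<odot>\<^bsub>Q\<^esub> x = \<zero>\<^bsub>Q\<^esub>" "g \<in> carrier S" "x \<in> carrier Q" for g x and a b :: nat
    proof -
      have "g [^]\<^bsub>S\<^esub> (a + b) \<odot>\<^bsub>Q\<^esub> x = g [^]\<^bsub>S\<^esub> b \<odot>\<^bsub>Q\<^esub> (g [^]\<^bsub>S\<^esub> a \<odot>\<^bsub>Q\<^esub> x)"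
        using that(2,3) by (simp add: Q.smult_assoc1[symmetric] Q.R.nat_pow_mult add.commute)
      then show ?thesis using that by simp
    qed
    have "x \<in> ?W (f # gs)" if x: "x \<in> ?W gs" "\<exists>N::nat. f [^]\<^bsub>S\<^esub> N \<odot>\<^bsub>Q\<^esub> x = \<zero>\<^bsub>Q\<^esub>" for x
    proof -
      obtain a b where "\<And>g. g \<in> set gs \<Longrightarrow> g [^]\<^bsub>S\<^esub> (a::nat) \<odot>\<^bsub>Q\<^esub> x = \<zero>\<^bsub>Q\<^esub>"
         "f [^]\<^bsub>S\<^esub> (b::nat) \<odot>\<^bsub>Q\<^esub> x = \<zero>\<^bsub>Q\<^esub>" "x \<in> carrier Q" using x by auto
      then have "\<forall>g\<in>set (f # gs). g [^]\<^bsub>S\<^esub> (a + b) \<odot>\<^bsub>Q\<^esub> x = \<zero>\<^bsub>Q\<^esub>"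
        using up[of _ a x b] up[of f b x a] f Cons.prems(2) by (auto simp: add.commute subset_iff)
      then show ?thesis using \<open>x \<in> carrier Q\<close> by blast
    qed
    then show ?thesis by auto
  qed
  show ?case using 1 2 Cons.IH[OF fs, of "f # gs"] f Cons.prems(2) by (simp add: Q.divisible_tower.simps)
qed

lemma injective_acyclic:
  fixes E0 Q :: "('s, 'e) module"
  assumes "noetherian_ring S" "module S E0"
    "\<epsilon> \<in> lin_maps S (self_module S) E0" "inj_on \<epsilon> (carrier S)"
    and Q: "injective_module S Q" and fs: "set fs \<subseteq> carrier S" and t: "1 \<le> t"
  shows "kills S fs Q (carrier Q) \<one>\<^bsub>S\<^esub> t"
proof -
  interpret Q: module S Q using Q by (simp add: injective_module_def)
  show ?thesis
    using injective_tower[OF assms(1-5) fs, of "[]"]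
    by (intro Q.divisible_tower_acyclic t fs Q.carrier_is_submodule) simp
qed

context module_map begin

text \<open>The cohomology of degree \<open>0\<close> of the colimit is the power torsion submodule.\<close>

lemma lifts_zero_iff:
  assumes fs: "set fs \<subseteq> carrier S" and W: "submodule W S M" and z: "z \<in> carrier S"
  shows "lifts fs W z 0 \<longleftrightarrow>
    (\<forall>y\<in>\<phi> ` W. (\<exists>n. \<forall>f\<in>set fs. f [^]\<^bsub>S\<^esub> (n::nat) \<odot>\<^bsub>N\<^esub> y = \<zero>\<^bsub>N\<^esub>) \<longrightarrow>
       (\<exists>x\<in>W. (\<exists>n. \<forall>f\<in>set fs. f [^]\<^bsub>S\<^esub> (n::nat) \<odot>\<^bsub>M\<^esub> x = \<zero>\<^bsub>M\<^esub>) \<and> z \<odot>\<^bsub>N\<^esub> y = \<phi> x))"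
    (is "_ \<longleftrightarrow> ?R")
proof -
  let ?l = "length fs"
  note W' = image_submodule[OF W]
  have dN: "(\<forall>xs. kos_d N (powers S fs n) (deg0 N ?l y) xs = \<zero>\<^bsub>N\<^esub>) \<longleftrightarrow> (\<forall>f\<in>set fs. f [^]\<^bsub>S\<^esub> n \<odot>\<^bsub>N\<^esub> y = \<zero>\<^bsub>N\<^esub>)"
    if "y \<in> carrier N" for y and n :: nat
    using N.kos_d_deg0[OF M.R.powers_carrier[OF fs] length_powers that] by (simp add: powers_def)
  have dM: "(\<forall>xs. kos_d M (powers S fs n) (deg0 M ?l y) xs = \<zero>\<^bsub>M\<^esub>) \<longleftrightarrow> (\<forall>f\<in>set fs. f [^]\<^bsub>S\<^esub> n \<odot>\<^bsub>M\<^esub> y = \<zero>\<^bsub>M\<^esub>)"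
    if "y \<in> carrier M" for y and n :: nat
    using M.kos_d_deg0[OF M.R.powers_carrier[OF fs] length_powers that] by (simp add: powers_def)
  have t: "kos_t N (powers S fs k) (deg0 N ?l y) = deg0 N ?l y" if "y \<in> carrier N" for y k
    using fs that by (intro N.kos_t_deg0) auto
  let ?F = "replicate ?l False"
  have eval: "deg0 N ?l y ?F = y" "deg0 M ?l x ?F = x" for x y by (simp_all add: deg0_def)
  show ?thesis
  proof
    assume l: "lifts fs W z 0"
    show ?R
    proof (intro ballI impI)
      fix y assume y: "y \<in> \<phi> ` W" and "\<exists>n. \<forall>f\<in>set fs. f [^]\<^bsub>S\<^esub> (n::nat) \<odot>\<^bsub>N\<^esub> y = \<zero>\<^bsub>N\<^esub>"
      then obtain n where n: "\<forall>f\<in>set fs. f [^]\<^bsub>S\<^esub> (n::nat) \<odot>\<^bsub>N\<^esub> y = \<zero>\<^bsub>N\<^esub>" by blast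
      have yN: "y \<in> carrier N" using N.submodule_subset[OF W' y] .
      have "\<forall>xs. kos_d N (powers S fs n) (deg0 N ?l y) xs = \<zero>\<^bsub>N\<^esub>" using n dN[OF yN] by blast
      with l N.deg0_cochain[OF W' y] obtain k m where m: "m \<in> cochains M W ?l 0"
        "\<forall>xs. kos_d M (powers S fs (n + k)) m xs = \<zero>\<^bsub>M\<^esub>"
        "\<forall>xs. z \<odot>\<^bsub>N\<^esub> kos_t N (powers S fs k) (deg0 N ?l y) xs = \<phi> (m xs)"
        unfolding lifts_def by blast
      have mW: "m ?F \<in> W" using M.cochains_closed[OF m(1)] .
      have "\<forall>f\<in>set fs. f [^]\<^bsub>S\<^esub> (n + k) \<odot>\<^bsub>M\<^esub> m ?F = \<zero>\<^bsub>M\<^esub>"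
        using m(2) dM[OF M.submodule_subset[OF W mW]] M.cochains_deg0[OF m(1)] by metis
      moreover have "z \<odot>\<^bsub>N\<^esub> y = \<phi> (m ?F)" using m(3) t[OF yN] eval(1) by metis
      ultimately show "\<exists>x\<in>W. (\<exists>n. \<forall>f\<in>set fs. f [^]\<^bsub>S\<^esub> (n::nat) \<odot>\<^bsub>M\<^esub> x = \<zero>\<^bsub>M\<^esub>) \<and> z \<odot>\<^bsub>N\<^esub> y = \<phi> x"
        using mW by blast
    qed
  next
    assume r: ?R
    show "lifts fs W z 0"
      unfolding lifts_def
    proof (intro allI ballI impI)
      fix n c assume c: "c \<in> cochains N (\<phi> ` W) ?l 0" and dc: "\<forall>xs. kos_d N (powers S fs n) c xs = \<zero>\<^bsub>N\<^esub>"
      define y where "y = c ?F"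
      have cy: "c = deg0 N ?l y" unfolding y_def by (rule N.cochains_deg0[OF c])
      have yW: "y \<in> \<phi> ` W" unfolding y_def by (rule N.cochains_closed[OF c])
      have yN: "y \<in> carrier N" using N.submodule_subset[OF W' yW] .
      have "\<forall>f\<in>set fs. f [^]\<^bsub>S\<^esub> n \<odot>\<^bsub>N\<^esub> y = \<zero>\<^bsub>N\<^esub>" using dc dN[OF yN] cy by blast
      with r yW obtain x k where x: "x \<in> W" "\<forall>f\<in>set fs. f [^]\<^bsub>S\<^esub> (k::nat) \<odot>\<^bsub>M\<^esub> x = \<zero>\<^bsub>M\<^esub>" "z \<odot>\<^bsub>N\<^esub> y = \<phi> x" by blast
      have xM: "x \<in> carrier M" using M.submodule_subset[OF W x(1)] .
      have "f [^]\<^bsub>S\<^esub> (n + k) \<odot>\<^bsub>M\<^esub> x = \<zero>\<^bsub>M\<^esub>" if "f \<in> set fs" for f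
      proof -
        have f: "f \<in> carrier S" using that fs by auto
        have "f [^]\<^bsub>S\<^esub> (n + k) \<odot>\<^bsub>M\<^esub> x = f [^]\<^bsub>S\<^esub> n \<odot>\<^bsub>M\<^esub> (f [^]\<^bsub>S\<^esub> k \<odot>\<^bsub>M\<^esub> x)"
          using f xM by (simp add: M.smult_assoc1[symmetric] M.R.nat_pow_mult)
        then show ?thesis using x(2) that f by simp
      qed
      then have 1: "\<forall>xs. kos_d M (powers S fs (n + k)) (deg0 M ?l x) xs = \<zero>\<^bsub>M\<^esub>" using dM[OF xM] by blast
      have 2: "\<forall>xs. z \<odot>\<^bsub>N\<^esub> kos_t N (powers S fs k) c xs = \<phi> (deg0 M ?l x xs)"
        unfolding cy t[OF yN] using x(3) z by (simp add: deg0_def)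
      show "\<exists>k. \<exists>m\<in>cochains M W ?l 0. (\<forall>xs. kos_d M (powers S fs (n + k)) m xs = \<zero>\<^bsub>M\<^esub>) \<and>
          (\<forall>xs. z \<odot>\<^bsub>N\<^esub> kos_t N (powers S fs k) c xs = \<phi> (m xs))"
        using 1 2 M.deg0_cochain[OF W x(1)] by blast
    qed
  qed
qed

end

lemma (in module) kills_zero_iff:
  assumes fs: "set fs \<subseteq> carrier R" and W: "submodule W R M" and z: "z \<in> carrier R"
  shows "kills R fs M W z 0 \<longleftrightarrow>
    (\<forall>y\<in>W. (\<exists>n. \<forall>f\<in>set fs. f [^] (n::nat) \<odot>\<^bsub>M\<^esub> y = \<zero>\<^bsub>M\<^esub>) \<longrightarrow> z \<odot>\<^bsub>M\<^esub> y = \<zero>\<^bsub>M\<^esub>)" (is "_ \<longleftrightarrow> ?R")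
proof -
  let ?l = "length fs" and ?F = "replicate (length fs) False"
  have dM: "(\<forall>xs. kos_d M (powers R fs n) (deg0 M ?l y) xs = \<zero>\<^bsub>M\<^esub>) \<longleftrightarrow> (\<forall>f\<in>set fs. f [^] n \<odot>\<^bsub>M\<^esub> y = \<zero>\<^bsub>M\<^esub>)"
    if "y \<in> carrier M" for y and n :: nat
    using kos_d_deg0[OF R.powers_carrier[OF fs] length_powers that] by (simp add: powers_def)
  have t: "kos_t M (powers R fs k) (deg0 M ?l y) = deg0 M ?l y" if "y \<in> carrier M" for y k
    using fs that by (intro kos_t_deg0) auto
  have eval: "deg0 M ?l x ?F = x" for x by (simp add: deg0_def)
  have neg: "h = (\<lambda>xs. \<zero>\<^bsub>M\<^esub>)" if "h \<in> cochains M W ?l (0 - 1)" for h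
    using cochains_neg_degree[OF that] by auto
  show ?thesis
  proof
    assume kl: "kills R fs M W z 0"
    show ?R
    proof (intro ballI impI)
      fix y assume y: "y \<in> W" and "\<exists>n. \<forall>f\<in>set fs. f [^] (n::nat) \<odot>\<^bsub>M\<^esub> y = \<zero>\<^bsub>M\<^esub>"
      then obtain n where n: "\<forall>f\<in>set fs. f [^] (n::nat) \<odot>\<^bsub>M\<^esub> y = \<zero>\<^bsub>M\<^esub>" by blast
      have yM: "y \<in> carrier M" using submodule_subset[OF W y] .
      have "\<And>xs. kos_d M (powers R fs n) (deg0 M ?l y) xs = \<zero>\<^bsub>M\<^esub>" using n dM[OF yM] by blast
      from killsE[OF kl deg0_cochain[OF W y] this] obtain k h where h: "h \<in> cochains M W ?l (0 - 1)"
        "\<And>xs. z \<odot>\<^bsub>M\<^esub> kos_t M (powers R fs k) (deg0 M ?l y) xs = kos_d M (powers R fs (n + k)) h xs" by blast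
      show "z \<odot>\<^bsub>M\<^esub> y = \<zero>\<^bsub>M\<^esub>" using h(2)[of ?F] neg[OF h(1)] t[OF yM] eval fs by (simp add: kos_d_zero)
    qed
  next
    assume r: ?R
    show "kills R fs M W z 0"
    proof (rule killsI)
      fix n c assume c: "c \<in> cochains M W ?l 0" and dc: "\<And>xs. kos_d M (powers R fs n) c xs = \<zero>\<^bsub>M\<^esub>"
      define y where "y = c ?F"
      have cy: "c = deg0 M ?l y" unfolding y_def by (rule cochains_deg0[OF c])
      have yW: "y \<in> W" unfolding y_def by (rule cochains_closed[OF c])
      have yM: "y \<in> carrier M" using submodule_subset[OF W yW] .
      have "\<forall>f\<in>set fs. f [^] n \<odot>\<^bsub>M\<^esub> y = \<zero>\<^bsub>M\<^esub>" using dc dM[OF yM] cy by blast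
      then have "z \<odot>\<^bsub>M\<^esub> y = \<zero>\<^bsub>M\<^esub>" using r yW by blast
      then have "\<forall>xs. z \<odot>\<^bsub>M\<^esub> kos_t M (powers R fs 0) c xs = kos_d M (powers R fs (n + 0)) (\<lambda>xs. \<zero>\<^bsub>M\<^esub>) xs"
        unfolding cy t[OF yM] using fs z by (simp add: deg0_def kos_d_zero)
      then show "\<exists>k. \<exists>h\<in>cochains M W ?l (0 - 1).
        \<forall>xs. z \<odot>\<^bsub>M\<^esub> kos_t M (powers R fs k) c xs = kos_d M (powers R fs (n + k)) h xs"
        using cochains_null[OF W] by blast
    qed
  qed
qed

text \<open>Let \<open>Z\<^sup>i\<close> be the cocycles of the resolution, so that \<open>Z\<^sup>0 \<cong> S\<close>. Since the terms are acyclic,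
  the cohomology of \<open>S\<close> in degree \<open>j = p + 1\<close> is that of \<open>Z\<^sup>p\<close> in degree \<open>1\<close>, which is the
  cokernel of the map from the torsion of \<open>E\<^sup>p\<close> to the torsion of \<open>Z\<^sup>p\<^sup>+\<^sup>1\<close>. This is the
  definition of local cohomology. Each isomorphism appears as an equivalence of annihilation
  statements.\<close>

theorem local_cohomology_annihilator:
  fixes E :: "nat \<Rightarrow> ('s, 'e) module"
  assumes noeth: "noetherian_ring S" and "cring S" and res: "injective_resolution S (self_module S) E \<epsilon> \<delta>"
    and fs: "set fs \<subseteq> carrier S" and z: "z \<in> carrier S"
  shows "z \<in> annihilator S (local_cohomology S (Idl\<^bsub>S\<^esub> (set fs)) E \<delta> j) \<longleftrightarrow>
    kills S fs (self_module S) (carrier S) z (int j)"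
proof -
  interpret S: cring S by fact
  interpret C: cochain_complex_of_modules S E \<delta>
    using res by unfold_locales (simp add: injective_resolution_def)
  interpret SS: module S "self_module S" by (rule S.self_module_is_module)
  have \<epsilon>: "\<epsilon> \<in> lin_maps S (self_module S) (E 0)" and inj: "inj_on \<epsilon> (carrier S)"
    and im: "\<epsilon> ` carrier S = cocycles E \<delta> 0" and injE: "\<And>i. injective_module S (E i)"
    and ex: "\<And>i. cocycles E \<delta> (Suc i) = coboundaries E \<delta> (Suc i)"
    using res by (simp_all add: injective_resolution_def self_module_def)
  have SR: "carrier (self_module S) = carrier S" by (simp add: self_module_def)
  have E0: "module S (E 0)" by (rule C.module_K)
  have acyc: "kills S fs (E i) (carrier (E i)) \<one>\<^bsub>S\<^esub> t" if "1 \<le> t" for i t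
    by (rule injective_acyclic[OF noeth E0 \<epsilon> inj injE fs that])
  interpret e: module_map S "self_module S" "E 0" \<epsilon>
    using \<epsilon> E0 S.self_module_is_module by (intro module_map.intro module_map_axioms.intro)
  let ?Z = "cocycles E \<delta>"
  let ?T = "torsion_part S (Idl\<^bsub>S\<^esub> (set fs))"
  define tors where "tors = (\<lambda>i x. \<exists>n. \<forall>f\<in>set fs. f [^]\<^bsub>S\<^esub> (n::nat) \<odot>\<^bsub>E i\<^esub> x = \<zero>\<^bsub>E i\<^esub>)"
  have T: "carrier (?T (E i)) = {x \<in> carrier (E i). tors i x}" for i
    unfolding tors_def by (rule torsion_part_eq[OF C.module_K fs])
  have ZS: "kills S fs (self_module S) (carrier S) z t \<longleftrightarrow> kills S fs (E 0) (?Z 0) z t" for t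
    using e.kills_inj_image[OF fs SS.carrier_is_submodule z, of t] inj im by (simp add: SR)
  have Zim: "\<delta> i ` carrier (E i) = ?Z (Suc i)" for i using ex by (simp add: C.coboundaries_Suc)
  have Zker: "{x \<in> carrier (E i). \<delta> i x = \<zero>\<^bsub>E (Suc i)\<^esub>} = ?Z i" for i by (simp add: cocycles_def)
  have shift: "kills S fs (E i) (?Z i) z (t + 1) \<longleftrightarrow> module_map.lifts S (E i) (E (Suc i)) (\<delta> i) fs (carrier (E i)) z t"
    if "0 \<le> t" for i t
  proof -
    interpret m: module_map S "E i" "E (Suc i)" "\<delta> i" by (rule C.map_K)
    show ?thesis
      using m.lifts_imp_kills_kernel[OF fs m.M.carrier_is_submodule z, of t] acyc[of "t + 1" i] that
        m.kills_kernel_imp_lifts[OF fs m.M.carrier_is_submodule z, of t] Zker[of i] by auto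
  qed
  have shift2: "module_map.lifts S (E i) (E (Suc i)) (\<delta> i) fs (carrier (E i)) z t \<longleftrightarrow> kills S fs (E (Suc i)) (?Z (Suc i)) z t"
    if "1 \<le> t" for i t
  proof -
    interpret m: module_map S "E i" "E (Suc i)" "\<delta> i" by (rule C.map_K)
    show ?thesis
      using m.lifts_imp_kills_image[OF fs m.M.carrier_is_submodule z, of t] acyc[of t i] that
        m.kills_image_imp_lifts[OF fs m.M.carrier_is_submodule z, of t] Zim[of i] by auto
  qed
  have chain: "kills S fs (E i) (?Z i) z (int k + 1) \<longleftrightarrow> kills S fs (E (i + k)) (?Z (i + k)) z 1" for i k
  proof (induction k arbitrary: i)
    case (Suc k)
    have "kills S fs (E i) (?Z i) z (int (Suc k) + 1) \<longleftrightarrow> kills S fs (E (Suc i)) (?Z (Suc i)) z (int k + 1)"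
      using shift[of "int k + 1" i] shift2[of "int k + 1" i] by (simp add: add.commute)
    then show ?case using Suc[of "Suc i"] by simp
  qed simp
  show ?thesis
  proof (cases j)
    case 0
    interpret m: module_map S "E 0" "E (Suc 0)" "\<delta> 0" by (rule C.map_K)
    have B: "coboundaries (\<lambda>i. ?T (E i)) \<delta> 0 = {\<zero>\<^bsub>E 0\<^esub>}" by (simp add: coboundaries_def torsion_part_def)
    have Z: "cocycles (\<lambda>i. ?T (E i)) \<delta> 0 = {x \<in> ?Z 0. tors 0 x}"
      unfolding cocycles_def T by (auto simp: torsion_part_def)
    have "submodule {\<zero>\<^bsub>E 0\<^esub>} S (E 0)" by (rule module.submoduleI[OF E0]) auto
    moreover have "submodule {x \<in> ?Z 0. tors 0 x} S (E 0)"
      unfolding tors_def by (rule module.power_torsion_submodule[OF E0 fs C.cocycles_submodule])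
    ultimately have "z \<in> annihilator S (local_cohomology S (Idl\<^bsub>S\<^esub> (set fs)) E \<delta> j) \<longleftrightarrow>
        (\<forall>y\<in>?Z 0. tors 0 y \<longrightarrow> z \<odot>\<^bsub>E 0\<^esub> y = \<zero>\<^bsub>E 0\<^esub>)"
      unfolding local_cohomology_def cohomology_def 0 B Z subquotient_torsion_part
      using subquotient_annihilator[OF E0, of "{\<zero>\<^bsub>E 0\<^esub>}" "{x \<in> ?Z 0. tors 0 x}" z] z by blast
    also have "\<dots> \<longleftrightarrow> kills S fs (E 0) (?Z 0) z 0"
      using module.kills_zero_iff[OF E0 fs C.cocycles_submodule z] by (simp add: tors_def)
    finally show ?thesis using ZS 0 by simp
  next
    case (Suc p)
    interpret m: module_map S "E p" "E (Suc p)" "\<delta> p" by (rule C.map_K)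
    have B: "coboundaries (\<lambda>i. ?T (E i)) \<delta> (Suc p) = \<delta> p ` {x \<in> carrier (E p). tors p x}"
      unfolding coboundaries_def nat.case T ..
    have Z: "cocycles (\<lambda>i. ?T (E i)) \<delta> (Suc p) = {x \<in> ?Z (Suc p). tors (Suc p) x}"
      unfolding cocycles_def T by (auto simp: torsion_part_def)
    have "submodule (\<delta> p ` {x \<in> carrier (E p). tors p x}) S (E (Suc p))"
      unfolding tors_def by (rule m.image_submodule[OF m.M.power_torsion_submodule[OF fs m.M.carrier_is_submodule]])
    moreover have "submodule {x \<in> ?Z (Suc p). tors (Suc p) x} S (E (Suc p))"
      unfolding tors_def by (rule m.N.power_torsion_submodule[OF fs C.cocycles_submodule])
    ultimately have "z \<in> annihilator S (local_cohomology S (Idl\<^bsub>S\<^esub> (set fs)) E \<delta> j) \<longleftrightarrow>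
        (\<forall>y\<in>?Z (Suc p). tors (Suc p) y \<longrightarrow> z \<odot>\<^bsub>E (Suc p)\<^esub> y \<in> \<delta> p ` {x \<in> carrier (E p). tors p x})"
      unfolding local_cohomology_def cohomology_def Suc B Z subquotient_torsion_part
      using subquotient_annihilator[OF C.module_K, of "\<delta> p ` {x \<in> carrier (E p). tors p x}" "Suc p" "{x \<in> ?Z (Suc p). tors (Suc p) x}" z] z by blast
    also have "\<dots> \<longleftrightarrow> m.lifts fs (carrier (E p)) z 0"
      unfolding m.lifts_zero_iff[OF fs m.M.carrier_is_submodule z] Zim tors_def by blast
    also have "\<dots> \<longleftrightarrow> kills S fs (E 0) (?Z 0) z (int j)"
      using shift[of 0 p] chain[of 0 p] Suc by (simp add: add.commute)
    finally show ?thesis using ZS by simp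
  qed
qed

section \<open>Finite length and torsion in graded modules\<close>

context module begin

lemma coset_eq_iff:
  assumes B: "submodule B R M" and z: "z \<in> carrier M" "w \<in> carrier M"
  shows "B +>\<^bsub>M\<^esub> z = B +>\<^bsub>M\<^esub> w \<longleftrightarrow> z \<ominus>\<^bsub>M\<^esub> w \<in> B"
proof -
  have mem: "v \<in> B +>\<^bsub>M\<^esub> u \<longleftrightarrow> v \<in> carrier M \<and> v \<ominus>\<^bsub>M\<^esub> u \<in> B" if u: "u \<in> carrier M" for u v
  proof
    assume "v \<in> B +>\<^bsub>M\<^esub> u"
    then obtain b where b: "b \<in> B" "v = b \<oplus>\<^bsub>M\<^esub> u" by (auto simp: a_r_coset_def r_coset_def)
    then show "v \<in> carrier M \<and> v \<ominus>\<^bsub>M\<^esub> u \<in> B"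
      using u submodule_subset[OF B b(1)] by (simp add: a_minus_def M.a_assoc M.r_neg)
  next
    assume v: "v \<in> carrier M \<and> v \<ominus>\<^bsub>M\<^esub> u \<in> B"
    then have "v = (v \<ominus>\<^bsub>M\<^esub> u) \<oplus>\<^bsub>M\<^esub> u" using u by (simp add: a_minus_def M.a_assoc M.l_neg)
    then show "v \<in> B +>\<^bsub>M\<^esub> u" using v by (auto simp: a_r_coset_def r_coset_def)
  qed
  show ?thesis
  proof
    assume "B +>\<^bsub>M\<^esub> z = B +>\<^bsub>M\<^esub> w"
    moreover have "z \<in> B +>\<^bsub>M\<^esub> z" using z submodule_zero[OF B] by (simp add: mem)
    ultimately show "z \<ominus>\<^bsub>M\<^esub> w \<in> B" using mem[OF z(2)] by blast
  next
    assume d: "z \<ominus>\<^bsub>M\<^esub> w \<in> B"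
    have "v \<ominus>\<^bsub>M\<^esub> z \<in> B \<longleftrightarrow> v \<ominus>\<^bsub>M\<^esub> w \<in> B" if v: "v \<in> carrier M" for v
    proof -
      have 1: "v \<ominus>\<^bsub>M\<^esub> w = (v \<ominus>\<^bsub>M\<^esub> z) \<oplus>\<^bsub>M\<^esub> (z \<ominus>\<^bsub>M\<^esub> w)"
        using v z by (simp add: a_minus_def M.a_assoc) (simp add: M.a_assoc[symmetric] M.l_neg)
      have 2: "v \<ominus>\<^bsub>M\<^esub> z = (v \<ominus>\<^bsub>M\<^esub> w) \<ominus>\<^bsub>M\<^esub> (z \<ominus>\<^bsub>M\<^esub> w)"
        using v z minus_minus4[of v w z w] by simp
      show ?thesis
        using submodule_add[OF B _ d, of "v \<ominus>\<^bsub>M\<^esub> z"] submodule_minus[OF B _ d, of "v \<ominus>\<^bsub>M\<^esub> w"] 1 2 by metis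
    qed
    then show "B +>\<^bsub>M\<^esub> z = B +>\<^bsub>M\<^esub> w" using mem z by blast
  qed
qed

lemma coset_zero: "submodule B R M \<Longrightarrow> B +>\<^bsub>M\<^esub> \<zero>\<^bsub>M\<^esub> = B"
  using submodule_subset[of B] by (force simp: a_r_coset_def r_coset_def)

lemma coset_zero_iff: "submodule B R M \<Longrightarrow> z \<in> carrier M \<Longrightarrow> B +>\<^bsub>M\<^esub> z = B \<longleftrightarrow> z \<in> B"
  using coset_eq_iff[of B z "\<zero>\<^bsub>M\<^esub>"] coset_zero[of B] by simp

lemma coset_add:
  assumes B: "submodule B R M" and z: "z \<in> carrier M" "w \<in> carrier M"
  shows "(B +>\<^bsub>M\<^esub> z) <+>\<^bsub>M\<^esub> (B +>\<^bsub>M\<^esub> w) = B +>\<^bsub>M\<^esub> (z \<oplus>\<^bsub>M\<^esub> w)"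
proof
  show "(B +>\<^bsub>M\<^esub> z) <+>\<^bsub>M\<^esub> (B +>\<^bsub>M\<^esub> w) \<subseteq> B +>\<^bsub>M\<^esub> (z \<oplus>\<^bsub>M\<^esub> w)"
  proof
    fix v assume "v \<in> (B +>\<^bsub>M\<^esub> z) <+>\<^bsub>M\<^esub> (B +>\<^bsub>M\<^esub> w)"
    then obtain b c where b: "b \<in> B" "c \<in> B" "v = (b \<oplus>\<^bsub>M\<^esub> z) \<oplus>\<^bsub>M\<^esub> (c \<oplus>\<^bsub>M\<^esub> w)"
      by (auto simp: a_r_coset_def r_coset_def set_add_def set_mult_def)
    have "v = (b \<oplus>\<^bsub>M\<^esub> c) \<oplus>\<^bsub>M\<^esub> (z \<oplus>\<^bsub>M\<^esub> w)"
      using b z submodule_subset[OF B b(1)] submodule_subset[OF B b(2)] by (simp add: M.a_ac)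
    then show "v \<in> B +>\<^bsub>M\<^esub> (z \<oplus>\<^bsub>M\<^esub> w)"
      using submodule_add[OF B b(1,2)] by (auto simp: a_r_coset_def r_coset_def)
  qed
  show "B +>\<^bsub>M\<^esub> (z \<oplus>\<^bsub>M\<^esub> w) \<subseteq> (B +>\<^bsub>M\<^esub> z) <+>\<^bsub>M\<^esub> (B +>\<^bsub>M\<^esub> w)"
  proof
    fix v assume "v \<in> B +>\<^bsub>M\<^esub> (z \<oplus>\<^bsub>M\<^esub> w)"
    then obtain b where b: "b \<in> B" "v = b \<oplus>\<^bsub>M\<^esub> (z \<oplus>\<^bsub>M\<^esub> w)" by (auto simp: a_r_coset_def r_coset_def)
    then have "v = (b \<oplus>\<^bsub>M\<^esub> z) \<oplus>\<^bsub>M\<^esub> (\<zero>\<^bsub>M\<^esub> \<oplus>\<^bsub>M\<^esub> w)"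
      using z submodule_subset[OF B b(1)] by (simp add: M.a_ac)
    then show "v \<in> (B +>\<^bsub>M\<^esub> z) <+>\<^bsub>M\<^esub> (B +>\<^bsub>M\<^esub> w)"
      using b(1) submodule_zero[OF B] unfolding a_r_coset_def r_coset_def set_add_def set_mult_def by fastforce
  qed
qed

lemma coset_smult:
  assumes B: "submodule B R M" and z: "z \<in> carrier M" and s: "s \<in> carrier R"
  shows "B <+>\<^bsub>M\<^esub> ((\<lambda>x. s \<odot>\<^bsub>M\<^esub> x) ` (B +>\<^bsub>M\<^esub> z)) = B +>\<^bsub>M\<^esub> (s \<odot>\<^bsub>M\<^esub> z)"
proof
  show "B <+>\<^bsub>M\<^esub> ((\<lambda>x. s \<odot>\<^bsub>M\<^esub> x) ` (B +>\<^bsub>M\<^esub> z)) \<subseteq> B +>\<^bsub>M\<^esub> (s \<odot>\<^bsub>M\<^esub> z)"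
  proof
    fix v assume "v \<in> B <+>\<^bsub>M\<^esub> ((\<lambda>x. s \<odot>\<^bsub>M\<^esub> x) ` (B +>\<^bsub>M\<^esub> z))"
    then obtain b c where b: "b \<in> B" "c \<in> B" "v = b \<oplus>\<^bsub>M\<^esub> s \<odot>\<^bsub>M\<^esub> (c \<oplus>\<^bsub>M\<^esub> z)"
      by (auto simp: a_r_coset_def r_coset_def set_add_def set_mult_def)
    have "v = (b \<oplus>\<^bsub>M\<^esub> s \<odot>\<^bsub>M\<^esub> c) \<oplus>\<^bsub>M\<^esub> s \<odot>\<^bsub>M\<^esub> z"
      using b z s submodule_subset[OF B b(1)] submodule_subset[OF B b(2)] by (simp add: smult_r_distr M.a_ac)
    then show "v \<in> B +>\<^bsub>M\<^esub> (s \<odot>\<^bsub>M\<^esub> z)"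
      using submodule_add[OF B b(1) submodule_smult[OF B s b(2)]] by (auto simp: a_r_coset_def r_coset_def)
  qed
  show "B +>\<^bsub>M\<^esub> (s \<odot>\<^bsub>M\<^esub> z) \<subseteq> B <+>\<^bsub>M\<^esub> ((\<lambda>x. s \<odot>\<^bsub>M\<^esub> x) ` (B +>\<^bsub>M\<^esub> z))"
  proof
    fix v assume "v \<in> B +>\<^bsub>M\<^esub> (s \<odot>\<^bsub>M\<^esub> z)"
    then obtain b where b: "b \<in> B" "v = b \<oplus>\<^bsub>M\<^esub> s \<odot>\<^bsub>M\<^esub> z" by (auto simp: a_r_coset_def r_coset_def)
    then have "v = b \<oplus>\<^bsub>M\<^esub> s \<odot>\<^bsub>M\<^esub> (\<zero>\<^bsub>M\<^esub> \<oplus>\<^bsub>M\<^esub> z)" using z by simp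
    then show "v \<in> B <+>\<^bsub>M\<^esub> ((\<lambda>x. s \<odot>\<^bsub>M\<^esub> x) ` (B +>\<^bsub>M\<^esub> z))"
      using b(1) submodule_zero[OF B] unfolding a_r_coset_def r_coset_def set_add_def set_mult_def by fastforce
  qed
qed

end

lemma image_submodule_subquotient:
  fixes M :: "('s, 'm) module"
  assumes "module S M" and B: "submodule B S M" and Z: "submodule Z S M" and L: "submodule L S M" and LZ: "L \<subseteq> Z"
  shows "submodule ((\<lambda>z. B +>\<^bsub>M\<^esub> z) ` L) S (subquotient M Z B)"
proof -
  interpret module S M by fact
  let ?H = "subquotient M Z B" and ?c = "\<lambda>z. B +>\<^bsub>M\<^esub> z"
  note LM = submodule_subset[OF L] and ZM = submodule_subset[OF Z]
  have H: "carrier ?H = ?c ` Z" "zero ?H = B" "add ?H = set_add M"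
    "smult ?H = (\<lambda>s C. B <+>\<^bsub>M\<^esub> ((\<lambda>x. s \<odot>\<^bsub>M\<^esub> x) ` C))" by (simp_all add: subquotient_def)
  have grp: "group (add_monoid ?H)"
  proof (rule groupI)
    fix x y assume "x \<in> carrier (add_monoid ?H)" "y \<in> carrier (add_monoid ?H)"
    then obtain a b where ab: "a \<in> Z" "x = ?c a" "b \<in> Z" "y = ?c b" by (auto simp: H)
    show "x \<otimes>\<^bsub>add_monoid ?H\<^esub> y \<in> carrier (add_monoid ?H)"
      using ab submodule_add[OF Z ab(1,3)] coset_add[OF B ZM[OF ab(1)] ZM[OF ab(3)]] by (auto simp: H)
    fix z assume "z \<in> carrier (add_monoid ?H)"
    then obtain c where c: "c \<in> Z" "z = ?c c" by (auto simp: H)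
    show "x \<otimes>\<^bsub>add_monoid ?H\<^esub> y \<otimes>\<^bsub>add_monoid ?H\<^esub> z = x \<otimes>\<^bsub>add_monoid ?H\<^esub> (y \<otimes>\<^bsub>add_monoid ?H\<^esub> z)"
      using ZM[OF ab(1)] ZM[OF ab(3)] ZM[OF c(1)] by (simp add: H ab c coset_add[OF B] M.a_assoc)
  next
    show "\<one>\<^bsub>add_monoid ?H\<^esub> \<in> carrier (add_monoid ?H)"
      using coset_zero[OF B] submodule_zero[OF Z] by (auto simp: H)
  next
    fix x assume "x \<in> carrier (add_monoid ?H)"
    then obtain a where a: "a \<in> Z" "x = ?c a" by (auto simp: H)
    have "B <+>\<^bsub>M\<^esub> ?c a = ?c a" using coset_add[OF B M.zero_closed ZM[OF a(1)]] coset_zero[OF B] ZM[OF a(1)] by simp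
    then show "\<one>\<^bsub>add_monoid ?H\<^esub> \<otimes>\<^bsub>add_monoid ?H\<^esub> x = x" by (simp add: H a)
    have "?c (\<ominus>\<^bsub>M\<^esub> a) <+>\<^bsub>M\<^esub> ?c a = B"
      using coset_add[OF B M.a_inv_closed[OF ZM[OF a(1)]] ZM[OF a(1)]] coset_zero[OF B] ZM[OF a(1)] by (simp add: M.l_neg)
    then show "\<exists>y\<in>carrier (add_monoid ?H). y \<otimes>\<^bsub>add_monoid ?H\<^esub> x = \<one>\<^bsub>add_monoid ?H\<^esub>"
      using submodule_neg[OF Z a(1)] by (auto simp: H a)
  qed
  show ?thesis
  proof (intro submodule.intro submodule_axioms.intro)
    show "subgroup (?c ` L) (add_monoid ?H)"
    proof (rule group.subgroupI[OF grp])
      show "?c ` L \<subseteq> carrier (add_monoid ?H)" using LZ by (auto simp: H)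
      show "?c ` L \<noteq> {}" using submodule_zero[OF L] by blast
      fix x assume "x \<in> ?c ` L"
      then obtain a where a: "a \<in> L" "x = ?c a" by auto
      have "?c (\<ominus>\<^bsub>M\<^esub> a) <+>\<^bsub>M\<^esub> ?c a = B"
        using coset_add[OF B M.a_inv_closed[OF LM[OF a(1)]] LM[OF a(1)]] coset_zero[OF B] LM[OF a(1)] by (simp add: M.l_neg)
      then have "inv\<^bsub>add_monoid ?H\<^esub> x = ?c (\<ominus>\<^bsub>M\<^esub> a)"
        using a LZ submodule_neg[OF L a(1)] by (intro group.inv_equality[OF grp]) (auto simp: H)
      then show "inv\<^bsub>add_monoid ?H\<^esub> x \<in> ?c ` L" using submodule_neg[OF L a(1)] by simp
      fix y assume "y \<in> ?c ` L"
      then obtain b where b: "b \<in> L" "y = ?c b" by auto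
      show "x \<otimes>\<^bsub>add_monoid ?H\<^esub> y \<in> ?c ` L"
        using submodule_add[OF L a(1) b(1)] coset_add[OF B LM[OF a(1)] LM[OF b(1)]] by (simp add: H a b)
    qed
    fix s x assume s: "s \<in> carrier S" and "x \<in> ?c ` L"
    then obtain a where a: "a \<in> L" "x = ?c a" by auto
    show "s \<odot>\<^bsub>?H\<^esub> x \<in> ?c ` L"
      using submodule_smult[OF L s a(1)] coset_smult[OF B LM[OF a(1)] s] by (simp add: H a)
  qed
qed

text \<open>Pull the composition series back to submodules \<open>B = P\<^sub>0 \<subset> \<dots> \<subset> P\<^sub>l = Z\<close>. For a submodule \<open>V\<close>
  let \<open>\<sigma> V\<close> be the set of those \<open>k\<close> for which \<open>V \<inter> P\<^bsub>k+1\<^esub>\<close> is not contained in \<open>P\<^sub>k\<close>. Since the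
  factors are simple, two submodules between
  \<open>B\<close> and \<open>Z\<close> with \<open>V' \<subseteq> V\<close> and \<open>\<sigma> V' = \<sigma> V\<close> coincide, and a descending
  chain of finite sets \<open>\<sigma> (U n)\<close> is eventually constant.\<close>

lemma finite_length_descending_chain:
  fixes M :: "('s, 'm) module"
  assumes "module S M" and B: "submodule B S M" and Z: "submodule Z S M" and BZ: "B \<subseteq> Z"
    and fl: "finite_length S (subquotient M Z B)"
    and U: "\<And>n. submodule (U n) S M" "\<And>n. B \<subseteq> U n" "\<And>n. U n \<subseteq> Z" "\<And>n. U (Suc n) \<subseteq> U n"
  shows "\<exists>m. \<forall>n\<ge>m. U n = U m"
proof -
  interpret module S M by fact
  let ?H = "subquotient M Z B" and ?c = "\<lambda>z. B +>\<^bsub>M\<^esub> z"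
  have H: "carrier ?H = ?c ` Z" "zero ?H = B" "add ?H = set_add M"
    "smult ?H = (\<lambda>s C. B <+>\<^bsub>M\<^esub> ((\<lambda>x. s \<odot>\<^bsub>M\<^esub> x) ` C))" by (simp_all add: subquotient_def)
  note ZM = submodule_subset[OF Z]
  obtain l N where NN: "N 0 = {B} \<and> N l = ?c ` Z \<and> (\<forall>k\<le>l. submodule (N k) S ?H) \<and>
      (\<forall>k<l. N k \<subset> N (Suc k) \<and>
        (\<forall>L. submodule L S ?H \<longrightarrow> N k \<subseteq> L \<longrightarrow> L \<subseteq> N (Suc k) \<longrightarrow> L = N k \<or> L = N (Suc k)))"
    using fl unfolding finite_length_def H by (elim exE) (rule that)
  have N0: "N 0 = {B}" and Nl: "N l = ?c ` Z" using NN by (simp_all only:)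
  have Nsub: "submodule (N k) S ?H" if "k \<le> l" for k using NN that by (simp only:)
  have Nmono: "N k \<subset> N (Suc k)" if "k < l" for k using NN that by (simp only:)
  have simple: "L = N k \<or> L = N (Suc k)"
    if "k < l" "submodule L S ?H" "N k \<subseteq> L" "L \<subseteq> N (Suc k)" for k L
    using NN that by meson
  define P where "P = (\<lambda>k. {z \<in> Z. ?c z \<in> N k})"
  have P0: "P 0 = B"
  proof
    show "P 0 \<subseteq> B" using coset_zero_iff[OF B ZM] unfolding P_def N0 by fast
    show "B \<subseteq> P 0" using coset_zero_iff[OF B ZM] BZ unfolding P_def N0 by fast
  qed
  have Pl: "P l = Z" unfolding P_def Nl by blast
  have PZ: "P k \<subseteq> Z" for k unfolding P_def by blast
  have Psub: "submodule (P k) S M" if k: "k \<le> l" for k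
  proof -
    note sk = Nsub[OF k]
    have add: "x <+>\<^bsub>M\<^esub> y \<in> N k" if "x \<in> N k" "y \<in> N k" for x y
      using subgroup.m_closed[OF submodule.axioms(1)[OF sk]] that by (simp add: H)
    have smult: "B <+>\<^bsub>M\<^esub> ((\<lambda>x. s \<odot>\<^bsub>M\<^esub> x) ` x) \<in> N k" if "s \<in> carrier S" "x \<in> N k" for s x
      using submodule.smult_closed[OF sk] that by (simp add: H)
    have zero: "B \<in> N k" using subgroup.one_closed[OF submodule.axioms(1)[OF sk]] by (simp add: H)
    have smultP: "s \<odot>\<^bsub>M\<^esub> z \<in> P k" if "s \<in> carrier S" "z \<in> P k" for s z
      using that smult[OF that(1), of "?c z"] coset_smult[OF B ZM that(1), of z] submodule_smult[OF Z]
      unfolding P_def by auto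
    show ?thesis
    proof (rule submodule_criterion)
      show "P k \<subseteq> carrier M" using ZM unfolding P_def by blast
      show "\<zero>\<^bsub>M\<^esub> \<in> P k" using zero coset_zero[OF B] submodule_zero[OF Z] unfolding P_def by simp
      show "s \<odot>\<^bsub>M\<^esub> z \<in> P k" if "s \<in> carrier S" "z \<in> P k" for s z by (rule smultP[OF that])
      show "z \<oplus>\<^bsub>M\<^esub> w \<in> P k" if z: "z \<in> P k" "w \<in> P k" for z w
      proof -
        have "?c z <+>\<^bsub>M\<^esub> ?c w \<in> N k" using add z unfolding P_def by blast
        then show ?thesis using z ZM coset_add[OF B, of z w] submodule_add[OF Z, of z w] unfolding P_def by auto
      qed
    qed
  qed
  have Psimple: "L = P k \<or> L = P (Suc k)"
    if k: "k < l" and L: "submodule L S M" "P k \<subseteq> L" "L \<subseteq> P (Suc k)" for k L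
  proof -
    have LZ: "L \<subseteq> Z" using L(3) PZ by blast
    have NP: "N j = ?c ` P j" if "j \<le> l" for j
    proof -
      have "N j \<subseteq> ?c ` Z" using subgroup.subset[OF submodule.axioms(1)[OF Nsub[OF that]]] by (simp add: H)
      then show ?thesis unfolding P_def by blast
    qed
    have BL: "B \<subseteq> L"
    proof -
      have "B \<in> N k" using subgroup.one_closed[OF submodule.axioms(1)[OF Nsub[of k]]] k by (simp add: H)
      moreover have "?c b = B" if "b \<in> B" for b using coset_zero_iff[OF B, of b] submodule_subset[OF B that] that by blast
      ultimately have "B \<subseteq> P k" using BZ unfolding P_def by auto
      then show ?thesis using L(2) by blast
    qed
    have pullback: "L = P j" if j: "j \<le> l" and eq: "?c ` L = N j" for j
    proof -
      have "z \<in> L \<longleftrightarrow> z \<in> P j" if z: "z \<in> Z" for z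
      proof
        show "z \<in> L \<Longrightarrow> z \<in> P j" using eq z unfolding P_def by blast
        assume "z \<in> P j"
        then obtain w where w: "w \<in> L" "?c z = ?c w" using eq unfolding P_def by blast
        have zw: "z \<in> carrier M" "w \<in> carrier M" using z w LZ ZM by auto
        have "z \<ominus>\<^bsub>M\<^esub> w \<in> L" using w(2) coset_eq_iff[OF B zw] BL by blast
        then have "(z \<ominus>\<^bsub>M\<^esub> w) \<oplus>\<^bsub>M\<^esub> w \<in> L" by (rule submodule_add[OF L(1) _ w(1)])
        then show "z \<in> L" using zw by (simp add: a_minus_def M.a_assoc M.l_neg)
      qed
      then show ?thesis using LZ PZ by blast
    qed
    have "?c ` L = N k \<or> ?c ` L = N (Suc k)"
    proof (rule simple[OF k image_submodule_subquotient[OF \<open>module S M\<close> B Z L(1) LZ]])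
      show "N k \<subseteq> ?c ` L" using NP[of k] k L(2) by auto
      show "?c ` L \<subseteq> N (Suc k)" using L(3) unfolding P_def by blast
    qed
    then show ?thesis using pullback[of k] pullback[of "Suc k"] k by auto
  qed
  have UP: "submodule {p \<oplus>\<^bsub>M\<^esub> u | p u. p \<in> P k \<and> u \<in> V \<inter> P (Suc k)} S M" if k: "k < l" and V: "submodule V S M" for k V
    using submodule_sum[OF Psub submodule_Int[OF V Psub], of k "Suc k"] k by simp
  \<comment> \<open>The steps of the composition series at which \<open>V\<close> grows.\<close>
  define \<sigma> where "\<sigma> = (\<lambda>V. {k. k < l \<and> \<not> V \<inter> P (Suc k) \<subseteq> P k})"
  have \<sigma>mono: "\<sigma> V \<subseteq> \<sigma> V'" if "V \<subseteq> V'" for V V' using that unfolding \<sigma>_def by blast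
  have Pmono: "P k \<subseteq> P (Suc k)" if "k < l" for k using Nmono[OF that] unfolding P_def by blast
  have \<sigma>eq: "V = V'" if V: "submodule V S M" "submodule V' S M" "B \<subseteq> V'" "V' \<subseteq> V" "V \<subseteq> Z" and eq: "\<sigma> V = \<sigma> V'" for V V'
  proof -
    have "k \<le> l \<Longrightarrow> V \<inter> P k \<subseteq> V'" for k
    proof (induction k)
      case 0 then show ?case using P0 V(3) by blast
    next
      case (Suc k)
      show ?case
      proof
        fix x assume x: "x \<in> V \<inter> P (Suc k)"
        show "x \<in> V'"
        proof (cases "x \<in> P k")
          case True then show ?thesis using Suc x by auto
        next
          case False
          then have "k \<in> \<sigma> V'" using x Suc.prems eq unfolding \<sigma>_def by auto
          then obtain y where y: "y \<in> V'" "y \<in> P (Suc k)" "y \<notin> P k" unfolding \<sigma>_def by blast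
          have k: "k < l" using Suc.prems by simp
          let ?L = "{p \<oplus>\<^bsub>M\<^esub> u | p u. p \<in> P k \<and> u \<in> V' \<inter> P (Suc k)}"
          have s: "submodule (P k) S M" "submodule (P (Suc k)) S M" using Psub k by auto
          have "y = \<zero>\<^bsub>M\<^esub> \<oplus>\<^bsub>M\<^esub> y" using submodule_subset[OF V(2) y(1)] by simp
          then have yL: "y \<in> ?L" using y submodule_zero[OF s(1)] by blast
          have "P k \<subseteq> ?L"
          proof
            fix p assume p: "p \<in> P k"
            have "p = p \<oplus>\<^bsub>M\<^esub> \<zero>\<^bsub>M\<^esub>" using submodule_subset[OF s(1) p] by simp
            then show "p \<in> ?L" using p submodule_zero[OF V(2)] submodule_zero[OF s(2)] by blast
          qed
          moreover have "?L \<subseteq> P (Suc k)" using Pmono[OF k] submodule_add[OF s(2)] by blast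
          ultimately have "?L = P (Suc k)" using Psimple[OF k UP[OF k V(2)]] yL y(3) by blast
          then obtain p u where pu: "p \<in> P k" "u \<in> V'" "x = p \<oplus>\<^bsub>M\<^esub> u" using x by blast
          have pM: "p \<in> carrier M" "u \<in> carrier M" using submodule_subset[OF s(1) pu(1)] submodule_subset[OF V(2) pu(2)] by auto
          have "p = x \<ominus>\<^bsub>M\<^esub> u" using pM pu(3) by (simp add: a_minus_def M.a_assoc M.r_neg)
          moreover have "x \<ominus>\<^bsub>M\<^esub> u \<in> V" using x pu(2) V(4) by (intro submodule_minus[OF V(1)]) auto
          ultimately have "p \<in> V'" using Suc pu(1) by auto
          then show ?thesis unfolding pu(3) using pu(2) by (rule submodule_add[OF V(2)])
        qed
      qed
    qed
    from this[of l] show ?thesis using Pl V(4,5) by auto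
  qed
  have Umono: "U j \<subseteq> U i" if "i \<le> j" for i j using lift_Suc_antimono_le[of U, OF U(4) that] .
  obtain m where m: "\<And>n. card (\<sigma> (U m)) \<le> card (\<sigma> (U n))"
    using ex_has_least_nat[of "\<lambda>n. True" 0 "\<lambda>n. card (\<sigma> (U n))"] by blast
  have "U n = U m" if n: "m \<le> n" for n
  proof -
    have fin: "finite (\<sigma> (U m))" unfolding \<sigma>_def by simp
    have sub: "\<sigma> (U n) \<subseteq> \<sigma> (U m)" by (rule \<sigma>mono[OF Umono[OF n]])
    have "\<sigma> (U n) = \<sigma> (U m)" using card_subset_eq[OF fin sub] m[of n] card_mono[OF fin sub] by linarith
    then show ?thesis using \<sigma>eq[OF U(1,1,2) Umono[OF n] U(3)] by metis
  qed
  then show ?thesis by blast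
qed

text \<open>The sum of the homogeneous components with degree in \<open>P\<close>. The inductive form avoids
  projections to components.\<close>

inductive_set graded_span :: "('s, 'm) module \<Rightarrow> (int \<Rightarrow> 'm set) \<Rightarrow> int set \<Rightarrow> 'm set"
  for M :: "('s, 'm) module" and Mg :: "int \<Rightarrow> 'm set" and P :: "int set" where
  zero: "\<zero>\<^bsub>M\<^esub> \<in> graded_span M Mg P"
| add: "a \<in> P \<Longrightarrow> x \<in> Mg a \<Longrightarrow> y \<in> graded_span M Mg P \<Longrightarrow> x \<oplus>\<^bsub>M\<^esub> y \<in> graded_span M Mg P"

lemma graded_span_mono: "x \<in> graded_span M Mg P \<Longrightarrow> P \<subseteq> Q \<Longrightarrow> x \<in> graded_span M Mg Q"
  by (induction rule: graded_span.induct) (auto intro: graded_span.intros)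

locale graded = module S M for S :: "('s, 'b) ring_scheme" and M :: "('s, 'm) module" +
  fixes Sg :: "nat \<Rightarrow> 's set" and Mg :: "int \<Rightarrow> 'm set"
  assumes graded: "graded_module S Sg M Mg"
begin

lemmas span_step = graded_span.add[where M = M and Mg = Mg]

lemma component_subgroup: "additive_subgroup (Mg a) M"
  using graded by (simp add: graded_module_def internal_direct_sum_def)

lemma component_carrier: "x \<in> Mg a \<Longrightarrow> x \<in> carrier M"
  using additive_subgroup.a_subset[OF component_subgroup] by blast

lemma component_smult: "s \<in> Sg i \<Longrightarrow> x \<in> Mg a \<Longrightarrow> s \<odot>\<^bsub>M\<^esub> x \<in> Mg (int i + a)"
  using graded by (simp add: graded_module_def)

lemma span_carrier: "x \<in> graded_span M Mg P \<Longrightarrow> x \<in> carrier M"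
  by (induction rule: graded_span.induct) (auto dest: component_carrier)

lemma span_add: "x \<in> graded_span M Mg P \<Longrightarrow> y \<in> graded_span M Mg P \<Longrightarrow> x \<oplus>\<^bsub>M\<^esub> y \<in> graded_span M Mg P"
proof (induction rule: graded_span.induct)
  case zero then show ?case using span_carrier by simp
next
  case (add a x z)
  then have "x \<oplus>\<^bsub>M\<^esub> z \<oplus>\<^bsub>M\<^esub> y = x \<oplus>\<^bsub>M\<^esub> (z \<oplus>\<^bsub>M\<^esub> y)"
    using span_carrier component_carrier by (intro M.a_assoc) auto
  then show ?case using span_step[OF add(1,2)] add by simp
qed

lemma span_component: "x \<in> Mg a \<Longrightarrow> a \<in> P \<Longrightarrow> x \<in> graded_span M Mg P"
  using span_step[OF _ _ graded_span.zero, of a P x] component_carrier by simp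

lemma span_neg: "x \<in> graded_span M Mg P \<Longrightarrow> \<ominus>\<^bsub>M\<^esub> x \<in> graded_span M Mg P"
proof (induction rule: graded_span.induct)
  case zero
  have "\<ominus>\<^bsub>M\<^esub> \<zero>\<^bsub>M\<^esub> = \<zero>\<^bsub>M\<^esub>" by simp
  then show ?case using graded_span.zero by metis
next
  case (add a x z)
  have "\<ominus>\<^bsub>M\<^esub> (x \<oplus>\<^bsub>M\<^esub> z) = \<ominus>\<^bsub>M\<^esub> x \<oplus>\<^bsub>M\<^esub> \<ominus>\<^bsub>M\<^esub> z"
    using add span_carrier component_carrier by (intro M.minus_add) auto
  moreover have "\<ominus>\<^bsub>M\<^esub> x \<in> Mg a" using add(2)
    by (rule additive_subgroup.a_inv_closed[OF component_subgroup])
  ultimately show ?case using span_step[OF add(1) _ add(4)] by simp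
qed

lemma span_finsum:
  "finite A \<Longrightarrow> (\<And>i. i \<in> A \<Longrightarrow> c i \<in> graded_span M Mg P) \<Longrightarrow> (\<Oplus>\<^bsub>M\<^esub> i\<in>A. c i) \<in> graded_span M Mg P"
proof (induction A rule: finite_induct)
  case empty then show ?case by (simp add: graded_span.zero)
next
  case (insert i A)
  then have "(\<Oplus>\<^bsub>M\<^esub> i\<in>insert i A. c i) = c i \<oplus>\<^bsub>M\<^esub> (\<Oplus>\<^bsub>M\<^esub> i\<in>A. c i)"
    using span_carrier by (intro M.finsum_insert) auto
  then show ?case using insert by (simp add: span_add)
qed

lemma span_UNIV: "x \<in> carrier M \<Longrightarrow> x \<in> graded_span M Mg UNIV"
proof -
  assume "x \<in> carrier M"
  then obtain c where c: "\<And>n. c n \<in> Mg n" "finite {n. c n \<noteq> \<zero>\<^bsub>M\<^esub>}" "x = (\<Oplus>\<^bsub>M\<^esub> n \<in> {n. c n \<noteq> \<zero>\<^bsub>M\<^esub>}. c n)"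
    using graded unfolding graded_module_def internal_direct_sum_def by blast
  show ?thesis unfolding c(3) by (rule span_finsum[OF c(2)]) (use c(1) span_component in blast)
qed

lemma span_smult_component:
  "x \<in> graded_span M Mg P \<Longrightarrow> s \<in> Sg i \<Longrightarrow> s \<in> carrier S \<Longrightarrow> (\<And>a. a \<in> P \<Longrightarrow> int i + a \<in> Q) \<Longrightarrow> s \<odot>\<^bsub>M\<^esub> x \<in> graded_span M Mg Q"
proof (induction rule: graded_span.induct)
  case zero then show ?case by (simp add: graded_span.zero)
next
  case (add a x z)
  have "s \<odot>\<^bsub>M\<^esub> (x \<oplus>\<^bsub>M\<^esub> z) = s \<odot>\<^bsub>M\<^esub> x \<oplus>\<^bsub>M\<^esub> s \<odot>\<^bsub>M\<^esub> z"
    using add span_carrier component_carrier by (intro smult_r_distr) auto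
  then show ?case using span_step[of "int i + a" Q] component_smult[OF add(5,2)] add by simp
qed

lemma span_smult_sum:
  assumes "finite A" "\<And>i. i \<in> A \<Longrightarrow> c i \<in> Sg i" "\<And>i. i \<in> A \<Longrightarrow> c i \<in> carrier S" "x \<in> graded_span M Mg P"
    "\<And>i a. i \<in> A \<Longrightarrow> a \<in> P \<Longrightarrow> int i + a \<in> Q"
  shows "(\<Oplus>\<^bsub>S\<^esub> i\<in>A. c i) \<odot>\<^bsub>M\<^esub> x \<in> graded_span M Mg Q"
  using assms
proof (induction A rule: finite_induct)
  case empty then show ?case using span_carrier by (simp add: graded_span.zero)
next
  case (insert i A)
  have "(\<Oplus>\<^bsub>S\<^esub> i\<in>insert i A. c i) \<odot>\<^bsub>M\<^esub> x = c i \<odot>\<^bsub>M\<^esub> x \<oplus>\<^bsub>M\<^esub> (\<Oplus>\<^bsub>S\<^esub> i\<in>A. c i) \<odot>\<^bsub>M\<^esub> x"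
    using insert span_carrier by (simp add: smult_l_distr Pi_def)
  moreover have "c i \<odot>\<^bsub>M\<^esub> x \<in> graded_span M Mg Q"
    using insert by (intro span_smult_component[of x P "c i" i]) auto
  ultimately show ?case using insert by (simp add: span_add)
qed

lemma span_bounded: "x \<in> graded_span M Mg UNIV \<Longrightarrow> \<exists>l u. x \<in> graded_span M Mg {l..<u}"
proof (induction rule: graded_span.induct)
  case zero then show ?case using graded_span.zero by blast
next
  case (add a x z)
  then obtain l u where z: "z \<in> graded_span M Mg {l..<u}" by blast
  have "z \<in> graded_span M Mg {min l a..<max u (a + 1)}" by (rule graded_span_mono[OF z]) auto
  moreover have "a \<in> {min l a..<max u (a + 1)}" by auto
  ultimately have "x \<oplus>\<^bsub>M\<^esub> z \<in> graded_span M Mg {min l a..<max u (a + 1)}" by (intro span_step[OF _ add(2)])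
  then show ?case by blast
qed

lemma span_split:
  "x \<in> graded_span M Mg UNIV \<Longrightarrow> \<exists>y\<in>graded_span M Mg {..<n}. \<exists>z\<in>graded_span M Mg {n..}. x = y \<oplus>\<^bsub>M\<^esub> z"
proof (induction rule: graded_span.induct)
  case zero
  show ?case by (intro bexI[of _ "\<zero>\<^bsub>M\<^esub>"] graded_span.zero) simp
next
  case (add a x w)
  then obtain y z where yz: "y \<in> graded_span M Mg {..<n}" "z \<in> graded_span M Mg {n..}" "w = y \<oplus>\<^bsub>M\<^esub> z" by blast
  have cl: "x \<in> carrier M" "y \<in> carrier M" "z \<in> carrier M" using add(2) yz span_carrier component_carrier by blast+
  show ?case
  proof (cases "a < n")
    case True
    have "x \<oplus>\<^bsub>M\<^esub> w = (x \<oplus>\<^bsub>M\<^esub> y) \<oplus>\<^bsub>M\<^esub> z" using yz(3) cl by (simp add: M.a_assoc)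
    moreover have "x \<oplus>\<^bsub>M\<^esub> y \<in> graded_span M Mg {..<n}" using True add(2) yz(1) by (intro span_step) auto
    ultimately show ?thesis using yz(2) by blast
  next
    case False
    have "x \<oplus>\<^bsub>M\<^esub> w = y \<oplus>\<^bsub>M\<^esub> (x \<oplus>\<^bsub>M\<^esub> z)" using yz(3) cl by (simp add: M.a_lcomm)
    moreover have "x \<oplus>\<^bsub>M\<^esub> z \<in> graded_span M Mg {n..}" using False add(2) yz(2) by (intro span_step) auto
    ultimately show ?thesis using yz(1) by blast
  qed
qed

lemma span_family:
  "x \<in> graded_span M Mg P \<Longrightarrow> \<exists>c A. finite A \<and> A \<subseteq> P \<and> (\<forall>n. c n \<in> Mg n) \<and> (\<forall>n. n \<notin> A \<longrightarrow> c n = \<zero>\<^bsub>M\<^esub>) \<and> x = (\<Oplus>\<^bsub>M\<^esub> n\<in>A. c n)"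
proof (induction rule: graded_span.induct)
  case zero
  show ?case
    by (rule exI[of _ "\<lambda>n. \<zero>\<^bsub>M\<^esub>"], rule exI[of _ "{}"]) (simp add: additive_subgroup.zero_closed[OF component_subgroup])
next
  case (add a x z)
  then obtain c A where c: "finite A" "A \<subseteq> P" "\<And>n. c n \<in> Mg n" "\<And>n. n \<notin> A \<Longrightarrow> c n = \<zero>\<^bsub>M\<^esub>" "z = (\<Oplus>\<^bsub>M\<^esub> n\<in>A. c n)" by blast
  let ?c = "c(a := x \<oplus>\<^bsub>M\<^esub> c a)"
  have cM: "c n \<in> carrier M" "x \<in> carrier M" for n using component_carrier c(3) add(2) by blast+
  have z: "z = (\<Oplus>\<^bsub>M\<^esub> n\<in>insert a A. c n)"
    unfolding c(5) using c(1,4) cM by (intro M.add.finprod_mono_neutral_cong_left) auto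
  also have "\<dots> = c a \<oplus>\<^bsub>M\<^esub> (\<Oplus>\<^bsub>M\<^esub> n\<in>A - {a}. c n)"
    using M.finsum_insert[of "A - {a}" a c] c(1) cM by (simp add: Pi_def)
  finally have "x \<oplus>\<^bsub>M\<^esub> z = (x \<oplus>\<^bsub>M\<^esub> c a) \<oplus>\<^bsub>M\<^esub> (\<Oplus>\<^bsub>M\<^esub> n\<in>A - {a}. c n)"
    using cM by (simp add: M.a_assoc M.finsum_closed Pi_def)
  also have "(\<Oplus>\<^bsub>M\<^esub> n\<in>A - {a}. c n) = (\<Oplus>\<^bsub>M\<^esub> n\<in>A - {a}. ?c n)"
    using cM by (intro M.finsum_cong') auto
  also have "(x \<oplus>\<^bsub>M\<^esub> c a) \<oplus>\<^bsub>M\<^esub> \<dots> = (\<Oplus>\<^bsub>M\<^esub> n\<in>insert a A. ?c n)"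
  proof -
    have "?c \<in> A - {a} \<rightarrow> carrier M" "?c a \<in> carrier M" using cM by auto
    from M.finsum_insert[OF _ _ this] show ?thesis using c(1) by (simp only: insert_Diff_single fun_upd_same) simp
  qed
  finally have "x \<oplus>\<^bsub>M\<^esub> z = (\<Oplus>\<^bsub>M\<^esub> n\<in>insert a A. ?c n)" .
  moreover have "?c n \<in> Mg n" for n
    using c(3) add(2) additive_subgroup.a_closed[OF component_subgroup] by simp
  ultimately show ?case using c(1,2,4) add(1) by (intro exI[of _ ?c] exI[of _ "insert a A"]) auto
qed

lemma span_disjoint:
  assumes x: "x \<in> graded_span M Mg P" "x \<in> graded_span M Mg Q" and PQ: "P \<inter> Q = {}"
  shows "x = \<zero>\<^bsub>M\<^esub>"
proof -
  have *: "\<exists>c A. finite A \<and> A \<subseteq> P \<and> (\<forall>n. c n \<in> Mg n) \<and> finite {n. c n \<noteq> \<zero>\<^bsub>M\<^esub>} \<and> {n. c n \<noteq> \<zero>\<^bsub>M\<^esub>} \<subseteq> P \<and>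
      x = (\<Oplus>\<^bsub>M\<^esub> n\<in>{n. c n \<noteq> \<zero>\<^bsub>M\<^esub>}. c n)" if xP: "x \<in> graded_span M Mg P" for P
  proof -
    obtain c A where c: "finite A" "A \<subseteq> P" "\<And>n. c n \<in> Mg n" "\<And>n. n \<notin> A \<Longrightarrow> c n = \<zero>\<^bsub>M\<^esub>" "x = (\<Oplus>\<^bsub>M\<^esub> n\<in>A. c n)"
      using span_family[OF xP] by blast
    have sub: "{n. c n \<noteq> \<zero>\<^bsub>M\<^esub>} \<subseteq> A" using c(4) by blast
    have "(\<Oplus>\<^bsub>M\<^esub> n\<in>{n. c n \<noteq> \<zero>\<^bsub>M\<^esub>}. c n) = (\<Oplus>\<^bsub>M\<^esub> n\<in>A. c n)"
      using c(1) component_carrier[OF c(3)] sub by (intro M.add.finprod_mono_neutral_cong_left) auto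
    then show ?thesis using c finite_subset[OF sub] sub by (intro exI[of _ c] exI[of _ A]) auto
  qed
  obtain c where c: "\<And>n. c n \<in> Mg n" "finite {n. c n \<noteq> \<zero>\<^bsub>M\<^esub>}" "{n. c n \<noteq> \<zero>\<^bsub>M\<^esub>} \<subseteq> P" "x = (\<Oplus>\<^bsub>M\<^esub> n\<in>{n. c n \<noteq> \<zero>\<^bsub>M\<^esub>}. c n)"
    using *[OF x(1)] by blast
  obtain d where d: "\<And>n. d n \<in> Mg n" "finite {n. d n \<noteq> \<zero>\<^bsub>M\<^esub>}" "{n. d n \<noteq> \<zero>\<^bsub>M\<^esub>} \<subseteq> Q" "x = (\<Oplus>\<^bsub>M\<^esub> n\<in>{n. d n \<noteq> \<zero>\<^bsub>M\<^esub>}. d n)"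
    using *[OF x(2)] by blast
  have ex: "\<exists>!c. (\<forall>n. c n \<in> Mg n) \<and> finite {n. c n \<noteq> \<zero>\<^bsub>M\<^esub>} \<and> x = (\<Oplus>\<^bsub>M\<^esub> n \<in> {n. c n \<noteq> \<zero>\<^bsub>M\<^esub>}. c n)"
    using graded span_carrier[OF x(1)] unfolding graded_module_def internal_direct_sum_def by blast
  have "c = d" using ex c d by blast
  then have "{n. c n \<noteq> \<zero>\<^bsub>M\<^esub>} = {}" using c(3) d(3) PQ by blast
  then show ?thesis using c(4) by simp
qed

end

text \<open>Let \<open>U n\<close> consist of the cocycles that are congruent to an element of degrees \<open>\<ge> n\<close> modulo
  coboundaries. By finite length the chain \<open>U\<close> is constant from some \<open>m\<close> on. As \<open>f\<close> raises
  degrees, \<open>w = f\<^sup>N x\<close> lies in \<open>U m\<close> for large \<open>N\<close>, hence in \<open>U n\<close> for all \<open>n \<ge> m\<close>. Take \<open>n\<close>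
  above all degrees of \<open>w\<close> and write \<open>w = v + \<phi> k\<close> with \<open>v\<close> in degrees \<open>\<ge> n\<close>. Comparing the
  parts of degree \<open>< n\<close> shows that \<open>w\<close> is the image of the part of \<open>k\<close> in the corresponding
  degrees.\<close>

lemma finite_length_power_torsion:
  fixes K :: "nat \<Rightarrow> ('s, 'm) module"
  assumes "cochain_complex S K \<phi>" and gr: "\<And>i. graded_module S Sg (K i) (Kg i)"
    and hom: "\<And>i. homogeneous_map (Kg i) (Kg (Suc i)) (\<phi> i)"
    and SgS: "\<And>n. Sg n \<subseteq> carrier S"
    and gen: "\<And>s. s \<in> carrier S \<Longrightarrow> \<exists>A c. finite A \<and> (\<forall>n\<in>A. c n \<in> Sg n) \<and> s = (\<Oplus>\<^bsub>S\<^esub> n\<in>A. c n)"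
    and fl: "finite_length S (cohomology K \<phi> i)"
    and f: "f \<in> irrelevant_ideal S Sg" and x: "x \<in> cocycles K \<phi> i"
  shows "\<exists>N. f [^]\<^bsub>S\<^esub> (N::nat) \<odot>\<^bsub>K i\<^esub> x \<in> coboundaries K \<phi> i"
proof -
  interpret C: cochain_complex_of_modules S K \<phi> by unfold_locales fact
  interpret M: graded S "K i" Sg "Kg i"
    using C.module_K gr by (intro graded.intro graded_axioms.intro)
  let ?M = "K i" and ?Z = "cocycles K \<phi> i" and ?B = "coboundaries K \<phi> i"
  let ?up = "\<lambda>n. graded_span ?M (Kg i) {n..}"
  note Z = C.cocycles_submodule[of i] and B = C.coboundaries_submodule[of i]
  note ZM = M.submodule_subset[OF Z] and BM = M.submodule_subset[OF B]
  obtain A c where A: "finite A" "\<And>n. n \<in> A \<Longrightarrow> 1 \<le> n" "\<And>n. n \<in> A \<Longrightarrow> c n \<in> Sg n" "f = (\<Oplus>\<^bsub>S\<^esub> n\<in>A. c n)"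
    using f unfolding irrelevant_ideal_def by blast
  have fS: "f \<in> carrier S" unfolding A(4) using A(3) SgS by (intro M.R.finsum_closed) auto
  have f_up: "f \<odot>\<^bsub>?M\<^esub> y \<in> ?up (n + 1)" if "y \<in> ?up n" for y n
    unfolding A(4) by (rule M.span_smult_sum[OF A(1,3) _ that]) (use A(2,3) SgS in force)+
  have S_up: "s \<odot>\<^bsub>?M\<^esub> y \<in> ?up n" if s: "s \<in> carrier S" and y: "y \<in> ?up n" for s y n
  proof -
    obtain A c where A: "finite A" "\<And>n. n \<in> A \<Longrightarrow> c n \<in> Sg n" "s = (\<Oplus>\<^bsub>S\<^esub> n\<in>A. c n)" using gen[OF s] by blast
    show ?thesis unfolding A(3) by (rule M.span_smult_sum[OF A(1,2) _ y]) (use A(2) SgS in force)+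
  qed
  have fpow: "f [^]\<^bsub>S\<^esub> N \<odot>\<^bsub>?M\<^esub> y \<in> ?up (n + int N)" if y: "y \<in> ?up n" for y n and N :: nat
  proof (induction N)
    case 0 then show ?case using y M.span_carrier by simp
  next
    case (Suc N)
    have "f [^]\<^bsub>S\<^esub> Suc N \<odot>\<^bsub>?M\<^esub> y = f \<odot>\<^bsub>?M\<^esub> (f [^]\<^bsub>S\<^esub> N \<odot>\<^bsub>?M\<^esub> y)"
      using fS M.span_carrier[OF y] by (simp add: M.smult_assoc1[symmetric] M.R.m_comm)
    then show ?case using f_up[OF Suc] by (simp add: add_ac)
  qed
  define U where "U = (\<lambda>n::nat. {z \<in> ?Z. \<exists>u\<in>?up (int n). \<exists>b\<in>?B. z = u \<oplus>\<^bsub>?M\<^esub> b})"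
  have Usub: "submodule (U n) S ?M" for n
  proof (rule M.submodule_criterion)
    show "U n \<subseteq> carrier ?M" using ZM unfolding U_def by blast
    have "\<zero>\<^bsub>?M\<^esub> = \<zero>\<^bsub>?M\<^esub> \<oplus>\<^bsub>?M\<^esub> \<zero>\<^bsub>?M\<^esub>" by simp
    then show "\<zero>\<^bsub>?M\<^esub> \<in> U n"
      using M.submodule_zero[OF Z] M.submodule_zero[OF B] graded_span.zero unfolding U_def by blast
  next
    fix z w assume "z \<in> U n" and w: "w \<in> U n"
    then obtain u b where z: "z \<in> ?Z" "u \<in> ?up (int n)" "b \<in> ?B" "z = u \<oplus>\<^bsub>?M\<^esub> b" unfolding U_def by blast
    obtain v b' where w: "w \<in> ?Z" "v \<in> ?up (int n)" "b' \<in> ?B" "w = v \<oplus>\<^bsub>?M\<^esub> b'" using w unfolding U_def by blast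
    have "z \<oplus>\<^bsub>?M\<^esub> w = (u \<oplus>\<^bsub>?M\<^esub> v) \<oplus>\<^bsub>?M\<^esub> (b \<oplus>\<^bsub>?M\<^esub> b')"
      unfolding z(4) w(4) using M.span_carrier[OF z(2)] BM[OF z(3)] M.span_carrier[OF w(2)] BM[OF w(3)] by (simp add: M.M.a_ac)
    then show "z \<oplus>\<^bsub>?M\<^esub> w \<in> U n"
      using M.submodule_add[OF Z z(1) w(1)] M.span_add[OF z(2) w(2)] M.submodule_add[OF B z(3) w(3)] unfolding U_def by blast
  next
    fix s z assume s: "s \<in> carrier S" and "z \<in> U n"
    then obtain u b where z: "z \<in> ?Z" "u \<in> ?up (int n)" "b \<in> ?B" "z = u \<oplus>\<^bsub>?M\<^esub> b" unfolding U_def by blast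
    have "s \<odot>\<^bsub>?M\<^esub> z = s \<odot>\<^bsub>?M\<^esub> u \<oplus>\<^bsub>?M\<^esub> s \<odot>\<^bsub>?M\<^esub> b" unfolding z(4) using s M.span_carrier[OF z(2)] BM[OF z(3)] by (rule M.smult_r_distr)
    then show "s \<odot>\<^bsub>?M\<^esub> z \<in> U n"
      using M.submodule_smult[OF Z s z(1)] S_up[OF s z(2)] M.submodule_smult[OF B s z(3)] unfolding U_def by blast
  qed
  have "\<exists>m. \<forall>n\<ge>m. U n = U m"
  proof (rule finite_length_descending_chain[OF C.module_K B Z C.coboundaries_cocycles])
    show "finite_length S (subquotient ?M ?Z ?B)" using fl by (simp add: cohomology_def)
    show "submodule (U n) S ?M" for n by (rule Usub)
    show "?B \<subseteq> U n" for n
    proof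
      fix b assume b: "b \<in> ?B"
      have "b = \<zero>\<^bsub>?M\<^esub> \<oplus>\<^bsub>?M\<^esub> b" using BM[OF b] by simp
      then show "b \<in> U n" using b C.coboundaries_cocycles[of i] graded_span.zero unfolding U_def by blast
    qed
    show "U n \<subseteq> ?Z" for n unfolding U_def by blast
    show "U (Suc n) \<subseteq> U n" for n
    proof
      fix z assume "z \<in> U (Suc n)"
      then obtain u b where z: "z \<in> ?Z" "u \<in> ?up (int (Suc n))" "b \<in> ?B" "z = u \<oplus>\<^bsub>?M\<^esub> b" unfolding U_def by blast
      have "u \<in> ?up (int n)" by (rule graded_span_mono[OF z(2)]) auto
      then show "z \<in> U n" using z unfolding U_def by blast
    qed
  qed
  then obtain m where m: "\<And>n. n \<ge> m \<Longrightarrow> U n = U m" by blast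
  obtain l u where lu: "x \<in> graded_span ?M (Kg i) {l..<u}" using M.span_bounded[OF M.span_UNIV[OF ZM[OF x]]] by blast
  have xl: "x \<in> ?up l" by (rule graded_span_mono[OF lu]) auto
  define N where "N = nat (int m - l)"
  define w where "w = f [^]\<^bsub>S\<^esub> N \<odot>\<^bsub>?M\<^esub> x"
  have wZ: "w \<in> ?Z" unfolding w_def using fS by (intro M.submodule_smult[OF Z] x) simp
  have wM: "w \<in> carrier ?M" by (rule ZM[OF wZ])
  have "w \<in> ?up (int m)" unfolding w_def by (rule graded_span_mono[OF fpow[OF xl, of N]]) (auto simp: N_def)
  moreover have "w = w \<oplus>\<^bsub>?M\<^esub> \<zero>\<^bsub>?M\<^esub>" using wM by simp
  ultimately have wU: "w \<in> U m" using wZ M.submodule_zero[OF B] unfolding U_def by blast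
  obtain l' u' where lu': "w \<in> graded_span ?M (Kg i) {l'..<u'}" using M.span_bounded[OF M.span_UNIV[OF wM]] by blast
  \<comment> \<open>All degrees of \<open>w\<close> are below \<open>n\<close>.\<close>
  define n where "n = max m (nat u')"
  have wlow: "w \<in> graded_span ?M (Kg i) {..<int n}" by (rule graded_span_mono[OF lu']) (auto simp: n_def)
  have "w \<in> U n" using wU m[of n] by (simp add: n_def)
  then obtain v b where vb: "v \<in> ?up (int n)" "b \<in> ?B" "w = v \<oplus>\<^bsub>?M\<^esub> b" unfolding U_def by blast
  have "w \<in> ?B"
  proof (cases i)
    case 0
    then have "b = \<zero>\<^bsub>?M\<^esub>" using vb(2) by (simp add: C.coboundaries_0)
    then have "w \<in> ?up (int n)" using vb M.span_carrier[OF vb(1)] by simp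
    then have "w = \<zero>\<^bsub>?M\<^esub>" by (rule M.span_disjoint[OF _ wlow]) auto
    then show ?thesis using M.submodule_zero[OF B] by simp
  next
    case (Suc j)
    interpret G: graded S "K j" Sg "Kg j" using C.module_K gr by (intro graded.intro graded_axioms.intro)
    interpret h: module_map S "K j" ?M "\<phi> j" using C.map_K[of j] Suc by simp
    obtain e where e: "\<And>a. \<phi> j ` Kg j a \<subseteq> Kg i (a + e)" using hom[of j] Suc unfolding homogeneous_map_def by blast
    have hspan: "\<phi> j y \<in> graded_span ?M (Kg i) Q" if "y \<in> graded_span (K j) (Kg j) P" "\<And>a. a \<in> P \<Longrightarrow> a + e \<in> Q" for y P Q
      using that
    proof (induction rule: graded_span.induct)
      case zero then show ?case by (simp add: graded_span.zero)
    next
      case (add a x y)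
      have "\<phi> j (x \<oplus>\<^bsub>K j\<^esub> y) = \<phi> j x \<oplus>\<^bsub>?M\<^esub> \<phi> j y"
        using add G.span_carrier G.component_carrier by (intro h.map_add) auto
      moreover have "\<phi> j x \<in> Kg i (a + e)" using e add(2) by blast
      ultimately show ?case using M.span_step[of "a + e" Q "\<phi> j x"] add by auto
    qed
    have BK: "?B = \<phi> j ` carrier (K j)" using Suc C.coboundaries_Suc[of j] by simp
    obtain k where k: "k \<in> carrier (K j)" "b = \<phi> j k" using vb(2) BK by auto
    obtain y z where yz: "y \<in> graded_span (K j) (Kg j) {..<int n - e}" "z \<in> graded_span (K j) (Kg j) {int n - e..}"
      "k = y \<oplus>\<^bsub>K j\<^esub> z" using G.span_split[OF G.span_UNIV[OF k(1)]] by blast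
    have yK: "y \<in> carrier (K j)" "z \<in> carrier (K j)" using yz G.span_carrier by auto
    have p1: "\<phi> j y \<in> graded_span ?M (Kg i) {..<int n}" by (rule hspan[OF yz(1)]) auto
    have p2: "\<phi> j z \<in> ?up (int n)" by (rule hspan[OF yz(2)]) auto
    have cl: "\<phi> j y \<in> carrier ?M" "\<phi> j z \<in> carrier ?M" "v \<in> carrier ?M" using yK M.span_carrier[OF vb(1)] by auto
    have bk: "b = \<phi> j y \<oplus>\<^bsub>?M\<^esub> \<phi> j z" using h.map_add[OF yK] yz(3) k(2) by simp
    have eq: "w \<oplus>\<^bsub>?M\<^esub> \<ominus>\<^bsub>?M\<^esub> \<phi> j y = v \<oplus>\<^bsub>?M\<^esub> \<phi> j z"
    proof -
      have "w = \<phi> j y \<oplus>\<^bsub>?M\<^esub> (v \<oplus>\<^bsub>?M\<^esub> \<phi> j z)" unfolding vb(3) bk using cl by (simp add: M.M.a_lcomm)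
      then have "w \<oplus>\<^bsub>?M\<^esub> \<ominus>\<^bsub>?M\<^esub> \<phi> j y = (v \<oplus>\<^bsub>?M\<^esub> \<phi> j z) \<oplus>\<^bsub>?M\<^esub> (\<phi> j y \<oplus>\<^bsub>?M\<^esub> \<ominus>\<^bsub>?M\<^esub> \<phi> j y)"
        using cl by (simp add: M.M.a_ac)
      then show ?thesis using cl by (simp add: M.M.r_neg)
    qed
    have "w \<oplus>\<^bsub>?M\<^esub> \<ominus>\<^bsub>?M\<^esub> \<phi> j y = \<zero>\<^bsub>?M\<^esub>"
    proof (rule M.span_disjoint)
      show "w \<oplus>\<^bsub>?M\<^esub> \<ominus>\<^bsub>?M\<^esub> \<phi> j y \<in> graded_span ?M (Kg i) {..<int n}" by (rule M.span_add[OF wlow M.span_neg[OF p1]])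
      show "w \<oplus>\<^bsub>?M\<^esub> \<ominus>\<^bsub>?M\<^esub> \<phi> j y \<in> ?up (int n)" unfolding eq by (rule M.span_add[OF vb(1) p2])
    qed auto
    then have "w = \<phi> j y" using wM cl(1) by (metis M.M.add.inv_closed M.M.add.inv_equality M.M.minus_minus)
    then show ?thesis using BK yK by auto
  qed
  then show ?thesis unfolding w_def by blast
qed

section \<open>Regular sequences and retractions\<close>

text \<open>Contraction with \<open>r\<^sub>1, \<dots>, r\<^sub>n\<close>, which lowers the degree by one.\<close>

primrec kos_h :: "('s, 'm, 'z) module_scheme \<Rightarrow> 's list \<Rightarrow> (bool list \<Rightarrow> 'm) \<Rightarrow> bool list \<Rightarrow> 'm" where
  "kos_h M [] c = (\<lambda>xs. \<zero>\<^bsub>M\<^esub>)"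
| "kos_h M (r # rs) c = (\<lambda>xs. case xs of [] \<Rightarrow> \<zero>\<^bsub>M\<^esub> | b # ys \<Rightarrow>
     (if b then \<ominus>\<^bsub>M\<^esub> kos_h M rs (\<lambda>zs. c (True # zs)) ys
      else r \<odot>\<^bsub>M\<^esub> c (True # ys) \<oplus>\<^bsub>M\<^esub> kos_h M rs (\<lambda>zs. c (False # zs)) ys))"

primrec lin_comb :: "('s, 'b) ring_scheme \<Rightarrow> 's list \<Rightarrow> 's list \<Rightarrow> 's" where
  "lin_comb R [] rs = \<zero>\<^bsub>R\<^esub>"
| "lin_comb R (g # gs) rs = hd rs \<otimes>\<^bsub>R\<^esub> g \<oplus>\<^bsub>R\<^esub> lin_comb R gs (tl rs)"

lemma (in cring) lin_comb_closed:
  "set gs \<subseteq> carrier R \<Longrightarrow> set rs \<subseteq> carrier R \<Longrightarrow> length rs = length gs \<Longrightarrow> lin_comb R gs rs \<in> carrier R"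
proof (induction gs arbitrary: rs)
  case (Cons g gs) then show ?case by (cases rs) auto
qed simp

lemma (in cring) genideal_lin_comb:
  assumes gs: "set gs \<subseteq> carrier R" and y: "y \<in> Idl (set gs)"
  shows "\<exists>rs. set rs \<subseteq> carrier R \<and> length rs = length gs \<and> y = lin_comb R gs rs"
proof -
  let ?C = "\<lambda>gs. {lin_comb R gs rs | rs. set rs \<subseteq> carrier R \<and> length rs = length gs}"
  have add: "lin_comb R gs rs \<oplus> lin_comb R gs rs' = lin_comb R gs (map2 (\<oplus>) rs rs')"
    if "set gs \<subseteq> carrier R" "set rs \<subseteq> carrier R" "length rs = length gs" "set rs' \<subseteq> carrier R" "length rs' = length gs" for gs rs rs'
    using that
  proof (induction gs arbitrary: rs rs')
    case (Cons g gs)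
    obtain r ra r' ra' where rs: "rs = r # ra" "rs' = r' # ra'" using Cons.prems by (cases rs; cases rs') auto
    have IH: "lin_comb R gs ra \<oplus> lin_comb R gs ra' = lin_comb R gs (map2 (\<oplus>) ra ra')"
      using Cons rs by auto
    have "lin_comb R gs ra \<in> carrier R" "lin_comb R gs ra' \<in> carrier R"
      using Cons.prems rs by (auto intro!: lin_comb_closed)
    then show ?case using Cons.prems rs by (simp add: l_distr a_ac flip: IH)
  qed simp
  have mult: "a \<otimes> lin_comb R gs rs = lin_comb R gs (map (\<lambda>r. a \<otimes> r) rs)"
    if "set gs \<subseteq> carrier R" "set rs \<subseteq> carrier R" "length rs = length gs" "a \<in> carrier R" for gs rs a
    using that
  proof (induction gs arbitrary: rs)
    case (Cons g gs)
    obtain r ra where rs: "rs = r # ra" using Cons.prems by (cases rs) auto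
    have "lin_comb R gs ra \<in> carrier R" using Cons.prems rs by (auto intro!: lin_comb_closed)
    then show ?case using Cons.prems Cons.IH[of ra] rs by (simp add: r_distr m_assoc)
  qed simp
  have zero: "lin_comb R gs (replicate (length gs) \<zero>) = \<zero>" if "set gs \<subseteq> carrier R" for gs
    using that by (induction gs) auto
  have mem: "g \<in> ?C gs" if "set gs \<subseteq> carrier R" "g \<in> set gs" for g gs
    using that
  proof (induction gs)
    case (Cons h gs)
    show ?case
    proof (cases "g = h")
      case True
      have "g = lin_comb R (h # gs) (\<one> # replicate (length gs) \<zero>)" using Cons.prems True zero by simp
      then show ?thesis by (intro CollectI exI[of _ "\<one> # replicate (length gs) \<zero>"]) auto
    next
      case False
      then have "g \<in> ?C gs" using Cons by auto
      then obtain rs where rs: "set rs \<subseteq> carrier R" "length rs = length gs" "g = lin_comb R gs rs" by blast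
      have "g = lin_comb R (h # gs) (\<zero> # rs)" using rs Cons.prems lin_comb_closed[of gs rs] by simp
      then show ?thesis using rs by (intro CollectI exI[of _ "\<zero> # rs"]) auto
    qed
  qed simp
  have "ideal (?C gs) R"
  proof (rule idealI[OF ring_axioms])
    show "subgroup (?C gs) (add_monoid R)"
    proof (rule add.subgroupI)
      show "?C gs \<subseteq> carrier R" using lin_comb_closed gs by blast
      show "?C gs \<noteq> {}" by (auto intro: exI[of _ "replicate (length gs) \<zero>"])
      fix a b assume "a \<in> ?C gs"
      then obtain rs where rs: "set rs \<subseteq> carrier R" "length rs = length gs" "a = lin_comb R gs rs" by blast
      have "\<ominus> a = (\<ominus> \<one>) \<otimes> a" using rs lin_comb_closed[OF gs] by (simp add: l_minus)
      then show "\<ominus> a \<in> ?C gs" using mult[OF gs rs(1,2), of "\<ominus> \<one>"] rs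
        by (intro CollectI exI[of _ "map (\<lambda>r. \<ominus> \<one> \<otimes> r) rs"]) auto
      assume "b \<in> ?C gs"
      then obtain rs' where rs': "set rs' \<subseteq> carrier R" "length rs' = length gs" "b = lin_comb R gs rs'" by blast
      show "a \<oplus> b \<in> ?C gs" using add[OF gs rs(1,2) rs'(1,2)] rs rs'
        by (intro CollectI exI[of _ "map2 (\<oplus>) rs rs'"]) (auto intro!: a_closed dest: set_zip_leftD set_zip_rightD)
    qed
    fix a x assume "a \<in> ?C gs" and x: "x \<in> carrier R"
    then obtain rs where rs: "set rs \<subseteq> carrier R" "length rs = length gs" "a = lin_comb R gs rs" by blast
    show xa: "x \<otimes> a \<in> ?C gs" using mult[OF gs rs(1,2) x] rs x
      by (intro CollectI exI[of _ "map (\<lambda>r. x \<otimes> r) rs"]) auto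
    have "a \<otimes> x = x \<otimes> a" using rs lin_comb_closed[OF gs] x by (simp add: m_comm)
    then show "a \<otimes> x \<in> ?C gs" using xa by simp
  qed
  then have "Idl (set gs) \<subseteq> ?C gs" by (rule genideal_minimal) (use mem gs in blast)
  then show ?thesis using y by blast
qed

context module begin

lemma kos_h_closed:
  assumes W: "submodule W R M"
  shows "set rs \<subseteq> carrier R \<Longrightarrow> (\<And>xs. c xs \<in> W) \<Longrightarrow> kos_h M rs c xs \<in> W"
  by (induction rs arbitrary: c xs) (auto simp: W submodule_closed split: list.split)

lemmas kos_h_carrier [simp] = kos_h_closed[OF carrier_is_submodule]

lemma neg_minus: "\<lbrakk>a \<in> carrier M; b \<in> carrier M\<rbrakk> \<Longrightarrow>
    \<ominus>\<^bsub>M\<^esub> (a \<ominus>\<^bsub>M\<^esub> b) = \<ominus>\<^bsub>M\<^esub> a \<ominus>\<^bsub>M\<^esub> \<ominus>\<^bsub>M\<^esub> b"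
  by (simp add: a_minus_def M.minus_add)

lemma kos_h_minus:
  "set rs \<subseteq> carrier R \<Longrightarrow> (\<And>xs. c xs \<in> carrier M) \<Longrightarrow> (\<And>xs. c' xs \<in> carrier M) \<Longrightarrow>
   kos_h M rs (\<lambda>xs. c xs \<ominus>\<^bsub>M\<^esub> c' xs) xs = kos_h M rs c xs \<ominus>\<^bsub>M\<^esub> kos_h M rs c' xs"
  by (induction rs arbitrary: c c' xs)
     (auto simp: smult_minus minus_add4 neg_minus split: list.split)

lemma kos_h_smult:
  "set rs \<subseteq> carrier R \<Longrightarrow> (\<And>xs. c xs \<in> carrier M) \<Longrightarrow> a \<in> carrier R \<Longrightarrow>
   kos_h M rs (\<lambda>xs. a \<odot>\<^bsub>M\<^esub> c xs) xs = a \<odot>\<^bsub>M\<^esub> kos_h M rs c xs"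
  by (induction rs arbitrary: c xs)
     (auto simp: smult_r_distr smult_r_minus smult_swap[of a] split: list.split)

lemma kos_d_neg:
  "set gs \<subseteq> carrier R \<Longrightarrow> (\<And>xs. c xs \<in> carrier M) \<Longrightarrow>
   kos_d M gs (\<lambda>xs. \<ominus>\<^bsub>M\<^esub> c xs) xs = \<ominus>\<^bsub>M\<^esub> kos_d M gs c xs"
  using kos_d_minus[of gs "\<lambda>xs. \<zero>\<^bsub>M\<^esub>" c xs] by (simp add: kos_d_zero a_minus_def)

text \<open>Every element of the ideal generated by \<open>gs\<close> acts on the Koszul complex of \<open>gs\<close> as a map
  homotopic to zero; the homotopy is contraction with the coefficients of the element.\<close>

lemma kos_homotopy:
  "set gs \<subseteq> carrier R \<Longrightarrow> set rs \<subseteq> carrier R \<Longrightarrow> length rs = length gs \<Longrightarrow> length xs = length gs \<Longrightarrow>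
   (\<And>xs. c xs \<in> carrier M) \<Longrightarrow>
   lin_comb R gs rs \<odot>\<^bsub>M\<^esub> c xs = kos_d M gs (kos_h M rs c) xs \<oplus>\<^bsub>M\<^esub> kos_h M rs (kos_d M gs c) xs"
proof (induction gs arbitrary: rs c xs)
  case (Cons g gs)
  obtain r rs' where rs: "rs = r # rs'" using Cons.prems by (cases rs) auto
  obtain b ys where xs: "xs = b # ys" using Cons.prems by (cases xs) auto
  have g: "g \<in> carrier R" "set gs \<subseteq> carrier R" "r \<in> carrier R" "set rs' \<subseteq> carrier R" "length rs' = length gs"
    and len: "length ys = length gs" and c: "\<And>xs. c xs \<in> carrier M"
    using Cons.prems rs xs by auto
  let ?T = "\<lambda>zs. c (True # zs)" and ?F = "\<lambda>zs. c (False # zs)"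
  have TM: "\<And>zs. ?T zs \<in> carrier M" and FM: "\<And>zs. ?F zs \<in> carrier M" using c by auto
  note IH = Cons.IH[OF g(2,4,5) len]
  have lc: "lin_comb R gs rs' \<in> carrier R" using g by (intro lin_comb_closed) auto
  define A where "A = kos_d M gs (kos_h M rs' ?F) ys"
  define B where "B = kos_h M rs' (kos_d M gs ?F) ys"
  define A' where "A' = kos_d M gs (kos_h M rs' ?T) ys"
  define B' where "B' = kos_h M rs' (kos_d M gs ?T) ys"
  define E where "E = kos_d M gs ?T ys"
  define H where "H = kos_h M rs' ?F ys"
  have cl: "A \<in> carrier M" "B \<in> carrier M" "A' \<in> carrier M" "B' \<in> carrier M" "E \<in> carrier M" "H \<in> carrier M"
    unfolding A_def B_def A'_def B'_def E_def H_def using g TM FM by auto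
  show ?case
  proof (cases b)
    case False
    have 1: "kos_d M (g # gs) (kos_h M rs c) xs = r \<odot>\<^bsub>M\<^esub> E \<oplus>\<^bsub>M\<^esub> A"
    proof -
      have "kos_d M (g # gs) (kos_h M rs c) xs = kos_d M gs (\<lambda>zs. r \<odot>\<^bsub>M\<^esub> ?T zs \<oplus>\<^bsub>M\<^esub> kos_h M rs' ?F zs) ys"
        using False xs rs by simp
      also have "\<dots> = kos_d M gs (\<lambda>zs. r \<odot>\<^bsub>M\<^esub> ?T zs) ys \<oplus>\<^bsub>M\<^esub> A"
        unfolding A_def using g TM FM by (intro kos_d_add) auto
      also have "kos_d M gs (\<lambda>zs. r \<odot>\<^bsub>M\<^esub> ?T zs) ys = r \<odot>\<^bsub>M\<^esub> E"
        unfolding E_def using g TM by (intro kos_d_smult) auto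
      finally show ?thesis .
    qed
    have 2: "kos_h M rs (kos_d M (g # gs) c) xs = r \<odot>\<^bsub>M\<^esub> (g \<odot>\<^bsub>M\<^esub> ?F ys \<ominus>\<^bsub>M\<^esub> E) \<oplus>\<^bsub>M\<^esub> B"
      using False xs rs by (simp add: E_def B_def)
    have "lin_comb R (g # gs) rs \<odot>\<^bsub>M\<^esub> c xs = r \<odot>\<^bsub>M\<^esub> (g \<odot>\<^bsub>M\<^esub> ?F ys) \<oplus>\<^bsub>M\<^esub> (A \<oplus>\<^bsub>M\<^esub> B)"
      using False xs rs g FM lc IH[of ?F] by (simp add: smult_l_distr smult_assoc1 A_def B_def)
    moreover define u v where "u = r \<odot>\<^bsub>M\<^esub> (g \<odot>\<^bsub>M\<^esub> ?F ys)" and "v = r \<odot>\<^bsub>M\<^esub> E"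
    ultimately have 3: "lin_comb R (g # gs) rs \<odot>\<^bsub>M\<^esub> c xs = u \<oplus>\<^bsub>M\<^esub> (A \<oplus>\<^bsub>M\<^esub> B)" by simp
    have uv: "u \<in> carrier M" "v \<in> carrier M" unfolding u_def v_def using g FM cl by auto
    have "r \<odot>\<^bsub>M\<^esub> (g \<odot>\<^bsub>M\<^esub> ?F ys \<ominus>\<^bsub>M\<^esub> E) = u \<ominus>\<^bsub>M\<^esub> v"
      unfolding u_def v_def using g FM cl by (intro smult_minus) auto
    moreover have "(v \<oplus>\<^bsub>M\<^esub> A) \<oplus>\<^bsub>M\<^esub> ((u \<ominus>\<^bsub>M\<^esub> v) \<oplus>\<^bsub>M\<^esub> B) = u \<oplus>\<^bsub>M\<^esub> (A \<oplus>\<^bsub>M\<^esub> B) \<oplus>\<^bsub>M\<^esub> (v \<oplus>\<^bsub>M\<^esub> \<ominus>\<^bsub>M\<^esub> v)"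
      using cl uv by (simp add: a_minus_def M.a_ac)
    ultimately show ?thesis unfolding 1 2 3 v_def[symmetric] using cl uv by (simp add: M.r_neg)
  next
    case True
    have 1: "kos_d M (g # gs) (kos_h M rs c) xs = g \<odot>\<^bsub>M\<^esub> (r \<odot>\<^bsub>M\<^esub> ?T ys \<oplus>\<^bsub>M\<^esub> H) \<oplus>\<^bsub>M\<^esub> A'"
    proof -
      have "kos_d M (g # gs) (kos_h M rs c) xs
          = g \<odot>\<^bsub>M\<^esub> (r \<odot>\<^bsub>M\<^esub> ?T ys \<oplus>\<^bsub>M\<^esub> H) \<ominus>\<^bsub>M\<^esub> kos_d M gs (\<lambda>zs. \<ominus>\<^bsub>M\<^esub> kos_h M rs' ?T zs) ys"
        using True xs rs by (simp add: H_def)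
      also have "kos_d M gs (\<lambda>zs. \<ominus>\<^bsub>M\<^esub> kos_h M rs' ?T zs) ys = \<ominus>\<^bsub>M\<^esub> A'"
        unfolding A'_def using g TM by (intro kos_d_neg) auto
      finally show ?thesis using cl by (simp add: a_minus_def)
    qed
    have 2: "kos_h M rs (kos_d M (g # gs) c) xs = \<ominus>\<^bsub>M\<^esub> (g \<odot>\<^bsub>M\<^esub> H \<ominus>\<^bsub>M\<^esub> B')"
    proof -
      have "kos_h M rs (kos_d M (g # gs) c) xs = \<ominus>\<^bsub>M\<^esub> kos_h M rs' (\<lambda>zs. g \<odot>\<^bsub>M\<^esub> ?F zs \<ominus>\<^bsub>M\<^esub> kos_d M gs ?T zs) ys"
        using True xs rs by simp
      also have "kos_h M rs' (\<lambda>zs. g \<odot>\<^bsub>M\<^esub> ?F zs \<ominus>\<^bsub>M\<^esub> kos_d M gs ?T zs) ys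
         = kos_h M rs' (\<lambda>zs. g \<odot>\<^bsub>M\<^esub> ?F zs) ys \<ominus>\<^bsub>M\<^esub> B'"
        unfolding B'_def using g TM FM by (intro kos_h_minus) auto
      also have "kos_h M rs' (\<lambda>zs. g \<odot>\<^bsub>M\<^esub> ?F zs) ys = g \<odot>\<^bsub>M\<^esub> H"
        unfolding H_def using g FM by (intro kos_h_smult) auto
      finally show ?thesis .
    qed
    have 3: "lin_comb R (g # gs) rs \<odot>\<^bsub>M\<^esub> c xs = g \<odot>\<^bsub>M\<^esub> (r \<odot>\<^bsub>M\<^esub> ?T ys) \<oplus>\<^bsub>M\<^esub> (A' \<oplus>\<^bsub>M\<^esub> B')"
      using True xs rs g TM lc IH[of ?T]
      by (simp add: smult_l_distr smult_assoc1 A'_def B'_def smult_swap[of r])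
    define u v where "u = g \<odot>\<^bsub>M\<^esub> (r \<odot>\<^bsub>M\<^esub> ?T ys)" and "v = g \<odot>\<^bsub>M\<^esub> H"
    have uv: "u \<in> carrier M" "v \<in> carrier M" unfolding u_def v_def using g TM cl by auto
    have "u \<oplus>\<^bsub>M\<^esub> v \<oplus>\<^bsub>M\<^esub> A' \<oplus>\<^bsub>M\<^esub> \<ominus>\<^bsub>M\<^esub> (v \<ominus>\<^bsub>M\<^esub> B') = u \<oplus>\<^bsub>M\<^esub> (A' \<oplus>\<^bsub>M\<^esub> B')"
    proof -
      have "u \<oplus>\<^bsub>M\<^esub> v \<oplus>\<^bsub>M\<^esub> A' \<oplus>\<^bsub>M\<^esub> \<ominus>\<^bsub>M\<^esub> (v \<ominus>\<^bsub>M\<^esub> B') = u \<oplus>\<^bsub>M\<^esub> (A' \<oplus>\<^bsub>M\<^esub> B') \<oplus>\<^bsub>M\<^esub> (v \<oplus>\<^bsub>M\<^esub> \<ominus>\<^bsub>M\<^esub> v)"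
        using cl uv by (simp add: a_minus_def M.minus_add M.a_ac)
      then show ?thesis using cl uv by (simp add: M.r_neg)
    qed
    then show ?thesis unfolding 1 2 3 using cl g TM
      by (simp add: smult_r_distr u_def[symmetric] v_def[symmetric])
  qed
qed simp

lemma cochains_kos_h:
  assumes W: "submodule W R M"
  shows "set rs \<subseteq> carrier R \<Longrightarrow> length rs = n \<Longrightarrow> c \<in> cochains M W n t \<Longrightarrow>
    kos_h M rs c \<in> cochains M W n (t - 1)"
proof (induction rs arbitrary: c n t)
  case Nil then show ?case by (simp add: cochains_null W)
next
  case (Cons g gs)
  have n: "n = Suc (length gs)" and g: "g \<in> carrier R" "set gs \<subseteq> carrier R" using Cons.prems by auto
  note c = Cons.prems(3)[unfolded n]
  note F = Cons.IH[OF g(2) refl cochains_False[OF c]]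
  note T = Cons.IH[OF g(2) refl cochains_True[OF c]]
  show ?case
  proof (rule cochainsI)
    fix xs
    show "kos_h M (g # gs) c xs \<in> W"
      by (rule kos_h_closed[OF W Cons.prems(1)]) (rule cochains_closed[OF c])
    show "length xs = n \<and> int (count_list xs True) = t - 1" if nz: "kos_h M (g # gs) c xs \<noteq> \<zero>\<^bsub>M\<^esub>"
    proof (rule ccontr)
      assume neg: "\<not> ?thesis"
      then obtain b ys where xs: "xs = b # ys" using nz by (cases xs) auto
      show False
      proof (cases b)
        case True
        then have "kos_h M gs (\<lambda>zs. c (True # zs)) ys = \<zero>\<^bsub>M\<^esub>"
          using neg xs n by (auto intro!: cochains_zero[OF T])
        then show False using nz xs True g by simp
      next
        case False
        then have "c (True # ys) = \<zero>\<^bsub>M\<^esub>" "kos_h M gs (\<lambda>zs. c (False # zs)) ys = \<zero>\<^bsub>M\<^esub>"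
          using neg xs n by (auto intro!: cochains_zero[OF F] cochains_zero[OF c])
        then show False using nz xs False g by simp
      qed
    qed
  qed
qed

text \<open>The list is a weakly regular sequence on \<open>M/L\<close>: each entry is a nonzerodivisor modulo its
  predecessors.\<close>

primrec regular_mod :: "'a list \<Rightarrow> 'c set \<Rightarrow> bool" where
  "regular_mod [] L \<longleftrightarrow> True"
| "regular_mod (y # ys) L \<longleftrightarrow> (\<forall>x\<in>carrier M. y \<odot>\<^bsub>M\<^esub> x \<in> L \<longrightarrow> x \<in> L) \<and>
     regular_mod ys {l \<oplus>\<^bsub>M\<^esub> y \<odot>\<^bsub>M\<^esub> b | l b. l \<in> L \<and> b \<in> carrier M}"

lemma extend_submodule:
  assumes L: "submodule L R M" and y: "y \<in> carrier R"
  shows "submodule {l \<oplus>\<^bsub>M\<^esub> y \<odot>\<^bsub>M\<^esub> b | l b. l \<in> L \<and> b \<in> carrier M} R M"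
proof -
  have "submodule ((\<lambda>b. y \<odot>\<^bsub>M\<^esub> b) ` carrier M) R M"
  proof (rule submodule_criterion)
    show "\<zero>\<^bsub>M\<^esub> \<in> (\<lambda>b. y \<odot>\<^bsub>M\<^esub> b) ` carrier M" using y by (intro image_eqI[of _ _ "\<zero>\<^bsub>M\<^esub>"]) auto
    show "v \<oplus>\<^bsub>M\<^esub> w \<in> (\<lambda>b. y \<odot>\<^bsub>M\<^esub> b) ` carrier M"
      if "v \<in> (\<lambda>b. y \<odot>\<^bsub>M\<^esub> b) ` carrier M" "w \<in> (\<lambda>b. y \<odot>\<^bsub>M\<^esub> b) ` carrier M" for v w
      using that y by (auto simp: smult_r_distr[symmetric])
    show "a \<odot>\<^bsub>M\<^esub> v \<in> (\<lambda>b. y \<odot>\<^bsub>M\<^esub> b) ` carrier M"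
      if "a \<in> carrier R" "v \<in> (\<lambda>b. y \<odot>\<^bsub>M\<^esub> b) ` carrier M" for a v
      using that y by (auto simp: smult_swap[of a y])
  qed (use y in auto)
  from submodule_sum[OF L this] show ?thesis by (rule back_subst[of "\<lambda>U. submodule U R M"]) blast
qed

text \<open>An ideal that contains a regular sequence of length greater than \<open>t\<close> has no Koszul
  cohomology in degree \<open>t\<close>. Let \<open>c\<close> be a cocycle modulo \<open>L\<close> and \<open>y\<close> the first element of the
  sequence. With the contraction \<open>h\<close> that belongs to \<open>y\<close>, one has \<open>y c \<equiv> d h c\<close> modulo \<open>L\<close>.
  Hence \<open>h c\<close> is a cocycle modulo \<open>L + y M\<close> in degree \<open>t - 1\<close>, and by induction
  \<open>h c = d g + l + y b\<close> with \<open>l\<close> in \<open>L\<close>. So \<open>y (c - d b)\<close> is in \<open>L\<close>, and \<open>y\<close> can be cancelled.\<close>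

lemma koszul_depth:
  assumes gs: "set gs \<subseteq> carrier R"
  shows "submodule L R M \<Longrightarrow> regular_mod ys L \<Longrightarrow> set ys \<subseteq> Idl (set gs) \<Longrightarrow>
    c \<in> cochains M (carrier M) (length gs) t \<Longrightarrow> t < int (length ys) \<Longrightarrow> (\<And>xs. kos_d M gs c xs \<in> L) \<Longrightarrow>
    \<exists>h\<in>cochains M (carrier M) (length gs) (t - 1). \<forall>xs. c xs \<ominus>\<^bsub>M\<^esub> kos_d M gs h xs \<in> L"
proof (induction ys arbitrary: L c t)
  case Nil
  have "c = (\<lambda>xs. \<zero>\<^bsub>M\<^esub>)" using cochains_neg_degree[OF Nil(4)] Nil(5) by auto
  then show ?case
    using submodule_zero[OF Nil(1)] gs cochains_null[OF carrier_is_submodule]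
    by (intro bexI[of _ "\<lambda>xs. \<zero>\<^bsub>M\<^esub>"]) (auto simp: kos_d_zero)
next
  case (Cons y ys)
  note L = Cons.prems(1) and c = Cons.prems(4) and dc = Cons.prems(6)
  note MM = carrier_is_submodule
  have reg: "\<And>x. x \<in> carrier M \<Longrightarrow> y \<odot>\<^bsub>M\<^esub> x \<in> L \<Longrightarrow> x \<in> L"
    and reg': "regular_mod ys {l \<oplus>\<^bsub>M\<^esub> y \<odot>\<^bsub>M\<^esub> b | l b. l \<in> L \<and> b \<in> carrier M}" using Cons.prems(2) by auto
  let ?L' = "{l \<oplus>\<^bsub>M\<^esub> y \<odot>\<^bsub>M\<^esub> b | l b. l \<in> L \<and> b \<in> carrier M}"
  obtain rs where rs: "set rs \<subseteq> carrier R" "length rs = length gs" "y = lin_comb R gs rs"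
    using genideal_lin_comb[OF gs] Cons.prems(3) by auto
  have y: "y \<in> carrier R" unfolding rs(3) by (rule lin_comb_closed[OF gs rs(1,2)])
  note L' = extend_submodule[OF L y]
  note LM = submodule_subset[OF L]
  have cM: "\<And>xs. c xs \<in> carrier M" using cochains_closed[OF c] .
  have dcM: "\<And>xs. kos_d M gs c xs \<in> carrier M" using cM gs by simp
  define e where "e = kos_h M rs c"
  have e: "e \<in> cochains M (carrier M) (length gs) (t - 1)"
    unfolding e_def by (rule cochains_kos_h[OF MM rs(1,2) c])
  have eM: "\<And>xs. e xs \<in> carrier M" using cochains_closed[OF e] .
  have hL: "kos_h M rs (kos_d M gs c) xs \<in> L" for xs by (rule kos_h_closed[OF L rs(1) dc])
  have deM: "kos_d M gs e xs \<in> carrier M" for xs using eM gs by simp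
  have homo: "y \<odot>\<^bsub>M\<^esub> c xs = kos_d M gs e xs \<oplus>\<^bsub>M\<^esub> kos_h M rs (kos_d M gs c) xs" if "length xs = length gs" for xs
    unfolding rs(3) e_def by (rule kos_homotopy[OF gs rs(1,2) that cM])
  have "kos_d M gs e xs \<in> ?L'" for xs
  proof (cases "length xs = length gs")
    case True
    have "kos_d M gs e xs = \<ominus>\<^bsub>M\<^esub> kos_h M rs (kos_d M gs c) xs \<oplus>\<^bsub>M\<^esub> y \<odot>\<^bsub>M\<^esub> c xs"
      unfolding homo[OF True] using deM LM[OF hL] M.a_lcomm[of "\<ominus>\<^bsub>M\<^esub> kos_h M rs (kos_d M gs c) xs" "kos_d M gs e xs"]
      by (simp add: M.l_neg)
    then show ?thesis using submodule_neg[OF L hL] cM by blast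
  next
    case False
    have "kos_d M gs e xs = \<zero>\<^bsub>M\<^esub>"
      using cochains_zero[OF cochains_kos_d[OF MM gs refl e], of xs] False by simp
    then show ?thesis using submodule_zero[OF L'] by simp
  qed
  from Cons.IH[OF L' reg' _ e _ this] obtain g where g: "g \<in> cochains M (carrier M) (length gs) (t - 1 - 1)"
    and eg: "\<And>xs. e xs \<ominus>\<^bsub>M\<^esub> kos_d M gs g xs \<in> ?L'" using Cons.prems(3,5) by auto
  have gM: "\<And>xs. g xs \<in> carrier M" using cochains_closed[OF g] .
  have dg: "kos_d M gs g \<in> cochains M (carrier M) (length gs) (t - 1)"
    using cochains_kos_d[OF MM gs refl g] by simp
  define q where "q = (\<lambda>xs. e xs \<ominus>\<^bsub>M\<^esub> kos_d M gs g xs)"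
  have q: "q \<in> cochains M (carrier M) (length gs) (t - 1)" unfolding q_def by (rule cochains_minus[OF MM e dg])
  have "\<exists>l b. l \<in> L \<and> b \<in> carrier M \<and> q xs = l \<oplus>\<^bsub>M\<^esub> y \<odot>\<^bsub>M\<^esub> b \<and> (q xs = \<zero>\<^bsub>M\<^esub> \<longrightarrow> b = \<zero>\<^bsub>M\<^esub>)" for xs
  proof (cases "q xs = \<zero>\<^bsub>M\<^esub>")
    case True
    then show ?thesis using submodule_zero[OF L] y by (intro exI[of _ "\<zero>\<^bsub>M\<^esub>"]) auto
  next
    case False
    then show ?thesis using eg[of xs] unfolding q_def by blast
  qed
  then obtain l b where lb: "\<And>xs. l xs \<in> L" "\<And>xs. b xs \<in> carrier M" "\<And>xs. q xs = l xs \<oplus>\<^bsub>M\<^esub> y \<odot>\<^bsub>M\<^esub> b xs"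
     "\<And>xs. q xs = \<zero>\<^bsub>M\<^esub> \<Longrightarrow> b xs = \<zero>\<^bsub>M\<^esub>" by metis
  have b: "b \<in> cochains M (carrier M) (length gs) (t - 1)"
    using lb(2,4) q unfolding cochains_def mem_Collect_eq by metis
  have lM: "\<And>xs. l xs \<in> carrier M" using lb(1) LM by blast
  have "c xs \<ominus>\<^bsub>M\<^esub> kos_d M gs b xs \<in> L" for xs
  proof (cases "length xs = length gs")
    case True
    have dbM: "kos_d M gs b xs \<in> carrier M" "kos_d M gs l xs \<in> carrier M" using lb(2) lM gs by auto
    have "kos_d M gs e xs = kos_d M gs q xs"
      unfolding q_def using kos_d_minus[of gs e "kos_d M gs g" xs] kos_d_kos_d[OF gs, of g xs] eM gM gs deM by simp
    also have "\<dots> = kos_d M gs (\<lambda>xs. l xs \<oplus>\<^bsub>M\<^esub> y \<odot>\<^bsub>M\<^esub> b xs) xs" using lb(3) by presburger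
    also have "\<dots> = kos_d M gs l xs \<oplus>\<^bsub>M\<^esub> kos_d M gs (\<lambda>xs. y \<odot>\<^bsub>M\<^esub> b xs) xs"
      using lM lb(2) gs y by (intro kos_d_add) auto
    also have "kos_d M gs (\<lambda>xs. y \<odot>\<^bsub>M\<^esub> b xs) xs = y \<odot>\<^bsub>M\<^esub> kos_d M gs b xs"
      using lb(2) gs y by (intro kos_d_smult) auto
    finally have de: "kos_d M gs e xs = kos_d M gs l xs \<oplus>\<^bsub>M\<^esub> y \<odot>\<^bsub>M\<^esub> kos_d M gs b xs" .
    define k where "k = kos_h M rs (kos_d M gs c) xs"
    have kM: "k \<in> carrier M" unfolding k_def by (rule LM[OF hL])
    have "y \<odot>\<^bsub>M\<^esub> (c xs \<ominus>\<^bsub>M\<^esub> kos_d M gs b xs) = y \<odot>\<^bsub>M\<^esub> c xs \<ominus>\<^bsub>M\<^esub> y \<odot>\<^bsub>M\<^esub> kos_d M gs b xs"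
      using y cM dbM by (intro smult_minus) auto
    also have "\<dots> = kos_d M gs l xs \<oplus>\<^bsub>M\<^esub> k \<oplus>\<^bsub>M\<^esub> (y \<odot>\<^bsub>M\<^esub> kos_d M gs b xs \<oplus>\<^bsub>M\<^esub> \<ominus>\<^bsub>M\<^esub> (y \<odot>\<^bsub>M\<^esub> kos_d M gs b xs))"
      unfolding homo[OF True] de k_def[symmetric] using kM dbM y by (simp add: a_minus_def M.a_ac)
    also have "\<dots> = kos_d M gs l xs \<oplus>\<^bsub>M\<^esub> k" using kM dbM y by (simp add: M.r_neg)
    also have "\<dots> \<in> L" unfolding k_def by (intro submodule_add[OF L] kos_d_closed[OF L gs] lb(1) hL)
    finally show ?thesis using reg cM dbM by simp
  next
    case False
    have "kos_d M gs b xs = \<zero>\<^bsub>M\<^esub>" using cochains_zero[OF cochains_kos_d[OF MM gs refl b], of xs] False by simp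
    moreover have "c xs = \<zero>\<^bsub>M\<^esub>" using cochains_zero[OF c] False by simp
    ultimately show ?thesis using submodule_zero[OF L] by simp
  qed
  then show ?case using b by blast
qed

end

text \<open>View a cocycle of \<open>S\<close> as one of \<open>R\<close>. Since powers of \<open>vs\<close> lie in the ideal of \<open>R\<close> that the
  powers of \<open>fs\<close> generate, it is a coboundary over \<open>R\<close> by \<open>koszul_depth\<close>. Applying \<open>\<rho>\<close>, which
  is linear over \<open>S\<close> and multiplies the cocycle by \<open>z\<close>, brings this back to \<open>S\<close>.\<close>

theorem kills_by_retraction:
  fixes R :: "('s, 'b) ring_scheme"
  assumes R: "cring R" and S: "S = R\<lparr>carrier := C\<rparr>" and CR: "C \<subseteq> carrier R" and cS: "cring S"
    and fs: "set fs \<subseteq> C" and z: "z \<in> C"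
    and ret: "\<rho> \<in> lin_maps S (self_module R) (self_module S)" "\<And>s. s \<in> C \<Longrightarrow> \<rho> s = z \<otimes>\<^bsub>R\<^esub> s"
    and reg: "\<And>m. module.regular_mod (self_module R) (map (\<lambda>x. x [^]\<^bsub>R\<^esub> (m::nat)) vs) {\<zero>\<^bsub>R\<^esub>}"
    and vs: "set vs \<subseteq> carrier R" "\<And>x. x \<in> set vs \<Longrightarrow> \<exists>n. x [^]\<^bsub>R\<^esub> (n::nat) \<in> Idl\<^bsub>R\<^esub> (set fs)"
    and t: "t < int (length vs)"
  shows "kills S fs (self_module S) C z t"
proof (rule killsI)
  interpret R: cring R by fact
  interpret S: cring S by fact
  note mR = R.self_module_is_module and mS = S.self_module_is_module
  have ops: "carrier S = C" "mult S = mult R" "add S = add R" "zero S = zero R" "one S = one R"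
    by (simp_all add: S)
  have SR: "carrier (self_module Q) = carrier Q" "smult (self_module Q) = mult Q"
     "add (self_module Q) = add Q" "zero (self_module Q) = zero Q" for Q :: "('s, 'c) ring_scheme" by (simp_all add: self_module_def)
  interpret A: module R "self_module R" by (rule mR)
  have "module S (self_module R)"
  proof (rule moduleI)
    show "abelian_group (self_module R)" by (rule A.M.abelian_group_axioms)
  qed (use CR in \<open>auto simp: SR ops R.l_distr R.r_distr R.m_assoc cS subset_iff\<close>)
  then interpret lam: module_map S "self_module R" "self_module S" \<rho>
    using ret(1) mS by (intro module_map.intro module_map_axioms.intro)
  interpret i: module_map S "self_module S" "self_module R" "\<lambda>x. x"
    using CR mS lam.M.module_axioms by (intro module_map.intro module_map_axioms.intro) (auto simp: lin_maps_def SR ops)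
  have fsR: "set fs \<subseteq> carrier R" and fsS: "set fs \<subseteq> carrier S" using fs CR by (auto simp: ops)
  fix N c
  assume c: "c \<in> cochains (self_module S) C (length fs) t"
    and dc: "\<And>xs. kos_d (self_module S) (powers S fs N) c xs = \<zero>\<^bsub>self_module S\<^esub>"
  let ?gs = "powers R fs N"
  have pow: "powers S fs N = ?gs" by (simp add: powers_def nat_pow_def S)
  have gsR: "set ?gs \<subseteq> carrier R" by (rule R.powers_carrier[OF fsR])
  have gsS: "set ?gs \<subseteq> carrier S" using S.powers_carrier[OF fsS, of N] by (simp add: pow)
  have cC: "c xs \<in> C" for xs using lam.N.cochains_closed[OF c] .
  have cR: "c \<in> cochains (self_module R) (carrier R) (length ?gs) t"
    using A.cochains_mono[OF i.map_cochains[OF c]] CR by simp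
  have dcR: "kos_d (self_module R) ?gs c xs \<in> {\<zero>\<^bsub>R\<^esub>}" for xs
    using i.map_kos_d[OF gsS, of c xs] dc[of xs] cC by (simp add: SR ops pow)
  have idealI: "ideal (Idl\<^bsub>R\<^esub> (set fs)) R" and idealL: "ideal (Idl\<^bsub>R\<^esub> (set ?gs)) R"
    using R.genideal_ideal fsR gsR by blast+
  have up: "x [^]\<^bsub>R\<^esub> (a + b) \<in> Idl\<^bsub>R\<^esub> (set ?gs)"
    if "x \<in> carrier R" "x [^]\<^bsub>R\<^esub> a \<in> Idl\<^bsub>R\<^esub> (set ?gs)" for x and a b :: nat
    using ideal.I_r_closed[OF idealL that(2), of "x [^]\<^bsub>R\<^esub> b"] that(1) by (simp add: R.nat_pow_mult)
  have "\<exists>e. x [^]\<^bsub>R\<^esub> (e::nat) \<in> Idl\<^bsub>R\<^esub> (set ?gs)" if x: "x \<in> set vs" for x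
  proof -
    obtain n where n: "x [^]\<^bsub>R\<^esub> (n::nat) \<in> Idl\<^bsub>R\<^esub> (set fs)" using vs(2)[OF x] by blast
    have xR: "x \<in> carrier R" using x vs(1) by auto
    \<comment> \<open>Any product of this many elements of \<open>fs\<close> contains an \<open>N\<close>-th power.\<close>
    let ?k = "Suc (\<Sum>f\<in>set fs. N)"
    have "(x [^]\<^bsub>R\<^esub> n) [^]\<^bsub>R\<^esub> ?k \<odot>\<^bsub>self_module R\<^esub> \<one>\<^bsub>R\<^esub> \<in> Idl\<^bsub>R\<^esub> (set ?gs)"
    proof (rule A.ideal_pow_torsion[OF _ fsR R.ideal_submodule[OF idealL]])
      show "(x [^]\<^bsub>R\<^esub> n) [^]\<^bsub>R\<^esub> ?k \<in> ideal_pow R (Idl\<^bsub>R\<^esub> (set fs)) ?k"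
        by (rule A.power_in_ideal_pow[OF idealI n])
      fix f assume f: "f \<in> set fs"
      then have "f [^]\<^bsub>R\<^esub> N \<in> set ?gs" by (simp add: powers_def)
      then show "f [^]\<^bsub>R\<^esub> N \<odot>\<^bsub>self_module R\<^esub> \<one>\<^bsub>R\<^esub> \<in> Idl\<^bsub>R\<^esub> (set ?gs)"
        using R.genideal_self[OF gsR] f fsR by (auto simp: SR subset_iff)
    qed (auto simp: SR)
    then show ?thesis using xR by (auto simp: SR R.nat_pow_pow R.nat_pow_mult)
  qed
  then obtain e where e: "\<And>x. x \<in> set vs \<Longrightarrow> x [^]\<^bsub>R\<^esub> (e x :: nat) \<in> Idl\<^bsub>R\<^esub> (set ?gs)" by metis
  define m where "m = Max (insert 0 (e ` set vs))"
  have xm: "x [^]\<^bsub>R\<^esub> m \<in> Idl\<^bsub>R\<^esub> (set ?gs)" if x: "x \<in> set vs" for x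
  proof -
    have "e x \<le> m" unfolding m_def using x by (intro Max_ge) auto
    then show ?thesis using up[OF _ e[OF x], of "m - e x"] x vs(1) by auto
  qed
  have zeroS: "submodule {\<zero>\<^bsub>R\<^esub>} R (self_module R)" by (rule R.ideal_submodule[OF R.zeroideal])
  obtain h where h: "h \<in> cochains (self_module R) (carrier (self_module R)) (length ?gs) (t - 1)"
    and ch: "\<And>xs. c xs \<ominus>\<^bsub>self_module R\<^esub> kos_d (self_module R) ?gs h xs \<in> {\<zero>\<^bsub>R\<^esub>}"
    using A.koszul_depth[OF gsR zeroS reg[of m] _ _ _ dcR, of t] xm cR t by (auto simp: SR)
  have hR: "h xs \<in> carrier R" for xs using A.cochains_closed[OF h] by (simp add: SR)
  have eq: "c xs = kos_d (self_module R) ?gs h xs" for xs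
  proof -
    have "kos_d (self_module R) ?gs h xs \<in> carrier (self_module R)" "c xs \<in> carrier (self_module R)"
      using A.kos_d_carrier[OF gsR, of h xs] hR cC[of xs] CR by (auto simp: SR)
    moreover have "c xs \<ominus>\<^bsub>self_module R\<^esub> kos_d (self_module R) ?gs h xs = \<zero>\<^bsub>self_module R\<^esub>" using ch[of xs] by (simp add: SR)
    ultimately show ?thesis by (metis A.M.add.inv_closed A.M.add.inv_equality A.M.minus_minus a_minus_def)
  qed
  have "z \<odot>\<^bsub>self_module S\<^esub> kos_t (self_module S) (powers S fs 0) c xs
      = kos_d (self_module S) (powers S fs (N + 0)) (\<lambda>xs. \<rho> (h xs)) xs" for xs
  proof -
    have "kos_t (self_module S) (powers S fs 0) c xs = c xs"
      using lam.N.kos_t_powers_0[OF fsS] c by (simp add: SR ops)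
    moreover have "z \<otimes>\<^bsub>R\<^esub> c xs = \<rho> (kos_d (self_module R) ?gs h xs)" using ret(2)[OF cC[of xs]] eq[of xs] by simp
    moreover have "\<rho> (kos_d (self_module R) ?gs h xs) = kos_d (self_module S) ?gs (\<lambda>xs. \<rho> (h xs)) xs"
      using hR by (intro lam.map_kos_d gsS) (simp add: SR)
    ultimately show ?thesis by (simp add: SR ops pow)
  qed
  moreover have "(\<lambda>xs. \<rho> (h xs)) \<in> cochains (self_module S) C (length fs) (t - 1)"
  proof (rule lam.N.cochains_change)
    show "(\<lambda>xs. \<rho> (h xs)) \<in> cochains (self_module S) (\<rho> ` carrier (self_module R)) (length fs) (t - 1)"
      using lam.map_cochains[OF h] by simp
    show "\<rho> (h xs) \<in> C" for xs using lam.map_closed[of "h xs"] hR by (simp add: SR ops)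
  qed
  ultimately show "\<exists>k. \<exists>h\<in>cochains (self_module S) C (length fs) (t - 1).
       \<forall>xs. z \<odot>\<^bsub>self_module S\<^esub> kos_t (self_module S) (powers S fs k) c xs = kos_d (self_module S) (powers S fs (N + k)) h xs"
    by blast
qed

section \<open>Traces and orbit polynomials\<close>

text \<open>A finite group of automorphisms of the ring \<open>RR\<close>. The multiplication of the group enters
  only through the permutation \<open>\<beta>\<close> of the index set that composition with one automorphism
  induces.\<close>

locale finite_action =
  fixes RR :: "'a::comm_ring_1 set" and H :: "'g set" and act :: "'g \<Rightarrow> 'a \<Rightarrow> 'a" and e :: 'g
  assumes one_RR: "1 \<in> RR"
    and add_RR: "\<And>x y. x \<in> RR \<Longrightarrow> y \<in> RR \<Longrightarrow> x + y \<in> RR"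
    and neg_RR: "\<And>x. x \<in> RR \<Longrightarrow> - x \<in> RR"
    and mult_RR: "\<And>x y. x \<in> RR \<Longrightarrow> y \<in> RR \<Longrightarrow> x * y \<in> RR"
    and finite_H: "finite H" and e_H: "e \<in> H"
    and act_RR: "\<And>g x. g \<in> H \<Longrightarrow> x \<in> RR \<Longrightarrow> act g x \<in> RR"
    and act_add: "\<And>g x y. g \<in> H \<Longrightarrow> x \<in> RR \<Longrightarrow> y \<in> RR \<Longrightarrow> act g (x + y) = act g x + act g y"
    and act_mult: "\<And>g x y. g \<in> H \<Longrightarrow> x \<in> RR \<Longrightarrow> y \<in> RR \<Longrightarrow> act g (x * y) = act g x * act g y"
    and act_one: "\<And>g. g \<in> H \<Longrightarrow> act g 1 = 1"
    and act_e: "\<And>x. x \<in> RR \<Longrightarrow> act e x = x"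
    and act_act: "\<And>k. k \<in> H \<Longrightarrow> \<exists>\<beta>. bij_betw \<beta> H H \<and> (\<forall>h\<in>H. \<forall>x\<in>RR. act k (act h x) = act (\<beta> h) x)"
begin

lemma zero_RR: "0 \<in> RR"
  using add_RR[OF one_RR neg_RR[OF one_RR]] by simp

lemma sum_RR: "(\<And>i. i \<in> I \<Longrightarrow> f i \<in> RR) \<Longrightarrow> sum f I \<in> RR"
  by (induction I rule: infinite_finite_induct) (auto intro: zero_RR add_RR)

lemma prod_RR: "(\<And>i. i \<in> I \<Longrightarrow> f i \<in> RR) \<Longrightarrow> prod f I \<in> RR"
  by (induction I rule: infinite_finite_induct) (auto intro: one_RR mult_RR)

lemma power_RR: "x \<in> RR \<Longrightarrow> x ^ n \<in> RR"
  by (induction n) (auto intro: one_RR mult_RR)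

lemma act_zero: "g \<in> H \<Longrightarrow> act g 0 = 0"
  using act_add[of g 0 0] zero_RR by simp

lemma act_neg: "g \<in> H \<Longrightarrow> x \<in> RR \<Longrightarrow> act g (- x) = - act g x"
  using act_add[of g x "- x"] neg_RR[of x] by (simp add: act_zero eq_neg_iff_add_eq_0 add.commute)

lemma act_sum: "g \<in> H \<Longrightarrow> (\<And>i. i \<in> I \<Longrightarrow> f i \<in> RR) \<Longrightarrow> act g (sum f I) = (\<Sum>i\<in>I. act g (f i))"
  by (induction I rule: infinite_finite_induct) (auto simp: act_zero act_add sum_RR)

lemma act_prod: "g \<in> H \<Longrightarrow> (\<And>i. i \<in> I \<Longrightarrow> f i \<in> RR) \<Longrightarrow> act g (prod f I) = (\<Prod>i\<in>I. act g (f i))"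
  by (induction I rule: infinite_finite_induct) (auto simp: act_one act_mult prod_RR)

lemma act_power: "g \<in> H \<Longrightarrow> x \<in> RR \<Longrightarrow> act g (x ^ n) = act g x ^ n"
  by (induction n) (auto simp: act_one act_mult power_RR)

definition invariant :: "'a \<Rightarrow> bool" where
  "invariant x \<longleftrightarrow> x \<in> RR \<and> (\<forall>g\<in>H. act g x = x)"

lemma invariant_mult: "invariant x \<Longrightarrow> invariant y \<Longrightarrow> invariant (x * y)"
  by (auto simp: invariant_def mult_RR act_mult)

lemma invariant_prod: "(\<And>i. i \<in> I \<Longrightarrow> invariant (f i)) \<Longrightarrow> invariant (prod f I)"
  by (auto simp: invariant_def prod_RR act_prod)

definition trace :: "'a \<Rightarrow> 'a" where
  "trace x = (\<Sum>h\<in>H. act h x)"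

lemma trace_invariant: "x \<in> RR \<Longrightarrow> invariant (trace x)"
proof -
  assume x: "x \<in> RR"
  have "act k (trace x) = trace x" if k: "k \<in> H" for k
  proof -
    obtain \<beta> where \<beta>: "bij_betw \<beta> H H" "\<And>h y. h \<in> H \<Longrightarrow> y \<in> RR \<Longrightarrow> act k (act h y) = act (\<beta> h) y"
      using act_act[OF k] by blast
    have "act k (trace x) = (\<Sum>h\<in>H. act (\<beta> h) x)"
      unfolding trace_def using k x \<beta>(2) by (simp add: act_sum act_RR)
    also have "\<dots> = trace x" unfolding trace_def by (rule sum.reindex_bij_betw[OF \<beta>(1)])
    finally show ?thesis .
  qed
  then show ?thesis using x by (simp add: invariant_def trace_def sum_RR act_RR)
qed

lemma trace_mult: "invariant s \<Longrightarrow> x \<in> RR \<Longrightarrow> trace (x * s) = trace x * s"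
  by (simp add: trace_def invariant_def act_mult sum_distrib_right)

lemma trace_add: "x \<in> RR \<Longrightarrow> y \<in> RR \<Longrightarrow> trace (x + y) = trace x + trace y"
  by (simp add: trace_def act_add sum.distrib)

lemma trace_sum: "(\<And>i. i \<in> I \<Longrightarrow> f i \<in> RR) \<Longrightarrow> trace (sum f I) = (\<Sum>i\<in>I. trace (f i))"
  by (simp add: trace_def act_sum sum.swap[of _ I])

text \<open>The norm of \<open>D = \<Sum> X\<^sub>i tr(Y\<^sub>i)\<close> is \<open>\<Prod>\<^sub>h \<Sum>\<^sub>i h(X\<^sub>i) tr(Y\<^sub>i)\<close>. Multiply out and collect the terms
  with equal products of traces: the group permutes them, so their coefficients add up to an
  invariant. An invariant multiple of a trace is a trace.\<close>

lemma norm_in_trace_ideal: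
  assumes I: "finite I" and X: "\<And>i. i \<in> I \<Longrightarrow> X i \<in> RR" and Y: "\<And>i. i \<in> I \<Longrightarrow> Y i \<in> RR"
    and D: "invariant D" "D = (\<Sum>i\<in>I. X i * trace (Y i))"
  shows "\<exists>t\<in>RR. trace t = D ^ card H"
proof -
  let ?S = "PiE H (\<lambda>_. I)"
  \<comment> \<open>A choice \<open>s\<close> of one summand in each factor contributes \<open>c s\<close> times the product of traces \<open>F s\<close>.\<close>
  define c where "c = (\<lambda>s. \<Prod>h\<in>H. act h (X (s h)))"
  define F where "F = (\<lambda>s. \<Prod>h\<in>H. trace (Y (s h)))"
  have S: "s \<in> ?S \<Longrightarrow> h \<in> H \<Longrightarrow> s h \<in> I" for s h by auto
  have fin: "finite ?S" using finite_H I by (intro finite_PiE) auto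
  have cRR: "c s \<in> RR" if "s \<in> ?S" for s unfolding c_def using S[OF that] by (intro prod_RR act_RR X) auto
  have inv_T: "invariant (trace (Y i))" if "i \<in> I" for i by (rule trace_invariant[OF Y[OF that]])
  have "D ^ card H = (\<Prod>h\<in>H. act h D)" using D(1) by (simp add: invariant_def)
  also have "\<dots> = (\<Prod>h\<in>H. \<Sum>i\<in>I. act h (X i) * trace (Y i))"
  proof (rule prod.cong[OF refl])
    fix h assume h: "h \<in> H"
    have T: "trace (Y i) \<in> RR" "act h (trace (Y i)) = trace (Y i)" if "i \<in> I" for i
      using inv_T[OF that] h by (auto simp: invariant_def)
    have "act h D = (\<Sum>i\<in>I. act h (X i * trace (Y i)))"
      unfolding D(2) using h X T by (intro act_sum mult_RR) auto
    also have "\<dots> = (\<Sum>i\<in>I. act h (X i) * trace (Y i))"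
      using h X T by (intro sum.cong) (auto simp: act_mult)
    finally show "act h D = (\<Sum>i\<in>I. act h (X i) * trace (Y i))" .
  qed
  also have "\<dots> = (\<Sum>s\<in>?S. \<Prod>h\<in>H. act h (X (s h)) * trace (Y (s h)))"
    by (rule prod_sum_PiE[OF finite_H]) (rule I)
  also have "\<dots> = (\<Sum>s\<in>?S. c s * F s)" by (simp add: c_def F_def prod.distrib)
  also have "\<dots> = (\<Sum>y\<in>F ` ?S. \<Sum>s | s \<in> ?S \<and> F s = y. c s * F s)"
    by (rule sum.image_gen[OF fin])
  also have "\<dots> = (\<Sum>y\<in>F ` ?S. y * (\<Sum>s | s \<in> ?S \<and> F s = y. c s))"
    by (intro sum.cong refl) (simp add: sum_distrib_left mult.commute)
  finally have eq: "D ^ card H = (\<Sum>y\<in>F ` ?S. y * (\<Sum>s | s \<in> ?S \<and> F s = y. c s))" .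
  have inv_c: "invariant (\<Sum>s | s \<in> ?S \<and> F s = y. c s)" for y
  proof -
    let ?Sy = "{s. s \<in> ?S \<and> F s = y}"
    have "act k (sum c ?Sy) = sum c ?Sy" if k: "k \<in> H" for k
    proof -
      obtain \<beta> where \<beta>: "bij_betw \<beta> H H" "\<And>h x. h \<in> H \<Longrightarrow> x \<in> RR \<Longrightarrow> act k (act h x) = act (\<beta> h) x"
        using act_act[OF k] by blast
      define \<gamma> where "\<gamma> = inv_into H \<beta>"
      have \<gamma>: "bij_betw \<gamma> H H" unfolding \<gamma>_def by (rule bij_betw_inv_into[OF \<beta>(1)])
      have \<gamma>\<beta>: "\<gamma> (\<beta> h) = h" "\<beta> (\<gamma> h) = h" if "h \<in> H" for h
        unfolding \<gamma>_def using \<beta>(1) that by (auto simp: bij_betw_def f_inv_into_f)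
      have \<beta>H: "\<beta> h \<in> H" "\<gamma> h \<in> H" if "h \<in> H" for h using \<beta>(1) \<gamma> that by (auto simp: bij_betw_def)
      have Fr: "F (restrict (s \<circ> \<delta>) H) = F s" if "bij_betw \<delta> H H" for \<delta> s
      proof -
        have "F (restrict (s \<circ> \<delta>) H) = (\<Prod>h\<in>H. trace (Y (s (\<delta> h))))" unfolding F_def by (intro prod.cong) auto
        also have "\<dots> = F s" unfolding F_def by (rule prod.reindex_bij_betw[OF that])
        finally show ?thesis .
      qed
      have bij: "bij_betw (\<lambda>s. restrict (s \<circ> \<gamma>) H) ?Sy ?Sy"
      proof (rule bij_betw_byWitness[where f' = "\<lambda>s. restrict (s \<circ> \<beta>) H"])
        show "\<forall>s\<in>?Sy. restrict (restrict (s \<circ> \<gamma>) H \<circ> \<beta>) H = s"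
        proof
          fix s assume "s \<in> ?Sy"
          then have "s \<in> extensional H" by (auto simp: PiE_def)
          then show "restrict (restrict (s \<circ> \<gamma>) H \<circ> \<beta>) H = s"
            using \<gamma>\<beta> \<beta>H by (intro extensionalityI[of _ H]) auto
        qed
        show "\<forall>s\<in>?Sy. restrict (restrict (s \<circ> \<beta>) H \<circ> \<gamma>) H = s"
        proof
          fix s assume "s \<in> ?Sy"
          then have "s \<in> extensional H" by (auto simp: PiE_def)
          then show "restrict (restrict (s \<circ> \<beta>) H \<circ> \<gamma>) H = s"
            using \<gamma>\<beta> \<beta>H by (intro extensionalityI[of _ H]) auto
        qed
        show "(\<lambda>s. restrict (s \<circ> \<gamma>) H) ` ?Sy \<subseteq> ?Sy" using Fr[OF \<gamma>] \<beta>H by auto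
        show "(\<lambda>s. restrict (s \<circ> \<beta>) H) ` ?Sy \<subseteq> ?Sy" using Fr[OF \<beta>(1)] \<beta>H by auto
      qed
      have "act k (sum c ?Sy) = (\<Sum>s\<in>?Sy. act k (c s))" using k cRR by (intro act_sum) auto
      also have "\<dots> = (\<Sum>s\<in>?Sy. c (restrict (s \<circ> \<gamma>) H))"
      proof (rule sum.cong[OF refl])
        fix s assume s: "s \<in> ?Sy"
        then have X': "X (s h) \<in> RR" if "h \<in> H" for h using X S that by blast
        have "act k (c s) = (\<Prod>h\<in>H. act k (act h (X (s h))))" unfolding c_def using k X' by (intro act_prod act_RR) auto
        also have "\<dots> = (\<Prod>h\<in>H. act (\<beta> h) (X (s (\<gamma> (\<beta> h)))))" using \<beta>(2) X' \<gamma>\<beta> by (intro prod.cong) auto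
        also have "\<dots> = (\<Prod>h\<in>H. act h (X (s (\<gamma> h))))"
          by (rule prod.reindex_bij_betw[OF \<beta>(1), of "\<lambda>h. act h (X (s (\<gamma> h)))"])
        also have "\<dots> = c (restrict (s \<circ> \<gamma>) H)" unfolding c_def by (intro prod.cong) auto
        finally show "act k (c s) = c (restrict (s \<circ> \<gamma>) H)" .
      qed
      also have "\<dots> = sum c ?Sy" by (rule sum.reindex_bij_betw[OF bij])
      finally show ?thesis .
    qed
    then show ?thesis unfolding invariant_def using cRR by (auto intro!: sum_RR)
  qed
  have "\<exists>t\<in>RR. y * (\<Sum>s | s \<in> ?S \<and> F s = y. c s) = trace t" if y: "y \<in> F ` ?S" for y
  proof -
    obtain s where s: "s \<in> ?S" "y = F s" using y by blast
    define w where "w = (\<Prod>h\<in>H - {e}. trace (Y (s h))) * (\<Sum>s | s \<in> ?S \<and> F s = y. c s)"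
    have w: "invariant w" unfolding w_def using S[OF s(1)] inv_T by (intro invariant_mult invariant_prod inv_c) auto
    have "y * (\<Sum>s | s \<in> ?S \<and> F s = y. c s) = trace (Y (s e)) * w"
      unfolding w_def s(2) F_def using prod.remove[OF finite_H e_H, of "\<lambda>h. trace (Y (s h))"] by (simp add: mult_ac)
    also have "\<dots> = trace (Y (s e) * w)" using w Y[OF S[OF s(1) e_H]] by (simp add: trace_mult)
    finally show ?thesis using w Y[OF S[OF s(1) e_H]] by (auto simp: invariant_def intro!: mult_RR)
  qed
  then have "\<forall>y\<in>F ` ?S. \<exists>t. t \<in> RR \<and> y * (\<Sum>s | s \<in> ?S \<and> F s = y. c s) = trace t" by blast
  from bchoice[OF this] obtain t
    where t: "\<And>y. y \<in> F ` ?S \<Longrightarrow> t y \<in> RR" "\<And>y. y \<in> F ` ?S \<Longrightarrow> y * (\<Sum>s | s \<in> ?S \<and> F s = y. c s) = trace (t y)"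
    by blast
  have "D ^ card H = trace (\<Sum>y\<in>F ` ?S. t y)" unfolding eq using t by (simp add: trace_sum)
  then show ?thesis using t(1) sum_RR by metis
qed

text \<open>For \<open>g \<noteq> e\<close> let \<open>D\<close> be a multiple of \<open>f\<^sub>g - g f\<^sub>g\<close>. Expanding \<open>\<Prod>\<^sub>g (g f\<^sub>g - h f\<^sub>g)\<close> over \<open>g \<noteq> e\<close>
  gives \<open>\<Sum>\<^sub>A x\<^sub>A h(y\<^sub>A)\<close>. The product vanishes for \<open>h \<noteq> e\<close>, because of the factor with \<open>g = h\<close>,
  and is some \<open>u\<close> dividing a power of \<open>D\<close> for \<open>h = e\<close>. Summing over \<open>h\<close> yields
  \<open>u = \<Sum>\<^sub>A x\<^sub>A tr(y\<^sub>A)\<close>. So a power of \<open>D\<close> lies in the ideal generated by the traces, and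
  \<open>norm_in_trace_ideal\<close> makes a higher power a trace.\<close>

theorem power_in_trace:
  assumes D: "invariant D"
    and sep: "\<And>g. g \<in> H \<Longrightarrow> g \<noteq> e \<Longrightarrow> \<exists>f\<in>RR. \<exists>w\<in>RR. D = (f - act g f) * w"
  shows "\<exists>t\<in>RR. \<exists>n. trace t = D ^ n"
proof -
  let ?H = "H - {e}"
  have finH: "finite ?H" using finite_H by simp
  obtain f w where fw: "\<And>g. g \<in> ?H \<Longrightarrow> f g \<in> RR" "\<And>g. g \<in> ?H \<Longrightarrow> w g \<in> RR"
    "\<And>g. g \<in> ?H \<Longrightarrow> D = (f g - act g (f g)) * w g" using sep by (metis DiffE insertI1)
  define u where "u = (\<Prod>g\<in>?H. act g (f g) - f g)"
  define v where "v = (\<Prod>g\<in>?H. - w g)"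
  define x where "x = (\<lambda>A. \<Prod>g\<in>A. act g (f g))"
  define y where "y = (\<lambda>A. \<Prod>g\<in>?H - A. - f g)"
  have x: "x A \<in> RR" if "A \<in> Pow ?H" for A unfolding x_def using that fw(1) by (intro prod_RR act_RR) auto
  have y: "y A \<in> RR" if "A \<in> Pow ?H" for A unfolding y_def using that fw(1) by (intro prod_RR neg_RR) auto
  have v: "v \<in> RR" unfolding v_def using fw(2) by (intro prod_RR neg_RR) auto
  have "D ^ card ?H = (\<Prod>g\<in>?H. (act g (f g) - f g) * (- w g))"
  proof -
    have "(\<Prod>g\<in>?H. (act g (f g) - f g) * (- w g)) = (\<Prod>g\<in>?H. D)"
      by (intro prod.cong refl) (simp add: fw(3) algebra_simps)
    then show ?thesis by simp
  qed
  also have "\<dots> = u * v" unfolding u_def v_def by (rule prod.distrib)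
  finally have Duv: "D ^ card ?H = v * u" by (simp add: mult.commute)
  have expand: "(\<Sum>A\<in>Pow ?H. x A * act h (y A)) = (if h = e then u else 0)" if h: "h \<in> H" for h
  proof -
    have "(\<Sum>A\<in>Pow ?H. x A * act h (y A)) = (\<Sum>A\<in>Pow ?H. (\<Prod>g\<in>A. act g (f g)) * (\<Prod>g\<in>?H - A. - act h (f g)))"
    proof (rule sum.cong[OF refl])
      fix A assume A: "A \<in> Pow ?H"
      have "act h (y A) = (\<Prod>g\<in>?H - A. act h (- f g))" unfolding y_def using h fw(1) by (intro act_prod neg_RR) auto
      also have "\<dots> = (\<Prod>g\<in>?H - A. - act h (f g))" using h fw(1) by (intro prod.cong) (auto simp: act_neg)
      finally show "x A * act h (y A) = (\<Prod>g\<in>A. act g (f g)) * (\<Prod>g\<in>?H - A. - act h (f g))" by (simp add: x_def)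
    qed
    also have "\<dots> = (\<Prod>g\<in>?H. act g (f g) + - act h (f g))" by (rule prod_add[OF finH, symmetric])
    also have "\<dots> = (if h = e then u else 0)"
    proof (cases "h = e")
      case True
      have "(\<Prod>g\<in>?H. act g (f g) + - act h (f g)) = u"
        unfolding u_def True using fw(1) act_e by (intro prod.cong) auto
      then show ?thesis using True by simp
    next
      case False
      then have "h \<in> ?H" using h by simp
      then have "(\<Prod>g\<in>?H. act g (f g) + - act h (f g)) = 0" using finH by (intro prod_zero) auto
      then show ?thesis using False by simp
    qed
    finally show ?thesis .
  qed
  have "(\<Sum>A\<in>Pow ?H. x A * trace (y A)) = (\<Sum>h\<in>H. \<Sum>A\<in>Pow ?H. x A * act h (y A))"
    unfolding trace_def sum_distrib_left by (rule sum.swap)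
  also have "\<dots> = u" using expand finite_H e_H by simp
  finally have u: "u = (\<Sum>A\<in>Pow ?H. x A * trace (y A))" ..
  have "\<exists>t\<in>RR. trace t = (D ^ card ?H) ^ card H"
  proof (rule norm_in_trace_ideal)
    show "finite (Pow ?H)" using finH by simp
    show "v * x A \<in> RR" if "A \<in> Pow ?H" for A using mult_RR[OF v x[OF that]] .
    show "y A \<in> RR" if "A \<in> Pow ?H" for A by (rule y[OF that])
    show "invariant (D ^ card ?H)" using D by (simp add: invariant_def power_RR act_power)
    show "D ^ card ?H = (\<Sum>A\<in>Pow ?H. v * x A * trace (y A))"
      unfolding Duv by (subst u) (simp add: sum_distrib_left mult_ac)
  qed
  then show ?thesis by (metis power_mult)
qed

text \<open>The coefficient of \<open>X\<^bsup>n-j\<^esup>\<close> in the orbit polynomial \<open>\<Prod>\<^sub>g (X - g x)\<close>, where \<open>n\<close> is the order of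
  the group.\<close>

definition orbit_coeff :: "'a \<Rightarrow> nat \<Rightarrow> 'a" where
  "orbit_coeff x j = (\<Sum>A | A \<subseteq> H \<and> card A = j. \<Prod>g\<in>A. - act g x)"

lemma orbit_coeff_invariant:
  assumes x: "x \<in> RR" shows "invariant (orbit_coeff x j)"
proof -
  let ?P = "{A. A \<subseteq> H \<and> card A = j}"
  have p: "(\<Prod>g\<in>A. - act g x) \<in> RR" if "A \<in> ?P" for A using that x by (intro prod_RR neg_RR act_RR) auto
  have "act k (orbit_coeff x j) = orbit_coeff x j" if k: "k \<in> H" for k
  proof -
    obtain \<beta> where \<beta>: "bij_betw \<beta> H H" "\<And>h y. h \<in> H \<Longrightarrow> y \<in> RR \<Longrightarrow> act k (act h y) = act (\<beta> h) y"
      using act_act[OF k] by blast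
    have inj: "inj_on \<beta> H" and im: "\<beta> ` H = H" using \<beta>(1) by (auto simp: bij_betw_def)
    have bij: "bij_betw (\<lambda>A. \<beta> ` A) ?P ?P"
    proof (rule bij_betw_imageI)
      show "inj_on (image \<beta>) ?P"
        by (rule inj_onI) (metis (mono_tags, lifting) inj inj_on_image_eq_iff mem_Collect_eq)
      show "image \<beta> ` ?P = ?P"
      proof
        show "image \<beta> ` ?P \<subseteq> ?P" using im card_image[OF inj_on_subset[OF inj]] by auto
        show "?P \<subseteq> image \<beta> ` ?P"
        proof
          fix A assume A: "A \<in> ?P"
          then obtain C where C: "C \<subseteq> H" "A = \<beta> ` C" using im by (metis mem_Collect_eq subset_imageE)
          then show "A \<in> image \<beta> ` ?P" using A card_image[OF inj_on_subset[OF inj C(1)]] by auto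
        qed
      qed
    qed
    have "act k (orbit_coeff x j) = (\<Sum>A\<in>?P. act k (\<Prod>g\<in>A. - act g x))"
      unfolding orbit_coeff_def using k p by (intro act_sum) auto
    also have "\<dots> = (\<Sum>A\<in>?P. \<Prod>g\<in>\<beta> ` A. - act g x)"
    proof (rule sum.cong[OF refl])
      fix A assume A: "A \<in> ?P"
      have "act k (\<Prod>g\<in>A. - act g x) = (\<Prod>g\<in>A. act k (- act g x))"
        using k A x by (intro act_prod neg_RR act_RR) auto
      also have "\<dots> = (\<Prod>g\<in>A. - act (\<beta> g) x)" using k A x \<beta>(2) by (intro prod.cong) (auto simp: act_neg act_RR)
      also have "\<dots> = (\<Prod>g\<in>\<beta> ` A. - act g x)"
        using A inj_on_subset[OF inj, of A] by (simp add: prod.reindex)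
      finally show "act k (\<Prod>g\<in>A. - act g x) = (\<Prod>g\<in>\<beta> ` A. - act g x)" .
    qed
    also have "\<dots> = orbit_coeff x j"
      unfolding orbit_coeff_def by (rule sum.reindex_bij_betw[OF bij])
    finally show ?thesis .
  qed
  then show ?thesis unfolding invariant_def orbit_coeff_def using p by (auto intro!: sum_RR)
qed

text \<open>This is the value of the orbit polynomial at \<open>x\<close>, which is zero because of the factor of the
  neutral element.\<close>

lemma orbit_equation:
  assumes x: "x \<in> RR"
  shows "x ^ card H = - (\<Sum>j\<in>{1..card H}. orbit_coeff x j * x ^ (card H - j))"
proof -
  have "0 = (\<Prod>g\<in>H. - act g x + x)"
    using e_H finite_H act_e[OF x] by (intro prod_zero[symmetric] bexI[of _ e]) auto
  also have "\<dots> = (\<Sum>A\<in>Pow H. (\<Prod>g\<in>A. - act g x) * x ^ (card H - card A))"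
    unfolding prod_add[OF finite_H] using finite_H
    by (intro sum.cong refl) (auto simp: card_Diff_subset finite_subset)
  also have "\<dots> = (\<Sum>j\<in>card ` Pow H. \<Sum>A | A \<in> Pow H \<and> card A = j. (\<Prod>g\<in>A. - act g x) * x ^ (card H - card A))"
    using finite_H by (intro sum.image_gen) auto
  also have "card ` Pow H = {0..card H}"
  proof
    show "card ` Pow H \<subseteq> {0..card H}" using finite_H card_mono by auto
    show "{0..card H} \<subseteq> card ` Pow H"
    proof
      fix j assume "j \<in> {0..card H}"
      then obtain A where "A \<subseteq> H" "card A = j" using obtain_subset_with_card_n[of j H] by auto
      then show "j \<in> card ` Pow H" by blast
    qed
  qed
  also have "(\<Sum>j\<in>{0..card H}. \<Sum>A | A \<in> Pow H \<and> card A = j. (\<Prod>g\<in>A. - act g x) * x ^ (card H - card A))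
     = (\<Sum>j\<in>{0..card H}. orbit_coeff x j * x ^ (card H - j))"
    unfolding orbit_coeff_def by (intro sum.cong refl) (simp add: sum_distrib_right Pow_def)
  also have "\<dots> = orbit_coeff x 0 * x ^ card H + (\<Sum>j\<in>{1..card H}. orbit_coeff x j * x ^ (card H - j))"
    by (simp add: sum.atLeast_Suc_atMost)
  also have "orbit_coeff x 0 = 1"
  proof -
    have "{A. A \<subseteq> H \<and> card A = 0} = {{}}" using finite_H by (auto dest: finite_subset)
    then show ?thesis by (simp add: orbit_coeff_def)
  qed
  finally show ?thesis by (simp add: eq_neg_iff_add_eq_0)
qed

end

section \<open>A chain condition for finitely generated extensions\<close>

text \<open>A submodule over the subring generated by \<open>T\<close>. Speaking of subgroups that are stable under a
  set avoids the construction of that subring.\<close>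

definition stable_subgroup :: "'a::comm_ring_1 set \<Rightarrow> 'a set \<Rightarrow> bool" where
  "stable_subgroup T L \<longleftrightarrow> 0 \<in> L \<and> (\<forall>x\<in>L. \<forall>y\<in>L. x - y \<in> L) \<and> (\<forall>t\<in>T. \<forall>x\<in>L. t * x \<in> L)"

definition acc_below :: "'a::comm_ring_1 set \<Rightarrow> 'a set \<Rightarrow> bool" where
  "acc_below T M \<longleftrightarrow> (\<forall>L :: nat \<Rightarrow> 'a set. (\<forall>n. stable_subgroup T (L n) \<and> L n \<subseteq> M \<and> L n \<subseteq> L (Suc n)) \<longrightarrow>
     (\<exists>c. \<forall>n\<ge>c. L n = L c))"

inductive_set module_span :: "'a::comm_ring_1 set \<Rightarrow> 'a set \<Rightarrow> 'a set" for T M where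
  base: "x \<in> M \<Longrightarrow> x \<in> module_span T M"
| diff: "x \<in> module_span T M \<Longrightarrow> y \<in> module_span T M \<Longrightarrow> x - y \<in> module_span T M"
| mult: "t \<in> T \<Longrightarrow> x \<in> module_span T M \<Longrightarrow> t * x \<in> module_span T M"

lemma stable_subgroup_add:
  assumes "stable_subgroup T L" "x \<in> L" "y \<in> L" shows "x + y \<in> L"
proof -
  have "0 - y \<in> L" using assms unfolding stable_subgroup_def by blast
  then have "x - (0 - y) \<in> L" using assms unfolding stable_subgroup_def by blast
  then show ?thesis by simp
qed

text \<open>Hilbert's basis theorem for modules. \<open>N n\<close> is the set of polynomial expressions in \<open>t\<close> of
  degree less than \<open>n\<close> with coefficients in \<open>M\<close>, and \<open>LC n k\<close> the set of leading coefficients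
  of those expressions of degree \<open>n\<close> that lie in \<open>L k\<close>. These sets grow with \<open>n\<close> and with \<open>k\<close>,
  so the chain condition in \<open>M\<close> makes \<open>LC n k\<close> independent of \<open>k\<close> for all large \<open>k\<close>, uniformly
  in \<open>n\<close>. An element of \<open>L k\<close> is then moved into an earlier \<open>L K\<close> by cancelling leading terms.\<close>

lemma acc_adjoin:
  fixes T M :: "'a::comm_ring_1 set"
  assumes M: "stable_subgroup T M" and acc: "acc_below T M"
  shows "acc_below (insert t T) (module_span {t} M)"
proof -
  define N where "N = rec_nat {0} (\<lambda>n X. {x + t ^ n * m | x m. x \<in> X \<and> m \<in> M})"
  have N0: "N 0 = {0}" and NS: "N (Suc n) = {x + t ^ n * m | x m. x \<in> N n \<and> m \<in> M}" for n
    by (simp_all add: N_def)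
  have M0: "0 \<in> M" and Mdiff: "\<And>x y. x \<in> M \<Longrightarrow> y \<in> M \<Longrightarrow> x - y \<in> M"
    and Mt: "\<And>s x. s \<in> T \<Longrightarrow> x \<in> M \<Longrightarrow> s * x \<in> M" using M by (auto simp: stable_subgroup_def)
  have Nst: "stable_subgroup T (N n)" for n
  proof (induction n)
    case 0 then show ?case by (simp add: N0 stable_subgroup_def)
  next
    case (Suc n)
    have "0 = 0 + t ^ n * 0" by simp
    then have 1: "0 \<in> N (Suc n)" using Suc M0 unfolding NS stable_subgroup_def by blast
    have 2: "(x + t ^ n * m) - (y + t ^ n * m') \<in> N (Suc n)" if "x \<in> N n" "y \<in> N n" "m \<in> M" "m' \<in> M" for x y m m'
    proof -
      have "(x + t ^ n * m) - (y + t ^ n * m') = (x - y) + t ^ n * (m - m')" by (simp add: algebra_simps)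
      then show ?thesis using Suc Mdiff that unfolding NS stable_subgroup_def by blast
    qed
    have 3: "s * (x + t ^ n * m) \<in> N (Suc n)" if "x \<in> N n" "s \<in> T" "m \<in> M" for x s m
    proof -
      have "s * (x + t ^ n * m) = s * x + t ^ n * (s * m)" by (simp add: algebra_simps)
      then show ?thesis using Suc Mt that unfolding NS stable_subgroup_def by blast
    qed
    show ?case unfolding stable_subgroup_def
    proof (intro conjI ballI 1)
      fix x y assume "x \<in> N (Suc n)" "y \<in> N (Suc n)"
      then show "x - y \<in> N (Suc n)" using 2 unfolding NS[of n] by blast
    next
      fix s x assume "s \<in> T" "x \<in> N (Suc n)"
      then show "s * x \<in> N (Suc n)" using 3 unfolding NS[of n] by blast
    qed
  qed
  have Nmono: "N n \<subseteq> N (Suc n)" for n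
  proof
    fix x assume "x \<in> N n"
    moreover have "x = x + t ^ n * 0" by simp
    ultimately show "x \<in> N (Suc n)" using M0 unfolding NS by blast
  qed
  have Nt: "t * x \<in> N (Suc n)" if "x \<in> N n" for x n
    using that
  proof (induction n arbitrary: x)
    case 0
    have "0 \<in> N (Suc 0)" using Nst[of "Suc 0"] unfolding stable_subgroup_def by blast
    then show ?case using 0 by (simp add: N0)
  next
    case (Suc n)
    then obtain y m where x: "x = y + t ^ n * m" "y \<in> N n" "m \<in> M" unfolding NS[of n] by blast
    have "t * x = t * y + t ^ Suc n * m" by (simp add: x algebra_simps)
    then show ?case using Suc.IH[OF x(2)] x(3) unfolding NS[of "Suc n"] by blast
  qed
  have Nle: "N a \<subseteq> N b" if "a \<le> b" for a b using lift_Suc_mono_le[of N, OF Nmono that] .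
  have union: "module_span {t} M \<subseteq> (\<Union>n. N n)"
  proof
    fix x assume "x \<in> module_span {t} M"
    then show "x \<in> (\<Union>n. N n)"
    proof (induction rule: module_span.induct)
      case (base x)
      have "x = 0 + t ^ 0 * x" by simp
      then have "x \<in> N (Suc 0)" using base unfolding NS N0 by blast
      then show ?case by blast
    next
      case (diff x y)
      then obtain a b where "x \<in> N a" "y \<in> N b" by blast
      then have "x \<in> N (max a b)" "y \<in> N (max a b)" using Nle[of a "max a b"] Nle[of b "max a b"] by auto
      then have "x - y \<in> N (max a b)" using Nst[of "max a b"] unfolding stable_subgroup_def by blast
      then show ?case by blast
    next
      case (mult s x)
      then show ?case using Nt by blast
    qed
  qed
  show ?thesis unfolding acc_below_def
  proof (intro allI impI)
    fix L :: "nat \<Rightarrow> 'a set"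
    assume "\<forall>n. stable_subgroup (insert t T) (L n) \<and> L n \<subseteq> module_span {t} M \<and> L n \<subseteq> L (Suc n)"
    then have Lst: "\<And>n. stable_subgroup (insert t T) (L n)" and LM: "\<And>n. L n \<subseteq> module_span {t} M"
      and Lmono: "\<And>n. L n \<subseteq> L (Suc n)" by auto
    have Lle: "L a \<subseteq> L b" if "a \<le> b" for a b using lift_Suc_mono_le[of L, OF Lmono that] .
    define LC where "LC = (\<lambda>n k. {m \<in> M. \<exists>x\<in>N n. x + t ^ n * m \<in> L k})"
    have LCst: "stable_subgroup T (LC n k)" for n k
      unfolding stable_subgroup_def
    proof (intro conjI ballI)
      have "0 \<in> N n" "0 \<in> L k" using Nst Lst unfolding stable_subgroup_def by blast+
      then show "0 \<in> LC n k" unfolding LC_def using M0 by force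
    next
      fix m m' assume "m \<in> LC n k" "m' \<in> LC n k"
      then obtain x y where *: "m \<in> M" "m' \<in> M" "x \<in> N n" "y \<in> N n" "x + t ^ n * m \<in> L k" "y + t ^ n * m' \<in> L k"
        unfolding LC_def by blast
      have "(x + t ^ n * m) - (y + t ^ n * m') \<in> L k" using *(5,6) Lst unfolding stable_subgroup_def by blast
      moreover have "(x + t ^ n * m) - (y + t ^ n * m') = (x - y) + t ^ n * (m - m')" by (simp add: algebra_simps)
      moreover have "x - y \<in> N n" using * Nst unfolding stable_subgroup_def by blast
      ultimately show "m - m' \<in> LC n k" unfolding LC_def using Mdiff *(1,2) by auto
    next
      fix s m assume s: "s \<in> T" and "m \<in> LC n k"
      then obtain x where *: "m \<in> M" "x \<in> N n" "x + t ^ n * m \<in> L k" unfolding LC_def by blast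
      have "s * (x + t ^ n * m) \<in> L k" using *(3) s Lst unfolding stable_subgroup_def by blast
      moreover have "s * (x + t ^ n * m) = s * x + t ^ n * (s * m)" by (simp add: algebra_simps)
      moreover have "s * x \<in> N n" using * s Nst unfolding stable_subgroup_def by blast
      ultimately show "s * m \<in> LC n k" unfolding LC_def using Mt[OF s *(1)] by auto
    qed
    have LCM: "LC n k \<subseteq> M" for n k unfolding LC_def by blast
    have LCk: "LC n k \<subseteq> LC n (Suc k)" for n k unfolding LC_def using Lmono by blast
    have LCn: "LC n k \<subseteq> LC (Suc n) k" for n k
    proof
      fix m assume "m \<in> LC n k"
      then obtain x where *: "m \<in> M" "x \<in> N n" "x + t ^ n * m \<in> L k" unfolding LC_def by blast
      have "t * (x + t ^ n * m) \<in> L k" using *(3) Lst unfolding stable_subgroup_def by blast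
      moreover have "t * (x + t ^ n * m) = t * x + t ^ Suc n * m" by (simp add: algebra_simps)
      ultimately show "m \<in> LC (Suc n) k" unfolding LC_def using Nt[OF *(2)] *(1) by auto
    qed
    have LCk': "LC n a \<subseteq> LC n b" if "a \<le> b" for n a b using lift_Suc_mono_le[of "LC n", OF LCk that] .
    have LCn': "LC a k \<subseteq> LC b k" if "a \<le> b" for a b k using lift_Suc_mono_le[of "\<lambda>n. LC n k", OF LCn that] .
    have stab: "\<exists>c. \<forall>n\<ge>c. F n = F c" if "\<And>n. stable_subgroup T (F n)" "\<And>n. F n \<subseteq> M" "\<And>n. F n \<subseteq> F (Suc n)" for F
      using acc that unfolding acc_below_def by blast
    have "LC k k \<subseteq> LC (Suc k) (Suc k)" for k using LCn[of k k] LCk[of "Suc k" k] by blast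
    then obtain c where c: "\<And>n. n \<ge> c \<Longrightarrow> LC n n = LC c c" using stab[of "\<lambda>k. LC k k"] LCst LCM by blast
    have "\<forall>n. \<exists>c. \<forall>k\<ge>c. LC n k = LC n c" using stab[of "LC n" for n] LCst LCM LCk by blast
    then obtain d where d: "\<And>n k. k \<ge> d n \<Longrightarrow> LC n k = LC n (d n)" by metis
    \<comment> \<open>The diagonal is constant from \<open>c\<close> on; the finitely many rows \<open>n < c\<close> are constant from \<open>d n\<close> on.\<close>
    define K where "K = Max (insert c (d ` {..<c}))"
    have Kc: "c \<le> K" unfolding K_def by (intro Max_ge) auto
    have Kd: "d n \<le> K" if "n < c" for n unfolding K_def using that by (intro Max_ge) auto
    have LCeq: "LC n k = LC n K" if "K \<le> k" for n k
    proof (cases "n < c")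
      case True then show ?thesis using d[of n k] d[of n K] Kd[OF True] that by simp
    next
      case False
      have *: "LC n j = LC c c" if j: "c \<le> j" for j
      proof
        have "LC n j \<subseteq> LC (max n j) (max n j)" using LCn'[of n "max n j" j] LCk'[of j "max n j" "max n j"] by auto
        then show "LC n j \<subseteq> LC c c" using c[of "max n j"] j by simp
        show "LC c c \<subseteq> LC n j" using LCn'[of c n c] LCk'[of c j n] False j by auto
      qed
      then show ?thesis using Kc that by simp
    qed
    have "L k = L K" if k: "K \<le> k" for k
    proof
      show "L K \<subseteq> L k" by (rule Lle[OF k])
      have "L k \<inter> N n \<subseteq> L K" for n
      proof (induction n)
        case 0
        have "0 \<in> L K" using Lst unfolding stable_subgroup_def by blast
        then show ?case unfolding N0 by blast
      next
        case (Suc n)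
        show ?case
        proof
          fix x assume x: "x \<in> L k \<inter> N (Suc n)"
          then obtain y m where y: "x = y + t ^ n * m" "y \<in> N n" "m \<in> M" unfolding NS[of n] by blast
          then have "m \<in> LC n k" unfolding LC_def using x by blast
          then obtain z where z: "z \<in> N n" "z + t ^ n * m \<in> L K" unfolding LCeq[OF k] unfolding LC_def by blast
          have "x - (z + t ^ n * m) \<in> L k" using x z(2) Lle[OF k] Lst unfolding stable_subgroup_def by blast
          moreover have "x - (z + t ^ n * m) = y - z" by (simp add: y)
          moreover have "y - z \<in> N n" using y(2) z(1) Nst unfolding stable_subgroup_def by blast
          ultimately have "y - z \<in> L K" using Suc by auto
          then have "(y - z) + (z + t ^ n * m) \<in> L K" by (rule stable_subgroup_add[OF Lst _ z(2)])
          then show "x \<in> L K" by (simp add: y)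
        qed
      qed
      then show "L k \<subseteq> L K" using LM[of k] union by blast
    qed
    then show "\<exists>c. \<forall>n\<ge>c. L n = L c" by blast
  qed
qed

lemma module_span_stable: "0 \<in> M \<Longrightarrow> stable_subgroup T (module_span T M)"
  unfolding stable_subgroup_def by (auto intro: module_span.intros)

lemma acc_module_span:
  fixes M :: "'a::comm_ring_1 set"
  assumes M: "finite M" "stable_subgroup {} M" and T: "finite T"
  shows "acc_below T (module_span T M)"
  using T
proof (induction T rule: finite_induct)
  case empty
  show ?case unfolding acc_below_def
  proof (intro allI impI)
    fix L :: "nat \<Rightarrow> 'a set"
    assume "\<forall>n. stable_subgroup {} (L n) \<and> L n \<subseteq> module_span {} M \<and> L n \<subseteq> L (Suc n)"
    then have LM: "\<And>n. L n \<subseteq> module_span {} M" and Lmono: "\<And>n. L n \<subseteq> L (Suc n)" by auto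
    have "x \<in> M" if "x \<in> module_span {} M" for x
      using that by (induction rule: module_span.induct) (use M(2) in \<open>auto simp: stable_subgroup_def\<close>)
    then have sub: "L n \<subseteq> M" for n using LM by blast
    have fin: "finite (L n)" for n using finite_subset[OF sub M(1)] .
    have Lle: "L a \<subseteq> L b" if "a \<le> b" for a b using lift_Suc_mono_le[of L, OF Lmono that] .
    have bound: "\<forall>n. card (L n) < Suc (card M)" using card_mono[OF M(1) sub] by (simp add: less_Suc_eq_le)
    obtain c where c: "\<And>n. card (L n) \<le> card (L c)"
      using ex_has_greatest_nat[of "\<lambda>_. True" 0 "\<lambda>n. card (L n)" "Suc (card M)"] bound by auto
    have "L n = L c" if "c \<le> n" for n
      using card_subset_eq[OF fin Lle[OF that]] c[of n] card_mono[OF fin Lle[OF that]] by simp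
    then show "\<exists>c. \<forall>n\<ge>c. L n = L c" by blast
  qed
next
  case (insert t T)
  let ?N = "module_span T M"
  have M0: "0 \<in> M" using M(2) by (simp add: stable_subgroup_def)
  have acc: "acc_below (insert t T) (module_span {t} ?N)"
    by (rule acc_adjoin[OF module_span_stable[OF M0] insert.IH])
  have N0: "0 \<in> ?N" using M0 by (rule module_span.base)
  have T_stable: "s * x \<in> module_span {t} ?N" if "s \<in> T" "x \<in> module_span {t} ?N" for s x
    using that(2)
  proof (induction rule: module_span.induct)
    case (base x) then show ?case using that(1) by (auto intro: module_span.intros)
  next
    case (diff x y) then show ?case by (simp add: right_diff_distrib module_span.diff)
  next
    case (mult u x)
    have "s * (u * x) = u * (s * x)" by (simp add: mult_ac)
    then show ?case using mult by (metis module_span.mult)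
  qed
  have "module_span (insert t T) M \<subseteq> module_span {t} ?N"
  proof
    fix x assume "x \<in> module_span (insert t T) M"
    then show "x \<in> module_span {t} ?N"
    proof (induction rule: module_span.induct)
      case (base x) then show ?case by (intro module_span.base)
    next
      case (diff x y) show ?case by (rule module_span.diff[OF diff.IH])
    next
      case (mult u x)
      show ?case
      proof (cases "u = t")
        case True show ?thesis unfolding True by (rule module_span.mult[OF _ mult.IH]) simp
      next
        case False
        then show ?thesis using mult.hyps(1) T_stable[OF _ mult.IH] by simp
      qed
    qed
  qed
  then have sub: "L n \<subseteq> module_span {t} ?N" if "L n \<subseteq> module_span (insert t T) M" for L :: "nat \<Rightarrow> 'a set" and n
    using that by (rule order_trans[rotated])
  show ?case unfolding acc_below_def
  proof (intro allI impI)
    fix L :: "nat \<Rightarrow> 'a set"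
    assume L: "\<forall>n. stable_subgroup (insert t T) (L n) \<and> L n \<subseteq> module_span (insert t T) M \<and> L n \<subseteq> L (Suc n)"
    show "\<exists>c. \<forall>n\<ge>c. L n = L c"
      using L sub[of L] by (intro acc[unfolded acc_below_def, rule_format]) simp
  qed
qed

section \<open>Polynomials and substitution\<close>

definition constp :: "'k::comm_ring_1 \<Rightarrow> ('x, 'k) mpoly" where
  "constp c = Poly_Mapping.single 0 c"

definition mono_val :: "('w \<Rightarrow> ('x, 'k::comm_ring_1) mpoly) \<Rightarrow> ('w \<Rightarrow>\<^sub>0 nat) \<Rightarrow> ('x, 'k) mpoly" where
  "mono_val s m = (\<Prod>x\<in>Poly_Mapping.keys m. s x ^ Poly_Mapping.lookup m x)"

text \<open>Evaluation at \<open>x \<mapsto> s x\<close>.\<close>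

definition psubst :: "('w \<Rightarrow> ('x, 'k::comm_ring_1) mpoly) \<Rightarrow> ('w, 'k) mpoly \<Rightarrow> ('x, 'k) mpoly" where
  "psubst s P = (\<Sum>m\<in>Poly_Mapping.keys P. constp (Poly_Mapping.lookup P m) * mono_val s m)"

lemma constp_add: "constp (a + b) = constp a + constp b" by (simp add: constp_def single_add)
lemma constp_mult: "constp (a * b) = constp a * constp b" by (simp add: constp_def mult_single)
lemma constp_0 [simp]: "constp 0 = 0" by (simp add: constp_def)
lemma constp_1 [simp]: "constp 1 = 1" by (simp add: constp_def)
lemma lin_mono_const: "lin_mono x c = constp c * lin_mono x 1"
  by (simp add: lin_mono_def constp_def mult_single)

lemma mono_val_superset:
  "finite A \<Longrightarrow> Poly_Mapping.keys m \<subseteq> A \<Longrightarrow> mono_val s m = (\<Prod>x\<in>A. s x ^ Poly_Mapping.lookup m x)"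
  unfolding mono_val_def by (rule prod.mono_neutral_left) (auto simp: in_keys_iff)

lemma mono_val_0 [simp]: "mono_val s 0 = 1" by (simp add: mono_val_def)

lemma mono_val_add: "mono_val s (m + m') = mono_val s m * mono_val s m'"
proof -
  let ?A = "Poly_Mapping.keys m \<union> Poly_Mapping.keys m'"
  have "mono_val s (m + m') = (\<Prod>x\<in>?A. s x ^ Poly_Mapping.lookup (m + m') x)"
    using keys_add[of m m'] by (intro mono_val_superset) auto
  also have "\<dots> = (\<Prod>x\<in>?A. s x ^ Poly_Mapping.lookup m x) * (\<Prod>x\<in>?A. s x ^ Poly_Mapping.lookup m' x)"
    by (simp add: lookup_add power_add prod.distrib)
  finally show ?thesis
    using mono_val_superset[of ?A m s] mono_val_superset[of ?A m' s] by simp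
qed

lemma psubst_add: "psubst s (P + Q) = psubst s P + psubst s Q"
  unfolding psubst_def
  by (rule setsum_keys_plus_distrib[of "\<lambda>m c. constp c * mono_val s m"]) (auto simp: constp_add distrib_right)

lemma psubst_0 [simp]: "psubst s 0 = 0" by (simp add: psubst_def)

lemma psubst_single [simp]: "psubst s (Poly_Mapping.single m c) = constp c * mono_val s m"
  by (cases "c = 0") (auto simp: psubst_def)

lemma psubst_sum: "psubst s (sum f A) = (\<Sum>i\<in>A. psubst s (f i))"
  by (induction A rule: infinite_finite_induct) (auto simp: psubst_add)

lemma mpoly_as_sum: "P = (\<Sum>m\<in>Poly_Mapping.keys P. Poly_Mapping.single m (Poly_Mapping.lookup P m))"
proof (rule poly_mapping_eqI)
  fix k
  show "Poly_Mapping.lookup P k =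
     Poly_Mapping.lookup (\<Sum>m\<in>Poly_Mapping.keys P. Poly_Mapping.single m (Poly_Mapping.lookup P m)) k"
    by (auto simp: lookup_sum lookup_single when_def in_keys_iff)
qed

lemma psubst_mult: "psubst s (P * Q) = psubst s P * psubst s Q"
proof -
  let ?l = Poly_Mapping.lookup and ?s = Poly_Mapping.single and ?k = Poly_Mapping.keys
  have "P * Q = (\<Sum>m\<in>?k P. \<Sum>m'\<in>?k Q. ?s (m + m') (?l P m * ?l Q m'))"
    by (subst mpoly_as_sum[of P], subst mpoly_as_sum[of Q]) (simp add: sum_product mult_single)
  then have "psubst s (P * Q) = (\<Sum>m\<in>?k P. \<Sum>m'\<in>?k Q. constp (?l P m * ?l Q m') * mono_val s (m + m'))"
    by (simp add: psubst_sum)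
  also have "\<dots> = psubst s P * psubst s Q"
    unfolding psubst_def sum_product by (intro sum.cong refl) (simp add: constp_mult mono_val_add mult_ac)
  finally show ?thesis .
qed

lemma psubst_constp [simp]: "psubst s (constp c) = constp c"
  unfolding constp_def by (simp add: constp_def)

lemma psubst_1 [simp]: "psubst s 1 = 1" using psubst_constp[of s 1] by simp

lemma psubst_lin_mono [simp]: "psubst s (lin_mono x c) = constp c * s x"
  by (simp add: lin_mono_def mono_val_def)

lemma psubst_uminus: "psubst s (- P) = - psubst s P"
  using psubst_add[of s P "- P"] by (simp add: eq_neg_iff_add_eq_0 add.commute)

lemma psubst_diff: "psubst s (P - Q) = psubst s P - psubst s Q"
  using psubst_add[of s P "- Q"] by (simp add: psubst_uminus)

lemma psubst_power: "psubst s (P ^ n) = psubst s P ^ n"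
  by (induction n) (auto simp: psubst_mult)

lemma psubst_prod: "psubst s (prod f A) = (\<Prod>i\<in>A. psubst s (f i))"
  by (induction A rule: infinite_finite_induct) (auto simp: psubst_mult)

lemma psubst_mono_val: "psubst s (mono_val s' m) = mono_val (\<lambda>x. psubst s (s' x)) m"
  by (simp add: mono_val_def psubst_prod psubst_power)

lemma psubst_psubst: "psubst s (psubst s' P) = psubst (\<lambda>x. psubst s (s' x)) P"
  by (simp add: psubst_def[of s'] psubst_sum psubst_mult psubst_mono_val) (simp add: psubst_def)

lemma psubst_cong:
  "(\<And>m x. m \<in> Poly_Mapping.keys P \<Longrightarrow> x \<in> Poly_Mapping.keys m \<Longrightarrow> s x = s' x) \<Longrightarrow> psubst s P = psubst s' P"
  unfolding psubst_def mono_val_def by (intro sum.cong arg_cong2[where f = "(*)"] prod.cong refl) auto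

lemma lin_mono_power: "lin_mono x 1 ^ n = Poly_Mapping.single (Poly_Mapping.single x n) 1"
proof (induction n)
  case (Suc n)
  have "Poly_Mapping.single x (Suc n) = Poly_Mapping.single x 1 + Poly_Mapping.single x n"
    by (simp flip: single_add)
  then show ?case using Suc by (simp add: lin_mono_def mult_single)
qed simp

lemma prod_single_one: "(\<Prod>i\<in>A. Poly_Mapping.single (f i) (1::'k::comm_ring_1)) = Poly_Mapping.single (\<Sum>i\<in>A. f i) 1"
  by (induction A rule: infinite_finite_induct) (auto simp: mult_single)

lemma mono_as_sum: "(\<Sum>x\<in>Poly_Mapping.keys m. Poly_Mapping.single x (Poly_Mapping.lookup m x)) = (m :: 'w \<Rightarrow>\<^sub>0 nat)"
proof (rule poly_mapping_eqI)
  fix k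
  show "Poly_Mapping.lookup (\<Sum>x\<in>Poly_Mapping.keys m. Poly_Mapping.single x (Poly_Mapping.lookup m x)) k = Poly_Mapping.lookup m k"
    by (auto simp: lookup_sum lookup_single when_def in_keys_iff)
qed

lemma mono_val_rename:
  "mono_val (\<lambda>x. lin_mono (\<sigma> x) 1) m = Poly_Mapping.single (rename_mono \<sigma> m) (1::'k::comm_ring_1)"
  unfolding mono_val_def rename_mono_def lin_mono_power by (rule prod_single_one)

lemma rename_vars_psubst: "rename_vars \<sigma> P = psubst (\<lambda>x. lin_mono (\<sigma> x) 1) P"
  unfolding rename_vars_def psubst_def mono_val_rename constp_def by (simp add: mult_single)

lemma mono_val_id: "mono_val (\<lambda>x. lin_mono x 1) m = Poly_Mapping.single m (1::'k::comm_ring_1)"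
  unfolding mono_val_def lin_mono_power prod_single_one mono_as_sum ..

lemma psubst_id: "psubst (\<lambda>x. lin_mono x 1) P = P"
  unfolding psubst_def mono_val_id constp_def
  by (subst (3) mpoly_as_sum) (simp add: mult_single)

definition vars_in :: "'w set \<Rightarrow> ('w, 'k::comm_ring_1) mpoly \<Rightarrow> bool" where
  "vars_in X P \<longleftrightarrow> (\<forall>m\<in>Poly_Mapping.keys P. Poly_Mapping.keys m \<subseteq> X)"

lemma poly_ring_carrier: "P \<in> carrier (poly_ring X) \<longleftrightarrow> vars_in X P"
  by (simp add: poly_ring_def vars_in_def)

lemma vars_in_constp: "vars_in X (constp c)"
  by (auto simp: vars_in_def constp_def)

lemma vars_in_0: "vars_in X 0" by (simp add: vars_in_def)

lemma vars_in_1: "vars_in X 1" using vars_in_constp[of X 1] by simp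

lemma vars_in_lin_mono: "x \<in> X \<Longrightarrow> vars_in X (lin_mono x c)"
  by (auto simp: vars_in_def lin_mono_def split: if_splits)

lemma vars_in_add: "vars_in X P \<Longrightarrow> vars_in X Q \<Longrightarrow> vars_in X (P + Q)"
  unfolding vars_in_def using keys_add[of P Q] by blast

lemma vars_in_uminus: "vars_in X P \<Longrightarrow> vars_in X (- P)"
  unfolding vars_in_def by (simp add: keys_def)

lemma vars_in_diff: "vars_in X P \<Longrightarrow> vars_in X Q \<Longrightarrow> vars_in X (P - Q)"
  using vars_in_add[of X P "- Q"] vars_in_uminus[of X Q] by simp

lemma vars_in_mult: "vars_in X P \<Longrightarrow> vars_in X Q \<Longrightarrow> vars_in X (P * Q)"
  unfolding vars_in_def
proof
  fix m assume P: "\<forall>m\<in>Poly_Mapping.keys P. Poly_Mapping.keys m \<subseteq> X" and Q: "\<forall>m\<in>Poly_Mapping.keys Q. Poly_Mapping.keys m \<subseteq> X"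
    and "m \<in> Poly_Mapping.keys (P * Q)"
  then obtain a b where "m = a + b" "a \<in> Poly_Mapping.keys P" "b \<in> Poly_Mapping.keys Q" using keys_mult[of P Q] by blast
  then show "Poly_Mapping.keys m \<subseteq> X" using P Q keys_add[of a b] by blast
qed

lemma vars_in_sum: "(\<And>i. i \<in> A \<Longrightarrow> vars_in X (f i)) \<Longrightarrow> vars_in X (sum f A)"
  by (induction A rule: infinite_finite_induct) (auto simp: vars_in_0 vars_in_add)

lemma vars_in_prod: "(\<And>i. i \<in> A \<Longrightarrow> vars_in X (f i)) \<Longrightarrow> vars_in X (prod f A)"
  by (induction A rule: infinite_finite_induct) (auto simp: vars_in_1 vars_in_mult)

lemma vars_in_power: "vars_in X P \<Longrightarrow> vars_in X (P ^ n)"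
  by (induction n) (auto simp: vars_in_1 vars_in_mult)

lemma vars_in_psubst:
  assumes "vars_in Y P" "\<And>x. x \<in> Y \<Longrightarrow> vars_in X (s x)" shows "vars_in X (psubst s P)"
  unfolding psubst_def mono_val_def using assms(1)
  by (intro vars_in_sum vars_in_mult vars_in_constp vars_in_prod vars_in_power assms(2)) (auto simp: vars_in_def)

lemma psubst_cong_vars: "vars_in X P \<Longrightarrow> (\<And>x. x \<in> X \<Longrightarrow> s x = s' x) \<Longrightarrow> psubst s P = psubst s' P"
  by (rule psubst_cong) (auto simp: vars_in_def)

lemma mpoly_induct [consumes 1, case_names const var add mult]:
  fixes P :: "('w, 'k::comm_ring_1) mpoly"
  assumes P: "vars_in X P" and c: "\<And>c. \<Phi> (constp c)" and v: "\<And>x. x \<in> X \<Longrightarrow> \<Phi> (lin_mono x 1)"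
    and a: "\<And>P Q. vars_in X P \<Longrightarrow> vars_in X Q \<Longrightarrow> \<Phi> P \<Longrightarrow> \<Phi> Q \<Longrightarrow> \<Phi> (P + Q)"
    and m: "\<And>P Q. vars_in X P \<Longrightarrow> vars_in X Q \<Longrightarrow> \<Phi> P \<Longrightarrow> \<Phi> Q \<Longrightarrow> \<Phi> (P * Q)"
  shows "\<Phi> P"
proof -
  let ?S = "{P. vars_in X P \<and> \<Phi> P}"
  have sum: "sum f A \<in> ?S" if "\<And>i. i \<in> A \<Longrightarrow> f i \<in> ?S" for f :: "('w \<Rightarrow>\<^sub>0 nat) \<Rightarrow> ('w, 'k) mpoly" and A
    using that c[of 0] by (induction A rule: infinite_finite_induct) (auto simp: vars_in_0 vars_in_add a)
  have prod: "prod f A \<in> ?S" if "\<And>i. i \<in> A \<Longrightarrow> f i \<in> ?S" for f :: "'w \<Rightarrow> ('w, 'k) mpoly" and A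
    using that c[of 1] by (induction A rule: infinite_finite_induct) (auto simp: vars_in_1 vars_in_mult m)
  have power: "Q ^ n \<in> ?S" if "Q \<in> ?S" for Q n
    using that c[of 1] by (induction n) (auto simp: vars_in_1 vars_in_mult m)
  have "psubst (\<lambda>x. lin_mono x (1::'k)) P \<in> ?S"
    unfolding psubst_def
  proof (rule sum)
    fix k assume "k \<in> Poly_Mapping.keys P"
    then have "mono_val (\<lambda>x. lin_mono x (1::'k)) k \<in> ?S"
      unfolding mono_val_def
    proof (intro prod power)
      fix x assume "x \<in> Poly_Mapping.keys k"
      then have "x \<in> X" using P \<open>k \<in> _\<close> by (auto simp: vars_in_def)
      then show "lin_mono x (1::'k) \<in> ?S" using v[of x] vars_in_lin_mono[of x X 1] by simp
    qed
    then show "constp (Poly_Mapping.lookup P k) * mono_val (\<lambda>x. lin_mono x (1::'k)) k \<in> ?S"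
    proof -
      assume "mono_val (\<lambda>x. lin_mono x (1::'k)) k \<in> ?S"
      then have v1: "vars_in X (mono_val (\<lambda>x. lin_mono x (1::'k)) k)" "\<Phi> (mono_val (\<lambda>x. lin_mono x (1::'k)) k)" by simp_all
      note v2 = vars_in_constp[of X "Poly_Mapping.lookup P k"] and v3 = c[of "Poly_Mapping.lookup P k"]
      show ?thesis using vars_in_mult[OF v2 v1(1)] m[OF v2 v1(1) v3 v1(2)] by simp
    qed
  qed
  then show ?thesis by (simp add: psubst_id)
qed

definition homog :: "nat \<Rightarrow> ('w, 'k::comm_ring_1) mpoly \<Rightarrow> bool" where
  "homog n P \<longleftrightarrow> (\<forall>m\<in>Poly_Mapping.keys P. mono_deg m = n)"

lemma mono_deg_superset: "finite A \<Longrightarrow> Poly_Mapping.keys m \<subseteq> A \<Longrightarrow> mono_deg m = (\<Sum>x\<in>A. Poly_Mapping.lookup m x)"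
  unfolding mono_deg_def by (rule sum.mono_neutral_left) (auto simp: in_keys_iff)

lemma mono_deg_add: "mono_deg (m + m') = mono_deg m + mono_deg m'"
proof -
  let ?A = "Poly_Mapping.keys m \<union> Poly_Mapping.keys m'"
  have "mono_deg (m + m') = (\<Sum>x\<in>?A. Poly_Mapping.lookup (m + m') x)"
    using keys_add[of m m'] by (intro mono_deg_superset) auto
  then show ?thesis
    using mono_deg_superset[of ?A m] mono_deg_superset[of ?A m'] by (simp add: lookup_add sum.distrib)
qed

lemma homog_0 [simp]: "homog n 0" by (simp add: homog_def)

lemma homog_constp: "homog 0 (constp c)" by (auto simp: homog_def constp_def mono_deg_def)

lemma homog_1: "homog 0 1" using homog_constp[of 1] by simp

lemma homog_lin_mono: "homog 1 (lin_mono x c)" by (auto simp: homog_def lin_mono_def mono_deg_def)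

lemma homog_add: "homog n P \<Longrightarrow> homog n Q \<Longrightarrow> homog n (P + Q)"
  unfolding homog_def using keys_add[of P Q] by blast

lemma homog_mult: "homog n P \<Longrightarrow> homog k Q \<Longrightarrow> homog (n + k) (P * Q)"
  unfolding homog_def
proof
  fix m assume P: "\<forall>m\<in>Poly_Mapping.keys P. mono_deg m = n" and Q: "\<forall>m\<in>Poly_Mapping.keys Q. mono_deg m = k"
    and "m \<in> Poly_Mapping.keys (P * Q)"
  then obtain a b where "m = a + b" "a \<in> Poly_Mapping.keys P" "b \<in> Poly_Mapping.keys Q" using keys_mult[of P Q] by blast
  then show "mono_deg m = n + k" using P Q by (simp add: mono_deg_add)
qed

lemma homog_sum: "(\<And>i. i \<in> A \<Longrightarrow> homog n (f i)) \<Longrightarrow> homog n (sum f A)"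
  by (induction A rule: infinite_finite_induct) (auto simp: homog_add)

lemma homog_prod: "(\<And>i. i \<in> A \<Longrightarrow> homog (n i) (f i)) \<Longrightarrow> finite A \<Longrightarrow> homog (sum n A) (prod f A)"
  by (induction A rule: infinite_finite_induct) (auto simp: homog_1 homog_mult)

lemma homog_power: "homog n P \<Longrightarrow> homog (k * n) (P ^ k)"
  by (induction k) (auto simp: homog_1 homog_mult)

lemma homog_psubst:
  assumes P: "homog n P" "vars_in X P" and s: "\<And>x. x \<in> X \<Longrightarrow> homog 1 (s x)" shows "homog n (psubst s P)"
  unfolding psubst_def
proof (rule homog_sum)
  fix m assume m: "m \<in> Poly_Mapping.keys P"
  have "homog (\<Sum>x\<in>Poly_Mapping.keys m. Poly_Mapping.lookup m x * 1) (mono_val s m)"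
    unfolding mono_val_def using m P(2) by (intro homog_prod homog_power s) (auto simp: vars_in_def)
  then have "homog n (mono_val s m)" using m P(1) by (simp add: homog_def mono_deg_def)
  then show "homog n (constp (Poly_Mapping.lookup P m) * mono_val s m)"
    using homog_mult[OF homog_constp, of n] by fastforce
qed

definition homog_part :: "nat \<Rightarrow> ('w, 'k::comm_ring_1) mpoly \<Rightarrow> ('w, 'k) mpoly" where
  "homog_part n P = (\<Sum>m | m \<in> Poly_Mapping.keys P \<and> mono_deg m = n. Poly_Mapping.single m (Poly_Mapping.lookup P m))"

lemma lookup_homog_part: "Poly_Mapping.lookup (homog_part n P) m = (if mono_deg m = n then Poly_Mapping.lookup P m else 0)"
  by (auto simp: homog_part_def lookup_sum lookup_single when_def in_keys_iff)

lemma homog_homog_part: "homog n (homog_part n P)"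
  by (auto simp: homog_def in_keys_iff lookup_homog_part split: if_splits)

lemma vars_in_homog_part: "vars_in X P \<Longrightarrow> vars_in X (homog_part n P)"
  by (auto simp: vars_in_def in_keys_iff lookup_homog_part split: if_splits)

lemma homog_part_sum: "P = (\<Sum>n\<in>mono_deg ` Poly_Mapping.keys P. homog_part n P)"
proof (rule poly_mapping_eqI)
  fix k
  show "Poly_Mapping.lookup P k = Poly_Mapping.lookup (\<Sum>n\<in>mono_deg ` Poly_Mapping.keys P. homog_part n P) k"
    by (auto simp: lookup_sum lookup_homog_part in_keys_iff)
qed

lemma homog_part_add: "homog_part n (P + Q) = homog_part n P + homog_part n Q"
  by (rule poly_mapping_eqI) (simp add: lookup_add lookup_homog_part)

lemma homog_part_homog: "homog k P \<Longrightarrow> homog_part n P = (if n = k then P else 0)"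
  by (rule poly_mapping_eqI) (auto simp: lookup_homog_part homog_def in_keys_iff)

lemma homog_part_sum_homog:
  "(\<And>i. i \<in> A \<Longrightarrow> homog i (f i)) \<Longrightarrow> finite A \<Longrightarrow> homog_part n (sum f A) = (if n \<in> A then f n else 0)"
proof (induction A rule: infinite_finite_induct)
  case empty
  show ?case using homog_part_homog[of 0 0 n] by simp
next
  case (insert a A)
  have "homog_part n (f a) = (if n = a then f a else 0)" by (rule homog_part_homog) (use insert.prems in simp)
  moreover have "homog_part n (sum f A) = (if n \<in> A then f n else 0)" using insert by simp
  ultimately show ?case using insert.hyps by (auto simp: homog_part_add)
qed simp

text \<open>Substituting linear forms preserves degrees, hence commutes with taking homogeneous parts.\<close>

lemma homog_part_psubst:
  assumes P: "vars_in X P" and s: "\<And>x. x \<in> X \<Longrightarrow> homog 1 (s x)"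
  shows "homog_part n (psubst s P) = psubst s (homog_part n P)"
proof -
  let ?D = "mono_deg ` Poly_Mapping.keys P"
  have "psubst s P = (\<Sum>n\<in>?D. psubst s (homog_part n P))"
    by (subst homog_part_sum) (simp add: psubst_sum)
  then have "homog_part n (psubst s P) = (if n \<in> ?D then psubst s (homog_part n P) else 0)"
    using homog_part_sum_homog[of ?D "\<lambda>n. psubst s (homog_part n P)" n]
      homog_psubst[OF homog_homog_part vars_in_homog_part[OF P] s] by simp
  moreover have "homog_part n P = 0" if "n \<notin> ?D"
  proof (rule poly_mapping_eqI)
    fix m show "Poly_Mapping.lookup (homog_part n P) m = Poly_Mapping.lookup 0 m"
      using that by (auto simp: lookup_homog_part in_keys_iff)
  qed
  ultimately show ?thesis by auto
qed

lemma cring_poly_ring: "cring (poly_ring X :: ('w, 'k::comm_ring_1) mpoly ring)"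
proof (rule cringI)
  show "abelian_group (poly_ring X :: ('w, 'k) mpoly ring)"
  proof (rule abelian_groupI)
    fix x :: "('w, 'k) mpoly" assume "x \<in> carrier (poly_ring X)"
    then show "\<exists>y\<in>carrier (poly_ring X). y \<oplus>\<^bsub>poly_ring X\<^esub> x = \<zero>\<^bsub>poly_ring X\<^esub>"
      using vars_in_uminus by (intro bexI[of _ "- x"]) (auto simp: poly_ring_carrier, simp add: poly_ring_def)
  qed (auto simp: poly_ring_carrier vars_in_add vars_in_0 poly_ring_def vars_in_def[symmetric] add_ac)
  show "Group.comm_monoid (poly_ring X :: ('w, 'k) mpoly ring)"
    by (rule comm_monoidI) (auto simp: poly_ring_def vars_in_def[symmetric] vars_in_mult vars_in_1 mult_ac)
qed (auto simp: poly_ring_def distrib_right)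

section \<open>A polynomial model of the symmetric algebra\<close>

text \<open>A basis \<open>B\<close> of \<open>V\<close> with dual basis \<open>coordf\<close> identifies \<open>Sym(V\<^sup>*)\<close> with the polynomials in
  variables indexed by \<open>B\<close>, where \<open>f \<in> V\<^sup>*\<close> corresponds to the linear form \<open>lin_part f\<close>, the
  sum of the terms \<open>f(b) X\<^sub>b\<close>. On representatives of cosets the identification and a section of
  it are \<open>model\<close> and \<open>embed\<close>; on cosets they are \<open>theta\<close> and its inverse \<open>psi\<close>. All
  computations take place in the polynomials, where monomials are available.\<close>

locale based_space = vector_space scale for scale :: "'k::{field,finite} \<Rightarrow> 'v::ab_group_add \<Rightarrow> 'v" +
  fixes B :: "'v set"
  assumes B_indep: "independent B" and B_span: "span B = UNIV" and B_finite: "finite B"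
begin

abbreviation W where "W \<equiv> dual_space scale"
abbreviation PW where "PW \<equiv> poly_ring W :: ('v \<Rightarrow> 'k, 'k) mpoly ring"
abbreviation I where "I \<equiv> sym_ideal scale"
abbreviation SymV where "SymV \<equiv> sym_dual scale"
abbreviation cls where "cls \<equiv> sym_class scale"

definition coordf :: "'v \<Rightarrow> 'v \<Rightarrow> 'k" where "coordf b = (\<lambda>v. representation B v b)"
definition lin_part :: "('v \<Rightarrow> 'k) \<Rightarrow> ('v, 'k) mpoly" where "lin_part f = (\<Sum>b\<in>B. lin_mono b (f b))"
definition model :: "('v \<Rightarrow> 'k, 'k) mpoly \<Rightarrow> ('v, 'k) mpoly" where "model = psubst lin_part"
definition embed :: "('v, 'k) mpoly \<Rightarrow> ('v \<Rightarrow> 'k, 'k) mpoly" where "embed = psubst (\<lambda>b. lin_mono (coordf b) 1)"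
definition theta :: "('v \<Rightarrow> 'k, 'k) mpoly set \<Rightarrow> ('v, 'k) mpoly" where "theta C = the_elem (model ` C)"

lemma dual_iff: "f \<in> W \<longleftrightarrow> (\<forall>v w. f (v + w) = f v + f w) \<and> (\<forall>c v. f (scale c v) = c * f v)"
proof -
  have "vector_space ((*) :: 'k \<Rightarrow> 'k \<Rightarrow> 'k)" by unfold_locales (auto simp: algebra_simps)
  then show ?thesis using vector_space_axioms by (simp add: dual_space_def Vector_Spaces.linear_iff)
qed

lemma dual_add: "f \<in> W \<Longrightarrow> h \<in> W \<Longrightarrow> (\<lambda>v. f v + h v) \<in> W"
  by (simp add: dual_iff algebra_simps)

lemma dual_scale: "f \<in> W \<Longrightarrow> (\<lambda>v. c * f v) \<in> W"
  by (simp add: dual_iff algebra_simps)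

lemma dual_diff: "f \<in> W \<Longrightarrow> h \<in> W \<Longrightarrow> (\<lambda>v. f v - h v) \<in> W"
  by (simp add: dual_iff algebra_simps)

lemma dual_zero: "(\<lambda>v. 0) \<in> W" by (simp add: dual_iff)

lemma dual_sum: "(\<And>i. i \<in> A \<Longrightarrow> f i \<in> W) \<Longrightarrow> (\<lambda>v. \<Sum>i\<in>A. f i v) \<in> W"
  by (induction A rule: infinite_finite_induct) (auto simp: dual_zero dual_add)

lemma coordf_dual: "coordf b \<in> W"
  unfolding dual_iff coordf_def
  using representation_add[OF B_indep] representation_scale[OF B_indep] by (simp add: B_span)

lemma expand: "v = (\<Sum>b\<in>B. scale (coordf b v) b)"
  unfolding coordf_def by (rule sum_representation_eq[OF B_indep _ B_finite, symmetric]) (auto simp: B_span)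

lemma dual_expand: "f \<in> W \<Longrightarrow> f v = (\<Sum>b\<in>B. f b * coordf b v)"
proof -
  assume f: "f \<in> W"
  have sum: "f (\<Sum>b\<in>A. g b) = (\<Sum>b\<in>A. f (g b))" for g :: "'v \<Rightarrow> 'v" and A
    using f scale_zero_left[of 0] dual_iff[of f]
    by (induction A rule: infinite_finite_induct) (auto, (metis mult_zero_left scale_zero_left)+)
  have "f v = f (\<Sum>b\<in>B. scale (coordf b v) b)" using expand[of v] by simp
  also have "\<dots> = (\<Sum>b\<in>B. f b * coordf b v)" unfolding sum using f by (simp add: dual_iff mult.commute)
  finally show ?thesis .
qed

lemma finite_V: "finite (UNIV :: 'v set)"
proof -
  have "UNIV \<subseteq> (\<lambda>c. \<Sum>b\<in>B. scale (c b) b) ` (PiE B (\<lambda>_. UNIV))"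
  proof
    fix v :: 'v
    have "v = (\<Sum>b\<in>B. scale (restrict (\<lambda>b. coordf b v) B b) b)" using expand[of v] by simp
    then show "v \<in> (\<lambda>c. \<Sum>b\<in>B. scale (c b) b) ` (PiE B (\<lambda>_. UNIV))"
      by (intro image_eqI[of _ _ "restrict (\<lambda>b. coordf b v) B"]) auto
  qed
  moreover have "finite (PiE B (\<lambda>_. UNIV :: 'k set))" by (rule finite_PiE[OF B_finite]) simp
  ultimately show ?thesis by (meson finite_imageI finite_subset)
qed

lemma finite_fun_V: "finite (UNIV :: ('v \<Rightarrow> 'c::finite) set)"
  using finite_PiE[OF finite_V, of "\<lambda>_. UNIV :: 'c set"] by simp

lemma finite_end_V: "finite (UNIV :: ('v \<Rightarrow> 'v) set)"
  using finite_PiE[OF finite_V, of "\<lambda>_. UNIV :: 'v set"] finite_V by simp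

lemma coordf_basis: "b \<in> B \<Longrightarrow> coordf b b' = (if b' = b then 1 else 0)" if "b' \<in> B"
  unfolding coordf_def using representation_basis[OF B_indep that] by auto

lemma lin_part_coord: "b \<in> B \<Longrightarrow> lin_part (coordf b) = lin_mono b 1"
proof -
  assume b: "b \<in> B"
  have "lin_part (coordf b) = (\<Sum>b'\<in>B. if b' = b then lin_mono b 1 else 0)"
    unfolding lin_part_def using coordf_basis b by (intro sum.cong refl) (auto simp: lin_mono_def)
  then show ?thesis using B_finite b by simp
qed

lemma lin_part_add: "lin_part (\<lambda>v. f v + h v) = lin_part f + lin_part h"
  by (simp add: lin_part_def lin_mono_def single_add sum.distrib)

lemma lin_part_scale: "lin_part (\<lambda>v. c * f v) = constp c * lin_part f"
  by (simp add: lin_part_def lin_mono_def constp_def mult_single sum_distrib_left)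

lemma lin_part_vars: "vars_in B (lin_part f)"
  unfolding lin_part_def by (intro vars_in_sum vars_in_lin_mono)

lemma lin_part_homog: "homog 1 (lin_part f)"
  unfolding lin_part_def by (intro homog_sum homog_lin_mono)

lemma lin_part_sum: "lin_part (\<lambda>v. \<Sum>i\<in>A. f i v) = (\<Sum>i\<in>A. lin_part (f i))"
proof (induction A rule: infinite_finite_induct)
  case (insert a A) then show ?case by (simp add: lin_part_add)
qed (auto simp: lin_part_def lin_mono_def)

lemma model_vars: "vars_in B (model P)"
  unfolding model_def by (rule vars_in_psubst[of UNIV]) (auto simp: vars_in_def lin_part_vars[unfolded vars_in_def])

lemma embed_vars: "vars_in W (embed Q)"
  unfolding embed_def by (rule vars_in_psubst[of UNIV]) (use vars_in_lin_mono[OF coordf_dual] in \<open>auto simp: vars_in_def\<close>)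

lemma model_embed: "vars_in B Q \<Longrightarrow> model (embed Q) = Q"
  unfolding model_def embed_def psubst_psubst
  by (subst psubst_cong_vars[of B Q _ "\<lambda>b. lin_mono b 1"]) (auto simp: lin_part_coord psubst_id)

lemma rels_carrier: "sym_rels scale \<subseteq> carrier PW"
  unfolding sym_rels_def
  by (auto simp: poly_ring_carrier intro!: vars_in_diff vars_in_lin_mono dual_add dual_scale)

lemma I_ideal: "ideal I PW"
  unfolding sym_ideal_def by (rule ring.genideal_ideal[OF cring.axioms(1)[OF cring_poly_ring] rels_carrier])

lemma rels_I: "sym_rels scale \<subseteq> I"
  unfolding sym_ideal_def by (rule ring.genideal_self[OF cring.axioms(1)[OF cring_poly_ring] rels_carrier])

lemma I_add: "a \<in> I \<Longrightarrow> b \<in> I \<Longrightarrow> a + b \<in> I"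
  using additive_subgroup.a_closed[OF ideal.axioms(1)[OF I_ideal]] by (simp add: poly_ring_def)

lemma I_zero: "0 \<in> I"
  using additive_subgroup.zero_closed[OF ideal.axioms(1)[OF I_ideal]] by (simp add: poly_ring_def)

lemma I_vars: "a \<in> I \<Longrightarrow> vars_in W a"
  using additive_subgroup.a_subset[OF ideal.axioms(1)[OF I_ideal]] poly_ring_carrier by blast

lemma I_mult: "vars_in W P \<Longrightarrow> a \<in> I \<Longrightarrow> P * a \<in> I"
  using ideal.I_l_closed[OF I_ideal, of a P] poly_ring_carrier[of P W] by (simp add: poly_ring_def)

lemma I_uminus: "a \<in> I \<Longrightarrow> - a \<in> I"
  using I_mult[of "- 1" a] vars_in_uminus[OF vars_in_1, of W] by simp

lemma I_diff: "a \<in> I \<Longrightarrow> b \<in> I \<Longrightarrow> a - b \<in> I"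
  using I_add[of a "- b"] I_uminus[of b] by simp

lemma model_I: "a \<in> I \<Longrightarrow> model a = 0"
proof -
  let ?K = "{P. vars_in W P \<and> model P = 0}"
  have "ideal ?K PW"
  proof (rule idealI)
    interpret cring PW by (rule cring_poly_ring)
    show "ring PW" by (rule ring_axioms)
    have inv: "inv\<^bsub>add_monoid PW\<^esub> a = - a" if "vars_in W a" for a
      using that vars_in_uminus[OF that]
      by (intro group.inv_equality[OF a_group]) (auto simp: poly_ring_carrier, simp_all add: poly_ring_def)
    show "subgroup ?K (add_monoid PW)"
    proof (rule group.subgroupI[OF a_group])
      show "?K \<subseteq> carrier (add_monoid PW)" by (auto simp: poly_ring_carrier)
      show "?K \<noteq> {}" using vars_in_0 by (auto simp: model_def intro!: exI[of _ 0])
      show "inv\<^bsub>add_monoid PW\<^esub> a \<in> ?K" if "a \<in> ?K" for a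
      proof -
        have a: "vars_in W a" "model a = 0" using that by simp_all
        have "vars_in W (- a)" by (rule vars_in_uminus[OF a(1)])
        moreover have "model (- a) = 0" using a(2) unfolding model_def psubst_uminus by simp
        ultimately show ?thesis unfolding inv[OF a(1)] mem_Collect_eq by (intro conjI)
      qed
      show "a \<otimes>\<^bsub>add_monoid PW\<^esub> b \<in> ?K" if "a \<in> ?K" "b \<in> ?K" for a b
        using that vars_in_add[of W a b] by (simp add: model_def psubst_add) (simp add: poly_ring_def psubst_add)
    qed
    show "x \<otimes>\<^bsub>PW\<^esub> a \<in> ?K" "a \<otimes>\<^bsub>PW\<^esub> x \<in> ?K" if "a \<in> ?K" "x \<in> carrier PW" for a x
      using that vars_in_mult[of W x a] vars_in_mult[of W a x] poly_ring_carrier[of x W]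
      by (auto simp: model_def psubst_mult poly_ring_def)
  qed
  moreover have "sym_rels scale \<subseteq> ?K"
  proof
    fix P assume P: "P \<in> sym_rels scale"
    have "model P = 0"
      using P unfolding sym_rels_def by (auto simp: model_def psubst_diff lin_part_add lin_part_scale)
    then show "P \<in> ?K" using P rels_carrier poly_ring_carrier[of P W] by blast
  qed
  ultimately have "I \<subseteq> ?K"
    unfolding sym_ideal_def by (rule ring.genideal_minimal[OF cring.axioms(1)[OF cring_poly_ring]])
  then show "a \<in> I \<Longrightarrow> model a = 0" by blast
qed

lemma lin_expand_I:
  assumes "finite A"
  shows "lin_mono (\<lambda>v. \<Sum>b\<in>A. c b * coordf b v) 1 - (\<Sum>b\<in>A. constp (c b) * lin_mono (coordf b) 1) \<in> I"
  using assms
proof (induction A rule: finite_induct)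
  case empty
  have "lin_mono (\<lambda>v. 0 * 0) 1 - lin_mono (\<lambda>v. 0) (0::'k) \<in> sym_rels scale"
    unfolding sym_rels_def using dual_zero by (intro UnI2 CollectI exI[of _ "0::'k"] exI[of _ "\<lambda>v. 0"] conjI refl)
  then show ?case using rels_I by (auto simp: lin_mono_def)
next
  case (insert a A)
  let ?h = "\<lambda>v. \<Sum>b\<in>A. c b * coordf b v" and ?f = "\<lambda>v. c a * coordf a v"
  have h: "?h \<in> W" by (intro dual_sum dual_scale coordf_dual)
  have f: "?f \<in> W" by (intro dual_scale coordf_dual)
  have 1: "lin_mono (\<lambda>v. ?f v + ?h v) (1::'k) - lin_mono ?f 1 - lin_mono ?h 1 \<in> I"
    using rels_I f h unfolding sym_rels_def by blast
  have "lin_mono ?f (1::'k) - lin_mono (coordf a) (c a) \<in> I"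
    using rels_I coordf_dual unfolding sym_rels_def by blast
  then have 2: "lin_mono ?f (1::'k) - constp (c a) * lin_mono (coordf a) 1 \<in> I" by (simp add: lin_mono_const[of "coordf a" "c a"])
  have "(lin_mono (\<lambda>v. ?f v + ?h v) (1::'k) - lin_mono ?f 1 - lin_mono ?h 1) +
     (lin_mono ?f (1::'k) - constp (c a) * lin_mono (coordf a) 1) +
     (lin_mono ?h 1 - (\<Sum>b\<in>A. constp (c b) * lin_mono (coordf b) 1)) \<in> I"
    by (intro I_add 1 2 insert.IH)
  moreover have "(\<lambda>v. \<Sum>b\<in>insert a A. c b * coordf b v) = (\<lambda>v. ?f v + ?h v)" using insert.hyps by simp
  ultimately show ?case using insert.hyps by (simp add: algebra_simps)
qed

text \<open>Modulo the relations, the variable of \<open>f\<close> is the linear combination of the variables of the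
  dual basis with coefficients \<open>f(b)\<close>; both sides are compatible with sums and products.\<close>

lemma embed_model_I: "vars_in W P \<Longrightarrow> P - embed (model P) \<in> I"
proof (induction P rule: mpoly_induct)
  case (const c) then show ?case by (simp add: embed_def model_def I_zero)
next
  case (var f)
  have "embed (model (lin_mono f 1)) = (\<Sum>b\<in>B. constp (f b) * lin_mono (coordf b) 1)"
    by (simp add: embed_def model_def lin_part_def psubst_sum)
  moreover have "lin_mono f 1 - (\<Sum>b\<in>B. constp (f b) * lin_mono (coordf b) 1) \<in> I"
    using lin_expand_I[OF B_finite, of f] unfolding dual_expand[OF var, symmetric] .
  ultimately show ?case by metis
next
  case (add P Q)
  have "P + Q - embed (model (P + Q)) = (P - embed (model P)) + (Q - embed (model Q))"
    by (simp add: embed_def model_def psubst_add)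
  then show ?case using I_add[OF add(3,4)] by (simp only:)
next
  case (mult P Q)
  have "P * Q - embed (model (P * Q)) = Q * (P - embed (model P)) + embed (model P) * (Q - embed (model Q))"
    by (simp add: embed_def model_def psubst_mult algebra_simps)
  then show ?case using I_add[OF I_mult[OF mult(2,3)] I_mult[OF embed_vars mult(4)]] by simp
qed

lemma I_iff: "a \<in> I \<longleftrightarrow> vars_in W a \<and> model a = 0"
  using I_vars model_I embed_model_I[of a] by (auto simp: embed_def)

lemma cls_def': "cls P = {i + P | i. i \<in> I}"
  by (auto simp: sym_class_def a_r_coset_def r_coset_def poly_ring_def)

lemma cls_carrier: "vars_in W P \<Longrightarrow> cls P \<in> carrier SymV"
  unfolding sym_dual_def FactRing_def sym_class_def A_RCOSETS_def RCOSETS_def a_r_coset_def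
  using poly_ring_carrier[of P W] by auto

lemma carrier_cls: "r \<in> carrier SymV \<Longrightarrow> \<exists>P. vars_in W P \<and> r = cls P"
  unfolding sym_dual_def FactRing_def sym_class_def A_RCOSETS_def RCOSETS_def a_r_coset_def
  using poly_ring_carrier by auto

lemma cls_hom: "cls \<in> ring_hom PW SymV"
proof -
  have "(\<lambda>P. I +>\<^bsub>PW\<^esub> P) \<in> ring_hom PW (PW Quot I)" by (rule ideal.rcos_ring_hom[OF I_ideal])
  then show ?thesis unfolding sym_dual_def using sym_class_def[of scale, abs_def] by presburger
qed

lemma cls_add: "vars_in W P \<Longrightarrow> vars_in W Q \<Longrightarrow> cls (P + Q) = cls P \<oplus>\<^bsub>SymV\<^esub> cls Q"
  using ring_hom_add[OF cls_hom, of P Q] poly_ring_carrier by (auto simp: poly_ring_def vars_in_def)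

lemma cls_mult: "vars_in W P \<Longrightarrow> vars_in W Q \<Longrightarrow> cls (P * Q) = cls P \<otimes>\<^bsub>SymV\<^esub> cls Q"
  using ring_hom_mult[OF cls_hom, of P Q] poly_ring_carrier by (auto simp: poly_ring_def vars_in_def)

lemma cls_one: "cls 1 = \<one>\<^bsub>SymV\<^esub>"
  using ring_hom_one[OF cls_hom] by (simp add: poly_ring_def)

lemma cls_zero: "cls 0 = \<zero>\<^bsub>SymV\<^esub>"
  by (simp add: cls_def' sym_dual_def FactRing_def)

lemma cls_eq_iff: assumes "vars_in W P" "vars_in W Q" shows "cls P = cls Q \<longleftrightarrow> model P = model Q"
proof
  assume "cls P = cls Q"
  moreover have "P \<in> cls P" unfolding cls_def' using I_zero by force
  ultimately obtain i where "i \<in> I" "P = i + Q" unfolding cls_def' by auto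
  then show "model P = model Q" using model_I by (simp add: model_def psubst_add)
next
  assume eq: "model P = model Q"
  have d: "P - Q \<in> I" using eq assms vars_in_diff[of W P Q] by (simp add: I_iff) (simp add: model_def psubst_diff)
  have "\<exists>j\<in>I. i + P = j + Q" "\<exists>j\<in>I. i + Q = j + P" if "i \<in> I" for i
    using I_add[OF that d] I_diff[OF that d]
    by (force intro!: bexI[of _ "i + (P - Q)"], force intro!: bexI[of _ "i - (P - Q)"])
  then show "cls P = cls Q" unfolding cls_def' by auto
qed

lemma theta_cls: "theta (cls P) = model P"
proof -
  have "model ` cls P = {model P}"
    unfolding cls_def' using model_I I_zero by (auto simp: model_def psubst_add intro!: image_eqI[of _ _ "0 + P"] exI[of _ 0])
  then show ?thesis by (simp add: theta_def)
qed

lemma cring_SymV: "cring SymV"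
  unfolding sym_dual_def by (rule ideal.quotient_is_cring[OF I_ideal cring_poly_ring])

lemma theta_vars: "r \<in> carrier SymV \<Longrightarrow> vars_in B (theta r)"
  using carrier_cls theta_cls model_vars by metis

lemma theta_add: "r \<in> carrier SymV \<Longrightarrow> s \<in> carrier SymV \<Longrightarrow> theta (r \<oplus>\<^bsub>SymV\<^esub> s) = theta r + theta s"
  using carrier_cls[of r] carrier_cls[of s] by (auto simp: cls_add[symmetric] theta_cls model_def psubst_add)

lemma theta_mult: "r \<in> carrier SymV \<Longrightarrow> s \<in> carrier SymV \<Longrightarrow> theta (r \<otimes>\<^bsub>SymV\<^esub> s) = theta r * theta s"
  using carrier_cls[of r] carrier_cls[of s] by (auto simp: cls_mult[symmetric] theta_cls model_def psubst_mult)

lemma theta_one: "theta \<one>\<^bsub>SymV\<^esub> = 1"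
  using theta_cls[of 1] by (simp add: cls_one model_def)

lemma theta_zero: "theta \<zero>\<^bsub>SymV\<^esub> = 0"
  using theta_cls[of 0] by (simp add: cls_zero model_def)

lemma theta_inj: "r \<in> carrier SymV \<Longrightarrow> s \<in> carrier SymV \<Longrightarrow> theta r = theta s \<longleftrightarrow> r = s"
  using carrier_cls[of r] carrier_cls[of s] cls_eq_iff theta_cls by metis

definition psi :: "('v, 'k) mpoly \<Rightarrow> ('v \<Rightarrow> 'k, 'k) mpoly set" where "psi Q = cls (embed Q)"

lemma psi_carrier: "psi Q \<in> carrier SymV" unfolding psi_def by (rule cls_carrier[OF embed_vars])

lemma theta_psi: "vars_in B Q \<Longrightarrow> theta (psi Q) = Q" by (simp add: psi_def theta_cls model_embed)

lemma psi_theta: "r \<in> carrier SymV \<Longrightarrow> psi (theta r) = r"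
  using theta_inj[OF psi_carrier] theta_psi[OF theta_vars] by simp

lemma sym_deg_iff: "r \<in> sym_deg scale n \<longleftrightarrow> r \<in> carrier SymV \<and> homog n (theta r)"
proof
  assume "r \<in> sym_deg scale n"
  then obtain P where P: "vars_in W P" "homog n P" "r = cls P"
    unfolding sym_deg_def using poly_ring_carrier by (auto simp: homog_def)
  then show "r \<in> carrier SymV \<and> homog n (theta r)"
    using homog_psubst[OF P(2,1), of lin_part] lin_part_homog by (simp add: cls_carrier theta_cls model_def)
next
  assume r: "r \<in> carrier SymV \<and> homog n (theta r)"
  have "homog n (embed (theta r))"
    unfolding embed_def using r theta_vars homog_lin_mono by (intro homog_psubst[of n _ B]) auto
  moreover have "cls (embed (theta r)) = r" using psi_theta r by (simp add: psi_def)
  moreover have "embed (theta r) \<in> carrier PW" using embed_vars poly_ring_carrier by blast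
  ultimately show "r \<in> sym_deg scale n" unfolding sym_deg_def homog_def
    by (intro image_eqI[of r _ "embed (theta r)"]) auto
qed

section \<open>The action of the general linear group on the model\<close>

text \<open>The action of \<open>g\<close> transported to polynomials in the variables \<open>X\<^sub>b\<close>: it substitutes for \<open>X\<^sub>b\<close>
  the linear form of the translated coordinate function.\<close>

definition alpha :: "('v \<Rightarrow> 'v) \<Rightarrow> ('v, 'k) mpoly \<Rightarrow> ('v, 'k) mpoly" where
  "alpha g = psubst (\<lambda>b. lin_part (dual_act g (coordf b)))"

abbreviation GL where "GL \<equiv> carrier (gen_lin_group scale)"

lemma GL_iff: "g \<in> GL \<longleftrightarrow> (\<forall>v w. g (v + w) = g v + g w) \<and> (\<forall>c v. g (scale c v) = scale c (g v)) \<and> bij g"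
  using vector_space_axioms by (auto simp: gen_lin_group_def Vector_Spaces.linear_iff)

lemma GL_inv: assumes "g \<in> GL" shows "inv_into UNIV g \<in> GL"
proof -
  have b: "bij g" and add: "\<And>v w. g (v + w) = g v + g w" and sc: "\<And>c v. g (scale c v) = scale c (g v)"
    using assms by (auto simp: GL_iff)
  have gi: "g (inv_into UNIV g v) = v" "inv_into UNIV g (g v) = v" for v
    using b by (auto simp: bij_is_surj surj_f_inv_f bij_is_inj)
  have "inv_into UNIV g (v + w) = inv_into UNIV g v + inv_into UNIV g w" for v w
    using gi(2)[of "inv_into UNIV g v + inv_into UNIV g w"] by (simp add: add gi(1))
  moreover have "inv_into UNIV g (scale c v) = scale c (inv_into UNIV g v)" for c v
    using gi(2)[of "scale c (inv_into UNIV g v)"] by (simp add: sc gi(1))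
  ultimately show ?thesis using bij_imp_bij_inv[OF b] by (auto simp: GL_iff)
qed

lemma dual_act_dual: "g \<in> GL \<Longrightarrow> f \<in> W \<Longrightarrow> dual_act g f \<in> W"
  using GL_inv[of g] by (simp add: dual_iff GL_iff dual_act_def)

lemma dual_act_comp: "g \<in> GL \<Longrightarrow> h \<in> GL \<Longrightarrow> dual_act g (dual_act h f) = dual_act (g \<circ> h) f"
  by (auto simp: dual_act_def GL_iff o_inv_distrib)

lemma dual_act_id: "dual_act id f = f" by (simp add: dual_act_def)

lemma dual_act_inv: "g \<in> GL \<Longrightarrow> dual_act g (dual_act (inv_into UNIV g) f) = f"
  "g \<in> GL \<Longrightarrow> dual_act (inv_into UNIV g) (dual_act g f) = f"
  by (simp_all add: dual_act_def GL_iff inv_inv_eq bij_is_surj surj_f_inv_f bij_is_inj)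

lemma alpha_lin_part:
  assumes g: "g \<in> GL" and f: "f \<in> W" shows "alpha g (lin_part f) = lin_part (dual_act g f)"
proof -
  have "alpha g (lin_part f) = (\<Sum>b\<in>B. constp (f b) * lin_part (dual_act g (coordf b)))"
    by (simp add: alpha_def lin_part_def[of f] psubst_sum)
  also have "\<dots> = lin_part (\<lambda>v. \<Sum>b\<in>B. f b * dual_act g (coordf b) v)"
    by (simp add: lin_part_sum lin_part_scale)
  also have "(\<lambda>v. \<Sum>b\<in>B. f b * dual_act g (coordf b) v) = dual_act g f"
    unfolding dual_act_def by (rule ext) (rule dual_expand[OF f, symmetric])
  finally show ?thesis .
qed

lemma model_rename: "g \<in> GL \<Longrightarrow> vars_in W P \<Longrightarrow> model (rename_vars (dual_act g) P) = alpha g (model P)"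
  unfolding model_def rename_vars_psubst alpha_def psubst_psubst
  using alpha_lin_part[of g, unfolded alpha_def] by (intro psubst_cong_vars[of W P]) auto

lemma rename_vars_in: "g \<in> GL \<Longrightarrow> vars_in W P \<Longrightarrow> vars_in W (rename_vars (dual_act g) P)"
  unfolding rename_vars_psubst by (rule vars_in_psubst) (auto intro: vars_in_lin_mono dual_act_dual)

lemma rename_I: "g \<in> GL \<Longrightarrow> i \<in> I \<Longrightarrow> rename_vars (dual_act g) i \<in> I"
  by (simp add: I_iff rename_vars_in model_rename) (simp add: alpha_def)

lemma sym_act_cls:
  assumes g: "g \<in> GL" and P: "vars_in W P" shows "sym_act g (cls P) = cls (rename_vars (dual_act g) P)"
proof
  show "sym_act g (cls P) \<subseteq> cls (rename_vars (dual_act g) P)"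
    unfolding sym_act_def cls_def' using rename_I[OF g] by (auto simp: rename_vars_psubst psubst_add)
  show "cls (rename_vars (dual_act g) P) \<subseteq> sym_act g (cls P)"
  proof
    fix Q assume "Q \<in> cls (rename_vars (dual_act g) P)"
    then obtain i where i: "i \<in> I" "Q = i + rename_vars (dual_act g) P" unfolding cls_def' by blast
    let ?j = "rename_vars (dual_act (inv_into UNIV g)) i"
    have "rename_vars (dual_act g) ?j = i"
      by (simp add: rename_vars_psubst psubst_psubst dual_act_inv[OF g] psubst_id)
    then have "Q = rename_vars (dual_act g) (?j + P)" unfolding i(2) by (simp add: rename_vars_psubst psubst_add)
    moreover have "?j \<in> I" by (rule rename_I[OF GL_inv[OF g] i(1)])
    ultimately show "Q \<in> sym_act g (cls P)" unfolding sym_act_def cls_def' by blast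
  qed
qed

lemma sym_act_carrier: "g \<in> GL \<Longrightarrow> r \<in> carrier SymV \<Longrightarrow> sym_act g r \<in> carrier SymV"
  using carrier_cls[of r] by (auto simp: sym_act_cls cls_carrier rename_vars_in)

lemma theta_sym_act: "g \<in> GL \<Longrightarrow> r \<in> carrier SymV \<Longrightarrow> theta (sym_act g r) = alpha g (theta r)"
  using carrier_cls[of r] by (auto simp: sym_act_cls theta_cls model_rename)

lemma alpha_vars: "vars_in B (alpha g P)"
  unfolding alpha_def by (rule vars_in_psubst[of UNIV]) (auto simp: vars_in_def lin_part_vars[unfolded vars_in_def])

lemma alpha_comp: "g \<in> GL \<Longrightarrow> h \<in> GL \<Longrightarrow> alpha g (alpha h P) = alpha (g \<circ> h) P"
proof -
  assume g: "g \<in> GL" and h: "h \<in> GL"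
  have "alpha g (alpha h P) = psubst (\<lambda>b. alpha g (lin_part (dual_act h (coordf b)))) P"
    by (simp add: alpha_def[of h] alpha_def[of g] psubst_psubst)
  then show ?thesis
    by (simp only: alpha_lin_part[OF g dual_act_dual[OF h coordf_dual]] dual_act_comp[OF g h] alpha_def[of "g \<circ> h"])
qed

lemma alpha_id: "vars_in B P \<Longrightarrow> alpha id P = P"
  unfolding alpha_def dual_act_id
  by (subst psubst_cong_vars[of B P _ "\<lambda>b. lin_mono b 1"]) (auto simp: lin_part_coord psubst_id)

end

locale group_on_space = based_space scale B for scale :: "'k::{field,finite} \<Rightarrow> 'v::ab_group_add \<Rightarrow> 'v" and B +
  fixes G :: "('v \<Rightarrow> 'v) set"
  assumes G: "subgroup G (gen_lin_group scale)"
begin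

lemma G_GL: "g \<in> G \<Longrightarrow> g \<in> GL" using subgroup.subset[OF G] by blast

lemma G_comp: "g \<in> G \<Longrightarrow> h \<in> G \<Longrightarrow> g \<circ> h \<in> G"
  using subgroup.m_closed[OF G, of g h] by (simp add: gen_lin_group_def)

lemma G_id: "id \<in> G" using subgroup.one_closed[OF G] by (simp add: gen_lin_group_def)

lemma finite_G: "finite G" using finite_subset[OF subset_UNIV finite_end_V] .

sublocale finite_action "{P :: ('v, 'k) mpoly. vars_in B P}" G alpha id
proof
  fix k assume k: "k \<in> G"
  have "inj_on ((\<circ>) k) G"
    using G_GL[OF k] by (auto simp: inj_on_def GL_iff fun_eq_iff bij_def inj_def)
  moreover have "(\<circ>) k ` G \<subseteq> G" using G_comp[OF k] by auto
  ultimately have "bij_betw ((\<circ>) k) G G"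
    using endo_inj_surj[OF finite_G] by (auto simp: bij_betw_def)
  then show "\<exists>\<beta>. bij_betw \<beta> G G \<and> (\<forall>h\<in>G. \<forall>x\<in>{P. vars_in B P}. alpha k (alpha h x) = alpha (\<beta> h) x)"
    using alpha_comp[OF G_GL[OF k] G_GL] by (intro exI[of _ "(\<circ>) k"]) simp
qed (auto simp: vars_in_1 vars_in_add vars_in_uminus vars_in_mult finite_G G_id alpha_vars alpha_id,
     auto simp: alpha_def psubst_add psubst_mult)

end

section \<open>Regularity of the variables\<close>

lemma (in cring) ideal_criterion:
  assumes sub: "J \<subseteq> carrier R" and "\<zero> \<in> J" and add: "\<And>x y. x \<in> J \<Longrightarrow> y \<in> J \<Longrightarrow> x \<oplus> y \<in> J"
    and mult: "\<And>a x. a \<in> carrier R \<Longrightarrow> x \<in> J \<Longrightarrow> a \<otimes> x \<in> J"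
  shows "ideal J R"
proof (rule idealI[OF ring_axioms])
  show "subgroup J (add_monoid R)"
  proof (rule group.subgroupI[OF a_group])
    show "inv\<^bsub>add_monoid R\<^esub> x \<in> J" if x: "x \<in> J" for x
    proof -
      have xc: "x \<in> carrier R" using x sub by blast
      have "\<ominus> x = (\<ominus> \<one>) \<otimes> x" using l_minus[OF one_closed xc] xc by simp
      then have "\<ominus> x \<in> J" using mult[OF _ x, of "\<ominus> \<one>"] by simp
      then show ?thesis by (simp add: a_inv_def)
    qed
  qed (use assms in auto)
  show "x \<otimes> a \<in> J" "a \<otimes> x \<in> J" if "a \<in> J" "x \<in> carrier R" for a x
    using mult[OF that(2,1)] m_comm[of x a] that sub by auto
qed

text \<open>From an ideal that is not finitely generated one could choose generators one after the
  other, each outside the ideal generated by the previous ones.\<close>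

lemma (in ring) noetherian_if_sequences_stabilise:
  assumes acc: "\<And>L :: nat \<Rightarrow> 'a set. (\<And>n. ideal (L n) R) \<Longrightarrow> (\<And>n. L n \<subseteq> L (Suc n)) \<Longrightarrow> \<exists>c. \<forall>n\<ge>c. L n = L c"
  shows "noetherian_ring R"
proof (rule noetherian_ringI, rule ccontr)
  fix J assume J: "ideal J R" and not: "\<not> (\<exists>A\<subseteq>carrier R. finite A \<and> J = Idl A)"
  have JR: "J \<subseteq> carrier R" by (rule additive_subgroup.a_subset[OF ideal.axioms(1)[OF J]])
  have "\<exists>x. x \<in> J - Idl A" if "finite A" "A \<subseteq> J" for A
    using not that genideal_minimal[OF J that(2)] JR by blast
  then obtain pick where pick: "\<And>A. finite A \<Longrightarrow> A \<subseteq> J \<Longrightarrow> pick A \<in> J - Idl A" by metis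
  define A where "A = rec_nat {} (\<lambda>_ A. insert (pick A) A)"
  have A0: "A 0 = {}" and AS: "\<And>n. A (Suc n) = insert (pick (A n)) (A n)" by (simp_all add: A_def)
  have A: "finite (A n) \<and> A n \<subseteq> J" for n
    using pick by (induction n) (auto simp: A0 AS)
  have AR: "A n \<subseteq> carrier R" for n using A[of n] JR by blast
  have ideals: "ideal (Idl (A n)) R" for n by (rule genideal_ideal[OF AR])
  have "Idl (A n) \<subseteq> Idl (A (Suc n))" for n
    by (rule genideal_minimal[OF ideals]) (use genideal_self[OF AR, of "Suc n"] AS in auto)
  from acc[of "\<lambda>n. Idl (A n)", OF ideals this] obtain c where "\<forall>n\<ge>c. Idl (A n) = Idl (A c)" by (elim exE)
  then have "Idl (A (Suc c)) = Idl (A c)" by (elim allE[of _ "Suc c"] impE) simp_all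
  moreover have "pick (A c) \<in> Idl (A (Suc c))" using genideal_self[OF AR, of "Suc c"] AS by auto
  ultimately show False using pick[of "A c"] A[of c] by auto
qed

lemma mono_deg_0_iff: "mono_deg m = 0 \<longleftrightarrow> m = 0"
proof
  assume "mono_deg m = 0"
  then show "m = 0" by (intro poly_mapping_eqI) (auto simp: mono_deg_def in_keys_iff)
qed (simp add: mono_deg_def)

text \<open>The constant term, as a polynomial, in the form of a substitution, so that it is visibly
  multiplicative.\<close>

definition aug :: "('w, 'k::comm_ring_1) mpoly \<Rightarrow> ('w, 'k) mpoly" where "aug = psubst (\<lambda>_. 0)"

lemma aug_eq:
  fixes P :: "('w, 'k::comm_ring_1) mpoly"
  shows "aug P = constp (Poly_Mapping.lookup P 0)"
proof -
  have mv: "mono_val (\<lambda>_. 0 :: ('w, 'k) mpoly) m = (if m = 0 then 1 else 0)" for m :: "'w \<Rightarrow>\<^sub>0 nat"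
  proof (cases "m = 0")
    case False
    then obtain x where "x \<in> Poly_Mapping.keys m" by (metis keys_eq_empty equals0I)
    then have "mono_val (\<lambda>_. 0 :: ('w, 'k) mpoly) m = 0"
      unfolding mono_val_def by (intro prod_zero) (auto simp: in_keys_iff power_0_left intro!: bexI[of _ x])
    then show ?thesis using False by simp
  qed simp
  have "aug P = (\<Sum>m\<in>Poly_Mapping.keys P. if m = 0 then constp (Poly_Mapping.lookup P m) else 0)"
    unfolding aug_def psubst_def by (intro sum.cong refl) (simp add: mv)
  also have "\<dots> = constp (Poly_Mapping.lookup P 0)"
    by (simp add: sum.delta) (simp add: in_keys_iff)
  finally show ?thesis .
qed

lemma aug_homog: "homog n P \<Longrightarrow> 1 \<le> n \<Longrightarrow> aug P = 0"
proof -
  assume h: "homog n P" "1 \<le> n"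
  have "0 \<notin> Poly_Mapping.keys P" using h mono_deg_0_iff[of 0] unfolding homog_def by (metis not_one_le_zero)
  then show ?thesis by (simp add: aug_eq in_keys_iff)
qed

lemma lookup_single_shift:
  fixes P :: "('w, 'k::comm_ring_1) mpoly"
  shows "Poly_Mapping.lookup (Poly_Mapping.single e 1 * P) (e + m) = Poly_Mapping.lookup P m"
proof -
  have "Poly_Mapping.single e 1 * P =
      (\<Sum>m'\<in>Poly_Mapping.keys P. Poly_Mapping.single (e + m') (Poly_Mapping.lookup P m'))"
    by (subst mpoly_as_sum[of P]) (simp add: sum_distrib_left mult_single)
  then show ?thesis by (simp add: lookup_sum lookup_single when_def) (auto simp: in_keys_iff)
qed

context based_space begin

lemma psi_add: "psi (P + Q) = psi P \<oplus>\<^bsub>SymV\<^esub> psi Q"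
  by (simp add: psi_def cls_add[symmetric] embed_vars) (simp add: embed_def psubst_add)

lemma psi_mult: "psi (P * Q) = psi P \<otimes>\<^bsub>SymV\<^esub> psi Q"
  by (simp add: psi_def cls_mult[symmetric] embed_vars) (simp add: embed_def psubst_mult)

lemma psi_zero: "psi 0 = \<zero>\<^bsub>SymV\<^esub>" by (simp add: psi_def embed_def cls_zero)

lemma psi_one: "psi 1 = \<one>\<^bsub>SymV\<^esub>" by (simp add: psi_def embed_def cls_one)

lemma psi_power: "psi (P ^ n) = psi P [^]\<^bsub>SymV\<^esub> n"
proof (induction n)
  case (Suc n)
  have "psi (P ^ Suc n) = psi (P ^ n) \<otimes>\<^bsub>SymV\<^esub> psi P" by (simp add: psi_mult[symmetric] mult.commute)
  then show ?case using Suc by (simp add: nat_pow_def)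
qed (simp add: psi_one nat_pow_def)

lemma theta_power: assumes "r \<in> carrier SymV" shows "theta (r [^]\<^bsub>SymV\<^esub> (n::nat)) = theta r ^ n"
proof -
  interpret cring SymV by (rule cring_SymV)
  show ?thesis using assms by (induction n) (simp_all add: theta_one theta_mult mult.commute)
qed

lemma theta_minus: assumes "r \<in> carrier SymV" shows "theta (\<ominus>\<^bsub>SymV\<^esub> r) = - theta r"
proof -
  interpret cring SymV by (rule cring_SymV)
  have "theta r + theta (\<ominus>\<^bsub>SymV\<^esub> r) = 0"
    using theta_add[of r "\<ominus>\<^bsub>SymV\<^esub> r"] assms by (simp add: r_neg theta_zero)
  then show ?thesis by (simp add: eq_neg_iff_add_eq_0 add.commute)
qed

lemma theta_dickson: "theta (dickson_top scale) = (\<Prod>f\<in>W - {\<lambda>v. 0}. lin_part f)"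
  and dickson_carrier: "dickson_top scale \<in> carrier SymV"
proof -
  interpret cring SymV by (rule cring_SymV)
  have fin: "finite (W - {\<lambda>v. 0})" using finite_subset[OF subset_UNIV finite_fun_V] .
  have c: "cls (lin_mono f 1) \<in> carrier SymV" if "f \<in> W" for f using that by (intro cls_carrier vars_in_lin_mono)
  have "finprod SymV (\<lambda>f. cls (lin_mono f 1)) A \<in> carrier SymV \<and>
    theta (finprod SymV (\<lambda>f. cls (lin_mono f 1)) A) = (\<Prod>f\<in>A. lin_part f)" if "finite A" "A \<subseteq> W" for A
    using that
  proof (induction A rule: finite_induct)
    case empty then show ?case by (simp add: theta_one)
  next
    case (insert f A)
    then have f: "cls (lin_mono f 1) \<in> carrier SymV" and A: "(\<lambda>f. cls (lin_mono f 1)) \<in> A \<rightarrow> carrier SymV" using c by auto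
    show ?case using insert f A by (simp add: theta_mult theta_cls model_def)
  qed
  from this[OF fin] show "theta (dickson_top scale) = (\<Prod>f\<in>W - {\<lambda>v. 0}. lin_part f)"
    "dickson_top scale \<in> carrier SymV" unfolding dickson_top_def by auto
qed

definition xvar :: "'v \<Rightarrow> ('v \<Rightarrow> 'k, 'k) mpoly set" where "xvar b = psi (lin_mono b 1)"

lemma xvar_carrier: "xvar b \<in> carrier SymV" unfolding xvar_def by (rule psi_carrier)

lemma theta_xvar_power: "b \<in> B \<Longrightarrow> theta (xvar b [^]\<^bsub>SymV\<^esub> (n::nat)) = Poly_Mapping.single (Poly_Mapping.single b n) 1"
  by (simp add: theta_power xvar_carrier) (simp add: xvar_def theta_psi vars_in_lin_mono lin_mono_power)

text \<open>The ideal generated by the \<open>n\<close>-th powers of the variables in \<open>Y\<close> consists of the polynomials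
  each of whose monomials is divisible by one of these powers. A further variable does not
  affect this divisibility, so its powers are nonzerodivisors modulo the ideal.\<close>

lemma regular_variable_powers:
  fixes n :: nat
  shows "distinct bs \<Longrightarrow> set bs \<subseteq> B \<Longrightarrow> Y \<inter> set bs = {} \<Longrightarrow>
    module.regular_mod (self_module SymV) (map (\<lambda>b. xvar b [^]\<^bsub>SymV\<^esub> n) bs)
      {r \<in> carrier SymV. \<forall>m\<in>Poly_Mapping.keys (theta r). \<exists>y\<in>Y. n \<le> Poly_Mapping.lookup m y}"
proof (induction bs arbitrary: Y)
  interpret cring SymV by (rule cring_SymV)
  interpret M: module SymV "self_module SymV" by (rule self_module_is_module)
  {
    case Nil show ?case by simp
  next
    case (Cons b bs)
    let ?L = "\<lambda>Y. {r \<in> carrier SymV. \<forall>m\<in>Poly_Mapping.keys (theta r). \<exists>y\<in>Y. n \<le> Poly_Mapping.lookup m y}"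
    let ?x = "xvar b [^]\<^bsub>SymV\<^esub> n" and ?e = "Poly_Mapping.single b n"
    have b: "b \<in> B" "b \<notin> Y" using Cons.prems by auto
    have x: "?x \<in> carrier SymV" using xvar_carrier by simp
    have th: "theta (?x \<otimes>\<^bsub>SymV\<^esub> r) = Poly_Mapping.single ?e 1 * theta r" if "r \<in> carrier SymV" for r
      using that x by (simp add: theta_mult theta_xvar_power b)
    have look: "Poly_Mapping.lookup (Poly_Mapping.single ?e 1 * P) (?e + m) = Poly_Mapping.lookup P m" for P :: "('v, 'k) mpoly" and m
      by (rule lookup_single_shift)
    have "r \<in> ?L Y" if r: "r \<in> carrier SymV" and xr: "?x \<otimes>\<^bsub>SymV\<^esub> r \<in> ?L Y" for r
    proof -
      have "\<exists>y\<in>Y. n \<le> Poly_Mapping.lookup m y" if m: "m \<in> Poly_Mapping.keys (theta r)" for m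
      proof -
        have "?e + m \<in> Poly_Mapping.keys (theta (?x \<otimes>\<^bsub>SymV\<^esub> r))"
          using m unfolding th[OF r] in_keys_iff look .
        then obtain y where "y \<in> Y" "n \<le> Poly_Mapping.lookup (?e + m) y" using xr by blast
        then show ?thesis using b(2) by (intro bexI[of _ y]) (auto simp: lookup_add lookup_single when_def split: if_splits)
      qed
      then show ?thesis using r by simp
    qed
    moreover have "{l \<oplus>\<^bsub>SymV\<^esub> ?x \<otimes>\<^bsub>SymV\<^esub> c | l c. l \<in> ?L Y \<and> c \<in> carrier SymV} = ?L (insert b Y)"
    proof (intro equalityI subsetI)
      fix r assume "r \<in> {l \<oplus>\<^bsub>SymV\<^esub> ?x \<otimes>\<^bsub>SymV\<^esub> c | l c. l \<in> ?L Y \<and> c \<in> carrier SymV}"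
      then obtain l c where l: "l \<in> ?L Y" and c: "c \<in> carrier SymV" and r: "r = l \<oplus>\<^bsub>SymV\<^esub> ?x \<otimes>\<^bsub>SymV\<^esub> c" by blast
      have lc: "l \<in> carrier SymV" using l by simp
      have tr: "theta r = theta l + Poly_Mapping.single ?e 1 * theta c"
        unfolding r th[OF c, symmetric] using lc c x by (intro theta_add) auto
      have "\<exists>y\<in>insert b Y. n \<le> Poly_Mapping.lookup m y" if m: "m \<in> Poly_Mapping.keys (theta r)" for m
      proof (cases "m \<in> Poly_Mapping.keys (theta l)")
        case True then show ?thesis using l by auto
      next
        case False
        then have "m \<in> Poly_Mapping.keys (Poly_Mapping.single ?e 1 * theta c)"
          using m keys_add[of "theta l" "Poly_Mapping.single ?e 1 * theta c"] unfolding tr by blast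
        then obtain m' where "m = ?e + m'"
          using keys_mult[of "Poly_Mapping.single ?e (1::'k)" "theta c"] by auto
        then show ?thesis by (intro bexI[of _ b]) (simp_all add: lookup_add)
      qed
      moreover have "r \<in> carrier SymV" unfolding r using lc c x by simp
      ultimately show "r \<in> ?L (insert b Y)" by simp
    next
      fix r assume r: "r \<in> ?L (insert b Y)"
      let ?P = "theta r"
      let ?A = "{m \<in> Poly_Mapping.keys ?P. n \<le> Poly_Mapping.lookup m b}"
      have rc: "r \<in> carrier SymV" using r by simp
      define Q where "Q = (\<Sum>m\<in>?A. Poly_Mapping.single (m - ?e) (Poly_Mapping.lookup ?P m))"
      define Z where "Z = (\<Sum>m\<in>Poly_Mapping.keys ?P - ?A. Poly_Mapping.single m (Poly_Mapping.lookup ?P m))"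
      have e: "?e + (m - ?e) = m" if "m \<in> ?A" for m
        using that by (intro poly_mapping_eqI) (auto simp: lookup_add lookup_minus lookup_single when_def)
      have "Poly_Mapping.single ?e 1 * Q = (\<Sum>m\<in>?A. Poly_Mapping.single m (Poly_Mapping.lookup ?P m))"
        unfolding Q_def sum_distrib_left by (intro sum.cong refl) (simp add: mult_single e)
      then have P: "?P = Z + Poly_Mapping.single ?e 1 * Q"
        unfolding Z_def using mpoly_as_sum[of ?P] sum.subset_diff[of ?A "Poly_Mapping.keys ?P" "\<lambda>m. Poly_Mapping.single m (Poly_Mapping.lookup ?P m)"]
        by simp
      have Pv: "vars_in B ?P" by (rule theta_vars[OF rc])
      have Qv: "vars_in B Q" unfolding Q_def
      proof (rule vars_in_sum)
        fix m assume m: "m \<in> ?A"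
        then have "Poly_Mapping.keys m \<subseteq> B" using Pv by (auto simp: vars_in_def)
        moreover have "Poly_Mapping.keys (m - ?e) \<subseteq> Poly_Mapping.keys m" by (auto simp: in_keys_iff lookup_minus)
        ultimately show "vars_in B (Poly_Mapping.single (m - ?e) (Poly_Mapping.lookup ?P m))" by (auto simp: vars_in_def)
      qed
      have Zv: "vars_in B Z" unfolding Z_def
        by (rule vars_in_sum) (use Pv in \<open>auto simp: vars_in_def\<close>)
      have Zk: "Poly_Mapping.keys Z \<subseteq> Poly_Mapping.keys ?P - ?A"
        unfolding Z_def by (rule order_trans[OF keys_sum]) auto
      have "psi Z \<in> ?L Y"
        using r Zk by (fastforce simp: psi_carrier theta_psi[OF Zv])
      moreover have "r = psi Z \<oplus>\<^bsub>SymV\<^esub> ?x \<otimes>\<^bsub>SymV\<^esub> psi Q"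
        using rc x psi_carrier P theta_inj[of r "psi Z \<oplus>\<^bsub>SymV\<^esub> ?x \<otimes>\<^bsub>SymV\<^esub> psi Q"]
        by (simp add: theta_add th theta_psi Zv Qv)
      ultimately show "r \<in> {l \<oplus>\<^bsub>SymV\<^esub> ?x \<otimes>\<^bsub>SymV\<^esub> c | l c. l \<in> ?L Y \<and> c \<in> carrier SymV}"
        using psi_carrier by blast
    qed
    moreover have "module.regular_mod (self_module SymV) (map (\<lambda>b. xvar b [^]\<^bsub>SymV\<^esub> n) bs) (?L (insert b Y))"
      using Cons.prems by (intro Cons.IH) auto
    moreover have "a \<odot>\<^bsub>self_module SymV\<^esub> c = a \<otimes>\<^bsub>SymV\<^esub> c" "a \<oplus>\<^bsub>self_module SymV\<^esub> c = a \<oplus>\<^bsub>SymV\<^esub> c"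
      "carrier (self_module SymV) = carrier SymV" for a c by (simp_all add: self_module_def)
    ultimately show ?case by (simp only: list.map M.regular_mod.simps) blast
  }
qed

end

section \<open>The invariant ring\<close>

context group_on_space begin

abbreviation RG where "RG \<equiv> inv_ring scale G"
abbreviation RGdeg where "RGdeg \<equiv> inv_deg scale G"
abbreviation RGplus where "RGplus \<equiv> irrelevant_ideal RG RGdeg"

lemma RG_ops: "mult RG = mult SymV" "add RG = add SymV" "zero RG = zero SymV" "one RG = one SymV"
  by (simp_all add: inv_ring_def)

lemma RG_pow: "r [^]\<^bsub>RG\<^esub> (n::nat) = r [^]\<^bsub>SymV\<^esub> n"
  by (simp add: nat_pow_def RG_ops)

lemma RG_iff: "r \<in> carrier RG \<longleftrightarrow> r \<in> carrier SymV \<and> invariant (theta r)"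
proof -
  have "sym_act g r = r \<longleftrightarrow> alpha g (theta r) = theta r" if "g \<in> G" "r \<in> carrier SymV" for g
    using theta_inj[OF sym_act_carrier[OF G_GL[OF that(1)] that(2)] that(2)] theta_sym_act[OF G_GL[OF that(1)] that(2)] by simp
  then show ?thesis by (auto simp: inv_ring_def invariant_def theta_vars)
qed

lemma RG_SymV: "r \<in> carrier RG \<Longrightarrow> r \<in> carrier SymV" by (simp add: RG_iff)

lemma psi_RG: "invariant P \<Longrightarrow> psi P \<in> carrier RG"
  by (simp add: RG_iff psi_carrier theta_psi invariant_def)

lemma cring_RG: "cring RG"
proof -
  interpret cring SymV by (rule cring_SymV)
  have iv: "invariant 0" "invariant 1" "\<And>x y. invariant x \<Longrightarrow> invariant y \<Longrightarrow> invariant (x + y)"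
    "\<And>x. invariant x \<Longrightarrow> invariant (- x)"
    by (auto simp: invariant_def zero_RR one_RR add_RR neg_RR act_zero act_one act_add act_neg simp del: mem_Collect_eq)
  have sub: "subring (carrier RG) SymV"
    by (rule subringI) (auto simp: RG_iff theta_one theta_minus theta_mult theta_add iv invariant_mult)
  have "subcring (carrier RG) SymV" by (rule subcringI'[OF sub])
  then have "cring (SymV\<lparr>carrier := carrier RG\<rparr>)"
    using subcring_iff[OF subringE(1)[OF sub]] by simp
  then show ?thesis by (simp add: inv_ring_def)
qed

lemma theta_finsum_RG:
  assumes "finite A" "\<And>n. n \<in> A \<Longrightarrow> c n \<in> carrier RG"
  shows "theta (\<Oplus>\<^bsub>RG\<^esub> n\<in>A. c n) = (\<Sum>n\<in>A. theta (c n))"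
proof -
  interpret cring RG by (rule cring_RG)
  show ?thesis using assms
  proof (induction A rule: finite_induct)
    case empty then show ?case by (simp add: theta_zero RG_ops)
  next
    case (insert a A)
    then have "c \<in> A \<rightarrow> carrier RG" "c a \<in> carrier RG" by auto
    then show ?case using insert theta_add[of "c a" "\<Oplus>\<^bsub>RG\<^esub> n\<in>A. c n"] RG_SymV by (simp add: RG_ops(2))
  qed
qed

lemma RGdeg_iff: "r \<in> RGdeg n \<longleftrightarrow> r \<in> carrier RG \<and> homog n (theta r)"
  by (auto simp: inv_deg_def sym_deg_iff RG_iff)

lemma invariant_homog_part: "invariant P \<Longrightarrow> invariant (homog_part n P)"
proof -
  assume P: "invariant P"
  have v: "vars_in B P" using P by (simp add: invariant_def)
  have "alpha g (homog_part n P) = homog_part n P" if "g \<in> G" for g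
    using homog_part_psubst[OF v lin_part_homog, of n "\<lambda>b. dual_act g (coordf b)", folded alpha_def] P that
    by (simp add: invariant_def)
  then show ?thesis using v by (simp add: invariant_def vars_in_homog_part)
qed

text \<open>The group acts by linear substitutions, so the homogeneous parts of an invariant are
  invariant.\<close>

lemma RG_homogeneous_sum:
  assumes r: "r \<in> carrier RG"
  shows "r = (\<Oplus>\<^bsub>RG\<^esub> n\<in>mono_deg ` Poly_Mapping.keys (theta r). psi (homog_part n (theta r)))"
    and "psi (homog_part n (theta r)) \<in> RGdeg n"
proof -
  interpret cring RG by (rule cring_RG)
  have inv: "invariant (homog_part n (theta r))" for n
    using r by (intro invariant_homog_part) (simp add: RG_iff)
  then have vars: "vars_in B (homog_part n (theta r))" for n by (simp add: invariant_def)
  note c = psi_RG[OF inv]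
  show "psi (homog_part n (theta r)) \<in> RGdeg n"
    using c by (simp add: RGdeg_iff theta_psi[OF vars] homog_homog_part)
  let ?A = "mono_deg ` Poly_Mapping.keys (theta r)"
  let ?s = "\<Oplus>\<^bsub>RG\<^esub> n\<in>?A. psi (homog_part n (theta r))"
  have "theta ?s = (\<Sum>n\<in>?A. homog_part n (theta r))"
    by (subst theta_finsum_RG) (simp_all add: c theta_psi[OF vars])
  also have "\<dots> = theta r" by (rule homog_part_sum[symmetric])
  finally have "theta ?s = theta r" .
  moreover have "?s \<in> carrier RG" using c by (intro finsum_closed) auto
  ultimately show "r = ?s" using theta_inj[of r ?s] r RG_SymV by auto
qed

lemma RGplus_iff: "r \<in> RGplus \<longleftrightarrow> r \<in> carrier RG \<and> aug (theta r) = 0"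
proof
  interpret cring RG by (rule cring_RG)
  assume "r \<in> RGplus"
  then obtain A c where A: "finite A" and c: "\<And>n. n \<in> A \<Longrightarrow> 1 \<le> n \<and> c n \<in> RGdeg n" and r: "r = (\<Oplus>\<^bsub>RG\<^esub> n\<in>A. c n)"
    unfolding irrelevant_ideal_def by blast
  have cR: "c n \<in> carrier RG" if "n \<in> A" for n using c[OF that] by (simp add: RGdeg_iff)
  have "aug (theta (c n)) = 0" if "n \<in> A" for n
    using c[OF that] aug_homog[of n "theta (c n)"] by (simp add: RGdeg_iff)
  then have "aug (theta r) = 0" by (simp add: r theta_finsum_RG[OF A cR] aug_def psubst_sum)
  moreover have "r \<in> carrier RG" unfolding r using cR by (intro finsum_closed) auto
  ultimately show "r \<in> carrier RG \<and> aug (theta r) = 0" by simp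
next
  assume r: "r \<in> carrier RG \<and> aug (theta r) = 0"
  have "Poly_Mapping.lookup (theta r) 0 = 0"
    using r by (metis aug_eq constp_def lookup_single_eq lookup_zero)
  then have "1 \<le> n" if "n \<in> mono_deg ` Poly_Mapping.keys (theta r)" for n
    using that by (auto simp: in_keys_iff mono_deg_0_iff Suc_le_eq neq0_conv[symmetric] simp del: neq0_conv)
  then show "r \<in> RGplus"
    unfolding irrelevant_ideal_def using RG_homogeneous_sum r
    by (intro CollectI exI[of _ "mono_deg ` Poly_Mapping.keys (theta r)"] exI[of _ "\<lambda>n. psi (homog_part n (theta r))"] conjI) auto
qed

text \<open>By \<open>RGplus_iff\<close> this is the kernel of a ring homomorphism, the constant term.\<close>

lemma RGplus_ideal: "ideal RGplus RG"
proof -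
  interpret cring RG by (rule cring_RG)
  show ?thesis
  proof (rule ideal_criterion)
    show "x \<oplus>\<^bsub>RG\<^esub> y \<in> RGplus" if "x \<in> RGplus" "y \<in> RGplus" for x y
      using that a_closed[of x y] by (simp add: RGplus_iff RG_ops(2) theta_add RG_SymV aug_def psubst_add)
    show "x \<otimes>\<^bsub>RG\<^esub> y \<in> RGplus" if "x \<in> carrier RG" "y \<in> RGplus" for x y
      using that m_closed[of x y] by (simp add: RGplus_iff RG_ops(1) theta_mult RG_SymV aug_def psubst_mult)
    show "\<zero>\<^bsub>RG\<^esub> \<in> RGplus" using zero_closed by (simp add: RGplus_iff RG_ops(3) theta_zero aug_def)
  qed (auto simp: RGplus_iff)
qed

lemma lin_mono_RR: "b \<in> B \<Longrightarrow> lin_mono b 1 \<in> {P. vars_in B P}" by (simp add: vars_in_lin_mono)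

definition orbit_coeffs :: "('v, 'k) mpoly set" where
  "orbit_coeffs = (\<lambda>(b, j). orbit_coeff (lin_mono b 1) j) ` (B \<times> {1..card G})"

text \<open>A finite set, because the field is finite. This gives the chain condition that starts
  Hilbert's argument for free.\<close>

definition small_exponents :: "('v, 'k) mpoly set" where
  "small_exponents = {P. vars_in B P \<and> (\<forall>m\<in>Poly_Mapping.keys P. \<forall>x. Poly_Mapping.lookup m x < card G)}"

lemma card_G_pos: "0 < card G" using finite_G G_id card_gt_0_iff by blast

lemma finite_small_exponents: "finite small_exponents"
proof -
  let ?E = "{m :: 'v \<Rightarrow>\<^sub>0 nat. \<forall>x. Poly_Mapping.lookup m x < card G}"
  have "Poly_Mapping.lookup ` ?E \<subseteq> PiE UNIV (\<lambda>_. {..<card G})" by auto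
  then have "finite (Poly_Mapping.lookup ` ?E)" by (rule finite_subset) (intro finite_PiE finite_V finite_lessThan)
  then have E: "finite ?E" by (rule finite_imageD) (auto intro!: inj_onI poly_mapping_eqI)
  have "Poly_Mapping.lookup ` small_exponents \<subseteq> {f. \<forall>m. (m \<in> ?E \<longrightarrow> f m \<in> (UNIV :: 'k set)) \<and> (m \<notin> ?E \<longrightarrow> f m = 0)}"
    by (auto simp: small_exponents_def in_keys_iff)
  then have "finite (Poly_Mapping.lookup ` small_exponents)"
    by (rule finite_subset) (intro finite_set_of_finite_funs E finite)
  then show ?thesis by (rule finite_imageD) (auto intro!: inj_onI poly_mapping_eqI)
qed

lemma small_exponents_stable: "stable_subgroup {} small_exponents"
  using keys_diff[where 'b = 'k] by (fastforce simp: stable_subgroup_def small_exponents_def vars_in_0 vars_in_diff)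

abbreviation span_small where "span_small \<equiv> module_span orbit_coeffs small_exponents"

lemma span_small_sum: "(\<And>i. i \<in> A \<Longrightarrow> f i \<in> span_small) \<Longrightarrow> sum f A \<in> span_small"
proof -
  have st: "stable_subgroup orbit_coeffs span_small"
    using module_span_stable small_exponents_stable by (auto simp: stable_subgroup_def)
  then have "0 \<in> span_small" by (simp add: stable_subgroup_def)
  then show "(\<And>i. i \<in> A \<Longrightarrow> f i \<in> span_small) \<Longrightarrow> sum f A \<in> span_small"
    using stable_subgroup_add[OF st] by (induction A rule: infinite_finite_induct) auto
qed

lemma small_exponents_single:
  "Poly_Mapping.keys m \<subseteq> B \<Longrightarrow> (\<And>x. Poly_Mapping.lookup m x < card G) \<Longrightarrow> Poly_Mapping.single m c \<in> small_exponents"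
  by (auto simp: small_exponents_def vars_in_def)

text \<open>When the exponent of \<open>X\<^sub>b\<close> in a monomial reaches the order of \<open>G\<close>, the orbit equation of \<open>X\<^sub>b\<close>
  expresses the monomial by ones with smaller exponents and invariant coefficients.\<close>

lemma span_small_var:
  assumes b: "b \<in> B" and P: "P \<in> span_small" shows "lin_mono b 1 * P \<in> span_small"
  using P
proof induction
  case (base P)
  let ?e = "Poly_Mapping.single b (1::nat)"
  have "Poly_Mapping.single (?e + m) c \<in> span_small" if m: "m \<in> Poly_Mapping.keys P" for m c
  proof -
    have mB: "Poly_Mapping.keys m \<subseteq> B" and ml: "Poly_Mapping.lookup m x < card G" for x
      using base m by (auto simp: small_exponents_def vars_in_def)
    show ?thesis
    proof (cases "Suc (Poly_Mapping.lookup m b) = card G")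
      case False
      then have "Suc (Poly_Mapping.lookup m b) < card G" using ml[of b] by simp
      then have "Poly_Mapping.lookup (?e + m) x < card G" for x
        using ml[of x] by (auto simp: lookup_add lookup_single when_def)
      moreover have "Poly_Mapping.keys (?e + m) \<subseteq> B" using mB b keys_add[of ?e m] by auto
      ultimately show ?thesis by (intro module_span.base small_exponents_single)
    next
      case True
      define m' where "m' = m - Poly_Mapping.single b (Poly_Mapping.lookup m b)"
      have m'b: "Poly_Mapping.lookup m' b = 0" and m'x: "Poly_Mapping.lookup m' x \<le> Poly_Mapping.lookup m x" for x
        by (auto simp: m'_def lookup_minus lookup_single when_def)
      have "?e + m = Poly_Mapping.single b (card G) + m'"
        by (rule poly_mapping_eqI) (use True in \<open>auto simp: m'_def lookup_add lookup_minus lookup_single when_def\<close>)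
      then have "Poly_Mapping.single (?e + m) c = lin_mono b 1 ^ card G * Poly_Mapping.single m' c"
        by (simp add: lin_mono_power mult_single)
      also have "\<dots> = (\<Sum>j\<in>{1..card G}. orbit_coeff (lin_mono b 1) j * (lin_mono b 1 ^ (card G - j) * Poly_Mapping.single m' (- c)))"
        unfolding orbit_equation[OF lin_mono_RR[OF b]]
        by (simp add: sum_distrib_left sum_distrib_right sum_negf single_uminus mult.assoc)
      also have "\<dots> \<in> span_small"
      proof (rule span_small_sum)
        fix j assume j: "j \<in> {1..card G}"
        have "Poly_Mapping.lookup (Poly_Mapping.single b (card G - j) + m') x < card G" for x
          using m'x[of x] ml[of x] m'b j card_G_pos by (auto simp: lookup_add lookup_single when_def)
        moreover have "Poly_Mapping.keys (Poly_Mapping.single b (card G - j) + m') \<subseteq> B"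
        proof
          fix x assume "x \<in> Poly_Mapping.keys (Poly_Mapping.single b (card G - j) + m')"
          then have "x = b \<or> 0 < Poly_Mapping.lookup m' x"
            by (auto simp: in_keys_iff lookup_add lookup_single when_def split: if_splits)
          then show "x \<in> B" using b m'x[of x] mB by (auto simp: in_keys_iff)
        qed
        ultimately have "lin_mono b 1 ^ (card G - j) * Poly_Mapping.single m' (- c) \<in> small_exponents"
          by (simp add: lin_mono_power mult_single small_exponents_single)
        then show "orbit_coeff (lin_mono b 1) j * (lin_mono b 1 ^ (card G - j) * Poly_Mapping.single m' (- c)) \<in> span_small"
          using b j by (intro module_span.mult module_span.base) (auto simp: orbit_coeffs_def)
      qed
      finally show ?thesis .
    qed
  qed
  then have "(\<Sum>m\<in>Poly_Mapping.keys P. Poly_Mapping.single (?e + m) (Poly_Mapping.lookup P m)) \<in> span_small"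
    by (rule span_small_sum)
  also have "(\<Sum>m\<in>Poly_Mapping.keys P. Poly_Mapping.single (?e + m) (Poly_Mapping.lookup P m)) = lin_mono b 1 * P"
    by (subst (3) mpoly_as_sum[of P]) (simp add: sum_distrib_left lin_mono_def mult_single)
  finally show ?case .
next
  case (diff x y) then show ?case by (simp add: right_diff_distrib module_span.diff)
next
  case (mult t x)
  then show ?case using module_span.mult[of t orbit_coeffs "lin_mono b 1 * x"] by (simp add: mult.left_commute)
qed

lemma span_small_const:
  assumes P: "P \<in> span_small" shows "constp c * P \<in> span_small"
  using P
proof induction
  case (base P)
  have "Poly_Mapping.keys (constp c * P) \<subseteq> Poly_Mapping.keys P"
    by (rule order_trans[OF keys_mult]) (auto simp: constp_def split: if_splits)
  then show ?case using base by (intro module_span.base) (fastforce simp: small_exponents_def vars_in_def)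
next
  case (diff x y) then show ?case by (simp add: right_diff_distrib module_span.diff)
next
  case (mult t x)
  then show ?case using module_span.mult[of t orbit_coeffs "constp c * x"] by (simp add: mult.left_commute)
qed

lemma span_small_all: assumes "vars_in B P" shows "P \<in> span_small"
proof -
  have "\<forall>Q\<in>span_small. P * Q \<in> span_small"
    using assms
  proof (induction P rule: mpoly_induct)
    case (const c) show ?case using span_small_const by blast
  next
    case (var b) then show ?case using span_small_var by blast
  next
    case (add P Q)
    have "P * Z + Q * Z \<in> span_small" if "Z \<in> span_small" for Z
      using add(3,4) that span_small_sum[of "{True, False}" "\<lambda>i. if i then P * Z else Q * Z"] by simp
    then show ?case by (simp add: distrib_right)
  next
    case (mult P Q) then show ?case by (simp add: mult.assoc)
  qed
  moreover have "1 \<in> span_small"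
    using small_exponents_single[of 0 1] card_G_pos by (intro module_span.base) (simp)
  ultimately show ?thesis by force
qed

text \<open>Ideals of the invariant ring are stable under its elements, in particular under the orbit
  coefficients of the variables. The ring of all polynomials satisfies the ascending chain
  condition for subgroups stable under these, by \<open>span_small_all\<close> and \<open>acc_module_span\<close>.\<close>

theorem noetherian_RG: "noetherian_ring RG"
proof -
  interpret cring RG by (rule cring_RG)
  note neg_closed = a_inv_closed
  have acc: "acc_below orbit_coeffs span_small"
    by (rule acc_module_span[OF finite_small_exponents small_exponents_stable])
      (simp add: orbit_coeffs_def B_finite)
  show ?thesis
  proof (rule noetherian_if_sequences_stabilise)
    fix L :: "nat \<Rightarrow> ('v \<Rightarrow> 'k, 'k) mpoly set set"
    assume L: "\<And>n. ideal (L n) RG" and mono: "\<And>n. L n \<subseteq> L (Suc n)"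
    have LR: "L n \<subseteq> carrier RG" for n by (rule additive_subgroup.a_subset[OF ideal.axioms(1)[OF L]])
    have "stable_subgroup orbit_coeffs (theta ` L n)" for n
    proof -
      interpret ideal "L n" RG by (rule L)
      have "0 \<in> theta ` L n" using theta_zero zero_closed RG_ops(3) by (metis image_eqI)
      moreover have "theta x - theta y \<in> theta ` L n" if "x \<in> L n" "y \<in> L n" for x y
      proof -
        have x: "x \<in> carrier SymV" and y: "y \<in> carrier RG" using that LR RG_SymV by auto
        have "theta (x \<oplus>\<^bsub>RG\<^esub> \<ominus>\<^bsub>RG\<^esub> y) = theta x + theta (\<ominus>\<^bsub>RG\<^esub> y)"
          using theta_add[OF x RG_SymV[OF neg_closed[OF y]]] by (simp add: RG_ops(2))
        moreover have "theta y + theta (\<ominus>\<^bsub>RG\<^esub> y) = 0"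
          using theta_add[OF RG_SymV[OF y] RG_SymV[OF neg_closed[OF y]]] r_neg[OF y] theta_zero by (simp add: RG_ops)
        ultimately have "theta x - theta y = theta (x \<oplus>\<^bsub>RG\<^esub> \<ominus>\<^bsub>RG\<^esub> y)"
          by (metis add_diff_cancel_left' diff_0 diff_conv_add_uminus add_uminus_conv_diff)
        moreover have "x \<oplus>\<^bsub>RG\<^esub> \<ominus>\<^bsub>RG\<^esub> y \<in> L n" using that by (intro a_closed a_inv_closed)
        ultimately show ?thesis by simp
      qed
      moreover have "t * theta x \<in> theta ` L n" if t: "t \<in> orbit_coeffs" and x: "x \<in> L n" for t x
      proof -
        have inv: "invariant t" using t orbit_coeff_invariant[OF lin_mono_RR] by (auto simp: orbit_coeffs_def)
        have "theta (psi t \<otimes>\<^bsub>RG\<^esub> x) = t * theta x"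
          using theta_mult[OF psi_carrier RG_SymV, of x t] theta_psi[of t] inv x LR by (auto simp: RG_ops(1) invariant_def)
        moreover have "psi t \<otimes>\<^bsub>RG\<^esub> x \<in> L n" by (rule I_l_closed[OF x psi_RG[OF inv]])
        ultimately show ?thesis by (metis image_eqI)
      qed
      ultimately show ?thesis unfolding stable_subgroup_def by blast
    qed
    moreover have "theta ` L n \<subseteq> span_small" for n using span_small_all theta_vars RG_SymV LR[of n] by blast
    moreover have "theta ` L n \<subseteq> theta ` L (Suc n)" for n using mono[of n] by blast
    ultimately obtain c where c: "\<And>n. c \<le> n \<Longrightarrow> theta ` L n = theta ` L c"
      using acc[unfolded acc_below_def, rule_format, of "\<lambda>n. theta ` L n"] by blast
    have "L n = L c" if "c \<le> n" for n
    proof -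
      have "inj_on theta (carrier RG)" by (auto intro!: inj_onI simp: theta_inj RG_SymV)
      then show ?thesis using inj_on_image_eq_iff[OF _ LR LR] c[OF that] by blast
    qed
    then show "\<exists>c. \<forall>n\<ge>c. L n = L c" by blast
  qed
qed

end

section \<open>Powers of the top Dickson class\<close>

context group_on_space begin

abbreviation DT where "DT \<equiv> dickson_top scale"

lemma lin_part_diff: "lin_part (\<lambda>v. f v - h v) = lin_part f - lin_part h"
  using lin_part_add[of "\<lambda>v. f v - h v" h] by simp

text \<open>The group permutes the nonzero linear forms.\<close>

lemma dickson_RG: "DT \<in> carrier RG"
proof -
  let ?W = "W - {\<lambda>v. 0}"
  have "alpha g (\<Prod>f\<in>?W. lin_part f) = (\<Prod>f\<in>?W. lin_part f)" if "g \<in> G" for g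
  proof -
    note g = G_GL[OF that]
    have zero: "dual_act h (\<lambda>v. 0) = (\<lambda>v. 0 :: 'k)" for h :: "'v \<Rightarrow> 'v" by (simp add: dual_act_def)
    have bij: "bij_betw (dual_act g) ?W ?W"
    proof (rule bij_betw_byWitness[where f' = "dual_act (inv_into UNIV g)"])
      show "dual_act g ` ?W \<subseteq> ?W"
      proof (rule image_subsetI)
        fix f assume f: "f \<in> ?W"
        have "dual_act g f \<noteq> (\<lambda>v. 0)" using f dual_act_inv(2)[OF g, of f] zero[of "inv_into UNIV g"] by auto
        then show "dual_act g f \<in> ?W" using dual_act_dual[OF g] f by blast
      qed
      show "dual_act (inv_into UNIV g) ` ?W \<subseteq> ?W"
      proof (rule image_subsetI)
        fix f assume f: "f \<in> ?W"
        have "dual_act (inv_into UNIV g) f \<noteq> (\<lambda>v. 0)" using f dual_act_inv(1)[OF g, of f] zero[of g] by auto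
        then show "dual_act (inv_into UNIV g) f \<in> ?W" using dual_act_dual[OF GL_inv[OF g]] f by blast
      qed
    qed (simp_all add: dual_act_inv[OF g])
    have "alpha g (\<Prod>f\<in>?W. lin_part f) = (\<Prod>f\<in>?W. lin_part (dual_act g f))"
      using alpha_lin_part[OF g] by (simp add: alpha_def psubst_prod)
    also have "\<dots> = (\<Prod>f\<in>?W. lin_part f)" by (rule prod.reindex_bij_betw[OF bij])
    finally show ?thesis .
  qed
  then have "invariant (theta DT)"
    unfolding theta_dickson invariant_def by (simp add: vars_in_prod lin_part_vars)
  then show ?thesis using dickson_carrier by (simp add: RG_iff)
qed

text \<open>An element \<open>g \<noteq> 1\<close> moves some coordinate function \<open>f\<close>, and \<open>f - g f\<close> is then one of the
  factors of the Dickson class.\<close>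

lemma dickson_separates:
  assumes g: "g \<in> G" "g \<noteq> id"
  shows "\<exists>f\<in>{P. vars_in B P}. \<exists>w\<in>{P. vars_in B P}. theta DT = (f - alpha g f) * w"
proof -
  obtain u where u: "inv_into UNIV g u \<noteq> u"
  proof -
    have "bij g" using G_GL[OF g(1)] by (simp add: GL_iff)
    moreover obtain v where "g v \<noteq> v" using g(2) by fastforce
    ultimately have "inv_into UNIV g (g v) \<noteq> g v" by (simp add: bij_is_inj)
    then show ?thesis using that by blast
  qed
  have "\<exists>b\<in>B. coordf b (inv_into UNIV g u) \<noteq> coordf b u"
  proof (rule ccontr)
    assume "\<not> ?thesis"
    then have "(\<Sum>b\<in>B. scale (coordf b (inv_into UNIV g u)) b) = (\<Sum>b\<in>B. scale (coordf b u) b)" by (intro sum.cong) auto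
    then show False using u expand by metis
  qed
  then obtain b where b: "coordf b (inv_into UNIV g u) \<noteq> coordf b u" by blast
  let ?l = "\<lambda>v. coordf b v - dual_act g (coordf b) v"
  let ?W = "W - {\<lambda>v. 0}"
  have "?l u \<noteq> 0" using b by (simp add: dual_act_def)
  then have "?l \<noteq> (\<lambda>v. 0)" by metis
  then have l: "?l \<in> ?W" using dual_diff[OF coordf_dual dual_act_dual[OF G_GL[OF g(1)] coordf_dual]] by blast
  have "lin_part ?l = lin_part (coordf b) - alpha g (lin_part (coordf b))"
    by (simp only: lin_part_diff alpha_lin_part[OF G_GL[OF g(1)] coordf_dual])
  moreover have "theta DT = lin_part ?l * (\<Prod>f\<in>?W - {?l}. lin_part f)"
    unfolding theta_dickson by (rule prod.remove[OF _ l]) (rule finite_subset[OF subset_UNIV finite_fun_V])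
  moreover have "vars_in B (\<Prod>f\<in>?W - {?l}. lin_part f)" by (intro vars_in_prod lin_part_vars)
  ultimately show ?thesis using lin_part_vars[of "coordf b"] by auto
qed

text \<open>In the orbit equation of a variable, all coefficients but the leading one are invariants
  without constant term.\<close>

lemma variable_power_in_extension:
  assumes "b \<in> B" and J: "ideal J SymV" "RGplus \<subseteq> J"
  shows "xvar b [^]\<^bsub>SymV\<^esub> card G \<in> J"
proof -
  interpret cring SymV by (rule cring_SymV)
  interpret ideal J SymV by (rule J)
  let ?X = "lin_mono b 1 :: ('v, 'k) mpoly"
  note X = lin_mono_RR[OF assms(1)]
  have "psi (orbit_coeff ?X j) \<in> RGplus" if "j \<in> {1..card G}" for j
  proof -
    note inv = orbit_coeff_invariant[OF X, of j]
    have "aug (\<Prod>g\<in>A. - alpha g ?X) = 0" if A: "A \<subseteq> G \<and> card A = j" for A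
    proof -
      have "finite A" "A \<noteq> {}" using A \<open>j \<in> _\<close> finite_subset[OF _ finite_G] by auto
      moreover have "aug (alpha g ?X) = 0" if "g \<in> A" for g
        by (simp add: aug_def alpha_def lin_part_def psubst_sum)
      ultimately show ?thesis by (simp add: aug_def psubst_prod psubst_uminus power_0_left card_eq_0_iff)
    qed
    then have "aug (orbit_coeff ?X j) = 0" by (simp add: orbit_coeff_def aug_def psubst_sum)
    then show ?thesis using psi_RG[OF inv] inv by (simp add: RGplus_iff theta_psi invariant_def)
  qed
  then have oc: "psi (orbit_coeff ?X j) \<in> J" if "j \<in> {1..card G}" for j using that J(2) by blast
  have sum: "psi (sum f A) \<in> J" if "\<And>j. j \<in> A \<Longrightarrow> psi (f j) \<in> J" for f :: "nat \<Rightarrow> ('v, 'k) mpoly" and A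
    using that by (induction A rule: infinite_finite_induct) (auto simp: psi_zero psi_add)
  have "psi (?X ^ card G) = psi (\<Sum>j\<in>{1..card G}. - (?X ^ (card G - j)) * orbit_coeff ?X j)"
    unfolding orbit_equation[OF X] by (simp add: sum_negf mult.commute)
  also have "\<dots> \<in> J" by (rule sum) (simp only: psi_mult I_l_closed oc psi_carrier)
  finally show ?thesis unfolding xvar_def psi_power .
qed

text \<open>The retraction is \<open>\<rho> r = tr(t r)\<close>, where \<open>tr t\<close> is a power of the Dickson class. The
  exponent can be taken positive, since \<open>t\<close> may be multiplied by the class.\<close>

theorem dickson_power_kills:
  assumes fs: "RGplus = Idl\<^bsub>RG\<^esub> (set fs)" "set fs \<subseteq> carrier RG"
  shows "\<exists>N::nat. 1 \<le> N \<and> (\<forall>t. t < int (card B) \<longrightarrow> kills RG fs (self_module RG) (carrier RG) (DT [^]\<^bsub>RG\<^esub> N) t)"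
proof -
  interpret R: cring SymV by (rule cring_SymV)
  interpret S: cring RG by (rule cring_RG)
  have invD: "invariant (theta DT)" using dickson_RG by (simp add: RG_iff)
  obtain t0 N0 where t0: "t0 \<in> {P. vars_in B P}" "trace t0 = theta DT ^ N0"
    using power_in_trace[OF invD dickson_separates] by blast
  \<comment> \<open>The additional factor makes the exponent positive.\<close>
  define t where "t = t0 * theta DT"
  define N where "N = Suc N0"
  have t: "vars_in B t" using t0(1) theta_vars[OF dickson_carrier] by (simp add: t_def vars_in_mult)
  have tr: "trace t = theta DT ^ N" using trace_mult[OF invD t0(1)] t0(2) by (simp add: t_def N_def mult.commute)
  define \<rho> where "\<rho> = (\<lambda>r. psi (trace (t * theta r)))"
  have tv: "t * theta r \<in> {P. vars_in B P}" if "r \<in> carrier SymV" for r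
    using t theta_vars[OF that] by (simp add: vars_in_mult)
  have tinv: "invariant (trace (t * theta r))" if "r \<in> carrier SymV" for r by (rule trace_invariant[OF tv[OF that]])
  have \<rho>mult: "\<rho> (s \<otimes>\<^bsub>SymV\<^esub> r) = s \<otimes>\<^bsub>SymV\<^esub> \<rho> r" if s: "s \<in> carrier RG" and r: "r \<in> carrier SymV" for s r
  proof -
    have sv: "s \<in> carrier SymV" "invariant (theta s)" using s by (auto simp: RG_iff)
    have "trace (t * theta (s \<otimes>\<^bsub>SymV\<^esub> r)) = theta s * trace (t * theta r)"
      using trace_mult[OF sv(2) tv[OF r]] by (simp add: theta_mult[OF sv(1) r] mult_ac)
    then show ?thesis by (simp add: \<rho>_def psi_mult psi_theta[OF sv(1)])
  qed
  have \<rho>add: "\<rho> (r \<oplus>\<^bsub>SymV\<^esub> r') = \<rho> r \<oplus>\<^bsub>SymV\<^esub> \<rho> r'" if "r \<in> carrier SymV" "r' \<in> carrier SymV" for r r'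
    using trace_add[OF tv[OF that(1)] tv[OF that(2)]]
    by (simp add: \<rho>_def theta_add[OF that] distrib_left psi_add)
  have \<rho>1: "\<rho> s = DT [^]\<^bsub>RG\<^esub> N \<otimes>\<^bsub>SymV\<^esub> s" if s: "s \<in> carrier RG" for s
  proof -
    have sv: "s \<in> carrier SymV" "invariant (theta s)" using s by (auto simp: RG_iff)
    have "\<rho> s = psi (theta DT ^ N * theta s)" using trace_mult[OF sv(2), of t] t by (simp add: \<rho>_def tr)
    then show ?thesis by (simp add: psi_mult psi_power psi_theta[OF sv(1)] psi_theta[OF dickson_carrier] RG_pow)
  qed
  obtain bs where bs: "set bs = B" "distinct bs" using finite_distinct_list[OF B_finite] by blast
  let ?vs = "map xvar bs"
  have fsR: "set fs \<subseteq> carrier SymV" using fs(2) RG_SymV by blast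
  have J: "ideal (Idl\<^bsub>SymV\<^esub> (set fs)) SymV" by (rule R.genideal_ideal[OF fsR])
  have fsJ: "RGplus \<subseteq> Idl\<^bsub>SymV\<^esub> (set fs)"
  proof -
    interpret J: ideal "Idl\<^bsub>SymV\<^esub> (set fs)" SymV by (rule J)
    have "ideal (carrier RG \<inter> Idl\<^bsub>SymV\<^esub> (set fs)) RG"
    proof (rule S.ideal_criterion)
      show "\<zero>\<^bsub>RG\<^esub> \<in> carrier RG \<inter> Idl\<^bsub>SymV\<^esub> (set fs)" using S.zero_closed J.zero_closed by (simp add: RG_ops)
      show "x \<oplus>\<^bsub>RG\<^esub> y \<in> carrier RG \<inter> Idl\<^bsub>SymV\<^esub> (set fs)"
        if "x \<in> carrier RG \<inter> Idl\<^bsub>SymV\<^esub> (set fs)" "y \<in> carrier RG \<inter> Idl\<^bsub>SymV\<^esub> (set fs)" for x y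
        using that S.a_closed[of x y] J.a_closed[of x y] by (simp add: RG_ops)
      show "a \<otimes>\<^bsub>RG\<^esub> x \<in> carrier RG \<inter> Idl\<^bsub>SymV\<^esub> (set fs)"
        if "a \<in> carrier RG" "x \<in> carrier RG \<inter> Idl\<^bsub>SymV\<^esub> (set fs)" for a x
        using that S.m_closed[of a x] J.I_l_closed[of x a] RG_SymV[of a] by (simp add: RG_ops)
    qed simp
    then have "Idl\<^bsub>RG\<^esub> (set fs) \<subseteq> carrier RG \<inter> Idl\<^bsub>SymV\<^esub> (set fs)"
      using fs(2) R.genideal_self[OF fsR] by (intro S.genideal_minimal) auto
    then show ?thesis by (simp add: fs(1))
  qed
  have reg: "module.regular_mod (self_module SymV) (map (\<lambda>x. x [^]\<^bsub>SymV\<^esub> (m::nat)) ?vs) {\<zero>\<^bsub>SymV\<^esub>}" for m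
  proof -
    have "{r \<in> carrier SymV. \<forall>m'\<in>Poly_Mapping.keys (theta r). \<exists>y\<in>{}. m \<le> Poly_Mapping.lookup m' y} = {\<zero>\<^bsub>SymV\<^esub>}"
      using theta_inj[OF _ R.zero_closed] theta_zero by auto
    then show ?thesis using regular_variable_powers[OF bs(2), of "{}" m] bs(1) by (simp add: o_def)
  qed
  have "kills RG fs (self_module RG) (carrier RG) (DT [^]\<^bsub>RG\<^esub> N) t" if "t < int (card B)" for t
  proof (rule kills_by_retraction[OF cring_SymV, where \<rho> = \<rho> and vs = ?vs])
    show "RG = SymV\<lparr>carrier := carrier RG\<rparr>" by (simp add: inv_ring_def)
    show "carrier RG \<subseteq> carrier SymV" using RG_SymV by blast
    show "cring RG" by (rule cring_RG)
    show "set fs \<subseteq> carrier RG" by (rule fs(2))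
    show "DT [^]\<^bsub>RG\<^esub> N \<in> carrier RG" using dickson_RG by simp
    show "\<rho> \<in> lin_maps RG (self_module SymV) (self_module RG)"
      using tinv psi_RG \<rho>add \<rho>mult by (auto simp: lin_maps_def self_module_def RG_ops \<rho>_def)
    show "\<rho> s = DT [^]\<^bsub>RG\<^esub> N \<otimes>\<^bsub>SymV\<^esub> s" if "s \<in> carrier RG" for s by (rule \<rho>1[OF that])
    show "module.regular_mod (self_module SymV) (map (\<lambda>x. x [^]\<^bsub>SymV\<^esub> (m::nat)) ?vs) {\<zero>\<^bsub>SymV\<^esub>}" for m by (rule reg)
    show "set ?vs \<subseteq> carrier SymV" using xvar_carrier by auto
    show "\<exists>n. x [^]\<^bsub>SymV\<^esub> (n::nat) \<in> Idl\<^bsub>SymV\<^esub> (set fs)" if "x \<in> set ?vs" for x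
      using that bs(1) variable_power_in_extension[OF _ J fsJ] by auto
    show "t < int (length ?vs)" using that bs distinct_card[OF bs(2)] by simp
  qed
  then show ?thesis by (intro exI[of _ N] conjI) (simp_all add: N_def)
qed

end

section \<open>Annihilation of the cohomology of complexes\<close>

theorem corollary1p4:
  fixes p q e d r :: nat
    and scale :: "'k::{field, finite} \<Rightarrow> 'v::ab_group_add \<Rightarrow> 'v"
    and G :: "('v \<Rightarrow> 'v) set"
    and S :: "('v \<Rightarrow> 'k, 'k) mpoly set ring"
    and Sg :: "nat \<Rightarrow> ('v \<Rightarrow> 'k, 'k) mpoly set set"
    and D :: "('v \<Rightarrow> 'k, 'k) mpoly set"
    and E :: "nat \<Rightarrow> (('v \<Rightarrow> 'k, 'k) mpoly set, 'e) module"
    and \<epsilon> :: "('v \<Rightarrow> 'k, 'k) mpoly set \<Rightarrow> 'e"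
    and \<delta> :: "nat \<Rightarrow> 'e \<Rightarrow> 'e"
    and a :: "nat \<Rightarrow> nat"
    and \<qq> :: "nat \<Rightarrow> ('v \<Rightarrow> 'k, 'k) mpoly set"
    and K :: "nat \<Rightarrow> (('v \<Rightarrow> 'k, 'k) mpoly set, 'm) module"
    and Kg :: "nat \<Rightarrow> int \<Rightarrow> 'm set"
    and \<phi> :: "nat \<Rightarrow> 'm \<Rightarrow> 'm"
  assumes "prime p" and "1 \<le> e" and "q = p ^ e" and "card (UNIV :: 'k set) = q"
    and "vector_space scale"
    and "\<exists>B. finite B \<and> module.span scale B = UNIV"
    and "vector_space.dim scale UNIV = d"
    and "subgroup G (gen_lin_group scale)"
    and "S = inv_ring scale G" and "Sg = inv_deg scale G"
    and "D = dickson_top scale"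
    and "injective_resolution S (self_module S) E \<epsilon> \<delta>"
    and "\<And>j. j < d \<Longrightarrow> a j =
      (LEAST n. 1 \<le> n \<and>
        D [^]\<^bsub>S\<^esub> n \<in> annihilator S (local_cohomology S (irrelevant_ideal S Sg) E \<delta> j))"
    and "\<And>i. i < d \<Longrightarrow> \<qq> i = (\<Otimes>\<^bsub>S\<^esub> j \<in> {0..i}. D [^]\<^bsub>S\<^esub> a j)"
    and "cochain_complex S K \<phi>"
    and "\<And>i. r < i \<Longrightarrow> carrier (K i) = {\<zero>\<^bsub>K i\<^esub>}"
    and "\<And>i. graded_free_module S Sg (K i) (Kg i)"
    and "\<And>i. homogeneous_map (Kg i) (Kg (Suc i)) (\<phi> i)"
    and "\<And>i. finite_length S (cohomology K \<phi> i)"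
  shows "\<forall>i<d. \<qq> i \<in> annihilator S (cohomology K \<phi> i)"
proof -
  interpret V: vector_space scale by fact
  obtain B0 where B0: "finite B0" "V.span B0 = UNIV" using assms(6) by blast
  obtain B where indep: "V.independent B" and span: "V.span B = UNIV" and card_B: "card B = d"
    using V.basis_exists[of UNIV] assms(7) by (metis UNIV_I subset_antisym subset_UNIV)
  have finB: "finite B" using V.independent_span_bound[OF B0(1) indep] B0(2) by simp
  interpret group_on_space scale B G
    by (intro group_on_space.intro based_space.intro based_space_axioms.intro group_on_space_axioms.intro)
      (fact V.vector_space_axioms indep span finB assms(8))+
  note S = assms(9) and Sg = assms(10) and D = assms(11)
  interpret cring S unfolding S by (rule cring_RG)
  have noeth: "noetherian_ring S" unfolding S by (rule noetherian_RG)
  have "ideal (irrelevant_ideal S Sg) S" unfolding S Sg by (rule RGplus_ideal)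
  then obtain A where A: "A \<subseteq> carrier S" "finite A" "irrelevant_ideal S Sg = Idl\<^bsub>S\<^esub> A"
    using noetherian_ring.finetely_gen[OF noeth] by blast
  obtain fs where fsA: "set fs = A" using finite_list[OF A(2)] by blast
  have fs: "set fs \<subseteq> carrier S" and plus: "irrelevant_ideal S Sg = Idl\<^bsub>S\<^esub> (set fs)" using A fsA by auto
  have Dc: "D \<in> carrier S" unfolding S D by (rule dickson_RG)
  obtain N where N1: "1 \<le> N" and N: "\<And>t. t < int d \<Longrightarrow> kills S fs (self_module S) (carrier S) (D [^]\<^bsub>S\<^esub> (N::nat)) t"
    using dickson_power_kills[of fs] plus fs card_B unfolding S Sg D by blast
  note ann = local_cohomology_annihilator[OF noeth is_cring assms(12) fs, folded plus]
  have ka: "kills S fs (self_module S) (carrier S) (D [^]\<^bsub>S\<^esub> a j) (int j)" if j: "j < d" for j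
  proof -
    let ?Q = "\<lambda>n::nat. 1 \<le> n \<and> D [^]\<^bsub>S\<^esub> n \<in> annihilator S (local_cohomology S (irrelevant_ideal S Sg) E \<delta> j)"
    have "kills S fs (self_module S) (carrier S) (D [^]\<^bsub>S\<^esub> N) (int j)" using j by (intro N) simp
    then have "?Q N" using N1 ann[of "D [^]\<^bsub>S\<^esub> N" j] Dc by simp
    \<comment> \<open>The minimum is attained, because the set of exponents contains \<open>N\<close>.\<close>
    then have "?Q (a j)" unfolding assms(13)[OF j] by (rule LeastI)
    then show ?thesis using ann[of "D [^]\<^bsub>S\<^esub> a j" j] Dc by simp
  qed
  let ?z = "\<lambda>j. D [^]\<^bsub>S\<^esub> a j"
  have z: "?z j \<in> carrier S" for j using Dc by simp
  interpret C: cochain_complex_of_modules S K \<phi> by unfold_locales fact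
  have graded: "graded_module S Sg (K i) (Kg i)" for i using assms(17) by (simp add: graded_free_module_def)
  have kK: "kills S fs (K p) (carrier (K p)) (?z t) (int t)" if "t < d" for p t
  proof -
    obtain Bp where "is_basis S (K p) Bp" using assms(17)[of p] unfolding graded_free_module_def by blast
    then interpret F: free_module S "K p" Bp using C.module_K[of p] by (intro free_module.intro free_module_axioms.intro)
    show ?thesis by (rule F.kills_free[OF fs z ka[OF that]])
  qed
  have SgS: "Sg n \<subseteq> carrier S" for n unfolding S Sg using RGdeg_iff by blast
  have gen: "\<exists>A c. finite A \<and> (\<forall>n\<in>A. c n \<in> Sg n) \<and> s = (\<Oplus>\<^bsub>S\<^esub> n\<in>A. c n)" if "s \<in> carrier S" for s
    using RG_homogeneous_sum[OF that[unfolded S]] unfolding S Sg by (metis finite_imageI finite_keys)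
  have tors: "\<exists>N. \<forall>f\<in>set fs. f [^]\<^bsub>S\<^esub> (N::nat) \<odot>\<^bsub>K p\<^esub> x \<in> coboundaries K \<phi> p" if x: "x \<in> cocycles K \<phi> p" for p x
  proof -
    interpret M: module S "K p" by (rule C.module_K)
    have xc: "x \<in> carrier (K p)" using x by (simp add: cocycles_def)
    have "\<exists>N. f [^]\<^bsub>S\<^esub> (N::nat) \<odot>\<^bsub>K p\<^esub> x \<in> coboundaries K \<phi> p" if "f \<in> set fs" for f
      using finite_length_power_torsion[OF assms(15) graded assms(18) SgS gen assms(19) _ x] genideal_self[OF fs] that plus by blast
    then obtain n where n: "\<And>f. f \<in> set fs \<Longrightarrow> f [^]\<^bsub>S\<^esub> (n f :: nat) \<odot>\<^bsub>K p\<^esub> x \<in> coboundaries K \<phi> p" by metis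
    have "f [^]\<^bsub>S\<^esub> (Max (n ` set fs)) \<odot>\<^bsub>K p\<^esub> x \<in> coboundaries K \<phi> p" if f: "f \<in> set fs" for f
    proof -
      have le: "n f \<le> Max (n ` set fs)" using f by simp
      have fc: "f \<in> carrier S" using f fs by blast
      have "f [^]\<^bsub>S\<^esub> (Max (n ` set fs)) = f [^]\<^bsub>S\<^esub> (Max (n ` set fs) - n f) \<otimes>\<^bsub>S\<^esub> f [^]\<^bsub>S\<^esub> n f"
        using le fc by (simp add: nat_pow_mult)
      then show ?thesis
        using M.submodule_smult[OF C.coboundaries_submodule _ n[OF f], of "f [^]\<^bsub>S\<^esub> (Max (n ` set fs) - n f)"] fc xc
        by (simp add: M.smult_assoc1)
    qed
    then show ?thesis by blast
  qed
  show ?thesis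
  proof (intro allI impI)
    fix i assume i: "i < d"
    have prod: "\<qq> i = consecutive_prod S ?z 0 (Suc i)"
      using assms(14)[OF i] consecutive_prod_finprod[of ?z 0 "Suc i", OF z] by (simp add: atLeastLessThanSuc_atLeastAtMost)
    have "\<qq> i \<odot>\<^bsub>K i\<^esub> x \<in> coboundaries K \<phi> i" if "x \<in> cocycles K \<phi> i" for x
      unfolding prod by (rule C.consecutive_prod_kills_cohomology[OF fs z kK tors i that])
    moreover have "\<qq> i \<in> carrier S" unfolding prod by (rule consecutive_prod_carrier[OF z])
    ultimately show "\<qq> i \<in> annihilator S (cohomology K \<phi> i)"
      unfolding cohomology_def subquotient_annihilator[OF C.module_K C.coboundaries_submodule C.cocycles_submodule] by blast
  qed
qed

end
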